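(* Let $\mathbb{I}\subset\mathbb{CP}^2$ be a conic that is either regular or a union of two distinct lines. Let $\gamma\subset\mathbb{CP}^2$ be an irreducible algebraic curve different from a line and from $\mathbb{I}$ that generates a rationally integrable $\mathbb{I}$-angular billiard. Then $\gamma$ is a conic.
   Context: $\mathbb{I}$-angular symmetry. For $B\in\mathbb{CP}^2\setminus\mathbb{I}$, the $\mathbb{I}$-angular symmetry with center $B$ is the projective involution $\mathbb{CP}^2\to\mathbb{CP}^2$ that fixes $B$, preserves each line $L$ through $B$, and acts on $L$ as the projective involution fixing $B$ and permuting the two points of $L\cap\mathbb{I}$ (if $L$ is tangent to $\mathbb{I}$, i.e. meets it at one point only, it acts on $L$ as the unique non-trivial projective involution of $L$ fixing $B$ and that point). Rationally integrable $\mathbb{I}$-angular billiard. An irreducible algebraic curve $\gamma\subset\mathbb{CP}^2$ different from a line and from $\mathbb{I}$ generates a rationally integrable $\mathbb{I}$-angular billiard if there exists a non-constant rational function $G$ on $\mathbb{CP}^2$ with poles contained in $\mathbb{I}$ such that for every $C\in\gamma\setminus\mathbb{I}$ the restriction of $G$ to the projective tangent line $T_C\gamma$ is invariant under the $\mathbb{I}$-angular symmetry with center $C$. *)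

theory Defs
  imports "HOL-Analysis.Analysis" "HOL-Computational_Algebra.Computational_Algebra"
begin

section \<open>Complex projective plane\<close>

definition proj_rel :: "complex^3 \<Rightarrow> complex^3 \<Rightarrow> bool" where
  "proj_rel x y \<longleftrightarrow> x \<noteq> 0 \<and> y \<noteq> 0 \<and> (\<exists>c. c \<noteq> 0 \<and> y = c *s x)"

lemma part_equivp_proj_rel: "part_equivp proj_rel"
proof (rule part_equivpI)
  show "\<exists>x. proj_rel x x"
    by (rule exI[of _ "axis 1 1"]) (auto simp: proj_rel_def axis_eq_0_iff intro!: exI[of _ 1])
  show "symp proj_rel"
  proof (rule sympI)
    fix x y assume "proj_rel x y"
    then obtain c where c: "x \<noteq> 0" "y \<noteq> 0" "c \<noteq> 0" "y = c *s x"
      by (auto simp: proj_rel_def)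
    then have "x = inverse c *s y" by simp
    with c show "proj_rel y x"
      unfolding proj_rel_def by (metis inverse_nonzero_iff_nonzero)
  qed
  show "transp proj_rel"
  proof (rule transpI)
    fix x y z assume "proj_rel x y" "proj_rel y z"
    then obtain c d where "x \<noteq> 0" "z \<noteq> 0" "c \<noteq> 0" "y = c *s x" "d \<noteq> 0" "z = d *s y"
      by (auto simp: proj_rel_def)
    then show "proj_rel x z"
      unfolding proj_rel_def by (auto intro!: exI[of _ "d * c"])
  qed
qed

quotient_type cp2 = "complex^3" / partial: proj_rel
  by (rule part_equivp_proj_rel)

text \<open>
  \<open>rep_cp2 p\<close> is some vector of homogeneous coordinates of \<open>p\<close>. It is used below
  only in expressions that do not depend on which one is chosen.
\<close>

lemma rep_cp2_nonzero: "rep_cp2 p \<noteq> 0"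
  using Quotient3_rep_reflp[OF Quotient3_cp2, of p] by (simp add: proj_rel_def)

lemma abs_rep_cp2: "abs_cp2 (rep_cp2 p) = p"
  by (rule Quotient3_abs_rep[OF Quotient3_cp2])

lemma rep_abs_cp2:
  assumes "v \<noteq> 0"
  obtains c where "c \<noteq> 0" "rep_cp2 (abs_cp2 v) = c *s v"
proof -
  have "proj_rel v v" using assms by (auto simp: proj_rel_def intro!: exI[of _ 1])
  then have "proj_rel v (rep_cp2 (abs_cp2 v))"
    by (metis Quotient3_cp2 Quotient3_rel_rep Quotient3_rep_reflp Quotient3_abs_rep Quotient3_rel)
  then show ?thesis using that by (auto simp: proj_rel_def)
qed

definition projective_transformation :: "(cp2 \<Rightarrow> cp2) \<Rightarrow> bool" where
  "projective_transformation \<sigma> \<longleftrightarrow>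
     (\<exists>A :: complex^3^3. invertible A \<and> (\<forall>p. \<sigma> p = abs_cp2 (A *v rep_cp2 p)))"


section \<open>Homogeneous polynomials in three variables and plane curves\<close>

text \<open>
  The ring \<open>\<complex>[x\<^sub>1, x\<^sub>2, x\<^sub>3]\<close> is represented as \<open>\<complex>[x\<^sub>3][x\<^sub>2][x\<^sub>1]\<close>: the outermost
  indeterminate is \<open>x\<^sub>1\<close>, the innermost one is \<open>x\<^sub>3\<close>.
\<close>

type_synonym poly3 = "complex poly poly poly"

definition eval3 :: "poly3 \<Rightarrow> complex^3 \<Rightarrow> complex" where
  "eval3 f v = poly (poly (poly f [:[:v $ 1:]:]) [:v $ 2:]) (v $ 3)"

definition homogeneous :: "nat \<Rightarrow> poly3 \<Rightarrow> bool" where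
  "homogeneous d f \<longleftrightarrow> (\<forall>i j k. coeff (coeff (coeff f i) j) k \<noteq> 0 \<longrightarrow> i + j + k = d)"

definition grad3 :: "poly3 \<Rightarrow> complex^3 \<Rightarrow> complex^3" where
  "grad3 f v = vector [eval3 (pderiv f) v,
                       eval3 (map_poly pderiv f) v,
                       eval3 (map_poly (map_poly pderiv) f) v]"

definition zero_locus :: "poly3 \<Rightarrow> cp2 set" where
  "zero_locus f = {p. eval3 f (rep_cp2 p) = 0}"

lemma eval3_altdef:
  "eval3 f v = (\<Sum>i\<le>degree f. \<Sum>j\<le>degree (coeff f i). \<Sum>k\<le>degree (coeff (coeff f i) j).
      coeff (coeff (coeff f i) j) k * v $ 1 ^ i * v $ 2 ^ j * v $ 3 ^ k)"
proof -
  have const2: "[:[:a:]:] ^ n = [:[:a ^ n:]:]" and const1: "[:a:] ^ n = [:a ^ n:]"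
    for a :: complex and n by (induction n) (auto simp: one_pCons)
  have p2: "poly g [:[:a:]:] = (\<Sum>i\<le>degree g. coeff g i * [:[:a ^ i:]:])" for g :: poly3 and a
    by (simp only: poly_altdef const2)
  have p1: "poly g [:a:] = (\<Sum>i\<le>degree g. coeff g i * [:a ^ i:])" for g :: "complex poly poly" and a
    by (simp only: poly_altdef const1)
  have c: "poly [:x:] y = x" for x y :: "'a :: comm_ring_1" by simp
  have "eval3 f v = (\<Sum>i\<le>degree f. (\<Sum>j\<le>degree (coeff f i).
          poly (coeff (coeff f i) j) (v $ 3) * v $ 2 ^ j) * v $ 1 ^ i)"
    unfolding eval3_def p2 by (simp only: poly_sum poly_mult c) (simp only: p1 poly_sum poly_mult c)
  then show ?thesis
    by (simp add: poly_altdef sum_distrib_left sum_distrib_right mult_ac)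
qed

lemma eval3_scale:
  assumes "homogeneous d f"
  shows "eval3 f (c *s v) = c ^ d * eval3 f v"
proof -
  have "coeff (coeff (coeff f i) j) k * (c * v $ 1) ^ i * (c * v $ 2) ^ j * (c * v $ 3) ^ k =
        c ^ d * (coeff (coeff (coeff f i) j) k * v $ 1 ^ i * v $ 2 ^ j * v $ 3 ^ k)" for i j k
  proof (cases "coeff (coeff (coeff f i) j) k = 0")
    case False
    then have "d = i + j + k" using assms by (auto simp: homogeneous_def)
    then show ?thesis by (simp add: power_mult_distrib power_add mult_ac)
  qed simp
  then show ?thesis by (simp only: eval3_altdef sum_distrib_left vector_smult_component)
qed

lemma abs_cp2_in_zero_locus_iff:
  assumes "homogeneous d f" "v \<noteq> 0"
  shows "abs_cp2 v \<in> zero_locus f \<longleftrightarrow> eval3 f v = 0"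
proof -
  obtain c where "c \<noteq> 0" "rep_cp2 (abs_cp2 v) = c *s v" using rep_abs_cp2[OF assms(2)] .
  then show ?thesis by (simp add: zero_locus_def eval3_scale[OF assms(1)])
qed

definition projective_line :: "cp2 set \<Rightarrow> bool" where
  "projective_line L \<longleftrightarrow> (\<exists>f. f \<noteq> 0 \<and> homogeneous 1 f \<and> L = zero_locus f)"

definition plane_conic :: "cp2 set \<Rightarrow> bool" where
  "plane_conic S \<longleftrightarrow> (\<exists>f. f \<noteq> 0 \<and> homogeneous 2 f \<and> S = zero_locus f)"

definition regular_conic :: "cp2 set \<Rightarrow> bool" where
  "regular_conic S \<longleftrightarrow>
     (\<exists>f. f \<noteq> 0 \<and> homogeneous 2 f \<and> S = zero_locus f \<and> (\<forall>p\<in>S. grad3 f (rep_cp2 p) \<noteq> 0))"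

definition union_of_two_distinct_lines :: "cp2 set \<Rightarrow> bool" where
  "union_of_two_distinct_lines S \<longleftrightarrow>
     (\<exists>L1 L2. projective_line L1 \<and> projective_line L2 \<and> L1 \<noteq> L2 \<and> S = L1 \<union> L2)"

definition irreducible_curve_equation :: "poly3 \<Rightarrow> cp2 set \<Rightarrow> bool" where
  "irreducible_curve_equation f \<gamma> \<longleftrightarrow>
     irreducible f \<and> (\<exists>d. homogeneous d f) \<and> \<gamma> = zero_locus f"

definition irreducible_curve :: "cp2 set \<Rightarrow> bool" where
  "irreducible_curve \<gamma> \<longleftrightarrow> (\<exists>f. irreducible_curve_equation f \<gamma>)"

text \<open>
  Tangent lines are taken at the regular points of the curve only: \<open>tangent_line_at \<gamma> C L\<close>
  holds for no \<open>L\<close> if \<open>C\<close> is a singular point of \<open>\<gamma>\<close>. The irreducible equation \<open>f\<close> of \<open>\<gamma>\<close>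
  is unique up to a constant factor, hence \<open>L\<close> is unique if it exists.
\<close>

definition tangent_line_at :: "cp2 set \<Rightarrow> cp2 \<Rightarrow> cp2 set \<Rightarrow> bool" where
  "tangent_line_at \<gamma> C L \<longleftrightarrow> C \<in> \<gamma> \<and>
     (\<exists>f. irreducible_curve_equation f \<gamma> \<and> grad3 f (rep_cp2 C) \<noteq> 0 \<and>
          L = {p. (\<Sum>i\<in>UNIV. grad3 f (rep_cp2 C) $ i * rep_cp2 p $ i) = 0})"


section \<open>Rational functions\<close>

text \<open>
  A rational function on the projective plane is given by its reduced form: a quotient of two
  coprime homogeneous polynomials of the same degree. The support of its polar divisor is then
  the zero locus of the denominator.
\<close>

definition reduced_fraction :: "poly3 \<Rightarrow> poly3 \<Rightarrow> bool" where
  "reduced_fraction P Q \<longleftrightarrow>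
     Q \<noteq> 0 \<and> coprime P Q \<and> (\<exists>d. homogeneous d P \<and> homogeneous d Q)"

definition constant_fraction :: "poly3 \<Rightarrow> poly3 \<Rightarrow> bool" where
  "constant_fraction P Q \<longleftrightarrow> (\<exists>c :: complex. P = [:[:[:c:]:]:] * Q)"

definition poles :: "poly3 \<Rightarrow> poly3 \<Rightarrow> cp2 set" where
  "poles P Q = zero_locus Q"

definition fraction_value :: "poly3 \<Rightarrow> poly3 \<Rightarrow> cp2 \<Rightarrow> complex" where
  "fraction_value P Q p = eval3 P (rep_cp2 p) / eval3 Q (rep_cp2 p)"

lemma fraction_value_abs:
  assumes "homogeneous d P" "homogeneous d Q" "v \<noteq> 0"
  shows "fraction_value P Q (abs_cp2 v) = eval3 P v / eval3 Q v"
proof -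
  obtain c where "c \<noteq> 0" "rep_cp2 (abs_cp2 v) = c *s v" using rep_abs_cp2[OF assms(3)] .
  then show ?thesis
    by (simp add: fraction_value_def eval3_scale[OF assms(1)] eval3_scale[OF assms(2)])
qed


section \<open>Angular symmetries and angular billiards\<close>

text \<open>
  For a conic \<open>I\<close> and a point \<open>B \<notin> I\<close>, every line \<open>L\<close> through \<open>B\<close> meets \<open>I\<close> at one or two
  points. If at two points, the involution of \<open>L\<close> fixes \<open>B\<close> and exchanges them (an involution
  fixing all three points would be trivial).
\<close>

definition is_angular_symmetry :: "cp2 set \<Rightarrow> cp2 \<Rightarrow> (cp2 \<Rightarrow> cp2) \<Rightarrow> bool" where
  "is_angular_symmetry I B \<sigma> \<longleftrightarrow>
     projective_transformation \<sigma> \<and> \<sigma> \<circ> \<sigma> = id \<and> \<sigma> B = B \<and>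
     (\<forall>L. projective_line L \<and> B \<in> L \<longrightarrow>
        \<sigma> ` L = L \<and>
        (\<forall>p q. p \<noteq> q \<and> L \<inter> I = {p, q} \<longrightarrow> \<sigma> p = q \<and> \<sigma> q = p) \<and>
        (\<forall>p. L \<inter> I = {p} \<longrightarrow> \<sigma> p = p \<and> (\<exists>x\<in>L. \<sigma> x \<noteq> x)))"

text \<open>
  Since \<open>C \<notin> I\<close>, the line \<open>L\<close> below is not contained in \<open>I\<close>, and the symmetry preserves
  \<open>L - I\<close>. There the restriction of the rational function to \<open>L\<close> has no poles, so that its
  invariance is an equality of complex values.
\<close>

definition generates_rationally_integrable_angular_billiard ::
    "cp2 set \<Rightarrow> cp2 set \<Rightarrow> bool" where
  "generates_rationally_integrable_angular_billiard I \<gamma> \<longleftrightarrow>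
     irreducible_curve \<gamma> \<and> \<not> projective_line \<gamma> \<and> \<gamma> \<noteq> I \<and>
     (\<exists>P Q. reduced_fraction P Q \<and> \<not> constant_fraction P Q \<and> poles P Q \<subseteq> I \<and>
        (\<forall>C\<in>\<gamma> - I. \<forall>L. tangent_line_at \<gamma> C L \<longrightarrow>
           (\<exists>\<sigma>. is_angular_symmetry I C \<sigma> \<and>
              (\<forall>x\<in>L - I. fraction_value P Q (\<sigma> x) = fraction_value P Q x))))"

end

theory Submission
  imports Defs "HOL-Computational_Algebra.Computational_Algebra" "HOL-Computational_Algebra.Field_as_Ring"
begin

text \<open>
  Let \<open>Q\<close> be an equation of the conic, \<open>f\<close> one of the curve, and \<open>F / Q\<^sup>m\<close> the integral. In a tangent
  line, with \<open>R\<close> polar to the point \<open>C\<close>, the angular symmetry is \<open>C + R \<mapsto> C - R\<close>, so \<open>F (C + R)\<close> is even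
  in \<open>R\<close>. The integral is constant along the curve, and after subtracting that constant we may
  assume \<open>f dvd F\<close> and \<open>\<not> Q dvd F\<close>.

  Along a branch \<open>(1 : t\<^sup>q : y)\<close> in a frame adapted to it, \<open>y = t\<^sup>p (1 + \<dots>)\<close>, the quasihomogeneous leading
  part of \<open>F\<close> inherits the evenness. This forces \<open>p = 2 q\<close>, and moreover \<open>y\<close> is a series in \<open>t\<^sup>q\<close>
  unless the curve osculates the conic at the point in question; that happens at one point at most,
  since at such a point the restriction of \<open>F\<close> to the conic, a form of degree \<open>2 deg F\<close>, has a zero of
  order greater than \<open>deg F\<close>.

  Let the tangent of the conic at that point be the line at infinity. The rational function
  \<open>(3 y\<^sub>2 y\<^sub>4 - 5 y\<^sub>3\<^sup>2)\<^sup>3 / y\<^sub>2\<^sup>8\<close> on the curve, where \<open>y\<^sub>i\<close> is the \<open>i\<close>-th derivative of \<open>y\<close> by \<open>x\<close>, is a constant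
  multiple of the cube of the second derivative of \<open>y\<^sub>2 powr (-2/3)\<close>. It has no poles. Hence it is
  constant, by taking traces to the \<open>x\<close>-line along Puiseux expansions, and this differential equation
  integrates to a quadratic equation.
\<close>

section \<open>Evaluation of polynomials in algebras\<close>

definition ring_hom_fun :: "('a::comm_ring_1 \<Rightarrow> 'b::comm_ring_1) \<Rightarrow> bool" where
  "ring_hom_fun h \<longleftrightarrow> h 0 = 0 \<and> h 1 = 1 \<and> (\<forall>x y. h (x + y) = h x + h y) \<and> (\<forall>x y. h (x * y) = h x * h y)"

lemma ring_hom_funI:
  assumes "h 0 = 0" "h 1 = 1" "\<And>x y. h (x + y) = h x + h y" "\<And>x y. h (x * y) = h x * h y"
  shows "ring_hom_fun h"
  using assms by (auto simp: ring_hom_fun_def)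

lemma ring_hom_fun_simps:
  assumes "ring_hom_fun h"
  shows "h 0 = 0" "h 1 = 1" "h (x + y) = h x + h y" "h (x * y) = h x * h y"
    "h (- x) = - h x" "h (x - y) = h x - h y" "h (x ^ n) = h x ^ n"
proof -
  show 1: "h 0 = 0" "h 1 = 1" "h (x + y) = h x + h y" "h (x * y) = h x * h y" for x y
    using assms by (auto simp: ring_hom_fun_def)
  show 2: "h (- x) = - h x" for x using 1(3)[of x "- x"] 1(1) by (simp add: add_eq_0_iff)
  show "h (x - y) = h x - h y" using 1(3)[of x "- y"] 2 by simp
  show "h (x ^ n) = h x ^ n" by (induction n) (auto simp: 1)
qed

lemma ring_hom_fun_sum:
  assumes "ring_hom_fun h" shows "h (sum f A) = (\<Sum>x\<in>A. h (f x))"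
  by (induction A rule: infinite_finite_induct) (auto simp: ring_hom_fun_simps[OF assms])


lemma ring_hom_fun_comp:
  assumes "ring_hom_fun g" "ring_hom_fun h" shows "ring_hom_fun (\<lambda>x. g (h x))"
  using assms by (auto simp: ring_hom_fun_def)

lemma ring_hom_fun_dvd:
  assumes "ring_hom_fun h" "p dvd q" "h p = 0" shows "h q = 0"
  using assms by (auto simp: ring_hom_fun_simps elim!: dvdE)

definition peval :: "('a::comm_ring_1 \<Rightarrow> 'b::comm_ring_1) \<Rightarrow> 'b \<Rightarrow> 'a poly \<Rightarrow> 'b" where
  "peval h x p = poly (map_poly h p) x"

lemma peval_0 [simp]: "peval h x 0 = 0"
  by (simp add: peval_def)

lemma peval_pCons: "h 0 = 0 \<Longrightarrow> peval h x (pCons a p) = h a + x * peval h x p"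
  by (auto simp: peval_def map_poly_pCons)

lemma peval_altdef:
  assumes "h 0 = 0" "degree p \<le> n"
  shows "peval h x p = (\<Sum>i\<le>n. h (coeff p i) * x ^ i)"
proof -
  have "degree (map_poly h p) \<le> n"
    by (rule degree_le) (use assms in \<open>auto simp: coeff_map_poly coeff_eq_0\<close>)
  then have "(\<Sum>i\<le>degree (map_poly h p). h (coeff p i) * x ^ i) = (\<Sum>i\<le>n. h (coeff p i) * x ^ i)"
    by (intro sum.mono_neutral_left)
       (auto simp: coeff_map_poly[of h, OF assms(1), symmetric] coeff_eq_0)
  then show ?thesis
    by (simp add: peval_def poly_altdef coeff_map_poly assms)
qed

lemma ring_hom_fun_peval:
  assumes "ring_hom_fun h" shows "ring_hom_fun (peval h x)"
proof -
  note [simp] = ring_hom_fun_simps[OF assms] peval_pCons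
  have add: "peval h x (p + q) = peval h x p + peval h x q" for p q
  proof (induction p q rule: poly_induct2)
    case (pCons a p b q) then show ?case by (simp add: algebra_simps)
  qed simp
  have smult: "peval h x (smult c p) = h c * peval h x p" for c p
    by (induction p) (auto simp: algebra_simps)
  have mult: "peval h x (p * q) = peval h x p * peval h x q" for p q
    by (induction p) (auto simp: algebra_simps add smult)
  show ?thesis by (rule ring_hom_funI) (auto simp: add mult one_pCons)
qed

lemma peval_const: "h 0 = 0 \<Longrightarrow> peval h x [:c:] = h c"
  by (simp add: peval_pCons)

lemma peval_hom_comp:
  assumes "ring_hom_fun g" "ring_hom_fun h"
  shows "g (peval h x p) = peval (\<lambda>c. g (h c)) (g x) p"
  using ring_hom_fun_simps[OF assms(1)] ring_hom_fun_simps[OF assms(2)]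
  by (induction p) (auto simp: peval_pCons)


definition ev :: "(complex \<Rightarrow> 'a::comm_ring_1) \<Rightarrow> poly3 \<Rightarrow> 'a \<Rightarrow> 'a \<Rightarrow> 'a \<Rightarrow> 'a" where
  "ev h F a b c = peval (peval (peval h c) b) a F"

lemma ring_hom_fun_ev: "ring_hom_fun h \<Longrightarrow> ring_hom_fun (\<lambda>F. ev h F a b c)"
  unfolding ev_def by (intro ring_hom_fun_peval)

lemmas ev_simps = ring_hom_fun_simps[OF ring_hom_fun_ev]

lemma ev_hom:
  assumes "ring_hom_fun g" "ring_hom_fun h"
  shows "g (ev h F a b c) = ev (\<lambda>x. g (h x)) F (g a) (g b) (g c)"
proof -
  have 1: "ring_hom_fun (peval h c)" "ring_hom_fun (peval (peval h c) b)"
    by (intro ring_hom_fun_peval assms)+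
  show ?thesis unfolding ev_def
    by (subst peval_hom_comp[OF assms(1) 1(2)], subst peval_hom_comp[OF assms(1) 1(1)],
        subst peval_hom_comp[OF assms(1) assms(2)]) (rule refl)
qed

lemma ev_altdef:
  assumes h: "ring_hom_fun h"
    and "\<And>i j k. coeff (coeff (coeff F i) j) k \<noteq> 0 \<Longrightarrow> i \<le> n \<and> j \<le> n \<and> k \<le> n"
  shows "ev h F a b c = (\<Sum>i\<le>n. \<Sum>j\<le>n. \<Sum>k\<le>n. h (coeff (coeff (coeff F i) j) k) * a ^ i * b ^ j * c ^ k)"
proof -
  have h1: "ring_hom_fun (peval h c)" "ring_hom_fun (peval (peval h c) b)"
    by (intro ring_hom_fun_peval h)+
  have d3: "degree (coeff (coeff F i) j) \<le> n" for i j
    by (rule degree_le) (use assms(2) in \<open>auto simp: not_le[symmetric]\<close>)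
  have d2: "degree (coeff F i) \<le> n" for i
  proof (rule degree_le, intro allI impI)
    fix j assume "n < j"
    then have "coeff (coeff (coeff F i) j) k = 0" for k using assms(2)[of i j k] by force
    then show "coeff (coeff F i) j = 0" by (simp add: poly_eq_iff)
  qed
  have d1: "degree F \<le> n"
  proof (rule degree_le, intro allI impI)
    fix i assume "n < i"
    then have "coeff (coeff (coeff F i) j) k = 0" for j k using assms(2)[of i j k] by force
    then show "coeff F i = 0" by (simp add: poly_eq_iff)
  qed
  show ?thesis unfolding ev_def
    by (simp add: peval_altdef[of "peval (peval h c) b", OF ring_hom_fun_simps(1)[OF h1(2)] d1]
        peval_altdef[of "peval h c", OF ring_hom_fun_simps(1)[OF h1(1)] d2]
        peval_altdef[of h, OF ring_hom_fun_simps(1)[OF h] d3]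
        sum_distrib_left sum_distrib_right mult_ac)
qed

lemma ex_coeff_bound:
  "\<exists>n. \<forall>i j k. coeff (coeff (coeff F i) j) k \<noteq> (0::complex) \<longrightarrow> i \<le> n \<and> j \<le> n \<and> k \<le> n"
proof -
  define A where "A = (\<Sum>i\<le>degree F. degree (coeff F i) + (\<Sum>j\<le>degree (coeff F i). degree (coeff (coeff F i) j)))"
  show ?thesis
  proof (rule exI[of _ "degree F + A"], intro allI impI)
    fix i j k assume nz: "coeff (coeff (coeff F i) j) k \<noteq> (0::complex)"
    have i: "i \<le> degree F" using nz by (intro le_degree) auto
    have j: "j \<le> degree (coeff F i)" using nz by (intro le_degree) auto
    have k: "k \<le> degree (coeff (coeff F i) j)" using nz by (intro le_degree) auto
    have "degree (coeff F i) + (\<Sum>j\<le>degree (coeff F i). degree (coeff (coeff F i) j)) \<le> A"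
      unfolding A_def using i by (intro member_le_sum) auto
    moreover have "degree (coeff (coeff F i) j) \<le> (\<Sum>j\<le>degree (coeff F i). degree (coeff (coeff F i) j))"
      using j by (intro member_le_sum) auto
    ultimately show "i \<le> degree F + A \<and> j \<le> degree F + A \<and> k \<le> degree F + A"
      using i j k by linarith
  qed
qed

lemma ring_hom_fun_id [simp]: "ring_hom_fun (\<lambda>x. x)"
  by (auto simp: ring_hom_fun_def)

lemma eval3_eq_ev: "eval3 F v = ev (\<lambda>x. x) F (vec_nth v 1) (vec_nth v 2) (vec_nth v 3)"
proof -
  have 1: "poly p [:[:a:]:] = peval (\<lambda>x. x) [:[:a:]:] p" for p :: poly3 and a
    by (simp add: peval_def)
  have h2: "ring_hom_fun (\<lambda>p::complex poly poly. poly p [:a:])" for a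
    by (auto simp: ring_hom_fun_def)
  have h3: "ring_hom_fun (\<lambda>p::complex poly. poly p a)" for a
    by (auto simp: ring_hom_fun_def)
  have e3: "peval (\<lambda>x. x) c = (\<lambda>p::complex poly. poly p c)" for c
    by (rule ext) (simp add: peval_def)
  have e2: "poly (poly p [:b:]) c = peval (\<lambda>p. poly p c) b p" for p :: "complex poly poly" and b c
    using peval_hom_comp[OF h3[of c] ring_hom_fun_id, of "[:b:]" p] by (simp add: peval_def)
  have "eval3 F v = peval (\<lambda>q. poly (poly q [:vec_nth v 2:]) (vec_nth v 3)) (vec_nth v 1) F"
    unfolding eval3_def 1
    using peval_hom_comp[OF ring_hom_fun_comp[OF h3[of "vec_nth v 3"] h2[of "vec_nth v 2"]] ring_hom_fun_id, of "[:[:vec_nth v 1:]:]" F]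
    by simp
  then show ?thesis by (simp add: ev_def e3 e2)
qed


abbreviation cf3 :: "poly3 \<Rightarrow> nat \<Rightarrow> nat \<Rightarrow> nat \<Rightarrow> complex" where
  "cf3 F i j k \<equiv> coeff (coeff (coeff F i) j) k"

lemma poly3_eqI: "(\<And>i j k. cf3 F i j k = cf3 G i j k) \<Longrightarrow> F = G"
  by (simp add: poly_eq_iff)

lemma homogeneousD: "homogeneous n F \<Longrightarrow> cf3 F i j k \<noteq> 0 \<Longrightarrow> i + j + k = n"
  by (auto simp: homogeneous_def)

lemma sum_triangle:
  fixes f :: "nat \<Rightarrow> nat \<Rightarrow> nat \<Rightarrow> 'a::comm_monoid_add"
  assumes "\<And>i j k. i + j + k \<noteq> n \<Longrightarrow> f i j k = 0"
  shows "(\<Sum>i\<le>n. \<Sum>j\<le>n. \<Sum>k\<le>n. f i j k) = (\<Sum>(j,k)\<in>{(j,k). j + k \<le> n}. f (n - j - k) j k)"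
proof -
  have sub: "{(j, k). j + k \<le> n} \<subseteq> {..n} \<times> {..n}" by auto
  have "(\<Sum>i\<le>n. \<Sum>j\<le>n. \<Sum>k\<le>n. f i j k) = (\<Sum>j\<le>n. \<Sum>k\<le>n. \<Sum>i\<le>n. f i j k)"
    by (subst sum.swap, rule sum.cong[OF refl], subst sum.swap, rule refl)
  also have "\<dots> = (\<Sum>j\<le>n. \<Sum>k\<le>n. if j + k \<le> n then f (n - j - k) j k else 0)"
  proof (intro sum.cong refl)
    fix j k
    have "(\<Sum>i\<le>n. f i j k) = (\<Sum>i\<le>n. if i = n - j - k then (if j + k \<le> n then f (n - j - k) j k else 0) else 0)"
      by (intro sum.cong refl) (auto intro: assms)
    then show "(\<Sum>i\<le>n. f i j k) = (if j + k \<le> n then f (n - j - k) j k else 0)"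
      by simp
  qed
  also have "\<dots> = (\<Sum>(j,k)\<in>{..n} \<times> {..n}. if j + k \<le> n then f (n - j - k) j k else 0)"
    by (simp add: sum.cartesian_product)
  also have "\<dots> = (\<Sum>(j,k)\<in>{(j,k). j + k \<le> n}. f (n - j - k) j k)"
    by (rule sum.mono_neutral_cong_right) (use sub in auto)
  finally show ?thesis .
qed

lemma finite_triangle [simp]: "finite {(j,k). j + k \<le> (n::nat)}"
  by (rule finite_subset[of _ "{..n} \<times> {..n}"]) auto

lemma ev_homogeneous:
  assumes "ring_hom_fun h" "homogeneous n F"
  shows "ev h F a b c = (\<Sum>(j,k)\<in>{(j,k). j + k \<le> n}. h (cf3 F (n - j - k) j k) * a ^ (n - j - k) * b ^ j * c ^ k)"
proof -
  have "ev h F a b c = (\<Sum>i\<le>n. \<Sum>j\<le>n. \<Sum>k\<le>n. h (cf3 F i j k) * a ^ i * b ^ j * c ^ k)"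
    by (rule ev_altdef[OF assms(1)]) (use homogeneousD[OF assms(2)] in fastforce)
  also have "\<dots> = (\<Sum>(j,k)\<in>{(j,k). j + k \<le> n}. h (cf3 F (n - j - k) j k) * a ^ (n - j - k) * b ^ j * c ^ k)"
    by (rule sum_triangle) (use homogeneousD[OF assms(2)] ring_hom_fun_simps(1)[OF assms(1)] in force)
  finally show ?thesis .
qed

lemma ev_scale:
  assumes "ring_hom_fun h" "homogeneous n F"
  shows "ev h F (s * a) (s * b) (s * c) = s ^ n * ev h F a b c"
proof -
  have "s ^ n = s ^ (n - j - k) * s ^ j * s ^ k" if "j + k \<le> n" for j k
    using that by (simp add: power_add[symmetric])
  then show ?thesis
    unfolding ev_homogeneous[OF assms] sum_distrib_left
    by (intro sum.cong refl) (auto simp: power_mult_distrib mult_ac)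
qed

lemma ev_eq_0_iff:
  assumes "\<And>a b c. ev (\<lambda>x. x) F a b c = 0"
  shows "F = 0"
proof -
  have p: "p = 0" if "\<And>x. peval h x p = 0" "\<And>q. h q = 0 \<Longrightarrow> q = 0" "h 0 = 0"
    for p and h :: "'a::comm_ring_1 \<Rightarrow> complex"
  proof -
    have "map_poly h p = 0" using that(1) unfolding peval_def
      by (metis poly_all_0_iff_0)
    then have "h (coeff p i) = 0" for i using that(3) by (metis coeff_map_poly coeff_0)
    then show ?thesis using that(2) by (simp add: poly_eq_iff)
  qed
  show ?thesis
  proof (rule poly3_eqI)
    have h0: "peval (\<lambda>x. x) c 0 = 0" for c :: complex by simp
    have *: "map_poly (peval (peval (\<lambda>x. x) c) b) F = 0" for b c :: complex
      using assms unfolding ev_def peval_def[of _ _ F] by (metis poly_all_0_iff_0)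
    have 1: "peval (peval (\<lambda>x. x) c) b (coeff F i) = 0" for b c i
      using arg_cong[OF *[of c b], of "\<lambda>p. coeff p i"] by (simp add: coeff_map_poly)
    have **: "map_poly (peval (\<lambda>x. x) c) (coeff F i) = 0" for c :: complex and i
      using 1 unfolding peval_def[of "peval (\<lambda>x. x) _"] by (metis poly_all_0_iff_0)
    have 2: "peval (\<lambda>x. x) c (coeff (coeff F i) j) = 0" for c i j
      using arg_cong[OF **[of c i], of "\<lambda>p. coeff p j"] by (simp add: coeff_map_poly)
    have 3: "coeff (coeff F i) j = 0" for i j
      using 2[of _ i j] poly_all_0_iff_0[of "coeff (coeff F i) j"] unfolding peval_def by simp
    show "cf3 F i j k = cf3 0 i j k" for i j k by (simp add: 3)
  qed
qed

lemma homogeneous_0 [simp]: "homogeneous n 0"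
  by (auto simp: homogeneous_def)

lemma homogeneous_add: "homogeneous n F \<Longrightarrow> homogeneous n G \<Longrightarrow> homogeneous n (F + G)"
  by (force simp: homogeneous_def)

lemma homogeneous_diff: "homogeneous n F \<Longrightarrow> homogeneous n G \<Longrightarrow> homogeneous n (F - G)"
  by (force simp: homogeneous_def)

lemma homogeneous_sum: "(\<And>x. x \<in> A \<Longrightarrow> homogeneous n (f x)) \<Longrightarrow> homogeneous n (sum f A)"
  by (induction A rule: infinite_finite_induct) (auto intro: homogeneous_add)

lemma cf3_mult: "cf3 (F * G) i j k = (\<Sum>i'\<le>i. \<Sum>j'\<le>j. \<Sum>k'\<le>k. cf3 F i' j' k' * cf3 G (i - i') (j - j') (k - k'))"
  by (simp add: coeff_mult coeff_sum)

lemma homogeneous_mult: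
  assumes "homogeneous n F" "homogeneous m G"
  shows "homogeneous (n + m) (F * G)"
  unfolding homogeneous_def
proof (intro allI impI)
  fix i j k assume "cf3 (F * G) i j k \<noteq> 0"
  then obtain i' j' k' where *: "i' \<le> i" "j' \<le> j" "k' \<le> k"
    "cf3 F i' j' k' * cf3 G (i - i') (j - j') (k - k') \<noteq> 0"
    unfolding cf3_mult by (metis (no_types, lifting) atMost_iff sum.neutral)
  then have "i' + j' + k' = n" "i - i' + (j - j') + (k - k') = m"
    using homogeneousD[OF assms(1), of i' j' k'] homogeneousD[OF assms(2), of "i - i'" "j - j'" "k - k'"] by auto
  with * show "i + j + k = n + m" by linarith
qed

lemma homogeneous_power: "homogeneous n F \<Longrightarrow> homogeneous (n * e) (F ^ e)"
proof (induction e)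
  case 0 show ?case by (auto simp: homogeneous_def one_pCons coeff_pCons split: nat.splits)
next
  case (Suc e) then show ?case using homogeneous_mult[of n F "n * e" "F ^ e"] by simp
qed

definition const3 :: "complex \<Rightarrow> poly3" where "const3 c = [:[:[:c:]:]:]"
definition lin3 :: "complex \<Rightarrow> complex \<Rightarrow> complex \<Rightarrow> poly3" where
  "lin3 p q r = [:[:[:0, r:], [:q:]:], [:[:p:]:]:]"

lemma ring_hom_fun_const3 [simp]: "ring_hom_fun const3"
  by (auto simp: ring_hom_fun_def const3_def one_pCons)

lemma homogeneous_const3: "homogeneous 0 (const3 c)"
  by (auto simp: homogeneous_def const3_def coeff_pCons split: nat.splits)

lemma homogeneous_lin3: "homogeneous 1 (lin3 p q r)"
  by (auto simp: homogeneous_def lin3_def coeff_pCons split: nat.splits)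

lemma ev_const3: "ring_hom_fun h \<Longrightarrow> ev h (const3 c) x y z = h c"
  by (simp add: ev_def const3_def peval_const ring_hom_fun_simps(1) ring_hom_fun_peval)

lemma ev_lin3:
  assumes h: "ring_hom_fun h"
  shows "ev h (lin3 p q r) x y z = h p * x + h q * y + h r * z"
proof -
  have "peval h z 0 = 0" "peval (peval h z) y 0 = 0" by auto
  then show ?thesis using ring_hom_fun_simps(1)[OF h]
    by (simp add: ev_def lin3_def peval_pCons algebra_simps)
qed


lemma ring_hom_fun_fps_const [simp]: "ring_hom_fun (fps_const :: complex \<Rightarrow> complex fps)"
  by (auto simp: ring_hom_fun_def)

lemma ring_hom_fun_fls_const [simp]: "ring_hom_fun (fls_const :: complex \<Rightarrow> complex fls)"
  by (auto simp: ring_hom_fun_def fls_plus_const)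

lemma ring_hom_fun_fps_to_fls [simp]: "ring_hom_fun (fps_to_fls :: complex fps \<Rightarrow> complex fls)"
  by (auto simp: ring_hom_fun_def fls_times_fps_to_fls)

lemma ring_hom_fun_pCons_const [simp]: "ring_hom_fun (\<lambda>x::'a::comm_ring_1. [:x:])"
  by (auto simp: ring_hom_fun_def one_pCons)

lemma ring_hom_fun_compose_fls:
  assumes "G \<noteq> 0" "fps_nth G 0 = 0"
  shows "ring_hom_fun (\<lambda>F. fls_compose_fps F G :: complex fls)"
  using assms by (auto simp: ring_hom_fun_def fls_compose_fps_add fls_compose_fps_mult)

lemma ring_hom_fun_compose_fps:
  assumes "fps_nth G 0 = 0"
  shows "ring_hom_fun (\<lambda>F. fps_compose F G :: complex fps)"
  using assms by (auto simp: ring_hom_fun_def fps_compose_add_distrib fps_compose_mult_distrib)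

lemma ring_hom_fun_poly [simp]: "ring_hom_fun (\<lambda>p. poly p (x::'a::comm_ring_1))"
  by (auto simp: ring_hom_fun_def)

subsection \<open>Linear substitution\<close>

definition subst3 :: "(complex \<times> complex \<times> complex) \<Rightarrow> (complex \<times> complex \<times> complex) \<Rightarrow>
    (complex \<times> complex \<times> complex) \<Rightarrow> poly3 \<Rightarrow> poly3" where
  "subst3 u v w F = (case (u, v, w) of ((u1,u2,u3), (v1,v2,v3), (w1,w2,w3)) \<Rightarrow>
     ev const3 F (lin3 u1 v1 w1) (lin3 u2 v2 w2) (lin3 u3 v3 w3))"

lemma ev_subst3:
  assumes h: "ring_hom_fun h"
  shows "ev h (subst3 (u1,u2,u3) (v1,v2,v3) (w1,w2,w3) F) x y z =
    ev h F (h u1 * x + h v1 * y + h w1 * z) (h u2 * x + h v2 * y + h w2 * z) (h u3 * x + h v3 * y + h w3 * z)"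
  unfolding subst3_def prod.case
  by (subst ev_hom[of "\<lambda>F. ev h F x y z", OF ring_hom_fun_ev[OF h] ring_hom_fun_const3])
     (simp only: ev_const3[OF h] ev_lin3[OF h])

lemma homogeneous_subst3:
  assumes "homogeneous n F"
  shows "homogeneous n (subst3 u v w F)"
proof -
  obtain u1 u2 u3 v1 v2 v3 w1 w2 w3 where uvw: "u = (u1,u2,u3)" "v = (v1,v2,v3)" "w = (w1,w2,w3)"
    by (cases u, cases v, cases w) auto
  have 1: "homogeneous n (const3 c * lin3 u1 v1 w1 ^ (n - j - k) * lin3 u2 v2 w2 ^ j * lin3 u3 v3 w3 ^ k)"
    if "j + k \<le> n" for c j k
  proof -
    have "homogeneous (0 + 1 * (n - j - k) + 1 * j + 1 * k)
       (const3 c * lin3 u1 v1 w1 ^ (n - j - k) * lin3 u2 v2 w2 ^ j * lin3 u3 v3 w3 ^ k)"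
      by (intro homogeneous_mult homogeneous_power homogeneous_lin3 homogeneous_const3)
    then show ?thesis using that by simp
  qed
  show ?thesis unfolding uvw subst3_def prod.case ev_homogeneous[OF ring_hom_fun_const3 assms]
    by (intro homogeneous_sum) (auto intro!: 1[unfolded diff_diff_left])
qed

section \<open>Nullstellensatz for irreducible polynomials\<close>

lemma irreducible_bezout:
  fixes p q :: "'a::{factorial_ring_gcd,semiring_gcd_mult_normalize} poly"
  assumes p: "irreducible p" "degree p > 0" "\<not> p dvd q"
  obtains u v r where "r \<noteq> 0" "u * p + v * q = [:r:]"
proof -
  define J where "J = {D. D \<noteq> 0 \<and> (\<exists>u v. D = u * p + v * q)}"
  have [simp]: "p \<noteq> 0" using p by auto
  have "1 * p + 0 * q \<in> J" unfolding J_def by (auto intro: exI[of _ 1] exI[of _ 0])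
  then obtain D where D: "D \<in> J" "\<And>D'. D' \<in> J \<Longrightarrow> degree D \<le> degree D'"
    using ex_has_least_nat[of "\<lambda>D. D \<in> J" _ degree] by blast
  from D(1) obtain u v where uv: "D = u * p + v * q" and D0: "D \<noteq> 0" by (auto simp: J_def)
  have key: "\<exists>c k. c \<noteq> 0 \<and> smult c f = D * k" if "f = a * p + b * q" for f a b
  proof -
    from pseudo_mod(1)[OF D0, of f] obtain c k where ck: "c \<noteq> 0" "smult c f = D * k + pseudo_mod f D" by auto
    have "pseudo_mod f D = smult c f - D * k" using ck by simp
    also have "\<dots> = (smult c a - u * k) * p + (smult c b - v * k) * q"
      unfolding that uv by (simp add: algebra_simps smult_add_right)
    finally have "pseudo_mod f D \<in> J \<or> pseudo_mod f D = 0" unfolding J_def by blast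
    then have "pseudo_mod f D = 0" using D(2) pseudo_mod(2)[OF D0, of f] by force
    then show ?thesis using ck by auto
  qed
  have prime: "prime_elem p" using p(1) irreducible_imp_prime_elem by blast
  have ndvd: "\<not> p dvd [:c:]" if "c \<noteq> 0" for c
    using that p(2) dvd_imp_degree_le[of p "[:c:]"] by auto
  obtain c k where ck: "c \<noteq> 0" "smult c p = D * k" using key[of p 1 0] by auto
  obtain c' k' where ck': "c' \<noteq> 0" "smult c' q = D * k'" using key[of q 0 1] by auto
  have "p dvd D * k" unfolding ck(2)[symmetric] by (rule dvd_smult) simp
  then consider "p dvd D" | "p dvd k" using prime prime_elem_dvd_mult_iff by blast
  then have "degree D = 0"
  proof cases
    case 1
    then have "p dvd smult c' q" unfolding ck' by simp
    then have "p dvd [:c':] * q" by simp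
    then show ?thesis using prime p(3) ndvd[OF ck'(1)] prime_elem_dvd_mult_iff by blast
  next
    case 2
    then obtain k1 where "k = p * k1" by auto
    then have "p * [:c:] = p * (D * k1)" using ck(2) by (simp add: algebra_simps)
    then have "[:c:] = D * k1" by (subst (asm) mult_left_cancel) auto
    then have "degree (D * k1) = 0" "D * k1 \<noteq> 0" using ck(1) by (metis degree_pCons_0, metis pCons_eq_0_iff)
    then show ?thesis by (metis add_is_0 degree_mult_eq mult_eq_0_iff)
  qed
  then obtain r where "D = [:r:]" by (metis degree_eq_zeroE)
  then show ?thesis using that[of r u v] uv D0 by auto
qed

definition nullst :: "('a::{factorial_ring_gcd,semiring_gcd_mult_normalize} \<Rightarrow> complex) set \<Rightarrow> bool" where
  "nullst E \<longleftrightarrow> (\<forall>h\<in>E. ring_hom_fun h) \<and> (\<forall>r. (\<forall>h\<in>E. h r = 0) \<longrightarrow> r = 0) \<and>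
     (\<forall>p q. irreducible p \<longrightarrow> (\<forall>h\<in>E. h p = 0 \<longrightarrow> h q = 0) \<longrightarrow> p dvd q)"

lemma nullst_complex: "nullst {\<lambda>x::complex. x}"
  by (auto simp: nullst_def irreducible_def dvd_field_iff)

lemma nullst_poly:
  assumes E: "nullst E"
  shows "nullst {peval h x | h x. h \<in> E}"
  unfolding nullst_def
proof (intro conjI allI impI ballI)
  have hom: "ring_hom_fun h" if "h \<in> E" for h using that E by (auto simp: nullst_def)
  have zero: "r = 0" if "\<And>h. h \<in> E \<Longrightarrow> h r = 0" for r using that E by (auto simp: nullst_def)
  show "ring_hom_fun h" if "h \<in> {peval h x | h x. h \<in> E}" for h
    using that hom ring_hom_fun_peval by blast
  have all: "h (coeff q i) = 0" if "h \<in> E" "\<And>x. peval h x q = 0" for h q i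
  proof -
    have "map_poly h q = 0" using that(2) unfolding peval_def by (metis poly_all_0_iff_0)
    then show ?thesis using ring_hom_fun_simps(1)[OF hom[OF that(1)]] by (metis coeff_map_poly coeff_0)
  qed
  show "r = 0" if "\<forall>h\<in>{peval h x | h x. h \<in> E}. h r = 0" for r
  proof -
    have "coeff r i = 0" for i by (rule zero) (use that in \<open>blast intro: all\<close>)
    then show ?thesis by (simp add: poly_eq_iff)
  qed
  show "p dvd q" if p: "irreducible p" and pq: "\<forall>h\<in>{peval h x | h x. h \<in> E}. h p = 0 \<longrightarrow> h q = 0" for p q
  proof (cases "degree p = 0")
    case True
    then obtain c where c: "p = [:c:]" by (metis degree_eq_zeroE)
    then have ic: "irreducible c" using p irreducible_const_poly_iff by blast
    have "c dvd coeff q i" for i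
    proof -
      have "h (coeff q i) = 0" if h: "h \<in> E" "h c = 0" for h
      proof (rule all[OF h(1)])
        fix x
        have "peval h x p = 0" unfolding c using h ring_hom_fun_simps(1)[OF hom[OF h(1)]] by (simp add: peval_const)
        then show "peval h x q = 0" using pq h by blast
      qed
      then show ?thesis using ic E unfolding nullst_def by blast
    qed
    then show ?thesis unfolding c by (simp add: const_poly_dvd_iff)
  next
    case False
    show ?thesis
    proof (rule ccontr)
      assume "\<not> p dvd q"
      then obtain u v r where r: "r \<noteq> 0" "u * p + v * q = [:r:]"
        using irreducible_bezout[of p q] False p by (metis gr0I)
      have "r * lead_coeff p \<noteq> 0" using r p by auto
      then obtain h where h: "h \<in> E" "h (r * lead_coeff p) \<noteq> 0" using zero by blast
      note hs = ring_hom_fun_simps[OF hom[OF h(1)]]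
      have "coeff (map_poly h p) (degree p) \<noteq> 0" using h(2) hs by (auto simp: coeff_map_poly)
      then have "degree (map_poly h p) \<noteq> 0" using False
        by (metis coeff_eq_0 gr0I)
      then obtain x where "poly (map_poly h p) x = 0"
        using fundamental_theorem_of_algebra[of "map_poly h p"] constant_degree by metis
      then have px: "peval h x p = 0" by (simp add: peval_def)
      then have qx: "peval h x q = 0" using pq h(1) by blast
      have "peval h x [:r:] = 0" unfolding r(2)[symmetric]
        using px qx ring_hom_fun_simps[OF ring_hom_fun_peval[OF hom[OF h(1)]]] by simp
      then show False using h(2) hs by (simp add: peval_const)
    qed
  qed
qed

lemma irreducible_dvd_of_zeros:
  fixes f P :: poly3
  assumes "irreducible f" "\<And>a b c. ev (\<lambda>x. x) f a b c = 0 \<Longrightarrow> ev (\<lambda>x. x) P a b c = 0"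
  shows "f dvd P"
proof -
  let ?E1 = "{peval h x | h x. h \<in> {\<lambda>x::complex. x}}"
  let ?E2 = "{peval h x | h x. h \<in> ?E1}"
  let ?E3 = "{peval h x | h x. h \<in> ?E2}"
  have "nullst ?E3" by (intro nullst_poly nullst_complex)
  moreover have "\<forall>h\<in>?E3. h f = 0 \<longrightarrow> h P = 0" using assms(2) by (auto simp: ev_def)
  ultimately show ?thesis using assms(1) unfolding nullst_def by blast
qed

section \<open>Puiseux series\<close>

lemma poly_diophantine:
  fixes a b c :: "complex poly"
  assumes "coprime a b" "degree c < degree a + degree b" "degree a > 0"
  shows "\<exists>\<alpha> \<beta>. a * \<beta> + \<alpha> * b = c \<and> degree \<alpha> < degree a \<and> (degree b > 0 \<longrightarrow> degree \<beta> < degree b)"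
proof -
  obtain u v where uv: "u * a + v * b = 1"
    using bezout_coefficients_fst_snd[of a b] assms(1) using that by (simp add: coprime_iff_gcd_eq_1)
  define \<alpha> where "\<alpha> = (c * v) mod a"
  define \<beta> where "\<beta> = c * u + b * ((c * v) div a)"
  have "a * \<beta> + \<alpha> * b = c * (u * a) + b * ((c * v) div a * a + (c * v) mod a)"
    unfolding \<alpha>_def \<beta>_def by (simp only: algebra_simps)
  also have "\<dots> = c * (u * a + v * b)" unfolding div_mult_mod_eq by (simp only: algebra_simps)
  also have "\<dots> = c" unfolding uv by simp
  finally have eq: "a * \<beta> + \<alpha> * b = c" .
  have da: "degree \<alpha> < degree a" unfolding \<alpha>_def
    using assms(3) degree_mod_less[of a "c * v"] by (cases "a = 0"; cases "(c * v) mod a = 0") auto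
  have "degree \<beta> < degree b" if "degree b > 0"
  proof (cases "\<beta> = 0")
    case False
    have "a \<noteq> 0" using assms(3) by auto
    then have "degree a + degree \<beta> = degree (a * \<beta>)" using False by (simp add: degree_mult_eq)
    also have "a * \<beta> = c - \<alpha> * b" using eq by (simp add: algebra_simps)
    also have "degree (c - \<alpha> * b) < degree a + degree b"
      using degree_mult_le[of \<alpha> b] da by (intro degree_diff_less assms(2)) linarith
    finally show ?thesis by simp
  qed (use that in auto)
  then show ?thesis using eq da by (intro exI[of _ \<alpha>] exI[of _ \<beta>]) blast
qed

lemma hensel_factorization:
  fixes p :: "complex fps poly"
  assumes p: "lead_coeff p = 1" and ab: "map_poly (\<lambda>c. fps_nth c 0) p = a * b"
    and cop: "coprime a b" and la: "lead_coeff a = 1" "lead_coeff b = 1" and dab: "degree a > 0" "degree b > 0"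
  shows "\<exists>A B. p = A * B \<and> lead_coeff A = 1 \<and> degree A = degree a"
proof -
  define sl where "sl k = map_poly (\<lambda>c. fps_nth c k) p" for k
  have sl: "coeff (sl k) i = fps_nth (coeff p i) k" for k i
    by (simp add: sl_def coeff_map_poly)
  have nz: "a \<noteq> 0" "b \<noteq> 0" using dab by auto
  have dp: "degree p = degree a + degree b"
  proof -
    have "degree (sl 0) = degree p"
      by (rule antisym[OF degree_le le_degree]) (auto simp: sl p coeff_eq_0)
    then show ?thesis using ab nz by (simp add: sl_def degree_mult_eq)
  qed
  have dsl: "degree (sl k) < degree a + degree b" if "k > 0" for k
  proof -
    have "degree (sl k) \<le> degree p - 1"
    proof (rule degree_le, intro allI impI)
      fix i assume "degree p - 1 < i"
      then consider "i = degree p" | "i > degree p" by linarith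
      then show "coeff (sl k) i = 0" using that p by cases (auto simp: sl coeff_eq_0)
    qed
    then show ?thesis using dp dab by linarith
  qed
  define P where "P f k x = (if k = 0 then x = (a, b)
      else degree (fst x) < degree a \<and> degree (snd x) < degree b \<and>
        a * snd x + fst x * b + (\<Sum>i\<in>{0<..<k}. fst (f i) * snd (f (k - i))) = sl k)"
    for f :: "nat \<Rightarrow> complex poly \<times> complex poly" and k x
  have "\<exists>f. \<forall>k. P f k (f k)"
  proof (rule dependent_wellorder_choice)
    fix r and f g :: "nat \<Rightarrow> complex poly \<times> complex poly" and k :: nat assume "\<And>y. y < k \<Longrightarrow> f y = g y"
    then have "(\<Sum>i\<in>{0<..<k}. fst (f i) * snd (f (k - i))) = (\<Sum>i\<in>{0<..<k}. fst (g i) * snd (g (k - i)))"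
      by (intro sum.cong) auto
    then show "P f k r = P g k r" by (simp add: P_def)
  next
    fix k :: nat and f :: "nat \<Rightarrow> complex poly \<times> complex poly" assume IH: "\<And>y. y < k \<Longrightarrow> P f y (f y)"
    have dd: "degree (fst (f y)) < degree a \<and> degree (snd (f y)) < degree b" if "0 < y" "y < k" for y
      using IH[OF that(2)] that(1) unfolding P_def by (auto simp only: split: if_splits)
    show "\<exists>r. P f k r"
    proof (cases "k = 0")
      case False
      have "degree (fst (f i) * snd (f (k - i))) \<le> degree a + degree b - 1" if "i \<in> {0<..<k}" for i
        using degree_mult_le[of "fst (f i)" "snd (f (k - i))"] conjunct1[OF dd[of i]] conjunct2[OF dd[of "k - i"]] that
        by simp
      then have "degree (\<Sum>i\<in>{0<..<k}. fst (f i) * snd (f (k - i))) \<le> degree a + degree b - 1"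
        by (intro degree_sum_le) auto
      then have "degree (sl k - (\<Sum>i\<in>{0<..<k}. fst (f i) * snd (f (k - i)))) < degree a + degree b"
        using dsl[of k] False dab by (intro degree_diff_less) auto
      from poly_diophantine[OF cop this dab(1)] obtain \<alpha> \<beta> where "a * \<beta> + \<alpha> * b = sl k - (\<Sum>i\<in>{0<..<k}. fst (f i) * snd (f (k - i)))"
        "degree \<alpha> < degree a" "degree \<beta> < degree b"
        using dab(2) by blast
      then show ?thesis using False unfolding P_def by (intro exI[of _ "(\<alpha>, \<beta>)"]) simp
    qed (simp add: P_def)
  qed
  then obtain f where f: "\<And>k. P f k (f k)" by blast
  have f0: "f 0 = (a, b)" using f[of 0] by (simp add: P_def)
  have df: "degree (fst (f k)) < degree a" "degree (snd (f k)) < degree b" if "k > 0" for k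
    using f[of k] that unfolding P_def by (auto simp only: split: if_splits)
  have conv: "(\<Sum>i\<le>k. fst (f i) * snd (f (k - i))) = sl k" for k
  proof (cases "k = 0")
    case True
    then show ?thesis using ab by (simp add: f0 sl_def)
  next
    case False
    have "{..k} = insert 0 (insert k {0<..<k})" using False by auto
    then have "(\<Sum>i\<le>k. fst (f i) * snd (f (k - i))) =
       a * snd (f k) + fst (f k) * b + (\<Sum>i\<in>{0<..<k}. fst (f i) * snd (f (k - i)))"
      using False by (simp add: f0)
    then show ?thesis using f[of k] False unfolding P_def by simp
  qed
  define A where "A = (\<Sum>i\<le>degree a. monom (Abs_fps (\<lambda>k. coeff (fst (f k)) i)) i)"
  define B where "B = (\<Sum>i\<le>degree b. monom (Abs_fps (\<lambda>k. coeff (snd (f k)) i)) i)"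
  have cz: "coeff (fst (f k)) i = 0" if "i > degree a" for k i
    using that df(1)[of k] by (cases "k = 0") (auto simp: f0 coeff_eq_0)
  have cz': "coeff (snd (f k)) i = 0" if "i > degree b" for k i
    using that df(2)[of k] by (cases "k = 0") (auto simp: f0 coeff_eq_0)
  have cA: "coeff A i = Abs_fps (\<lambda>k. coeff (fst (f k)) i)" for i
    using cz[of i] by (cases "i \<le> degree a") (auto simp: A_def coeff_sum fps_eq_iff)
  have cB: "coeff B i = Abs_fps (\<lambda>k. coeff (snd (f k)) i)" for i
    using cz'[of i] by (cases "i \<le> degree b") (auto simp: B_def coeff_sum fps_eq_iff)
  have "p = A * B"
  proof (intro poly_eqI fps_ext)
    fix i k
    have "fps_nth (coeff (A * B) i) k =
       (\<Sum>i'\<le>i. \<Sum>k'\<le>k. coeff (fst (f k')) i' * coeff (snd (f (k - k'))) (i - i'))"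
      by (simp add: coeff_mult fps_sum_nth cA cB fps_mult_nth atLeast0AtMost)
    also have "\<dots> = coeff (\<Sum>k'\<le>k. fst (f k') * snd (f (k - k'))) i"
      by (subst sum.swap) (simp add: coeff_sum coeff_mult)
    finally show "fps_nth (coeff p i) k = fps_nth (coeff (A * B) i) k" by (simp add: conv sl)
  qed
  moreover have cA1: "coeff A (degree a) = 1"
  proof (rule fps_ext)
    fix k show "fps_nth (coeff A (degree a)) k = fps_nth 1 k"
      using df(1)[of k] la by (cases "k = 0") (auto simp: cA f0 coeff_eq_0)
  qed
  moreover have "degree A = degree a"
    using cA1 cz by (intro antisym degree_le le_degree) (auto simp: cA fps_eq_iff)
  ultimately show ?thesis by metis
qed


abbreviation ram :: "nat \<Rightarrow> complex fls \<Rightarrow> complex fls" where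
  "ram N F \<equiv> fls_compose_fps F (fps_X ^ N)"

lemma ring_hom_fun_ram [simp]: "N > 0 \<Longrightarrow> ring_hom_fun (ram N)"
  by (rule ring_hom_fun_compose_fls) auto

lemma ram_ram: "N > 0 \<Longrightarrow> M > 0 \<Longrightarrow> ram M (ram N F) = ram (N * M) F"
  by (subst fls_compose_fps_assoc) (auto simp: fps_X_power_compose power_mult[symmetric] mult.commute)

lemma subdegree_ram: "N > 0 \<Longrightarrow> fls_subdegree (ram N F) = fls_subdegree F * int N"
  by (subst subdegree_fls_compose_fps) auto

lemma ram_eq_0_iff: "N > 0 \<Longrightarrow> ram N F = 0 \<longleftrightarrow> F = 0"
  by (subst fls_compose_fps_eq_0_iff) auto

lemma monic_split_coprime:
  fixes p :: "complex poly"
  assumes "lead_coeff p = 1" "degree p = n" "n \<ge> 2" "coeff p (n - 1) = 0" "i < n" "coeff p i \<noteq> 0"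
  shows "\<exists>a b. p = a * b \<and> coprime a b \<and> lead_coeff a = 1 \<and> lead_coeff b = 1 \<and>
    degree a > 0 \<and> degree b > 0"
proof -
  have p0: "p \<noteq> 0" using assms by auto
  have "\<not> constant (poly p)" using assms by (simp add: constant_degree)
  then obtain c where c: "poly p c = 0" using fundamental_theorem_of_algebra by blast
  define k where "k = order c p"
  obtain b where b: "p = [:- c, 1:] ^ k * b" "\<not> [:- c, 1:] dvd b"
    using order_decomp[OF p0, of c] unfolding k_def by blast
  have k: "k > 0" using c p0 order_root unfolding k_def by (metis gr0I)
  have la: "lead_coeff ([:- c, 1:] ^ k) = 1" by (simp add: lead_coeff_power)
  have lb: "lead_coeff b = 1" using assms(1) la b(1) by (simp add: lead_coeff_mult)
  have b0: "b \<noteq> 0" using p0 b(1) by auto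
  have dg: "degree p = k + degree b" using b0 b(1) by (simp add: degree_mult_eq degree_linear_power)
  have "degree b > 0"
  proof (rule ccontr)
    assume "\<not> degree b > 0"
    then have "b = 1" using lb by (metis degree_eq_zeroE gr0I lead_coeff_pCons(2) one_pCons pCons_0_0 zero_neq_one lead_coeff_pCons(1))
    then have pn: "p = [:- c, 1:] ^ n" and "k = n" using b(1) dg assms(2) by auto
    have "coeff p (n - 1) = of_nat (n choose (n - 1)) * (- c)"
      unfolding pn using assms(3) by (simp add: coeff_linear_poly_power)
    also have "n choose (n - 1) = n" using assms(3) by (metis binomial_symmetric choose_one diff_le_self le_add_diff_inverse2 diff_diff_cancel one_le_numeral order_trans)
    finally have "c = 0" using assms(3,4) by auto
    then have "p = monom 1 n" by (simp add: pn monom_altdef)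
    then show False using assms(5,6) by simp
  qed
  moreover have "coprime ([:- c, 1:] ^ k) b"
  proof -
    have "prime_elem [:- c, 1:]" by (rule prime_elem_linear_field_poly) simp
    then have "coprime [:- c, 1:] b" using b(2) prime_elem_imp_coprime by blast
    then show ?thesis by simp
  qed
  ultimately show ?thesis using b(1) la lb k
    by (intro exI[of _ "[:- c, 1:] ^ k"] exI[of _ b]) (auto simp: degree_linear_power)
qed


lemma peval_pcompose:
  fixes p :: "'a::comm_ring_1 poly"
  assumes "ring_hom_fun h"
  shows "peval h x (pcompose p q) = peval h (peval h x q) p"
proof -
  have "pcompose p q = peval (\<lambda>c. [:c:]) q p" by (simp add: peval_def pcompose_altdef)
  then show ?thesis
    using peval_hom_comp[OF ring_hom_fun_peval[OF assms] ring_hom_fun_pCons_const, of x q p]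
    by (simp add: peval_const ring_hom_fun_simps[OF assms])
qed

lemma peval_map_poly: "g 0 = 0 \<Longrightarrow> h 0 = 0 \<Longrightarrow> peval h x (map_poly g p) = peval (\<lambda>c. h (g c)) x p"
  by (simp add: peval_def map_poly_map_poly o_def)

lemma peval_monic: "lead_coeff p = 1 \<Longrightarrow> ring_hom_fun h \<Longrightarrow>
   peval h x p = x ^ degree p + (\<Sum>i<degree p. h (coeff p i) * x ^ i)"
  by (subst peval_altdef[of h p "degree p"])
     (auto simp: ring_hom_fun_simps lessThan_Suc_atMost[symmetric] add.commute)

lemma coeff_pcompose_shift:
  fixes p :: "'a::comm_ring_1 poly"
  assumes "degree p = Suc n"
  shows "coeff (pcompose p [:s, 1:]) n = coeff p n + of_nat (Suc n) * s * coeff p (Suc n)"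
proof -
  have "pcompose p [:s, 1:] = (\<Sum>i\<le>Suc n. smult (coeff p i) ([:s, 1:] ^ i))"
    unfolding pcompose_altdef peval_def[symmetric]
    by (subst peval_altdef[where n = "Suc n"]) (auto simp: assms)
  also have "coeff \<dots> n = (\<Sum>i\<le>Suc n. coeff p i * coeff ([:s, 1:] ^ i) n)"
    by (simp add: coeff_sum)
  also have "\<dots> = (\<Sum>i\<in>{n, Suc n}. coeff p i * coeff ([:s, 1:] ^ i) n)"
  proof (rule sum.mono_neutral_right)
    show "\<forall>i\<in>{..Suc n} - {n, Suc n}. coeff p i * coeff ([:s, 1:] ^ i) n = 0"
    proof
      fix i assume "i \<in> {..Suc n} - {n, Suc n}"
      then have "degree ([:s, 1:] ^ i) < n"
        using degree_power_le[of "[:s, 1:]" i] by (cases "i < n") auto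
      then show "coeff p i * coeff ([:s, 1:] ^ i) n = 0" by (simp add: coeff_eq_0)
    qed
  qed auto
  also have "\<dots> = coeff p n + of_nat (Suc n) * s * coeff p (Suc n)"
    by (simp add: coeff_linear_poly_power mult_ac del: power_Suc)
  finally show ?thesis .
qed

lemma puiseux_root:
  fixes p :: "complex fls poly"
  assumes "lead_coeff p = 1" "degree p > 0"
  shows "\<exists>N r. N > 0 \<and> peval (ram N) r p = 0"
  using assms
proof (induction "degree p" arbitrary: p rule: less_induct)
  case less
  define n where "n = degree p"
  define s where "s = coeff p (n - 1) / of_nat n"
  define q where "q = pcompose p [:- s, 1:]"
  have n0: "n > 0" using less.prems n_def by simp
  have dq: "degree q = n" by (simp add: q_def degree_pcompose n_def)
  have lq: "lead_coeff q = 1" unfolding q_def by (subst lead_coeff_comp) (auto simp: less.prems)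
  have q1: "coeff q (n - 1) = 0"
  proof -
    have "coeff p n = 1" using less.prems n_def by simp
    moreover obtain k where "n = Suc k" using n0 gr0_implies_Suc by blast
    ultimately show ?thesis unfolding q_def using coeff_pcompose_shift[of p k "- s"] n_def
      by (simp add: s_def del: of_nat_Suc)
  qed
  have red: "\<exists>N r. N > 0 \<and> peval (ram N) r p = 0" if "N > 0" "peval (ram N) r q = 0" for N r
    using that unfolding q_def by (subst (asm) peval_pcompose) auto
  show ?case
  proof (cases "\<forall>i<n. coeff q i = 0")
    case True
    have "peval (ram 1) 0 q = 0"
      by (subst peval_monic[OF lq ring_hom_fun_ram]) (use True dq n0 in auto)
    then show ?thesis by (intro red[of 1]) auto
  next
    case False
    define S where "S = {i. i < n \<and> coeff q i \<noteq> 0}"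
    define sl where "sl i = of_int (fls_subdegree (coeff q i)) / (of_nat (n - i) :: real)" for i
    have S: "finite S" "S \<noteq> {}" using False by (auto simp: S_def)
    define i0 where "i0 = arg_min_on sl S"
    have i0: "i0 < n" "coeff q i0 \<noteq> 0" using arg_min_if_finite(1)[OF S, of sl] by (auto simp: S_def i0_def)
    have min: "sl i0 \<le> sl j" if "j < n" "coeff q j \<noteq> 0" for j
    proof -
      have "j \<in> S" using that by (simp add: S_def)
      then show ?thesis using arg_min_if_finite(2)[OF S, of sl] unfolding i0_def by (meson not_less)
    qed
    define N where "N = n - i0"
    define d where "d = fls_subdegree (coeff q i0)"
    have N0: "N > 0" using i0 N_def by simp
    have slope: "d * int (n - j) \<le> fls_subdegree (coeff q j) * int N" if "j < n" "coeff q j \<noteq> 0" for j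
    proof -
      have "of_int d / real N \<le> of_int (fls_subdegree (coeff q j)) / real (n - j)"
        using min[OF that] by (simp add: sl_def N_def d_def)
      then have "of_int d * real (n - j) \<le> of_int (fls_subdegree (coeff q j)) * real N"
        using N0 that by (simp add: field_simps)
      then have "real_of_int (d * int (n - j)) \<le> real_of_int (fls_subdegree (coeff q j) * int N)" by simp
      then show ?thesis by linarith
    qed
    obtain T :: "complex fls" where T: "T \<noteq> 0" "fls_subdegree T = 1"
      by (rule that[of fls_X]) auto
    define c where "c i = ram N (coeff q i) * T powi (- (d * int (n - i)))" for i
    have sc: "fls_subdegree (c i) = fls_subdegree (coeff q i) * int N - d * int (n - i)" if "coeff q i \<noteq> 0" for i
      using that N0 T unfolding c_def
      by (subst fls_subdegree_mult) (auto simp: ram_eq_0_iff subdegree_ram)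
    have c0: "fls_subdegree (c i) \<ge> 0" if "i \<le> n" for i
    proof (cases "coeff q i = 0 \<or> i = n")
      case True
      then show ?thesis using dq lq N0 by (auto simp: c_def)
    next
      case False
      then show ?thesis using sc[of i] slope[of i] that by auto
    qed
    define P where "P = (\<Sum>i\<le>n. monom (fls_regpart (c i)) i)"
    have cP: "coeff P i = (if i \<le> n then fls_regpart (c i) else 0)" for i
      by (simp add: P_def coeff_sum)
    have cn: "c n = 1" using dq lq N0 by (auto simp: c_def)
    have dP: "degree P = n"
      by (rule antisym[OF degree_le le_degree]) (auto simp: cP cn)
    have lP: "lead_coeff P = 1" by (simp add: dP cP cn)
    define p0 where "p0 = map_poly (\<lambda>c. fps_nth c 0) P"
    have cp0: "coeff p0 i = (if i \<le> n then fls_nth (c i) 0 else 0)" for i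
      by (simp add: p0_def coeff_map_poly cP)
    have dp0: "degree p0 = n"
      by (rule antisym[OF degree_le le_degree]) (auto simp: cp0 cn)
    have lp0: "lead_coeff p0 = 1" by (simp add: dp0 cp0 cn)
    have "coeff p0 i0 \<noteq> 0"
    proof -
      have "fls_subdegree (c i0) = 0" using sc[OF i0(2)] by (simp add: d_def N_def)
      moreover have "c i0 \<noteq> 0" using i0(2) T N0 by (simp add: c_def ram_eq_0_iff)
      ultimately show ?thesis using i0(1) nth_fls_subdegree_nonzero[of "c i0"] by (simp add: cp0)
    qed
    moreover have "coeff p0 (n - 1) = 0" using q1 N0 by (simp add: cp0 c_def)
    moreover from this have "n \<ge> 2" using \<open>coeff p0 i0 \<noteq> 0\<close> i0(1) by (cases "n = 1") auto
    ultimately obtain a b where ab: "p0 = a * b" "coprime a b" "lead_coeff a = 1" "lead_coeff b = 1"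
      "degree a > 0" "degree b > 0"
      using monic_split_coprime[OF lp0 dp0 _ _ i0(1)] by blast
    obtain A B where AB: "P = A * B" "lead_coeff A = 1" "degree A = degree a"
      using hensel_factorization[OF lP ab(1)[unfolded p0_def] ab(2-6)] by blast
    have "a \<noteq> 0" "b \<noteq> 0" using ab(5,6) by auto
    then have "degree p0 = degree a + degree b" unfolding ab(1) by (rule degree_mult_eq)
    then have "degree a < n" using dp0 ab(6) by simp
    define A' where "A' = map_poly fps_to_fls A"
    have dA': "degree A' = degree a" unfolding A'_def AB(3)[symmetric] by (rule degree_map_poly) auto
    have lA': "lead_coeff A' = 1" using dA' AB by (simp add: A'_def coeff_map_poly)
    have "\<exists>N r. N > 0 \<and> peval (ram N) r A' = 0"
    proof (rule less.hyps)
      show "degree A' < degree p" using dA' \<open>degree a < n\<close> n_def by simp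
      show "lead_coeff A' = 1" by (rule lA')
      show "0 < degree A'" using dA' ab(5) by simp
    qed
    then obtain M r where M: "M > 0" "peval (ram M) r A' = 0" by blast
    have hM: "ring_hom_fun (\<lambda>x. ram M (fps_to_fls x))"
      by (rule ring_hom_fun_comp[OF ring_hom_fun_ram[OF M(1)] ring_hom_fun_fps_to_fls])
    have "peval (\<lambda>x. ram M (fps_to_fls x)) r A = 0"
      using M(2) peval_map_poly[of fps_to_fls "ram M" r A] unfolding A'_def by simp
    then have "peval (\<lambda>x. ram M (fps_to_fls x)) r P = 0"
      unfolding AB(1) by (simp add: ring_hom_fun_simps[OF ring_hom_fun_peval[OF hM]])
    then have "(\<Sum>i\<le>n. ram M (c i) * r ^ i) = 0"
      using c0 by (subst (asm) peval_altdef[where n = n]) (auto simp: dP cP ring_hom_fun_simps[OF hM])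
    moreover have "ram (N * M) (coeff q i) * (r * ram M T powi d) ^ i = ram M (c i) * r ^ i * ram M T powi (d * int n)"
      if "i \<le> n" for i
    proof -
      have T0: "ram M T \<noteq> 0" using T M by (simp add: ram_eq_0_iff)
      have "ram M (c i) = ram (N * M) (coeff q i) * ram M T powi (- (d * int (n - i)))"
        unfolding c_def using M N0 by (subst fls_compose_fps_mult) (auto simp: fls_compose_fps_powi ram_ram)
      moreover have "(ram M T powi d) ^ i = ram M T powi (- (d * int (n - i))) * ram M T powi (d * int n)"
        using that T0 by (simp add: power_int_add[symmetric] power_int_power' of_nat_diff algebra_simps)
      ultimately show ?thesis by (simp add: power_mult_distrib mult_ac)
    qed
    ultimately have "(\<Sum>i\<le>n. ram (N * M) (coeff q i) * (r * ram M T powi d) ^ i) = 0"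
      by (simp add: sum_distrib_right[symmetric])
    then have "peval (ram (N * M)) (r * ram M T powi d) q = 0"
      by (subst peval_altdef[where n = n]) (auto simp: dq)
    then show ?thesis using M N0 by (intro red[of "N * M"]) auto
  qed
qed

lemma puiseux_split:
  fixes p :: "complex fls poly"
  assumes "lead_coeff p = 1" "degree p = n"
  shows "\<exists>N Y. N > 0 \<and> map_poly (ram N) p = (\<Prod>i<n. [:- Y i, 1:])"
  using assms
proof (induction n arbitrary: p)
  case 0
  then have "p = 1" by (metis degree_eq_zeroE lead_coeff_pCons(2) one_pCons pCons_0_0 zero_neq_one lead_coeff_pCons(1))
  then show ?case by (intro exI[of _ 1]) auto
next
  case (Suc n)
  obtain N r where N: "N > 0" "peval (ram N) r p = 0" using puiseux_root[of p] Suc.prems by auto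
  define p' where "p' = map_poly (ram N) p"
  have dp': "degree p' = Suc n" unfolding p'_def Suc.prems(2)[symmetric]
    by (rule degree_map_poly) (use N in \<open>auto simp: ram_eq_0_iff\<close>)
  have lp': "lead_coeff p' = 1" using dp' Suc.prems by (simp add: p'_def coeff_map_poly)
  have "poly p' r = 0" using N by (simp add: peval_def p'_def)
  then obtain q where q: "p' = [:- r, 1:] * q" by (auto simp: poly_eq_0_iff_dvd)
  have "q \<noteq> 0" using q dp' by auto
  then have "degree q = n" using dp' unfolding q by (subst (asm) degree_mult_eq) auto
  moreover have "lead_coeff q = 1" using lp' lead_coeff_mult[of "[:- r, 1:]" q] unfolding q by (simp del: mult_pCons_left)
  ultimately obtain M Y where M: "M > 0" "map_poly (ram M) q = (\<Prod>i<n. [:- Y i, 1:])"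
    using Suc.IH by blast
  have hom: "ring_hom_fun (map_poly (ram M))"
  proof -
    have "map_poly (ram M) p = peval (\<lambda>c. [:ram M c:]) [:0, 1:] p" for p
      by (induction p) (auto simp: peval_pCons map_poly_pCons)
    moreover have "ring_hom_fun (peval (\<lambda>c. [:ram M c:]) [:0, 1:])"
      by (rule ring_hom_fun_peval) (rule ring_hom_fun_comp[OF ring_hom_fun_pCons_const ring_hom_fun_ram[OF M(1)]])
    ultimately show ?thesis by presburger
  qed
  have "map_poly (ram (N * M)) p = map_poly (ram M) p'"
    unfolding p'_def by (subst map_poly_map_poly) (use N M in \<open>auto simp: o_def ram_ram\<close>)
  also have "\<dots> = map_poly (ram M) [:- r, 1:] * (\<Prod>i<n. [:- Y i, 1:])"
    unfolding q ring_hom_fun_simps[OF hom] M(2) ..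
  also have "map_poly (ram M) [:- r, 1:] = [:- ram M r, 1:]"
    using M by (simp add: map_poly_pCons)
  also have "[:- ram M r, 1:] * (\<Prod>i<n. [:- Y i, 1:]) = (\<Prod>i<Suc n. [:- (Y(n := ram M r)) i, 1:])"
    by (simp add: mult.commute)
  finally have "map_poly (ram (N * M)) p = (\<Prod>i<Suc n. [:- (Y(n := ram M r)) i, 1:])" .
  then show ?case using N M by (intro exI[of _ "N * M"] exI[of _ "Y(n := ram M r)"] conjI) simp_all
qed

section \<open>Places of a plane curve\<close>

definition e1 :: "complex fls \<Rightarrow> complex poly \<Rightarrow> complex fls" where
  "e1 X r = peval fls_const X r"

definition e2 :: "complex fls \<Rightarrow> complex fls \<Rightarrow> complex poly poly \<Rightarrow> complex fls" where
  "e2 X Y b = peval (e1 X) Y b"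

lemma ring_hom_fun_e1 [simp]: "ring_hom_fun (e1 X)"
  unfolding e1_def by (intro ring_hom_fun_peval ring_hom_fun_fls_const)

lemma ring_hom_fun_e2 [simp]: "ring_hom_fun (e2 X Y)"
  unfolding e2_def by (intro ring_hom_fun_peval ring_hom_fun_e1)

lemmas e1_simps [simp] = ring_hom_fun_simps[OF ring_hom_fun_e1]
lemmas e2_simps [simp] = ring_hom_fun_simps[OF ring_hom_fun_e2]

lemma e2_const [simp]: "e2 X Y [:r:] = e1 X r"
  by (simp add: e2_def peval_const)

lemma deriv_peval:
  fixes D :: "'b::comm_ring_1 \<Rightarrow> 'b"
  assumes add: "\<And>x y. D (x + y) = D x + D y" and mult: "\<And>x y. D (x * y) = D x * y + x * D y"
    and h: "ring_hom_fun h"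
  shows "D (peval h x p) = peval h x (pderiv p) * D x + peval (\<lambda>c. D (h c)) x p"
proof (induction p)
  case 0
  have "D 0 = 0" using add[of 0 0] by simp
  then show ?case by simp
next
  case (pCons a p)
  have D0: "D 0 = 0" using add[of 0 0] by simp
  have Dp: "peval (\<lambda>c. D (h c)) x (pCons a p) = D (h a) + x * peval (\<lambda>c. D (h c)) x p"
    by (rule peval_pCons) (simp add: D0 ring_hom_fun_simps[OF h])
  note hs = ring_hom_fun_simps[OF h] ring_hom_fun_simps[OF ring_hom_fun_peval[OF h]]
  show ?case
    by (simp add: peval_pCons[of h, OF hs(1)] hs Dp add mult pCons.IH pderiv_pCons algebra_simps)
qed

lemma peval_eq_0I: "(\<And>c. h c = 0) \<Longrightarrow> peval h x p = 0"
  by (induction p) (auto simp: peval_pCons)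

lemma deriv_e1: "fls_deriv (e1 X r) = e1 X (pderiv r) * fls_deriv X"
  unfolding e1_def by (subst deriv_peval) (auto intro: peval_eq_0I)

lemma deriv_e2: "fls_deriv (e2 X Y b) = e2 X Y (pderiv b) * fls_deriv Y + e2 X Y (map_poly pderiv b) * fls_deriv X"
proof -
  have "fls_deriv (e2 X Y b) = e2 X Y (pderiv b) * fls_deriv Y + peval (\<lambda>c. fls_deriv (e1 X c)) Y b"
    unfolding e2_def by (rule deriv_peval) auto
  also have "peval (\<lambda>c. fls_deriv (e1 X c)) Y b = e2 X Y (map_poly pderiv b) * fls_deriv X"
    by (induction b) (auto simp: deriv_e1 e2_def peval_pCons map_poly_pCons algebra_simps)
  finally show ?thesis .
qed

lemma e1_eq_0_iff:
  assumes "fls_deriv X \<noteq> 0"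
  shows "e1 X r = 0 \<longleftrightarrow> r = 0"
proof (induction "degree r" arbitrary: r rule: less_induct)
  case less
  show ?case
  proof
    assume r: "e1 X r = 0"
    show "r = 0"
    proof (cases "degree r = 0")
      case True
      then obtain c where "r = [:c:]" by (metis degree_eq_zeroE)
      then show ?thesis using r by (simp add: e1_def peval_const)
    next
      case False
      have "e1 X (pderiv r) * fls_deriv X = 0" using deriv_e1[of X r] r by simp
      then have "pderiv r = 0" using assms less[of "pderiv r"] False by (simp add: degree_pderiv)
      then show ?thesis using False by (simp add: pderiv_eq_0_iff)
    qed
  qed auto
qed

lemma e2_neq_0:
  assumes "irreducible f" "degree f > 0" "\<not> f dvd b" "fls_deriv X \<noteq> 0" "e2 X Y f = 0"
  shows "e2 X Y b \<noteq> 0"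
proof
  assume b: "e2 X Y b = 0"
  obtain u v r where r: "r \<noteq> 0" "u * f + v * b = [:r:]" using irreducible_bezout[OF assms(1-3)] .
  have "e1 X r = e2 X Y (u * f + v * b)" unfolding r by simp
  also have "\<dots> = 0" using b assms(5) by simp
  finally show False using r(1) assms(4) by (simp add: e1_eq_0_iff)
qed

lemma e2_pderiv_neq_0:
  assumes "irreducible f" "degree f > 0" "fls_deriv X \<noteq> 0" "e2 X Y f = 0"
  shows "e2 X Y (pderiv f) \<noteq> 0"
proof (rule e2_neq_0[OF assms(1,2) _ assms(3,4)])
  show "\<not> f dvd pderiv f"
  proof
    assume "f dvd pderiv f"
    moreover have "pderiv f \<noteq> 0" using assms(2) by (simp add: pderiv_eq_0_iff)
    ultimately show False using dvd_imp_degree_le[of f "pderiv f"] assms(2) by (simp add: degree_pderiv)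
  qed
qed

lemma e1_ram: "N > 0 \<Longrightarrow> ram N (e1 X r) = e1 (ram N X) r"
  unfolding e1_def by (subst peval_hom_comp[OF ring_hom_fun_ram]) auto

lemma e2_ram: "N > 0 \<Longrightarrow> ram N (e2 X Y b) = e2 (ram N X) (ram N Y) b"
  unfolding e2_def by (subst peval_hom_comp[OF ring_hom_fun_ram]) (auto simp: e1_ram)

lemma deriv_compose_fls:
  fixes F :: "complex fls"
  assumes "G \<noteq> 0" "fps_nth G 0 = 0"
  shows "fls_deriv (fls_compose_fps F G) = fls_compose_fps (fls_deriv F) G * fps_to_fls (fps_deriv G)"
proof -
  note [simp] = assms
  have reg: "fls_deriv (fls_compose_fps (fps_to_fls P) G) =
     fls_compose_fps (fls_deriv (fps_to_fls P)) G * fps_to_fls (fps_deriv G)" for P :: "complex fps"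
    by (simp add: fls_deriv_fps_to_fls fps_compose_deriv fls_times_fps_to_fls)
  define n where "n = nat (- fls_subdegree F)"
  define P where "P = fls_regpart (fls_X ^ n * F)"
  have P: "fls_X ^ n * F = fps_to_fls P"
  proof (cases "F = 0")
    case False
    then have "fls_subdegree (fls_X ^ n * F) = int n + fls_subdegree F" by (simp add: fls_subdegree_mult_fls_X_power)
    then show ?thesis unfolding P_def by (subst fls_regpart_to_fls_trivial) (auto simp: n_def)
  qed (auto simp: P_def)
  note cm = fls_compose_fps_mult[OF assms] fls_compose_fps_add[OF assms] fls_compose_fps_power[OF assms]
  have X: "fls_deriv (fls_X ^ n :: complex fls) = of_nat n * fls_X ^ (n - 1)" by (rule fls_deriv_X_power)
  have "fls_deriv (fls_compose_fps (fls_X ^ n * F) G) = fls_compose_fps (fls_deriv (fls_X ^ n * F)) G * fps_to_fls (fps_deriv G)"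
    unfolding P by (rule reg)
  then have "fps_to_fls G ^ n * fls_deriv (fls_compose_fps F G) =
     fps_to_fls G ^ n * (fls_compose_fps (fls_deriv F) G * fps_to_fls (fps_deriv G))"
    by (simp add: cm X fls_deriv_power fls_deriv_fps_to_fls algebra_simps)
  then show ?thesis by simp
qed

lemma deriv_ram_eq_0_iff: "N > 0 \<Longrightarrow> fls_deriv (ram N X) = 0 \<longleftrightarrow> fls_deriv X = 0"
  by (subst deriv_compose_fls) (auto simp: ram_eq_0_iff fps_deriv_power)


section \<open>Rational functions without poles\<close>

lemma lagrange_top_coeff:
  fixes Y :: "nat \<Rightarrow> 'a::field"
  assumes "inj_on Y {..<d}" "degree p < d"
  shows "coeff p (d - 1) = (\<Sum>i<d. poly p (Y i) / (\<Prod>j\<in>{..<d} - {i}. Y i - Y j))"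
proof -
  define L where "L i = (\<Prod>j\<in>{..<d} - {i}. [:- Y j, 1:])" for i
  define q where "q = (\<Sum>i<d. smult (poly p (Y i) / (\<Prod>j\<in>{..<d} - {i}. Y i - Y j)) (L i))"
  have dL: "degree (L i) = d - 1" if "i < d" for i
    unfolding L_def using that by (subst degree_prod_eq_sum_degree) auto
  have lL: "coeff (L i) (d - 1) = 1" if "i < d" for i
    using dL[OF that] lead_coeff_prod[of "\<lambda>j. [:- Y j, 1:]" "{..<d} - {i}"] by (simp add: L_def)
  have pL: "poly (L i) (Y k) = (if i = k then (\<Prod>j\<in>{..<d} - {i}. Y i - Y j) else 0)" if "i < d" "k < d" for i k
    using that by (auto simp: L_def poly_prod intro: prod_zero)
  have nz: "(\<Prod>j\<in>{..<d} - {i}. Y i - Y j) \<noteq> 0" if "i < d" for i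
    using assms(1) that by (auto simp: inj_on_def)
  have "poly q (Y k) = poly p (Y k)" if "k < d" for k
    using that nz[OF that] by (simp add: q_def poly_sum pL if_distrib cong: if_cong)
  then have "\<And>x. x \<in> Y ` {..<d} \<Longrightarrow> poly q x = poly p x" by auto
  moreover have "degree q < d"
  proof -
    have "degree q \<le> d - 1" unfolding q_def
      by (intro degree_sum_le) (use dL in \<open>auto intro: order_trans[OF degree_smult_le]\<close>)
    then show ?thesis using assms(2) by linarith
  qed
  moreover have "card (Y ` {..<d}) = d" using assms(1) by (simp add: card_image)
  ultimately have "q = p"
    using assms(2) by (intro poly_eqI_degree[of "Y ` {..<d}"]) auto
  moreover have "coeff q (d - 1) = (\<Sum>i<d. poly p (Y i) / (\<Prod>j\<in>{..<d} - {i}. Y i - Y j))"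
    using lL by (simp add: q_def coeff_sum)
  ultimately show ?thesis by simp
qed

lemma poly_pderiv_prod_root:
  fixes Y :: "nat \<Rightarrow> 'a::field"
  assumes "i < d"
  shows "poly (pderiv (\<Prod>j<d. [:- Y j, 1:])) (Y i) = (\<Prod>j\<in>{..<d} - {i}. Y i - Y j)"
proof -
  have "(\<Prod>j<d. [:- Y j, 1:]) = [:- Y i, 1:] * (\<Prod>j\<in>{..<d} - {i}. [:- Y j, 1:])"
    using assms by (subst prod.remove[of _ i]) auto
  then show ?thesis by (simp add: pderiv_mult pderiv_pCons poly_prod del: mult_pCons_left)
qed

lemma constant_power_sums:
  fixes g :: "nat \<Rightarrow> complex fls"
  assumes "\<And>j. fls_deriv (\<Sum>i<d. g i ^ j) = 0" "k < d"
  shows "fls_deriv (g k) = 0"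
proof -
  have 1: "(\<Sum>i<d. fls_deriv (g i) * g i ^ j) = 0" for j
  proof -
    have "fls_deriv (\<Sum>i<d. g i ^ Suc j) = of_nat (Suc j) * (\<Sum>i<d. fls_deriv (g i) * g i ^ j)"
      unfolding fls_deriv_sum fls_deriv_power sum_distrib_left by (simp add: mult_ac)
    then show ?thesis using assms(1)[of "Suc j"] by (simp del: of_nat_Suc)
  qed
  have 2: "(\<Sum>i<d. fls_deriv (g i) * poly P (g i)) = 0" for P
  proof -
    have "(\<Sum>i<d. fls_deriv (g i) * poly P (g i)) = (\<Sum>i<d. \<Sum>j\<le>degree P. coeff P j * (fls_deriv (g i) * g i ^ j))"
      by (simp add: poly_altdef sum_distrib_left mult_ac)
    also have "\<dots> = (\<Sum>j\<le>degree P. coeff P j * (\<Sum>i<d. fls_deriv (g i) * g i ^ j))"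
      by (subst sum.swap) (simp add: sum_distrib_left)
    finally show ?thesis by (simp add: 1)
  qed
  define S where "S = g ` {..<d} - {g k}"
  define P where "P = (\<Prod>s\<in>S. [:- s, 1:])"
  have fin: "finite S" by (simp add: S_def)
  have P: "poly P x = (\<Prod>s\<in>S. x - s)" for x by (simp add: P_def poly_prod)
  have Pk: "poly P (g k) \<noteq> 0" using fin by (auto simp: P S_def)
  have "poly P (g i) = (if g i = g k then poly P (g k) else 0)" if "i < d" for i
    using that fin by (auto simp: P S_def intro!: prod_zero)
  then have "(\<Sum>i<d. fls_deriv (g i) * poly P (g i)) = (\<Sum>i<d. if g i = g k then fls_deriv (g k) * poly P (g k) else 0)"
    by (intro sum.cong) auto
  also have "\<dots> = of_nat (card {i. i < d \<and> g i = g k}) * (fls_deriv (g k) * poly P (g k))"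
    by (simp add: sum.If_cases Collect_conj_eq lessThan_def)
  finally have "of_nat (card {i. i < d \<and> g i = g k}) * (fls_deriv (g k) * poly P (g k)) = 0" using 2 by simp
  moreover have "card {i. i < d \<and> g i = g k} \<noteq> 0" using assms(2) by auto
  ultimately show ?thesis using Pk by simp
qed

lemma fls_nth_e1_finite:
  assumes "N > 0"
  shows "\<exists>R. e1 (fls_const x0 + fls_X ^ N) r = fps_to_fls R \<and> fps_nth R 0 = poly r x0"
proof -
  define X where "X = fps_const x0 + fps_X ^ N"
  have X: "fps_to_fls X = fls_const x0 + fls_X ^ N" by (simp add: X_def fps_to_fls_power)
  have "fps_to_fls (peval fps_const X r) = e1 (fls_const x0 + fls_X ^ N) r"
    unfolding e1_def X[symmetric] by (subst peval_hom_comp[OF ring_hom_fun_fps_to_fls]) auto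
  moreover have "fps_nth (peval fps_const X r) 0 = poly r x0"
  proof -
    have h: "ring_hom_fun (\<lambda>F::complex fps. fps_nth F 0)" by (auto simp: ring_hom_fun_def)
    have "fps_nth X 0 = x0" using assms by (simp add: X_def)
    then show ?thesis
      using peval_hom_comp[OF h ring_hom_fun_fps_const, of X r] by (simp add: peval_def)
  qed
  ultimately show ?thesis by metis
qed

lemma fls_deriv_nz_of_subdegree: "fls_subdegree (X :: complex fls) \<noteq> 0 \<Longrightarrow> fls_deriv X \<noteq> 0"
proof
  assume "fls_subdegree X \<noteq> 0" "fls_deriv X = 0"
  then obtain c where "X = fls_const c" using fls_deriv_eq_0_iff[of X] by blast
  then show False using \<open>fls_subdegree X \<noteq> 0\<close> by simp
qed

lemma subdegree_e1_infinite:
  assumes "N > 0" "r \<noteq> 0"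
  shows "fls_subdegree (e1 (inverse (fls_X ^ N)) r) = - int N * int (degree r)"
  using assms(2)
proof (induction r)
  case (pCons c q)
  define X :: "complex fls" where "X = inverse (fls_X ^ N)"
  have sX: "fls_subdegree X = - int N" "X \<noteq> 0" by (auto simp: X_def fls_subdegree_pow)
  have eq: "e1 X (pCons c q) = fls_const c + X * e1 X q" by (simp add: e1_def peval_pCons)
  show ?case
  proof (cases "q = 0")
    case True
    then show ?thesis using pCons by (simp add: e1_def peval_const)
  next
    case False
    have q: "fls_subdegree (e1 X q) = - int N * int (degree q)" using pCons.IH False X_def by simp
    have "e1 X q \<noteq> 0"
    proof -
      have "fls_deriv X \<noteq> 0" using sX assms(1) by (intro fls_deriv_nz_of_subdegree) simp
      then show ?thesis using False by (simp add: e1_eq_0_iff)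
    qed
    then have s: "fls_subdegree (X * e1 X q) = - int N * int (Suc (degree q))"
      using q sX by (simp add: algebra_simps)
    then have "fls_subdegree (X * e1 X q) < 0" using assms(1) by simp
    then have "fls_subdegree (X * e1 X q + fls_const c) = fls_subdegree (X * e1 X q)"
      using \<open>e1 X q \<noteq> 0\<close> sX by (intro fls_subdegree_add_eq1) (auto simp del: fls_subdegree_mult)
    then show ?thesis using s False unfolding X_def[symmetric] eq by (simp add: add.commute)
  qed
qed simp

lemma rational_function_constant:
  fixes n R :: "complex poly"
  assumes "R \<noteq> 0"
    and fin: "\<And>x0. \<exists>N>0. fls_subdegree (e1 (fls_const x0 + fls_X ^ N) n / e1 (fls_const x0 + fls_X ^ N) R) \<ge> 0"
    and inf: "\<exists>N>0. fls_subdegree (e1 (inverse (fls_X ^ N)) n / e1 (inverse (fls_X ^ N)) R) \<ge> 0"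
  shows "\<exists>c. n = smult c R"
proof (cases "n = 0")
  case False
  define G where "G = gcd n R"
  obtain n1 R1 where nR: "n = G * n1" "R = G * R1" and cop: "coprime n1 R1"
    using gcd_coprime_exists[of n R] False unfolding G_def by (auto simp: mult.commute)
  have nz: "G \<noteq> 0" "n1 \<noteq> 0" "R1 \<noteq> 0" using False assms(1) nR by auto
  have "degree R1 = 0"
  proof (rule ccontr)
    assume "degree R1 \<noteq> 0"
    then obtain x0 where x0: "poly R1 x0 = 0"
      using fundamental_theorem_of_algebra[of R1] constant_degree by metis
    have n1: "poly n1 x0 \<noteq> 0" using coprime_poly_0[OF cop, of x0] x0 by auto
    obtain N where N: "N > 0" "fls_subdegree (e1 (fls_const x0 + fls_X ^ N) n / e1 (fls_const x0 + fls_X ^ N) R) \<ge> 0"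
      using fin by blast
    define X where "X = fls_const x0 + fls_X ^ N"
    have dX: "fls_deriv X \<noteq> 0" using N(1) by (auto simp: X_def fls_deriv_X_power)
    obtain A where A: "e1 X n1 = fps_to_fls A" "fps_nth A 0 = poly n1 x0" using fls_nth_e1_finite[OF N(1)] unfolding X_def by blast
    obtain B where B: "e1 X R1 = fps_to_fls B" "fps_nth B 0 = poly R1 x0" using fls_nth_e1_finite[OF N(1)] unfolding X_def by blast
    have AB: "A \<noteq> 0" "B \<noteq> 0" using A(1) B(1) nz e1_eq_0_iff[OF dX, of n1] e1_eq_0_iff[OF dX, of R1] by auto
    have "fls_subdegree (e1 X n / e1 X R) = int (subdegree A) - int (subdegree B)"
    proof -
      have "e1 X n / e1 X R = e1 X n1 / e1 X R1"
        using nz e1_eq_0_iff[OF dX] unfolding nR by simp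
      then show ?thesis unfolding A B using AB by (simp add: fls_divide_subdegree fls_subdegree_fls_to_fps)
    qed
    moreover have "subdegree A = 0" using A n1 by (simp add: subdegree_eq_0_iff)
    moreover have "subdegree B > 0" using B x0 AB(2) nth_subdegree_nonzero[of B] by (cases "subdegree B = 0") auto
    ultimately show False using N(2) unfolding X_def by simp
  qed
  then obtain r where r: "R1 = [:r:]" by (metis degree_eq_zeroE)
  obtain N where N: "N > 0" "fls_subdegree (e1 (inverse (fls_X ^ N)) n / e1 (inverse (fls_X ^ N)) R) \<ge> 0"
    using inf by blast
  define X :: "complex fls" where "X = inverse (fls_X ^ N)"
  have dX: "fls_deriv X \<noteq> 0" using N(1) by (intro fls_deriv_nz_of_subdegree) (simp add: X_def fls_subdegree_pow)
  have "fls_subdegree (e1 X n / e1 X R) = - int N * int (degree n) - (- int N * int (degree R))"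
    using nz False assms(1) e1_eq_0_iff[OF dX] subdegree_e1_infinite[OF N(1)]
    unfolding X_def by (subst fls_divide_subdegree) auto
  then have "int N * int (degree n) \<le> int N * int (degree R)" using N(2) unfolding X_def by simp
  then have "degree n \<le> degree R" using N(1) by simp
  then have "degree n1 = 0" using nR nz r by (simp add: degree_mult_eq)
  then obtain c where "n1 = [:c:]" by (metis degree_eq_zeroE)
  then have "n = smult (c / r) R" using nR r nz by simp
  then show ?thesis by blast
qed auto

lemma monic_remainder:
  fixes f b :: "'a::idom poly"
  assumes "lead_coeff f = 1" "degree f > 0"
  shows "\<exists>s. f dvd b - s \<and> degree s < degree f"
proof -
  have f0: "f \<noteq> 0" using assms by auto
  obtain q r where qr: "pseudo_divmod b f = (q, r)" by fastforce
  from pseudo_divmod[OF f0 qr] have "b = f * q + r" "r = 0 \<or> degree r < degree f"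
    using assms by auto
  then show ?thesis using assms(2) by (intro exI[of _ r]) auto
qed

lemma ring_hom_fun_of_nat: "ring_hom_fun h \<Longrightarrow> h (of_nat n) = of_nat n"
  by (induction n) (auto simp: ring_hom_fun_simps)

lemma e2_eq_poly: "e2 X Y b = poly (map_poly (e1 X) b) Y"
  by (simp add: e2_def peval_def)

lemma map_poly_e1_prod_roots:
  fixes f :: "complex poly poly"
  assumes f: "irreducible f" "lead_coeff f = 1" "degree f = d" "d > 0" and X: "fls_deriv X \<noteq> 0"
    and Y: "map_poly (e1 X) f = (\<Prod>i<d. [:- Y i, 1:])"
  shows "\<And>i. i < d \<Longrightarrow> e2 X (Y i) f = 0" "inj_on Y {..<d}"
    "\<And>i. i < d \<Longrightarrow> e2 X (Y i) (pderiv f) = (\<Prod>j\<in>{..<d} - {i}. Y i - Y j)"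
proof -
  show 1: "e2 X (Y i) f = 0" if "i < d" for i
    using that unfolding e2_eq_poly Y by (auto simp: poly_prod intro!: prod_zero)
  have "map_poly (e1 X) (pderiv f) = pderiv (map_poly (e1 X) f)"
    by (intro poly_eqI) (simp add: coeff_map_poly coeff_pderiv ring_hom_fun_of_nat[OF ring_hom_fun_e1])
  then show 2: "e2 X (Y i) (pderiv f) = (\<Prod>j\<in>{..<d} - {i}. Y i - Y j)" if "i < d" for i
    unfolding e2_eq_poly Y using poly_pderiv_prod_root[OF that, of Y] by simp
  show "inj_on Y {..<d}"
  proof (rule inj_onI)
    fix i j assume ij: "i \<in> {..<d}" "j \<in> {..<d}" "Y i = Y j"
    show "i = j"
    proof (rule ccontr)
      assume "i \<noteq> j"
      then have "(\<Prod>k\<in>{..<d} - {i}. Y i - Y k) = 0" using ij by (intro prod_zero) auto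
      then show False using 2[of i] e2_pderiv_neq_0[OF f(1) _ X 1[of i]] ij f by simp
    qed
  qed
qed

lemma regular_function_constant:
  fixes f a :: "complex poly poly" and r :: "complex poly"
  assumes f: "irreducible f" "lead_coeff f = 1" "degree f = d" "d > 0" and r: "r \<noteq> 0"
    and reg: "\<And>X Y. fls_deriv X \<noteq> 0 \<Longrightarrow> e2 X Y f = 0 \<Longrightarrow> fls_subdegree (e2 X Y a / e1 X r) \<ge> 0"
    and XY: "fls_deriv X \<noteq> 0" "e2 X Y f = 0"
  shows "fls_deriv (e2 X Y a / e1 X r) = 0"
proof -
  have split: "\<exists>N Y. N > 0 \<and> map_poly (e1 (ram N X)) f = (\<Prod>i<d. [:- Y i, 1:])" if "fls_deriv X \<noteq> 0" for X
  proof -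
    have "degree (map_poly (e1 X) f) = d" unfolding f(3)[symmetric]
      by (rule degree_map_poly) (use that in \<open>simp add: e1_eq_0_iff\<close>)
    moreover from this have "lead_coeff (map_poly (e1 X) f) = 1" using f by (simp add: coeff_map_poly)
    ultimately obtain N Y where N: "N > 0" "map_poly (ram N) (map_poly (e1 X) f) = (\<Prod>i<d. [:- Y i, 1:])"
      using puiseux_split by blast
    have "map_poly (ram N) (map_poly (e1 X) f) = map_poly (e1 (ram N X)) f"
      using N(1) by (subst map_poly_map_poly) (auto simp: o_def e1_ram)
    then show ?thesis using N by metis
  qed
  have "\<exists>s. \<forall>j. f dvd a ^ j * pderiv f - s j \<and> degree (s j) < d"
    using monic_remainder[of f] f by (intro choice) auto
  then obtain s where s: "\<And>j. f dvd a ^ j * pderiv f - s j" "\<And>j. degree (s j) < d" by blast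
  define n where "n j = coeff (s j) (d - 1)" for j
  have trace: "e1 X (n j) = (\<Sum>i<d. e2 X (Y i) a ^ j)"
    if X: "fls_deriv X \<noteq> 0" and Y: "map_poly (e1 X) f = (\<Prod>i<d. [:- Y i, 1:])" for X Y j
  proof -
    note R = map_poly_e1_prod_roots[OF f X Y]
    have "e1 X (n j) = coeff (map_poly (e1 X) (s j)) (d - 1)" by (simp add: n_def coeff_map_poly)
    also have "degree (map_poly (e1 X) (s j)) < d"
      using s(2)[of j] X by (subst degree_map_poly) (auto simp: e1_eq_0_iff)
    then have "coeff (map_poly (e1 X) (s j)) (d - 1) =
       (\<Sum>i<d. poly (map_poly (e1 X) (s j)) (Y i) / (\<Prod>j\<in>{..<d} - {i}. Y i - Y j))"
      by (rule lagrange_top_coeff[OF R(2)])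
    also have "\<dots> = (\<Sum>i<d. e2 X (Y i) a ^ j)"
    proof (rule sum.cong[OF refl])
      fix i assume "i \<in> {..<d}"
      then have i: "i < d" by simp
      have "e2 X (Y i) (a ^ j * pderiv f - s j) = 0"
        using ring_hom_fun_dvd[OF ring_hom_fun_e2 s(1) R(1)[OF i]] .
      then have "e2 X (Y i) (s j) = e2 X (Y i) a ^ j * e2 X (Y i) (pderiv f)" by simp
      moreover have "e2 X (Y i) (pderiv f) \<noteq> 0"
        using e2_pderiv_neq_0[OF f(1) _ X R(1)[OF i]] f by simp
      ultimately show "poly (map_poly (e1 X) (s j)) (Y i) / (\<Prod>j\<in>{..<d} - {i}. Y i - Y j) = e2 X (Y i) a ^ j"
        unfolding e2_eq_poly[symmetric] R(3)[OF i, symmetric] by simp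
    qed
    finally show ?thesis .
  qed
  have powersum: "e1 X (n j) / e1 X (r ^ j) = (\<Sum>i<d. (e2 X (Y i) a / e1 X r) ^ j)"
    if X: "fls_deriv X \<noteq> 0" and Y: "map_poly (e1 X) f = (\<Prod>i<d. [:- Y i, 1:])" for X Y j
    unfolding trace[OF that] by (simp add: sum_divide_distrib power_divide)
  have sub: "fls_subdegree (e1 X (n j) / e1 X (r ^ j)) \<ge> 0"
    if X: "fls_deriv X \<noteq> 0" and Y: "map_poly (e1 X) f = (\<Prod>i<d. [:- Y i, 1:])" for X Y j
  proof -
    note R = map_poly_e1_prod_roots[OF f X Y]
    have "\<exists>P. e2 X (Y i) a / e1 X r = fps_to_fls P" if "i < d" for i
      by (rule exI, rule sym, rule fls_regpart_to_fls_trivial, rule reg[OF X R(1)[OF that]])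
    then obtain P where P: "\<And>i. i < d \<Longrightarrow> e2 X (Y i) a / e1 X r = fps_to_fls (P i)" by metis
    have "e1 X (n j) / e1 X (r ^ j) = (\<Sum>i<d. fps_to_fls (P i) ^ j)"
      unfolding powersum[OF X Y] by (intro sum.cong) (auto simp: P)
    also have "\<dots> = fps_to_fls (\<Sum>i<d. P i ^ j)"
      by (simp add: ring_hom_fun_sum[OF ring_hom_fun_fps_to_fls] ring_hom_fun_simps[OF ring_hom_fun_fps_to_fls])
    finally show ?thesis by (simp add: fls_subdegree_fls_to_fps)
  qed
  have "\<exists>c. n j = smult c (r ^ j)" for j
  proof (rule rational_function_constant)
    show "r ^ j \<noteq> 0" using r by simp
    fix x0
    define X :: "complex fls" where "X = fls_const x0 + fls_X"
    have X: "fls_deriv X \<noteq> 0" by (simp add: X_def)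
    obtain N Y where N: "N > 0" "map_poly (e1 (ram N X)) f = (\<Prod>i<d. [:- Y i, 1:])" using split[OF X] by blast
    have "ram N X = fls_const x0 + fls_X ^ N"
      using N(1) by (simp add: X_def fls_compose_fps_add fps_to_fls_power)
    then show "\<exists>N>0. fls_subdegree (e1 (fls_const x0 + fls_X ^ N) (n j) / e1 (fls_const x0 + fls_X ^ N) (r ^ j)) \<ge> 0"
      using sub[OF _ N(2), of j] N(1) X deriv_ram_eq_0_iff[OF N(1), of X] by (intro exI[of _ N]) simp
  next
    define X :: "complex fls" where "X = inverse fls_X"
    have X: "fls_deriv X \<noteq> 0" by (rule fls_deriv_nz_of_subdegree) (simp add: X_def)
    obtain N Y where N: "N > 0" "map_poly (e1 (ram N X)) f = (\<Prod>i<d. [:- Y i, 1:])" using split[OF X] by blast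
    have "ram N X = inverse (fls_X ^ N)"
      using N(1) unfolding X_def by (subst fls_compose_fps_inverse) (auto simp: fps_to_fls_power)
    then show "\<exists>N>0. fls_subdegree (e1 (inverse (fls_X ^ N)) (n j) / e1 (inverse (fls_X ^ N)) (r ^ j)) \<ge> 0"
      using sub[OF _ N(2), of j] N(1) X deriv_ram_eq_0_iff[OF N(1), of X] by (intro exI[of _ N]) simp
  qed
  then have "\<exists>c. \<forall>j. n j = smult (c j) (r ^ j)" by (intro choice allI)
  then obtain c where c: "\<And>j. n j = smult (c j) (r ^ j)" by blast
  obtain N Z where N: "N > 0" "map_poly (e1 (ram N X)) f = (\<Prod>i<d. [:- Z i, 1:])" using split[OF XY(1)] by blast
  have X': "fls_deriv (ram N X) \<noteq> 0" using XY(1) N(1) by (simp add: deriv_ram_eq_0_iff)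
  define g where "g i = e2 (ram N X) (Z i) a / e1 (ram N X) r" for i
  have r0: "e1 (ram N X) r \<noteq> 0" using r X' by (simp add: e1_eq_0_iff)
  have psum: "(\<Sum>i<d. g i ^ j) = fls_const (c j)" for j
  proof -
    have "e1 (ram N X) (n j) = e1 (ram N X) [:c j:] * e1 (ram N X) (r ^ j)"
      unfolding e1_simps(4)[symmetric] c by simp
    moreover have "e1 (ram N X) [:c j:] = fls_const (c j)" by (simp add: e1_def peval_const)
    moreover have "e1 (ram N X) (r ^ j) \<noteq> 0" using r0 by simp
    ultimately show ?thesis using powersum[OF X' N(2), of j] unfolding g_def by simp
  qed
  have g: "fls_deriv (g k) = 0" if "k < d" for k
  proof (rule constant_power_sums[of g d k, OF _ that])
    show "fls_deriv (\<Sum>i<d. g i ^ j) = 0" for j unfolding psum by (rule fls_deriv_const)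
  qed
  have "e2 (ram N X) (ram N Y) f = 0" using XY(2) N(1) by (simp add: e2_ram[symmetric])
  then obtain k where k: "k < d" "ram N Y = Z k"
    unfolding e2_eq_poly N(2) poly_prod by (auto simp: prod_zero_iff)
  have "ram N (e2 X Y a / e1 X r) = g k"
    using N(1) unfolding g_def k(2)[symmetric] by (subst fls_compose_fps_divide) (auto simp: e2_ram e1_ram)
  then have "fls_deriv (ram N (e2 X Y a / e1 X r)) = 0" using g[OF k(1)] by simp
  then show ?thesis using N(1) by (simp add: deriv_ram_eq_0_iff)
qed

section \<open>Even polynomials and logarithmic derivatives\<close>

definition logd :: "complex poly \<Rightarrow> complex \<Rightarrow> complex" where
  "logd f x = poly (pderiv f) x / poly f x"

lemma logd_mult: "poly f x \<noteq> 0 \<Longrightarrow> poly g x \<noteq> 0 \<Longrightarrow> logd (f * g) x = logd f x + logd g x"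
  by (simp add: logd_def pderiv_mult add_divide_distrib)

lemma logd_power: "poly f x \<noteq> 0 \<Longrightarrow> logd (f ^ n) x = of_nat n * logd f x"
proof (induction n)
  case (Suc n)
  have "logd (f ^ Suc n) x = logd f x + logd (f ^ n) x"
    using Suc.prems unfolding power_Suc by (intro logd_mult) auto
  then show ?case using Suc by (simp add: algebra_simps)
qed (simp add: logd_def)

lemma logd_linear [simp]: "logd [:1, a:] x = a / (1 + a * x)"
  by (simp add: logd_def pderiv_pCons mult.commute)

definition even_poly :: "complex poly \<Rightarrow> bool" where
  "even_poly f \<longleftrightarrow> (\<forall>x. poly f (- x) = poly f x)"

lemma even_poly_pcompose: "even_poly f \<longleftrightarrow> pcompose f [:0, -1:] = f"
  unfolding even_poly_def poly_eq_poly_eq_iff[symmetric] fun_eq_iff by (simp add: poly_pcompose)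

lemma even_poly_pderiv: "even_poly f \<Longrightarrow> poly (pderiv f) (- x) = - poly (pderiv f) x"
proof -
  assume "even_poly f"
  then have "pderiv (pcompose f [:0, -1:]) = pderiv f" by (simp add: even_poly_pcompose)
  then have "poly (pcompose (pderiv f) [:0, -1:] * [:-1:]) x = poly (pderiv f) x"
    by (simp add: pderiv_pcompose pderiv_pCons)
  then have "- poly (pderiv f) (- x) = poly (pderiv f) x" by (simp add: poly_pcompose)
  from arg_cong[OF this, of uminus] show ?thesis by simp
qed

lemma even_poly_logd:
  assumes "even_poly f"
  shows "logd f x + logd f (- x) = 0"
  using even_poly_pderiv[OF assms, of x] assms by (simp add: logd_def even_poly_def)

lemma even_poly_logd_0: "even_poly f \<Longrightarrow> logd f 0 = 0"
  using even_poly_logd[of f 0] by simp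

lemma even_poly_power: "even_poly f \<Longrightarrow> even_poly (f ^ n)"
  by (simp add: even_poly_def poly_power)

lemma even_poly_cancel:
  assumes "even_poly (g * f)" "even_poly g" "g \<noteq> 0"
  shows "even_poly f"
proof -
  have "g * f = pcompose (g * f) [:0, -1:]" using assms(1) by (simp add: even_poly_pcompose)
  also have "\<dots> = g * pcompose f [:0, -1:]" using assms(2) by (simp add: even_poly_pcompose pcompose_mult)
  finally show ?thesis using assms(3) by (simp add: even_poly_pcompose)
qed

lemma pcompose_power: "pcompose (f ^ n) g = pcompose f g ^ n"
  by (induction n) (auto simp: pcompose_mult pcompose_1)

lemma linear_power_cancel:
  fixes R S :: "complex poly"
  assumes "[:1, a:] ^ n * R = [:1, a:] ^ m * S" "a * x = -1" "poly R x \<noteq> 0"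
  shows "m \<le> n"
proof (rule ccontr)
  assume "\<not> m \<le> n"
  then have "[:1, a:] ^ m = [:1, a:] ^ n * ([:1, a:] ^ (m - n))"
    by (simp add: power_add[symmetric])
  then have "[:1, a:] ^ n * R = [:1, a:] ^ n * ([:1, a:] ^ (m - n) * S)" using assms(1) by (simp add: mult.assoc)
  then have "R = [:1, a:] ^ (m - n) * S" by (subst (asm) mult_left_cancel) auto
  moreover have "poly [:1, a:] x = 0" using assms(2) by (simp add: mult.commute)
  ultimately have "poly R x = 0" using \<open>\<not> m \<le> n\<close> by simp
  then show False using assms(3) by simp
qed

lemma even_poly_opposite_linear_powers:
  assumes "even_poly ([:1, a:] ^ n * [:1, - a:] ^ m * R)" "a \<noteq> 0"
    and "poly R (1 / a) \<noteq> 0" "poly R (- 1 / a) \<noteq> 0"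
  shows "n = m"
proof -
  let ?s = "\<lambda>f. pcompose f [:0, -1::complex:]"
  have eq: "[:1, - a:] ^ n * [:1, a:] ^ m * ?s R = [:1, a:] ^ n * [:1, - a:] ^ m * R"
    using assms(1) by (simp add: even_poly_pcompose pcompose_mult pcompose_power pcompose_pCons)
  have eq': "[:1, a:] ^ n * ([:1, - a:] ^ m * R) = [:1, a:] ^ m * ([:1, - a:] ^ n * ?s R)"
    using eq by (simp add: mult_ac)
  have r: "a * (- 1 / a) = -1" using assms(2) by simp
  have "m \<le> n" by (rule linear_power_cancel[OF eq' r]) (use assms(2-4) in \<open>simp add: poly_power\<close>)
  moreover have "n \<le> m" by (rule linear_power_cancel[OF eq'[symmetric] r])
     (use assms(2-4) in \<open>simp add: poly_power poly_pcompose\<close>)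
  ultimately show ?thesis by simp
qed

section \<open>Binary forms\<close>

definition binform :: "('b::comm_ring_1 \<Rightarrow> 'a::comm_ring_1) \<Rightarrow> nat \<Rightarrow> 'b poly \<Rightarrow> 'a \<Rightarrow> 'a \<Rightarrow> 'a" where
  "binform h n P u v = (\<Sum>l\<le>n. h (coeff P l) * u ^ l * v ^ (n - l))"

lemma binform_linear_factor:
  assumes h: "ring_hom_fun h" and "degree R \<le> n"
  shows "binform h (Suc n) ([:-1, 1:] * R) u v = (u - v) * binform h n R u v"
proof -
  note [simp] = ring_hom_fun_simps[OF h]
  have c: "coeff ([:-1, 1:] * R) l = (if l = 0 then 0 else coeff R (l - 1)) - coeff R l" for l
    by (simp add: coeff_pCons split: nat.split)
  have "binform h (Suc n) ([:-1, 1:] * R) u v =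
     (\<Sum>l\<le>Suc n. (if l = 0 then 0 else h (coeff R (l - 1))) * u ^ l * v ^ (Suc n - l)) -
     (\<Sum>l\<le>Suc n. h (coeff R l) * u ^ l * v ^ (Suc n - l))"
    unfolding binform_def c sum_subtractf[symmetric] by (intro sum.cong) (auto simp: algebra_simps)
  also have "(\<Sum>l\<le>Suc n. (if l = 0 then 0 else h (coeff R (l - 1))) * u ^ l * v ^ (Suc n - l)) = u * binform h n R u v"
    by (subst sum.atMost_Suc_shift) (simp add: binform_def sum_distrib_left mult_ac)
  also have "(\<Sum>l\<le>Suc n. h (coeff R l) * u ^ l * v ^ (Suc n - l)) = v * binform h n R u v"
    using assms(2) by (simp add: binform_def sum_distrib_left Suc_diff_le coeff_eq_0 mult_ac)
  finally show ?thesis by (simp add: algebra_simps)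
qed

lemma binform_power_factor:
  fixes R :: "complex poly"
  assumes h: "ring_hom_fun h" and "degree R \<le> n"
  shows "binform h (n + k) ([:-1, 1:] ^ k * R) u v = (u - v) ^ k * binform h n R u v"
proof (induction k)
  case (Suc k)
  have "degree ([:-1, 1:] ^ k * R) \<le> n + k"
    using degree_mult_le[of "[:-1, 1:] ^ k" R] assms(2) degree_linear_power[of "-1::complex" k] by linarith
  then have "binform h (Suc (n + k)) ([:-1, 1:] * ([:-1, 1:] ^ k * R)) u v = (u - v) * binform h (n + k) ([:-1, 1:] ^ k * R) u v"
    by (rule binform_linear_factor[OF h])
  then show ?case using Suc by (simp only: power_Suc mult.assoc add_Suc_right)
qed simp

lemma binform_eq_left: "\<exists>R. binform h n P u v = h (coeff P 0) * v ^ n + u * R"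
proof -
  have "binform h n P u v = h (coeff P 0) * v ^ n + (\<Sum>l\<in>{1..n}. h (coeff P l) * u ^ l * v ^ (n - l))"
    unfolding binform_def atMost_atLeast0 by (subst sum.atLeast_Suc_atMost) auto
  also have "(\<Sum>l\<in>{1..n}. h (coeff P l) * u ^ l * v ^ (n - l)) = u * (\<Sum>l\<in>{1..n}. h (coeff P l) * u ^ (l - 1) * v ^ (n - l))"
    unfolding sum_distrib_left by (intro sum.cong refl) (auto simp: power_eq_if)
  finally show ?thesis by blast
qed

lemma binform_eq_right: "\<exists>R. binform h n P u v = h (coeff P n) * u ^ n + v * R"
proof -
  have "binform h n P u v = h (coeff P n) * u ^ n + (\<Sum>l<n. h (coeff P l) * u ^ l * v ^ (n - l))"
    unfolding binform_def lessThan_Suc_atMost[symmetric] by simp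
  also have "(\<Sum>l<n. h (coeff P l) * u ^ l * v ^ (n - l)) = v * (\<Sum>l<n. h (coeff P l) * u ^ l * v ^ (n - l - 1))"
    unfolding sum_distrib_left by (intro sum.cong refl) (auto simp: power_eq_if)
  finally show ?thesis by blast
qed

lemma binform_1_1: "degree P \<le> n \<Longrightarrow> ring_hom_fun h \<Longrightarrow> binform h n P 1 1 = h (poly P 1)"
  by (simp add: binform_def poly_altdef ring_hom_fun_sum[of h, symmetric])
     (intro arg_cong[of _ _ h] sum.mono_neutral_right; auto simp: coeff_eq_0)

abbreviation cbin :: "nat \<Rightarrow> complex poly \<Rightarrow> complex poly \<Rightarrow> complex poly \<Rightarrow> complex poly" where
  "cbin \<equiv> binform (\<lambda>c. [:c:])"

lemma poly_cbin: "poly (cbin n P u v) x = binform (\<lambda>c. c) n P (poly u x) (poly v x)"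
  by (simp add: binform_def poly_sum poly_power mult.assoc)

lemma binform_0_left: "binform (\<lambda>c. c) n P 0 v = coeff P 0 * v ^ n"
  using binform_eq_left[of "\<lambda>c. c" n P 0 v] by auto

lemma binform_0_right: "binform (\<lambda>c. c) n P u 0 = coeff P n * u ^ n"
  using binform_eq_right[of "\<lambda>c. c" n P u 0] by auto

lemma logd_cbin_left:
  assumes "poly l x = 0" "poly v x \<noteq> 0" "coeff P 0 \<noteq> 0" "l ^ 2 dvd u"
  shows "logd (cbin n P u v) x = of_nat n * logd v x"
proof -
  obtain R where R: "cbin n P u v = [:coeff P 0:] * v ^ n + u * R" using binform_eq_left[of "\<lambda>c. [:c:]" n P u v] by blast
  obtain u1 where u: "u = l ^ 2 * u1" using assms(4) by blast
  have "poly u x = 0" "poly (pderiv u) x = 0" using assms(1) by (auto simp: u pderiv_mult pderiv_power poly_power)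
  then have "logd (cbin n P u v) x = logd ([:coeff P 0:] * v ^ n) x"
    unfolding logd_def R by (simp add: pderiv_add pderiv_mult)
  also have "\<dots> = of_nat n * logd v x"
    using assms(2,3) by (subst logd_mult) (auto simp: logd_power poly_power, simp add: logd_def pderiv_pCons)
  finally show ?thesis .
qed

lemma logd_cbin_right:
  assumes "poly l x = 0" "poly u x \<noteq> 0" "coeff P n \<noteq> 0" "l ^ 2 dvd v"
  shows "logd (cbin n P u v) x = of_nat n * logd u x"
proof -
  obtain R where R: "cbin n P u v = [:coeff P n:] * u ^ n + v * R" using binform_eq_right[of "\<lambda>c. [:c:]" n P u v] by blast
  obtain v1 where v: "v = l ^ 2 * v1" using assms(4) by blast
  have "poly v x = 0" "poly (pderiv v) x = 0" using assms(1) by (auto simp: v pderiv_mult pderiv_power poly_power)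
  then have "logd (cbin n P u v) x = logd ([:coeff P n:] * u ^ n) x"
    unfolding logd_def R by (simp add: pderiv_add pderiv_mult)
  also have "\<dots> = of_nat n * logd u x"
    using assms(2,3) by (subst logd_mult) (auto simp: logd_power poly_power, simp add: logd_def pderiv_pCons)
  finally show ?thesis .
qed

lemma pderiv_sum: "pderiv (sum f A) = (\<Sum>x\<in>A. pderiv (f x))"
  by (induction A rule: infinite_finite_induct) (auto simp: pderiv_add)

lemma logd_cbin_1_1:
  assumes "degree P \<le> n" "poly P 1 \<noteq> 0" "poly u x = 1" "poly v x = 1" "poly (pderiv u) x = d" "poly (pderiv v) x = d"
  shows "logd (cbin n P u v) x = of_nat n * d"
proof -
  have p: "poly (cbin n P u v) x = poly P 1"
    unfolding poly_cbin assms by (rule binform_1_1) (use assms in auto)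
  have "poly (pderiv (cbin n P u v)) x = (\<Sum>l\<le>n. coeff P l * (of_nat l * d + of_nat (n - l) * d))"
    unfolding binform_def
    by (simp add: pderiv_sum poly_sum pderiv_mult pderiv_power poly_power assms pderiv_smult algebra_simps
             cong: sum.cong)
  also have "\<dots> = (\<Sum>l\<le>n. coeff P l) * (of_nat n * d)"
    unfolding sum_distrib_right by (intro sum.cong refl) (auto simp: of_nat_diff algebra_simps)
  also have "(\<Sum>l\<le>n. coeff P l) = poly P 1"
    using binform_1_1[OF assms(1) ring_hom_fun_id] by (simp add: binform_def)
  finally show ?thesis using assms(2) p by (simp add: logd_def)
qed


section \<open>Quasihomogeneous forms restricted to the tangent line\<close>

lemma poly_linear_simps:
  fixes A :: complex
  shows "poly ([:1, A:] ^ n) x = (1 + A * x) ^ n" "poly (pderiv ([:1, A:] ^ n)) 0 = of_nat n * A"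
  by (simp_all add: poly_power pderiv_power pderiv_pCons mult.commute)

lemma pderiv_linear_power: "pderiv ([:1, A:] ^ n) * [:1, A:] = [:of_nat n * A:] * [:1, A::complex:] ^ n"
proof (cases n)
  case (Suc m)
  have "pderiv ([:1, A:] ^ n) = [:of_nat n * A:] * [:1, A:] ^ m"
    unfolding Suc pderiv_power_Suc by (simp add: pderiv_pCons mult.commute)
  then show ?thesis unfolding Suc by (simp only: power_Suc mult_ac)
qed simp

lemma contact_order_two:
  fixes A0 A1 A2 :: complex and p q :: nat
  defines "s2 \<equiv> [:1, A2:] ^ q * [:1, A0:] ^ (p - q)" and "s1 \<equiv> [:1, A1:] ^ p"
  assumes bal: "of_nat q * A2 + of_nat (p - q) * A0 = of_nat p * A1" and "q < p"
    and c1: "of_nat q * A1 * A2 + of_nat p * A0 * A2 - of_nat q * A0 * A1 - of_nat p * A1 * A2 \<noteq> 0"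
  shows "\<exists>U. s2 - s1 = [:0, 1:] ^ 2 * U \<and> poly U 0 \<noteq> 0 \<and> logd U 0 = of_nat p * A1 - 2 / 3 * (A0 + A1 + A2)"
proof -
  define D where "D = s2 - s1"
  define c where "c = of_nat q * A1 * A2 + of_nat p * A0 * A2 - of_nat q * A0 * A1 - of_nat p * A1 * A2"
  let ?l0 = "[:1, A0:]" and ?l1 = "[:1, A1:]" and ?l2 = "[:1, A2:]"
  define \<beta> where "\<beta> = [:of_nat p * A1:] * ?l0 * ?l2"
  define \<alpha> where "\<alpha> = ?l1 * ([:of_nat q * A2:] * ?l0 + [:of_nat (p - q) * A0:] * ?l2)"
  have s1d: "?l1 * pderiv s1 = [:of_nat p * A1:] * s1"
    unfolding s1_def using pderiv_linear_power[of A1 p] by (simp only: mult.commute)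
  have s2d: "?l0 * ?l2 * pderiv s2 = ([:of_nat q * A2:] * ?l0 + [:of_nat (p - q) * A0:] * ?l2) * s2"
  proof -
    have "?l0 * ?l2 * pderiv s2 = ?l2 ^ q * ?l2 * (pderiv (?l0 ^ (p - q)) * ?l0) + ?l0 ^ (p - q) * ?l0 * (pderiv (?l2 ^ q) * ?l2)"
      unfolding s2_def pderiv_mult by (simp only: distrib_left distrib_right mult_ac)
    also have "\<dots> = ([:of_nat q * A2:] * ?l0 + [:of_nat (p - q) * A0:] * ?l2) * s2"
      unfolding pderiv_linear_power s2_def by (simp only: distrib_left distrib_right mult_ac add.commute)
    finally show ?thesis .
  qed
  have "\<alpha> - \<beta> = [:0, c:]"
  proof -
    have A1: "of_nat q * A2 + of_nat (p - q) * A0 - of_nat p * A1 = 0" using bal by simp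
    have pq: "of_nat (p - q) = (of_nat p - of_nat q :: complex)" using \<open>q < p\<close> by (simp add: of_nat_diff)
    show ?thesis unfolding \<alpha>_def \<beta>_def c_def using A1 unfolding pq by (simp, algebra)
  qed
  then have \<alpha>: "\<alpha> = [:0, c:] + \<beta>" by (simp only: diff_eq_eq)
  have "?l0 * ?l1 * ?l2 * pderiv D = ?l1 * (?l0 * ?l2 * pderiv s2) - ?l0 * ?l2 * (?l1 * pderiv s1)"
    unfolding D_def pderiv_diff by (simp only: right_diff_distrib left_diff_distrib mult_ac)
  also have "\<dots> = \<alpha> * s2 - \<beta> * s1"
    unfolding s1d s2d \<alpha>_def \<beta>_def by (simp only: mult_ac)
  also have "\<dots> = [:0, c:] * s2 + \<beta> * D"
    unfolding D_def \<alpha> by (simp only: distrib_right right_diff_distrib) simp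
  finally have main: "?l0 * ?l1 * ?l2 * pderiv D = [:0, c:] * s2 + \<beta> * D" .
  have D0: "poly D 0 = 0" by (simp add: D_def s1_def s2_def poly_power)
  then obtain D1 where D1: "D = [:0, 1:] * D1" using poly_eq_0_iff_dvd[of D 0] by auto
  have "poly (pderiv D) 0 = 0" using arg_cong[OF main, of "\<lambda>p. poly p 0"] D0 by simp
  then have "poly D1 0 = 0" unfolding D1 pderiv_mult by (simp add: pderiv_pCons)
  then obtain U where U: "D1 = [:0, 1:] * U" using poly_eq_0_iff_dvd[of D1 0] by auto
  have DU: "D = [:0, 1:] ^ 2 * U" unfolding D1 U by (simp add: power2_eq_square)
  have dD: "pderiv D = [:0, 1:] * (2 * U + [:0, 1:] * pderiv U)"
  proof -
    have "pderiv [:0, 1::complex:] = 1" by (simp add: pderiv_pCons)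
    then have "pderiv D = [:0, 1:] * ([:0, 1:] * pderiv U + U * 1) + [:0, 1:] * U * 1"
      unfolding D1 U pderiv_mult by (simp only: mult.commute)
    then show ?thesis by (simp only: mult_2 distrib_left distrib_right mult_1_right mult_1_left mult_ac add_ac)
  qed
  have "[:0, 1:] * (?l0 * ?l1 * ?l2 * (2 * U + [:0, 1:] * pderiv U)) = [:0, 1:] * ([:c:] * s2 + \<beta> * ([:0, 1:] * U))"
  proof -
    have "[:0, c:] = [:0, 1:] * [:c:]" by simp
    then show ?thesis using main unfolding dD unfolding D1 U by (simp only: distrib_left mult_ac)
  qed
  then have red: "?l0 * ?l1 * ?l2 * (2 * U + [:0, 1:] * pderiv U) = [:c:] * s2 + \<beta> * ([:0, 1:] * U)"
    by (subst (asm) mult_left_cancel) auto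
  have U0: "2 * poly U 0 = c"
    using arg_cong[OF red, of "\<lambda>p. poly p 0"] by (simp add: s2_def poly_power)
  have ds2: "poly (pderiv s2) 0 = of_nat p * A1"
    unfolding s2_def pderiv_mult using bal by (simp add: poly_linear_simps add.commute)
  have "(A0 + A1 + A2) * (2 * poly U 0) + 3 * poly (pderiv U) 0 = c * (of_nat p * A1) + of_nat p * A1 * poly U 0"
    using arg_cong[OF red, of "\<lambda>p. poly (pderiv p) 0"] ds2
    by (simp add: pderiv_mult pderiv_add pderiv_pCons \<beta>_def pderiv_smult algebra_simps)
  then have "3 * poly (pderiv U) 0 = poly U 0 * (3 * of_nat p * A1 - 2 * (A0 + A1 + A2))"
    unfolding U0[symmetric] by (simp add: algebra_simps)
  moreover have "poly U 0 \<noteq> 0" using U0 c1 unfolding c_def by auto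
  ultimately have "logd U 0 = of_nat p * A1 - 2 / 3 * (A0 + A1 + A2)"
    unfolding logd_def by (simp add: divide_simps) (simp add: algebra_simps)
  then show ?thesis using DU \<open>poly U 0 \<noteq> 0\<close> unfolding D_def by blast
qed

lemma even_restriction_first_order:
  fixes A0 A1 A2 :: complex and p q :: nat
  defines "s2 \<equiv> [:1, A2:] ^ q * [:1, A0:] ^ (p - q)" and "s1 \<equiv> [:1, A1:] ^ p"
  assumes bal: "of_nat q * A2 + of_nat (p - q) * A0 = of_nat p * A1" and "q < p"
    and c1: "of_nat q * A1 * A2 + of_nat p * A0 * A2 - of_nat q * A0 * A1 - of_nat p * A1 * A2 \<noteq> 0"
    and P: "P = [:-1, 1:] ^ k * P1" "poly P1 1 \<noteq> 0" "degree P1 + k \<le> K"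
    and ev: "even_poly ([:1, A0:] ^ E * [:1, A1:] ^ a * [:1, A2:] ^ N * cbin K P s2 s1)"
  shows "of_nat E * A0 + of_nat (a + K * p) * A1 + of_nat N * A2 = 2 / 3 * of_nat k * (A0 + A1 + A2)"
    "even_poly ((s2 - s1) ^ k) \<Longrightarrow> even_poly ([:1, A0:] ^ E * [:1, A1:] ^ a * [:1, A2:] ^ N * cbin (K - k) P1 s2 s1)"
proof -
  obtain U where U: "s2 - s1 = [:0, 1:] ^ 2 * U" "poly U 0 \<noteq> 0"
      "logd U 0 = of_nat p * A1 - 2 / 3 * (A0 + A1 + A2)"
    using contact_order_two[OF bal \<open>q < p\<close> c1] unfolding s1_def s2_def by blast
  define L where "L = [:1, A0:] ^ E * [:1, A1:] ^ a * [:1, A2:] ^ N"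
  define H where "H = cbin (K - k) P1 s2 s1"
  have kK: "K = (K - k) + k" using P(3) by simp
  have "cbin K P s2 s1 = (s2 - s1) ^ k * H"
    unfolding H_def P(1) by (subst kK, rule binform_power_factor) (use P(3) in auto)
  then have ev': "even_poly ((s2 - s1) ^ k * (L * H))" using ev unfolding L_def by (simp only: mult_ac)
  have nz: "s2 - s1 \<noteq> 0" using U by auto
  show "even_poly ((s2 - s1) ^ k) \<Longrightarrow> even_poly (L * H)"
    using even_poly_cancel[OF ev'] nz by simp
  have fac: "(s2 - s1) ^ k * (L * H) = ([:0, 1:] ^ 2) ^ k * (U ^ k * (L * H))"
    unfolding U(1) power_mult_distrib by (simp only: mult_ac)
  have ev2: "even_poly (U ^ k * (L * H))"
  proof (rule even_poly_cancel)
    show "even_poly (([:0, 1:] ^ 2) ^ k * (U ^ k * (L * H)))" using ev' unfolding fac .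
    show "even_poly (([:0, 1:] ^ 2) ^ k)"
      by (rule even_poly_power) (simp add: even_poly_def power2_eq_square)
  qed simp
  have s: "poly s2 0 = 1" "poly s1 0 = 1" "poly (pderiv s1) 0 = of_nat p * A1" "poly (pderiv s2) 0 = of_nat p * A1"
    using bal unfolding s1_def s2_def pderiv_mult by (simp_all add: poly_linear_simps add.commute)
  have pH: "poly H 0 \<noteq> 0" unfolding H_def poly_cbin s using P by (subst binform_1_1) auto
  have lH: "logd H 0 = of_nat (K - k) * (of_nat p * A1)"
    unfolding H_def by (rule logd_cbin_1_1) (use s P in auto)
  have pL: "poly L 0 \<noteq> 0" by (simp add: L_def poly_power)
  have lL: "logd L 0 = of_nat E * A0 + of_nat a * A1 + of_nat N * A2"
    unfolding L_def by (simp add: logd_mult logd_power poly_power)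
  have "logd (U ^ k * (L * H)) 0 = of_nat k * logd U 0 + (logd L 0 + logd H 0)"
    using U(2) pH pL by (simp add: logd_mult logd_power poly_power)
  then have eq: "of_nat k * (of_nat p * A1 - 2 / 3 * (A0 + A1 + A2)) +
     (of_nat E * A0 + of_nat a * A1 + of_nat N * A2 + of_nat (K - k) * (of_nat p * A1)) = 0"
    using even_poly_logd_0[OF ev2] unfolding lL lH U(3) by simp
  have kc: "of_nat K = (of_nat (K - k) + of_nat k :: complex)" using kK of_nat_add by metis
  show "of_nat E * A0 + of_nat (a + K * p) * A1 + of_nat N * A2 = 2 / 3 * of_nat k * (A0 + A1 + A2)"
    using eq unfolding of_nat_add of_nat_mult kc by (simp add: algebra_simps)
qed


lemma quadratic_from_weight_0:
  fixes r s K k :: nat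
  assumes "1 \<le> s" "s < r" "K \<ge> 1" "k \<le> K" "3 * (K * r * s) \<le> 2 * k * (r + s)"
  shows "r = 2 * s"
proof -
  have "K * (3 * r * s) \<le> K * (2 * (r + s))"
  proof -
    have "2 * k * (r + s) \<le> 2 * K * (r + s)" using assms(4) by simp
    then have "3 * (K * r * s) \<le> 2 * K * (r + s)" using assms(5) by (rule order_trans[rotated])
    then show ?thesis by (simp only: mult_ac)
  qed
  then have *: "3 * r * s \<le> 2 * (r + s)" using assms(3) by simp
  have "s < 2"
  proof (rule ccontr)
    assume "\<not> s < 2"
    then have "3 * r * 2 \<le> 3 * r * s" by (intro mult_le_mono2) simp
    then have "3 * r * 2 \<le> 2 * (r + s)" using * by (rule order_trans)
    then have "6 * r \<le> 2 * (r + s)" by simp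
    then show False using assms(2) by arith
  qed
  then have "s = 1" using assms(1) by simp
  then show ?thesis using * assms(2) by simp
qed


lemma quadratic_transversal:
  fixes r s g K k E a N :: nat and P :: "complex poly"
  defines "\<alpha> \<equiv> of_nat (g * s) / 2 :: complex"
  defines "A2 \<equiv> of_nat (g * r) - \<alpha>"
  defines "s2 \<equiv> [:1, A2:] ^ s * [:1, - \<alpha>:] ^ (r - s)" and "s1 \<equiv> [:1, \<alpha>:] ^ r"
  assumes sr: "1 \<le> s" "s < r" "1 \<le> g" and K: "1 \<le> K" "k \<le> K"
    and P: "coeff P 0 \<noteq> 0" "coeff P K \<noteq> 0"
    and ev: "even_poly ([:1, - \<alpha>:] ^ E * [:1, \<alpha>:] ^ a * [:1, A2:] ^ N * cbin K P s2 s1)"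
    and star: "3 * (- int E * int s + int (a + K * r) * int s + int N * (2 * int r - int s)) = 2 * int k * (2 * int r - int s)"
  shows "r = 2 * s"
proof -
  have a0: "\<alpha> \<noteq> 0" using sr by (simp add: \<alpha>_def)
  have r0: "(of_nat r :: complex) \<noteq> 0" "(of_nat s :: complex) \<noteq> 0" "(of_nat r :: complex) \<noteq> of_nat s"
    "(of_nat g :: complex) \<noteq> 0" using sr by auto
  have A2: "A2 / \<alpha> = 2 * of_nat r / of_nat s - 1"
    using r0 by (simp add: A2_def \<alpha>_def diff_divide_distrib)
  have plus: "1 + A2 * (1 / \<alpha>) = 2 * of_nat r / of_nat s" using A2 by simp
  have minus: "1 + A2 * (- 1 / \<alpha>) = 2 - 2 * of_nat r / of_nat s" using A2 by simp
  have m0: "2 - 2 * of_nat r / of_nat s \<noteq> (0::complex)" using r0 by (simp add: divide_simps)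
  define R where "R = [:1, A2:] ^ N * cbin K P s2 s1"
  have v: "poly s2 (1 / \<alpha>) = 0" "poly s1 (1 / \<alpha>) = 2 ^ r" "poly s1 (- 1 / \<alpha>) = 0"
     "poly s2 (- 1 / \<alpha>) \<noteq> 0" "poly [:1, A2:] (1 / \<alpha>) \<noteq> 0" "poly [:1, A2:] (- 1 / \<alpha>) \<noteq> 0"
    using a0 sr m0 r0 plus minus unfolding s2_def s1_def by (auto simp: poly_power mult.commute)
  have "poly R (1 / \<alpha>) \<noteq> 0" "poly R (- 1 / \<alpha>) \<noteq> 0"
    unfolding R_def using v P by (auto simp: poly_power poly_cbin binform_0_left binform_0_right simp del: poly_pCons)
  then have Ea: "E = a"
    using even_poly_opposite_linear_powers[of "- \<alpha>" E a R] ev a0 unfolding R_def by (simp add: mult.assoc)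
  have star': "3 * (K * r) * s + 3 * N * (2 * r - s) = 2 * k * (2 * r - s)"
  proof -
    have iz: "int (2 * r - s) = 2 * int r - int s" using sr by (simp add: of_nat_diff)
    have "int (3 * (K * r) * s + 3 * N * (2 * r - s)) = int (2 * k * (2 * r - s))"
      unfolding of_nat_mult of_nat_add iz using star unfolding Ea by (simp add: algebra_simps)
    then show ?thesis by (simp only: of_nat_eq_iff)
  qed
  have "K * (3 * r * s) \<le> K * (2 * (2 * r - s))"
  proof -
    have "2 * k * (2 * r - s) \<le> 2 * K * (2 * r - s)" using K by simp
    then have "3 * (K * r) * s \<le> 2 * K * (2 * r - s)" using star' by arith
    then show ?thesis by (simp only: mult_ac)
  qed
  then have *: "3 * r * s \<le> 2 * (2 * r - s)" using K by simp
  have "s < 2"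
  proof (rule ccontr)
    assume "\<not> s < 2"
    then have "3 * r * 2 \<le> 3 * r * s" by (intro mult_le_mono2) simp
    then have "3 * r * 2 \<le> 2 * (2 * r - s)" using * by (rule order_trans)
    then have "6 * r \<le> 2 * (2 * r - s)" by simp
    then show False using sr by arith
  qed
  then have s: "s = 1" using sr by simp
  show ?thesis
  proof (rule ccontr)
    assume "r \<noteq> 2 * s"
    then have r3: "r \<ge> 3" using sr s by simp
    have ev1: "even_poly ([:1, - \<alpha>:] ^ a * [:1, \<alpha>:] ^ a)"
      unfolding power_mult_distrib[symmetric] by (rule even_poly_power) (simp add: even_poly_def algebra_simps)
    have ev2: "even_poly ([:1, - \<alpha>:] ^ a * [:1, \<alpha>:] ^ a * R)"
      using ev unfolding Ea R_def by (simp only: mult.assoc)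
    have evR: "even_poly R" using even_poly_cancel[OF ev2 ev1] by simp
    have L1: "logd (cbin K P s2 s1) (1 / \<alpha>) = of_nat K * logd s1 (1 / \<alpha>)"
    proof (rule logd_cbin_left[where l = "[:1, - \<alpha>:]"])
      show "[:1, - \<alpha>:] ^ 2 dvd s2" unfolding s2_def using s r3
        by (intro dvd_mult le_imp_power_dvd) simp
    qed (use v P a0 in auto)
    have L2: "logd (cbin K P s2 s1) (- 1 / \<alpha>) = of_nat K * logd s2 (- 1 / \<alpha>)"
    proof (rule logd_cbin_right[where l = "[:1, \<alpha>:]"])
      show "[:1, \<alpha>:] ^ 2 dvd s1" unfolding s1_def using r3 by (intro le_imp_power_dvd) simp
    qed (use v P a0 in auto)
    have ls1: "logd s1 (1 / \<alpha>) = of_nat r * (\<alpha> / 2)"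
      unfolding s1_def using a0 by (subst logd_power) auto
    have ls2: "logd s2 (- 1 / \<alpha>) = A2 / (2 - 2 * of_nat r) + of_nat (r - 1) * (- \<alpha> / 2)"
      unfolding s2_def s using a0 minus m0 s by (subst logd_mult) (auto simp: logd_power poly_power)
    have c: "poly (cbin K P s2 s1) (1 / \<alpha>) \<noteq> 0" "poly (cbin K P s2 s1) (- 1 / \<alpha>) \<noteq> 0"
      using v P by (auto simp: poly_cbin binform_0_left binform_0_right)
    have lR1: "logd R (1 / \<alpha>) = of_nat N * (A2 / (2 * of_nat r)) + of_nat K * (of_nat r * (\<alpha> / 2))"
      unfolding R_def using c v(5) plus s
      by (subst logd_mult) (simp_all add: poly_power logd_power L1 ls1 del: poly_pCons)
    have lR2: "logd R (- 1 / \<alpha>) = of_nat N * (A2 / (2 - 2 * of_nat r)) +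
        of_nat K * (A2 / (2 - 2 * of_nat r) + of_nat (r - 1) * (- \<alpha> / 2))"
      unfolding R_def using c v(6) minus s L2 ls2
      by (subst logd_mult) (simp_all add: poly_power logd_power del: poly_pCons)
    define x where "x = real r"
    have x: "x \<ge> 3" using r3 by (simp add: x_def)
    have A2x: "A2 = \<alpha> * of_real (2 * x - 1)" using A2 a0 s by (simp add: x_def nonzero_divide_eq_eq mult.commute)
    have "logd R (1 / \<alpha>) + logd R (- 1 / \<alpha>) = 0" using even_poly_logd[OF evR, of "1 / \<alpha>"] by simp
    then have "\<alpha> * of_real (real N * ((2 * x - 1) / (2 * x) + (2 * x - 1) / (2 - 2 * x)) +
       real K * (x / 2 + (2 * x - 1) / (2 - 2 * x) - (x - 1) / 2)) = 0"
      unfolding lR1 lR2 A2x using r3 by (simp add: x_def of_nat_diff algebra_simps)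
    then have z: "real N * ((2 * x - 1) / (2 * x) + (2 * x - 1) / (2 - 2 * x)) +
       real K * (x / 2 + (2 * x - 1) / (2 - 2 * x) - (x - 1) / 2) = 0"
      using a0 by (metis mult_eq_0_iff of_real_eq_0_iff)
    have "(2 * x - 1) / (2 * x) + (2 * x - 1) / (2 - 2 * x) \<le> 0"
    proof -
      have "(2 * x - 1) / (2 * x) \<le> (2 * x - 1) / (2 * x - 2)" using x by (intro divide_left_mono) auto
      also have "\<dots> = - ((2 * x - 1) / (2 - 2 * x))" by (metis minus_diff_eq minus_divide_right)
      finally show ?thesis by simp
    qed
    then have n1: "real N * ((2 * x - 1) / (2 * x) + (2 * x - 1) / (2 - 2 * x)) \<le> 0"
      by (simp add: mult_nonneg_nonpos)
    have "x / 2 + (2 * x - 1) / (2 - 2 * x) - (x - 1) / 2 < 0"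
    proof -
      have "(2 * x - 1) / (2 * x - 2) > 1" using x by simp
      moreover have "(2 * x - 1) / (2 * x - 2) = - ((2 * x - 1) / (2 - 2 * x))" by (metis minus_diff_eq minus_divide_right)
      moreover have "x / 2 - (x - 1) / 2 = 1 / 2" by (simp add: diff_divide_distrib)
      ultimately show ?thesis by linarith
    qed
    then have "real K * (x / 2 + (2 * x - 1) / (2 - 2 * x) - (x - 1) / 2) < 0" using K by (simp add: mult_pos_neg)
    then show False using z n1 by linarith
  qed
qed

lemma quadratic_tangent_line:
  fixes r s g K k E a N :: nat and P :: "complex poly"
  defines "\<alpha> \<equiv> of_nat (g * r) / 2 :: complex"
  defines "A1 \<equiv> of_nat (g * s) - \<alpha>"
  defines "s2 \<equiv> [:1, \<alpha>:] ^ s * [:1, - \<alpha>:] ^ (r - s)" and "s1 \<equiv> [:1, A1:] ^ r"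
  assumes sr: "1 \<le> s" "s < r" "1 \<le> g" and K: "1 \<le> K" "k \<le> K"
    and P: "coeff P 0 \<noteq> 0"
    and ev: "even_poly ([:1, - \<alpha>:] ^ E * [:1, A1:] ^ a * [:1, \<alpha>:] ^ N * cbin K P s2 s1)"
    and star: "3 * (- int E * int r + int (a + K * r) * (2 * int s - int r) + int N * int r) = 2 * int k * (2 * int s - int r)"
  shows "r = 2 * s"
proof -
  have a0: "\<alpha> \<noteq> 0" using sr by (simp add: \<alpha>_def)
  have r0: "(of_nat r :: complex) \<noteq> 0" "(of_nat s :: complex) \<noteq> 0" "(of_nat r :: complex) \<noteq> of_nat s"
    "(of_nat g :: complex) \<noteq> 0" using sr by auto
  have A1: "A1 / \<alpha> = 2 * of_nat s / of_nat r - 1"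
    using r0 by (simp add: A1_def \<alpha>_def diff_divide_distrib)
  have plus: "1 + A1 * (1 / \<alpha>) = 2 * of_nat s / of_nat r" using A1 by simp
  have minus: "1 + A1 * (- 1 / \<alpha>) = 2 - 2 * of_nat s / of_nat r" using A1 by simp
  have m0: "2 - 2 * of_nat s / of_nat r \<noteq> (0::complex)" using r0 by (simp add: divide_simps)
  define R where "R = [:1, A1:] ^ a * cbin K P s2 s1"
  have v: "poly s2 (1 / \<alpha>) = 0" "poly s1 (1 / \<alpha>) \<noteq> 0" "poly s2 (- 1 / \<alpha>) = 0"
     "poly s1 (- 1 / \<alpha>) \<noteq> 0" "poly [:1, A1:] (1 / \<alpha>) \<noteq> 0" "poly [:1, A1:] (- 1 / \<alpha>) \<noteq> 0"
    using a0 sr m0 r0 plus minus unfolding s2_def s1_def by (auto simp: poly_power mult.commute)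
  have "poly R (1 / \<alpha>) \<noteq> 0" "poly R (- 1 / \<alpha>) \<noteq> 0"
    unfolding R_def using v P by (auto simp: poly_power poly_cbin binform_0_left binform_0_right simp del: poly_pCons)
  moreover have "even_poly ([:1, - \<alpha>:] ^ E * [:1, - (- \<alpha>):] ^ N * R)"
    using ev unfolding R_def minus_minus by (simp only: mult_ac)
  ultimately have "E = N"
    using even_poly_opposite_linear_powers[of "- \<alpha>" E N R] a0 by simp
  then have "(3 * (int a + int K * int r) - 2 * int k) * (2 * int s - int r) = 0"
    using star by (simp add: algebra_simps)
  moreover have "3 * (int a + int K * int r) - 2 * int k > 0"
  proof -
    have "int K * 1 \<le> int K * int r" using sr by (intro mult_left_mono) auto
    then show ?thesis using K unfolding distrib_left by linarith
  qed
  ultimately have "2 * int s - int r = 0" by simp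
  then show ?thesis by simp
qed

lemma binform_scale: "binform (\<lambda>c. c) K P (c * u) (c * v) = c ^ K * binform (\<lambda>c. c) K P u v"
  unfolding binform_def sum_distrib_left
proof (intro sum.cong refl)
  fix l assume "l \<in> {..K}"
  then have "c ^ K = c ^ l * c ^ (K - l)" by (simp add: power_add[symmetric])
  then show "coeff P l * (c * u) ^ l * (c * v) ^ (K - l) = c ^ K * (coeff P l * u ^ l * v ^ (K - l))"
    by (simp add: power_mult_distrib mult_ac)
qed

lemma even_poly_X_power_cancel:
  assumes "even_poly ([:0, 1:] ^ a * R)" "poly R 0 \<noteq> 0"
  shows "even_poly R"
proof -
  have "[:0, 1:] ^ a * R = pcompose ([:0, 1:] ^ a * R) [:0, -1:]" using assms(1) by (simp add: even_poly_pcompose)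
  also have "\<dots> = (- [:0, 1:]) ^ a * pcompose R [:0, -1:]"
    by (simp add: pcompose_mult pcompose_power pcompose_pCons)
  also have "\<dots> = [:0, 1:] ^ a * ((-1) ^ a * pcompose R [:0, -1:])"
    unfolding power_minus[of "[:0, 1:]"] by (simp only: mult_ac)
  finally have R: "R = (-1) ^ a * pcompose R [:0, -1:]" by (subst (asm) mult_left_cancel) auto
  have "poly R 0 = (-1) ^ a * poly R 0"
    using arg_cong[OF R, of "\<lambda>p. poly p 0"] by (simp add: poly_power poly_pcompose)
  then have "(-1) ^ a = (1::complex)" using assms(2) by simp
  then have "even a" by (cases "even a") auto
  then show ?thesis using R by (simp add: even_poly_pcompose)
qed

lemma quadratic_node_transversal:
  fixes r s g K k E a N :: nat and P :: "complex poly"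
  defines "A0 \<equiv> - of_nat (g * s) :: complex"
  defines "A2 \<equiv> of_nat (g * (r - s)) :: complex"
  defines "s2 \<equiv> [:1, A2:] ^ s * [:1, A0:] ^ (r - s)" and "s1 \<equiv> [:1, 0:] ^ r"
  assumes sr: "1 \<le> s" "s < r" "1 \<le> g" and K: "1 \<le> K" "k \<le> K"
    and P: "coeff P K \<noteq> 0" and n: "even (E + a + N + r * K)"
    and ev: "even_poly ([:1, A0:] ^ E * [:1, 0:] ^ a * [:1, A2:] ^ N * cbin K P s2 s1)"
    and star: "3 * (int N * (int r - int s) - int E * int s) = 2 * int k * (int r - 2 * int s)"
  shows "r = 2 * s"
proof -
  have A: "A0 \<noteq> 0" "A2 \<noteq> 0" using sr by (auto simp: A0_def A2_def)
  define n where "n = E + a + N + r * K"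
  define s2' where "s2' = [:A2, 1:] ^ s * [:A0, 1:] ^ (r - s)"
  define s1' :: "complex poly" where "s1' = [:0, 1:] ^ r"
  define R where "R = [:A0, 1:] ^ E * [:A2, 1:] ^ N * cbin K P s2' s1'"
  define Psi where "Psi = [:1, A0:] ^ E * [:1, 0:] ^ a * [:1, A2:] ^ N * cbin K P s2 s1"
  have rev: "poly ([:0, 1:] ^ a * R) t = t ^ n * poly Psi (1 / t)"
    if "t \<noteq> 0" for t
  proof -
    have l: "A0 + t = t * (1 + A0 / t)" "A2 + t = t * (1 + A2 / t)" using that by (simp_all add: distrib_left)
    have "poly s2' t = t ^ r * poly s2 (1 / t)"
    proof -
      have "t ^ r = t ^ s * t ^ (r - s)" using sr by (simp add: power_add[symmetric])
      then show ?thesis unfolding s2'_def s2_def by (simp add: poly_power l power_mult_distrib)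
    qed
    moreover have "poly s1' t = t ^ r * poly s1 (1 / t)" unfolding s1'_def s1_def by (simp add: poly_power)
    ultimately have "poly (cbin K P s2' s1') t = (t ^ r) ^ K * poly (cbin K P s2 s1) (1 / t)"
      unfolding poly_cbin by (simp only: binform_scale)
    then show ?thesis unfolding R_def n_def Psi_def
      by (simp add: poly_power l power_mult_distrib power_add power_mult)
  qed
  have "even_poly ([:0, 1:] ^ a * R)"
    unfolding even_poly_def
  proof
    fix t
    show "poly ([:0, 1:] ^ a * R) (- t) = poly ([:0, 1:] ^ a * R) t"
    proof (cases "t = 0")
      case False
      have "(- t) ^ n = t ^ n" using n unfolding n_def by (rule power_minus_even)
      moreover have "poly Psi (1 / (- t)) = poly Psi (1 / t)"
        using ev unfolding even_poly_def Psi_def[symmetric] by (simp only: minus_divide_right[symmetric])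
      moreover have "- t \<noteq> 0" using False by simp
      ultimately show ?thesis unfolding rev[OF False] rev[OF \<open>- t \<noteq> 0\<close>] by (simp only:)
    qed simp
  qed
  moreover have v: "poly s1' 0 = 0" "poly s2' 0 \<noteq> 0"
    unfolding s1'_def s2'_def using sr A by (auto simp: poly_power)
  then have c: "poly (cbin K P s2' s1') 0 \<noteq> 0" using P by (simp add: poly_cbin binform_0_right)
  then have R0: "poly R 0 \<noteq> 0" unfolding R_def using A by (simp add: poly_power)
  ultimately have evR: "even_poly R" using even_poly_X_power_cancel by blast
  have ld: "logd [:x, 1:] 0 = 1 / x" for x :: complex by (simp add: logd_def pderiv_pCons)
  have "logd (cbin K P s2' s1') 0 = of_nat K * logd s2' 0"
    by (rule logd_cbin_right[where l = "[:0, 1:]"])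
       (use v P sr in \<open>auto simp: s1'_def intro: le_imp_power_dvd\<close>)
  also have "logd s2' 0 = of_nat s / A2 + of_nat (r - s) / A0"
    unfolding s2'_def using A by (subst logd_mult) (auto simp: logd_power poly_power ld)
  finally have "logd R 0 = of_nat E / A0 + of_nat N / A2 + of_nat K * (of_nat s / A2 + of_nat (r - s) / A0)"
    unfolding R_def using A c by (simp add: logd_mult logd_power poly_power ld)
  then have "of_nat E / A0 + of_nat N / A2 + of_nat K * (of_nat s / A2 + of_nat (r - s) / A0) = 0"
    using even_poly_logd_0[OF evR] by simp
  then have "(of_nat E / A0 + of_nat N / A2 + of_nat K * (of_nat s / A2 + of_nat (r - s) / A0)) * (A0 * A2) = 0"
    by simp
  then have "(of_nat E + of_nat K * of_nat (r - s)) * A2 + (of_nat N + of_nat K * of_nat s) * A0 = 0"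
    using A by (simp add: algebra_simps)
  moreover define d where "d = r - s"
  ultimately have "of_nat g * (of_nat ((E + K * (r - s)) * (r - s))) = (of_nat g * of_nat ((N + K * s) * s) :: complex)"
    unfolding A0_def A2_def d_def[symmetric] of_nat_mult of_nat_add by (simp add: algebra_simps)
  then have "(of_nat ((E + K * (r - s)) * (r - s)) :: complex) = of_nat ((N + K * s) * s)" using sr by simp
  then have "(E + K * (r - s)) * (r - s) = (N + K * s) * s" by (simp only: of_nat_eq_iff)
  then have "int ((E + K * (r - s)) * (r - s)) = int ((N + K * s) * s)" by simp
  then have top: "(int E + int K * (int r - int s)) * (int r - int s) = (int N + int K * int s) * int s"
    using sr by (simp add: of_nat_diff)
  have "(int r - 2 * int s) * (3 * int N + 3 * int E + 3 * int K * int r - 2 * int k) = 0"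
    using star top by algebra
  moreover have "3 * int N + 3 * int E + 3 * int K * int r - 2 * int k > 0"
  proof -
    have "int K * 1 \<le> int K * int r" using sr by (intro mult_left_mono) auto
    then show ?thesis using K unfolding mult.assoc by linarith
  qed
  ultimately have "int r - 2 * int s = 0" by simp
  then show ?thesis by simp
qed

lemma quadratic_node_tangent:
  fixes r s g K k E a N :: nat and P :: "complex poly"
  defines "\<alpha> \<equiv> of_nat (g * (r - s)) / 2 :: complex"
  defines "A0 \<equiv> - of_nat (g * (r + s)) / 2 :: complex"
  defines "s2 \<equiv> [:1, \<alpha>:] ^ s * [:1, A0:] ^ (r - s)" and "s1 \<equiv> [:1, - \<alpha>:] ^ r"
  assumes sr: "1 \<le> s" "s < r" "1 \<le> g" and K: "1 \<le> K" "k \<le> K"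
    and P: "coeff P 0 \<noteq> 0" "coeff P K \<noteq> 0"
    and ev: "even_poly ([:1, A0:] ^ E * [:1, - \<alpha>:] ^ a * [:1, \<alpha>:] ^ N * cbin K P s2 s1)"
    and star: "3 * (- int E * (int r + int s) + int (a + K * r) * (int s - int r) + int N * (int r - int s)) = - 2 * int k * (int r + int s)"
  shows "r = 2 * s"
proof -
  have a0: "\<alpha> \<noteq> 0" using sr by (simp add: \<alpha>_def)
  have r0: "(of_nat r :: complex) \<noteq> 0" "(of_nat s :: complex) \<noteq> 0" "(of_nat r - of_nat s :: complex) \<noteq> 0"
    "(of_nat g :: complex) \<noteq> 0" using sr by auto
  have rs: "(of_nat (r - s) :: complex) = of_nat r - of_nat s" using sr by (simp add: of_nat_diff)
  define \<rho> where "\<rho> = (of_nat r + of_nat s) / (of_nat r - of_nat s :: complex)"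
  have rho: "\<rho> * (of_nat r - of_nat s) = of_nat r + of_nat s" using r0 by (simp add: \<rho>_def)
  have "A0 = - (of_nat g / 2 * (of_nat r + of_nat s))" by (simp add: A0_def)
  moreover have "\<alpha> = of_nat g / 2 * (of_nat r - of_nat s)" unfolding \<alpha>_def of_nat_mult rs by simp
  ultimately have A0: "A0 = - (\<rho> * \<alpha>)" unfolding rho[symmetric] by simp
  have plus: "1 + A0 * (1 / \<alpha>) = - 2 * of_nat s / (of_nat r - of_nat s)"
  proof -
    have "(1 - \<rho>) * (of_nat r - of_nat s) = - 2 * of_nat s" unfolding left_diff_distrib rho by simp
    then have "1 - \<rho> = - 2 * of_nat s / (of_nat r - of_nat s)" using r0(3) by (rule eq_divide_imp[rotated])
    then show ?thesis using a0 by (simp add: A0)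
  qed
  have minus: "1 + A0 * (- 1 / \<alpha>) = 2 * of_nat r / (of_nat r - of_nat s)"
  proof -
    have "(1 + \<rho>) * (of_nat r - of_nat s) = 2 * of_nat r" unfolding distrib_right rho by simp
    then have "1 + \<rho> = 2 * of_nat r / (of_nat r - of_nat s)" using r0(3) by (rule eq_divide_imp[rotated])
    then show ?thesis using a0 by (simp add: A0)
  qed
  define R where "R = [:1, A0:] ^ E * cbin K P s2 s1"
  have v: "poly s1 (1 / \<alpha>) = 0" "poly s2 (1 / \<alpha>) \<noteq> 0" "poly s2 (- 1 / \<alpha>) = 0"
     "poly s1 (- 1 / \<alpha>) \<noteq> 0" "poly [:1, A0:] (1 / \<alpha>) \<noteq> 0" "poly [:1, A0:] (- 1 / \<alpha>) \<noteq> 0"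
    using a0 sr r0 plus minus unfolding s2_def s1_def by (auto simp: poly_power mult.commute)
  have c: "poly (cbin K P s2 s1) (1 / \<alpha>) \<noteq> 0" "poly (cbin K P s2 s1) (- 1 / \<alpha>) \<noteq> 0"
    using v P by (auto simp: poly_cbin binform_0_left binform_0_right)
  have "poly R (1 / \<alpha>) \<noteq> 0" "poly R (- 1 / \<alpha>) \<noteq> 0"
    unfolding R_def using v c by (auto simp: poly_power simp del: poly_pCons)
  moreover have evR': "even_poly ([:1, \<alpha>:] ^ N * [:1, - \<alpha>:] ^ a * R)"
    using ev unfolding R_def by (simp only: mult_ac)
  ultimately have aN: "N = a"
    using even_poly_opposite_linear_powers[of \<alpha> N a R] a0 by simp
  have star': "3 * int E * (int r + int s) + 3 * int K * int r * (int r - int s) = 2 * int k * (int r + int s)"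
    using star unfolding aN by (simp add: algebra_simps)
  have "int K * (3 * int r * (int r - int s)) \<le> int K * (2 * (int r + int s))"
  proof -
    have "2 * int k * (int r + int s) \<le> 2 * int K * (int r + int s)" using K by (intro mult_right_mono) auto
    moreover have "0 \<le> 3 * int E * (int r + int s)" by simp
    ultimately have "3 * int K * int r * (int r - int s) \<le> 2 * int K * (int r + int s)" using star' by linarith
    then show ?thesis by (simp only: mult_ac)
  qed
  then have *: "3 * int r * (int r - int s) \<le> 2 * (int r + int s)" using K by (simp add: mult_le_cancel_left)
  have "r = s + 1"
  proof (rule ccontr)
    assume "r \<noteq> s + 1"
    then have "3 * int r * 2 \<le> 3 * int r * (int r - int s)" using sr by (intro mult_left_mono) auto
    then have "3 * int r * 2 \<le> 2 * (int r + int s)" using * by (rule order_trans)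
    then show False using sr by arith
  qed
  note r = this
  show ?thesis
  proof (rule ccontr)
    assume "r \<noteq> 2 * s"
    then have s2: "s \<ge> 2" using sr r by simp
    have ev1: "even_poly ([:1, \<alpha>:] ^ a * [:1, - \<alpha>:] ^ a)"
      unfolding power_mult_distrib[symmetric] by (rule even_poly_power) (simp add: even_poly_def algebra_simps)
    have evR: "even_poly R" using even_poly_cancel[OF evR'[unfolded aN] ev1] by simp
    have pl: "1 + A0 * (1 / \<alpha>) = - 2 * of_nat s" "1 + A0 * (- 1 / \<alpha>) = 2 * of_nat s + 2"
      using plus minus unfolding r by simp_all
    have A0': "A0 = - (\<alpha> * (2 * of_nat s + 1))" using A0 rho unfolding r by (simp add: mult.commute)
    have q1: "A0 / (- 2 * of_nat s) = \<alpha> * ((2 * of_nat s + 1) / (2 * of_nat s))"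
      by (simp only: A0' mult_minus_left minus_divide_divide times_divide_eq_right)
    have q2: "A0 / (2 * of_nat s + 2) = - (\<alpha> * ((2 * of_nat s + 1) / (2 * of_nat s + 2)))"
      by (simp only: A0' minus_divide_left times_divide_eq_right)
    have L1: "logd (cbin K P s2 s1) (1 / \<alpha>) = of_nat K * logd s2 (1 / \<alpha>)"
    proof (rule logd_cbin_right[where l = "[:1, - \<alpha>:]"])
      show "[:1, - \<alpha>:] ^ 2 dvd s1" unfolding s1_def using sr by (intro le_imp_power_dvd) simp
    qed (use v P a0 in auto)
    have L2: "logd (cbin K P s2 s1) (- 1 / \<alpha>) = of_nat K * logd s1 (- 1 / \<alpha>)"
    proof (rule logd_cbin_left[where l = "[:1, \<alpha>:]"])
      show "[:1, \<alpha>:] ^ 2 dvd s2" unfolding s2_def using s2 by (intro dvd_mult2 le_imp_power_dvd) simp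
    qed (use v P a0 in auto)
    have ls2: "logd s2 (1 / \<alpha>) = of_nat s * (\<alpha> / 2) + A0 / (- 2 * of_nat s)"
      unfolding s2_def r using a0 pl s2 by (subst logd_mult) (auto simp: logd_power poly_power)
    have ls1: "logd s1 (- 1 / \<alpha>) = of_nat r * (- \<alpha> / 2)"
      unfolding s1_def using a0 by (subst logd_power) auto
    have lR1: "logd R (1 / \<alpha>) = of_nat E * (A0 / (- 2 * of_nat s)) + of_nat K * (of_nat s * (\<alpha> / 2) + A0 / (- 2 * of_nat s))"
      unfolding R_def using c v(5) pl L1 ls2
      by (subst logd_mult) (simp_all add: poly_power logd_power del: poly_pCons)
    have lR2: "logd R (- 1 / \<alpha>) = of_nat E * (A0 / (2 * of_nat s + 2)) + of_nat K * (of_nat r * (- \<alpha> / 2))"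
      unfolding R_def using c v(6) pl L2 ls1
      by (subst logd_mult) (simp_all add: poly_power logd_power del: poly_pCons)
    define x where "x = real s"
    have x: "x \<ge> 2" using s2 by (simp add: x_def)
    have xs: "of_nat s = complex_of_real x" "of_nat r = complex_of_real (x + 1)"
      "of_nat E = complex_of_real (real E)" "of_nat K = complex_of_real (real K)" by (simp_all add: x_def r)
    have "logd R (1 / \<alpha>) + logd R (- 1 / \<alpha>) = 0" using even_poly_logd[OF evR, of "1 / \<alpha>"] by simp
    then have "\<alpha> * of_real (real E * ((2 * x + 1) / (2 * x) - (2 * x + 1) / (2 * x + 2)) +
       real K * (x / 2 + (2 * x + 1) / (2 * x) - (x + 1) / 2)) = 0"
      unfolding lR1 lR2 q1 q2 unfolding xs by (simp add: algebra_simps)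
    then have z: "real E * ((2 * x + 1) / (2 * x) - (2 * x + 1) / (2 * x + 2)) +
       real K * (x / 2 + (2 * x + 1) / (2 * x) - (x + 1) / 2) = 0"
      using a0 by (metis mult_eq_0_iff of_real_eq_0_iff)
    have "(2 * x + 1) / (2 * x + 2) \<le> (2 * x + 1) / (2 * x)" using x by (intro divide_left_mono) auto
    then have n1: "real E * ((2 * x + 1) / (2 * x) - (2 * x + 1) / (2 * x + 2)) \<ge> 0" by simp
    have "(2 * x + 1) / (2 * x) > 1" using x by simp
    moreover have "x / 2 - (x + 1) / 2 = - 1 / 2" by (simp add: add_divide_distrib)
    ultimately have "x / 2 + (2 * x + 1) / (2 * x) - (x + 1) / 2 > 0" by linarith
    then have "real K * (x / 2 + (2 * x + 1) / (2 * x) - (x + 1) / 2) > 0" using K by simp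
    then show False using z n1 by linarith
  qed
qed

definition qterm :: "('b::comm_ring_1 \<Rightarrow> 'a::comm_ring_1) \<Rightarrow> (nat \<Rightarrow> nat \<Rightarrow> 'b) \<Rightarrow> nat \<Rightarrow> nat \<Rightarrow> nat \<Rightarrow> nat \<Rightarrow> 'a \<Rightarrow> 'a \<Rightarrow> 'a \<Rightarrow> 'a" where
  "qterm h c n q p W x0 x1 x2 =
     (\<Sum>(j,k)\<in>{(j,k). j + k \<le> n \<and> q * j + p * k = W}. h (c j k) * x0 ^ (n - j - k) * x1 ^ j * x2 ^ k)"

lemma finite_qterm: "finite {(j,k). j + k \<le> (n::nat) \<and> q * j + p * k = W}"
  by (rule finite_subset[OF _ finite_triangle[of n]]) auto

lemma quasihomogeneous_form:
  fixes c :: "nat \<Rightarrow> nat \<Rightarrow> complex"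
  assumes sr: "0 < s" "s < r" "coprime s r" "0 < g" "q = g * s" "p = g * r"
    and ne: "j' + k' \<le> n" "q * j' + p * k' = W" "c j' k' \<noteq> 0"
  obtains E a N K P where "coeff P 0 \<noteq> 0" "coeff P K \<noteq> 0" "degree P = K" "E + a + N + r * K = n"
    "q * (a + r * K) + p * N = W"
    "\<And>l. l \<le> K \<Longrightarrow> coeff P l = c (a + r * (K - l)) (N + s * l)"
    "\<And>j k. j + k \<le> n \<Longrightarrow> q * j + p * k = W \<Longrightarrow> c j k \<noteq> 0 \<Longrightarrow> \<exists>l\<le>K. j = a + r * (K - l) \<and> k = N + s * l"
proof -
  define S where "S = {(j,k). (j + k \<le> n \<and> q * j + p * k = W) \<and> c j k \<noteq> 0}"
  have fin: "finite S" unfolding S_def by (rule finite_subset[OF _ finite_triangle[of n]]) auto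
  have neS: "S \<noteq> {}" using ne by (auto simp: S_def)
  define N where "N = Min (snd ` S)"
  have "N \<in> snd ` S" unfolding N_def using fin neS by (intro Min_in) auto
  then obtain jN where jN: "(jN, N) \<in> S" by auto
  have Nle: "N \<le> k" if "(j, k) \<in> S" for j k
    unfolding N_def using fin that by (intro Min_le) (auto intro: rev_image_eqI)
  have rep: "\<exists>l. jN = j + r * l \<and> k = N + s * l" if jk: "(j, k) \<in> S" for j k
  proof -
    have "g * (s * j + r * k) = g * (s * jN + r * N)"
      using jk jN sr unfolding S_def by (simp add: algebra_simps)
    then have eq: "s * j + r * k = s * jN + r * N" using sr by simp
    obtain u where u: "k = N + u" using Nle[OF jk] le_Suc_ex by blast
    have eq2: "s * j + r * u = s * jN" using eq unfolding u by (simp add: algebra_simps)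
    then have "s dvd s * j + r * u" by simp
    then have "s dvd r * u" by (simp add: dvd_add_right_iff)
    then have "s dvd u" using sr(3) coprime_dvd_mult_right_iff by blast
    then obtain l where l: "u = s * l" by blast
    have "s * jN = s * (j + r * l)" using eq2 unfolding l by (simp add: algebra_simps)
    then have "jN = j + r * l" using sr by simp
    then show ?thesis using u l by blast
  qed
  define Ls where "Ls = {l. r * l \<le> jN \<and> (jN - r * l, N + s * l) \<in> S}"
  have finL: "finite Ls"
  proof (rule finite_subset[of _ "{..jN}"])
    show "Ls \<subseteq> {..jN}"
    proof
      fix l assume "l \<in> Ls"
      then have "r * l \<le> jN" by (simp add: Ls_def)
      moreover have "l \<le> r * l" using sr by (cases r) auto
      ultimately have "l \<le> jN" by (rule order_trans[rotated])
      then show "l \<in> {..jN}" by simp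
    qed
  qed simp
  have L0: "0 \<in> Ls" using jN by (simp add: Ls_def)
  define K where "K = Max Ls"
  have KL: "K \<in> Ls" unfolding K_def using finL L0 by (intro Max_in) auto
  have Kge: "l \<le> K" if "l \<in> Ls" for l unfolding K_def using finL that by simp
  define a where "a = jN - r * K"
  have jNa: "jN = a + r * K" using KL by (simp add: a_def Ls_def)
  define E where "E = n - jN - N"
  have En: "E + a + N + r * K = n" using jN jNa by (simp add: E_def S_def)
  define P where "P = (\<Sum>l\<le>K. monom (c (a + r * (K - l)) (N + s * l)) l)"
  have cP: "coeff P l = (if l \<le> K then c (a + r * (K - l)) (N + s * l) else 0)" for l
    by (simp add: P_def coeff_sum)
  have cPK: "coeff P K \<noteq> 0" using KL jNa by (simp add: cP Ls_def S_def)
  have cP0: "coeff P 0 \<noteq> 0" using jN jNa by (simp add: cP S_def)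
  have dP: "degree P = K"
    by (rule antisym[OF degree_le le_degree]) (use cPK in \<open>auto simp: cP\<close>)
  have W: "q * (a + r * K) + p * N = W" using jN jNa by (simp add: S_def)
  have cover: "\<exists>l\<le>K. j = a + r * (K - l) \<and> k = N + s * l" if "j + k \<le> n" "q * j + p * k = W" "c j k \<noteq> 0" for j k
  proof -
    have jk: "(j, k) \<in> S" using that by (simp add: S_def)
    obtain l where l: "jN = j + r * l" "k = N + s * l" using rep[OF jk] by blast
    then have "l \<in> Ls" using jk by (simp add: Ls_def)
    then have lK: "l \<le> K" by (rule Kge)
    then have "r * K = r * (K - l) + r * l" by (simp add: distrib_left[symmetric])
    then have "j = a + r * (K - l)" using l(1) jNa by simp
    then show ?thesis using lK l(2) by blast
  qed
  show ?thesis by (rule that[OF cP0 cPK dP En W _ cover]) (simp_all add: cP)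
qed

lemma qterm_eq_binform:
  fixes c :: "nat \<Rightarrow> nat \<Rightarrow> complex" and h :: "complex \<Rightarrow> 'a::comm_ring_1"
  assumes h: "ring_hom_fun h" and sr: "0 < s" "s < r" "q * r = p * s"
    and n: "E + a + N + r * K = n" and W: "q * (a + r * K) + p * N = W"
    and cP: "\<And>l. l \<le> K \<Longrightarrow> coeff P l = c (a + r * (K - l)) (N + s * l)"
    and cover: "\<And>j k. j + k \<le> n \<Longrightarrow> q * j + p * k = W \<Longrightarrow> c j k \<noteq> 0 \<Longrightarrow> \<exists>l\<le>K. j = a + r * (K - l) \<and> k = N + s * l"
  shows "qterm h c n q p W x0 x1 x2 = x0 ^ E * x1 ^ a * x2 ^ N * binform h K P (x2 ^ s * x0 ^ (r - s)) (x1 ^ r)"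
proof -
  define \<phi> where "\<phi> l = (a + r * (K - l), N + s * l)" for l
  define f where "f = (\<lambda>(j,k). h (c j k) * x0 ^ (n - j - k) * x1 ^ j * x2 ^ k)"
  let ?T = "{(j,k). j + k \<le> n \<and> q * j + p * k = W}"
  have rs: "r * (K - l) + r * l = r * K" if "l \<le> K" for l using that by (simp add: distrib_left[symmetric])
  have sl: "s * l \<le> r * l" for l using sr by simp
  have ex: "n - (a + r * (K - l)) - (N + s * l) = E + (r - s) * l" if "l \<le> K" for l
    using rs[OF that] sl[of l] n unfolding diff_mult_distrib by arith
  have "inj_on \<phi> {..K}" using sr by (auto simp: inj_on_def \<phi>_def)
  have sub: "\<phi> ` {..K} \<subseteq> ?T"
  proof
    fix x assume "x \<in> \<phi> ` {..K}"
    then obtain l where l: "l \<le> K" "x = \<phi> l" by auto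
    have "a + r * (K - l) + (N + s * l) \<le> n" using rs[OF l(1)] sl[of l] n by arith
    moreover have "q * (a + r * (K - l)) + p * (N + s * l) = W"
    proof -
      have "q * (a + r * (K - l)) + p * (N + s * l) = q * a + q * (r * (K - l)) + p * N + (p * s) * l"
        by (simp add: algebra_simps)
      also have "\<dots> = q * a + q * (r * (K - l) + r * l) + p * N" unfolding sr(3)[symmetric] by (simp add: algebra_simps)
      also have "\<dots> = W" unfolding rs[OF l(1)] W[symmetric] by (simp add: algebra_simps)
      finally show ?thesis .
    qed
    ultimately show "x \<in> ?T" by (simp add: l(2) \<phi>_def)
  qed
  have "qterm h c n q p W x0 x1 x2 = sum f ?T" by (simp add: qterm_def f_def)
  also have "\<dots> = sum f (\<phi> ` {..K})"
  proof (rule sum.mono_neutral_right[OF finite_qterm sub], rule ballI)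
    fix x assume x: "x \<in> ?T - \<phi> ` {..K}"
    obtain j k where jk: "x = (j, k)" by (cases x)
    have "c j k = 0" using x cover[of j k] by (auto simp: \<phi>_def jk)
    then show "f x = 0" using h by (simp add: f_def ring_hom_fun_simps jk)
  qed
  also have "\<dots> = (\<Sum>l\<le>K. f (\<phi> l))" by (subst sum.reindex[OF \<open>inj_on \<phi> {..K}\<close>]) simp
  also have "\<dots> = (\<Sum>l\<le>K. x0 ^ E * x1 ^ a * x2 ^ N * (h (coeff P l) * (x2 ^ s * x0 ^ (r - s)) ^ l * (x1 ^ r) ^ (K - l)))"
  proof (intro sum.cong refl)
    fix l assume "l \<in> {..K}"
    then have l: "l \<le> K" by simp
    have fl: "f (\<phi> l) = h (coeff P l) * x0 ^ (E + (r - s) * l) * x1 ^ (a + r * (K - l)) * x2 ^ (N + s * l)"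
      unfolding f_def \<phi>_def prod.case ex[OF l] cP[OF l] ..
    show "f (\<phi> l) = x0 ^ E * x1 ^ a * x2 ^ N * (h (coeff P l) * (x2 ^ s * x0 ^ (r - s)) ^ l * (x1 ^ r) ^ (K - l))"
      unfolding fl power_add power_mult power_mult_distrib by (simp only: mult_ac)
  qed
  also have "\<dots> = x0 ^ E * x1 ^ a * x2 ^ N * binform h K P (x2 ^ s * x0 ^ (r - s)) (x1 ^ r)"
    by (simp add: binform_def sum_distrib_left)
  finally show ?thesis .
qed


text \<open>The weight \<open>w\<close> is the order of the equation of the conic along the branch.\<close>

lemma quasihomogeneous_even_form:
  fixes c :: "nat \<Rightarrow> nat \<Rightarrow> complex"
  assumes sr: "0 < s" "s < r" "coprime s r" "0 < g" "q = g * s" "p = g * r"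
    and ne: "j' + k' \<le> n" "q * j' + p * k' = W" "c j' k' \<noteq> 0"
    and \<nu>: "\<nu> = of_nat w / (2 :: complex)"
    and l: "l0 = [:1, - \<nu>:]" "l1 = [:1, of_nat q - \<nu>:]" "l2 = [:1, of_nat p - \<nu>:]"
    and ev: "even_poly (qterm (\<lambda>c. [:c:]) c n q p W l0 l1 l2)"
    and z: "poly (qterm (\<lambda>c. [:c:]) c n q p W l0 l1 l2) 0 = 0"
  obtains E a N K P k P1 where "coeff P 0 \<noteq> 0" "coeff P K \<noteq> 0" "E + a + N + r * K = n"
    "q * (a + r * K) + p * N = W"
    "even_poly (l0 ^ E * l1 ^ a * l2 ^ N * cbin K P (l2 ^ s * l0 ^ (r - s)) (l1 ^ r))"
    "P = [:-1, 1:] ^ k * P1" "poly P1 1 \<noteq> 0" "degree P1 + k = K" "1 \<le> k" "k \<le> K"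
    "3 * (- int E * int w + int (a + K * r) * (2 * int q - int w) + int N * (2 * int p - int w)) =
       2 * int k * (2 * int q + 2 * int p - 3 * int w)"
    "even_poly ((l2 ^ s * l0 ^ (r - s) - l1 ^ r) ^ k) \<longrightarrow>
       even_poly (l0 ^ E * l1 ^ a * l2 ^ N * cbin (K - k) P1 (l2 ^ s * l0 ^ (r - s)) (l1 ^ r))"
    "\<forall>(h :: complex \<Rightarrow> complex poly poly) x0 x1 x2. ring_hom_fun h \<longrightarrow>
       qterm h c n q p W x0 x1 x2 = x0 ^ E * x1 ^ a * x2 ^ N * binform h K P (x2 ^ s * x0 ^ (r - s)) (x1 ^ r)"
proof -
  obtain P K E a N where P: "coeff P 0 \<noteq> 0" "coeff P K \<noteq> 0" "degree P = K" and En: "E + a + N + r * K = n"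
    and W: "q * (a + r * K) + p * N = W"
    and cP: "\<And>l. l \<le> K \<Longrightarrow> coeff P l = c (a + r * (K - l)) (N + s * l)"
    and cover: "\<And>j k. j + k \<le> n \<Longrightarrow> q * j + p * k = W \<Longrightarrow> c j k \<noteq> 0 \<Longrightarrow> \<exists>l\<le>K. j = a + r * (K - l) \<and> k = N + s * l"
    by (rule quasihomogeneous_form[where c = c, OF sr ne]) (rule that; assumption)
  have qr: "q * r = p * s" using sr by simp
  note form = qterm_eq_binform[where c = c, OF _ sr(1,2) qr En W cP cover]
  have F: "qterm (\<lambda>c. [:c:]) c n q p W l0 l1 l2 = l0 ^ E * l1 ^ a * l2 ^ N * cbin K P (l2 ^ s * l0 ^ (r - s)) (l1 ^ r)"
    by (rule form) auto
  have "poly (l0 ^ E * l1 ^ a * l2 ^ N * cbin K P (l2 ^ s * l0 ^ (r - s)) (l1 ^ r)) 0 = binform (\<lambda>c. c) K P 1 1"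
    unfolding l by (simp add: poly_power poly_cbin)
  also have "\<dots> = poly P 1" by (rule binform_1_1) (use P in auto)
  finally have P1: "poly P 1 = 0" using z F by simp
  have P0: "P \<noteq> 0" using P by auto
  define k where "k = order 1 P"
  obtain P1 where P1: "P = [:- 1, 1:] ^ k * P1" "\<not> [:- 1, 1:] dvd P1"
    using order_decomp[OF P0, of 1] unfolding k_def by blast
  have P1': "poly P1 1 \<noteq> 0" using P1(2) by (simp add: poly_eq_0_iff_dvd)
  have k1: "k \<ge> 1" using \<open>poly P 1 = 0\<close> P0 order_root[of P 1] unfolding k_def by auto
  have "P1 \<noteq> 0" using P1(1) P0 by auto
  then have dk: "degree P1 + k = K" using P(3) unfolding P1(1) by (subst (asm) degree_mult_eq) (auto simp: degree_linear_power)
  have ev': "even_poly (l0 ^ E * l1 ^ a * l2 ^ N * cbin K P (l2 ^ s * l0 ^ (r - s)) (l1 ^ r))" using ev F by simp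
  have rs: "(of_nat (r - s) :: complex) = of_nat r - of_nat s" using sr by (simp add: of_nat_diff)
  have qp: "(of_nat q :: complex) = of_nat g * of_nat s" "(of_nat p :: complex) = of_nat g * of_nat r" using sr by simp_all
  have bal: "of_nat s * (of_nat p - \<nu>) + of_nat (r - s) * (- \<nu>) = of_nat r * (of_nat q - \<nu>)"
    unfolding rs qp by (simp add: algebra_simps)
  have c1: "of_nat s * (of_nat q - \<nu>) * (of_nat p - \<nu>) + of_nat r * (- \<nu>) * (of_nat p - \<nu>)
     - of_nat s * (- \<nu>) * (of_nat q - \<nu>) - of_nat r * (of_nat q - \<nu>) * (of_nat p - \<nu>) \<noteq> 0"
  proof -
    have "of_nat s * (of_nat q - \<nu>) * (of_nat p - \<nu>) + of_nat r * (- \<nu>) * (of_nat p - \<nu>)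
     - of_nat s * (- \<nu>) * (of_nat q - \<nu>) - of_nat r * (of_nat q - \<nu>) * (of_nat p - \<nu>) =
       of_nat p * of_nat q * (of_nat s - of_nat r)"
      unfolding qp by (simp add: algebra_simps)
    then show ?thesis using sr by simp
  qed
  note star = even_restriction_first_order[OF bal sr(2) c1 P1(1) P1' eq_refl[OF dk] ev'[unfolded l]]
  have st: "3 * (- int E * int w + int (a + K * r) * (2 * int q - int w) + int N * (2 * int p - int w)) =
       2 * int k * (2 * int q + 2 * int p - 3 * int w)"
  proof -
    have "(of_int (3 * (- int E * int w + int (a + K * r) * (2 * int q - int w) + int N * (2 * int p - int w))) :: complex) =
      6 * (of_nat E * - \<nu> + of_nat (a + K * r) * (of_nat q - \<nu>) + of_nat N * (of_nat p - \<nu>))"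
      unfolding \<nu> by (simp add: algebra_simps)
    also have "\<dots> = of_int (2 * int k * (2 * int q + 2 * int p - 3 * int w))"
      unfolding star(1) unfolding \<nu> by (simp add: algebra_simps)
    finally show ?thesis by (simp only: of_int_eq_iff)
  qed
  have kK: "k \<le> K" using dk by simp
  have s2: "even_poly ((l2 ^ s * l0 ^ (r - s) - l1 ^ r) ^ k) \<longrightarrow>
       even_poly (l0 ^ E * l1 ^ a * l2 ^ N * cbin (K - k) P1 (l2 ^ s * l0 ^ (r - s)) (l1 ^ r))"
    unfolding l by (rule impI) (rule star(2))
  have f: "\<forall>(h :: complex \<Rightarrow> complex poly poly) x0 x1 x2. ring_hom_fun h \<longrightarrow>
       qterm h c n q p W x0 x1 x2 = x0 ^ E * x1 ^ a * x2 ^ N * binform h K P (x2 ^ s * x0 ^ (r - s)) (x1 ^ r)"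
    by (intro allI impI) (rule form)
  show ?thesis by (rule that[OF P(1,2) En W ev' P1(1) P1' dk k1 kK st s2 f])
qed

lemma quasihomogeneous_quadratic:
  fixes c :: "nat \<Rightarrow> nat \<Rightarrow> complex"
  assumes qp: "0 < q" "q < p" and n: "even n"
    and ne: "j' + k' \<le> n" "q * j' + p * k' = W" "c j' k' \<noteq> 0"
    and \<nu>: "\<nu> = of_nat w / (2 :: complex)"
    and l: "l0 = [:1, - \<nu>:]" "l1 = [:1, of_nat q - \<nu>:]" "l2 = [:1, of_nat p - \<nu>:]"
    and ev: "even_poly (qterm (\<lambda>c. [:c:]) c n q p W l0 l1 l2)"
    and z: "poly (qterm (\<lambda>c. [:c:]) c n q p W l0 l1 l2) 0 = 0"
    and w: "w \<in> {0, q, p, 2 * q, p + q}"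
  shows "p = 2 * q"
proof -
  define g where "g = gcd q p"
  obtain s r where sr: "q = s * g" "p = r * g" "coprime s r"
    using gcd_coprime_exists[of q p] qp unfolding g_def by auto
  have g: "0 < g" using qp g_def by simp
  have sr': "0 < s" "s < r" "q = g * s" "p = g * r" using sr qp by (auto simp: mult.commute)
  have sr1: "1 \<le> s" "1 \<le> g" using sr' g by auto
  obtain E a N K P k P1 where P: "coeff P 0 \<noteq> 0" "coeff P K \<noteq> 0" "E + a + N + r * K = n"
    and W: "q * (a + r * K) + p * N = W"
    and evb: "even_poly (l0 ^ E * l1 ^ a * l2 ^ N * cbin K P (l2 ^ s * l0 ^ (r - s)) (l1 ^ r))"
    and k: "1 \<le> k" "k \<le> K"
    and star: "3 * (- int E * int w + int (a + K * r) * (2 * int q - int w) + int N * (2 * int p - int w)) =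
       2 * int k * (2 * int q + 2 * int p - 3 * int w)"
    by (rule quasihomogeneous_even_form[where c = c, OF sr'(1,2) sr(3) g sr'(3,4) ne \<nu> l ev z]) (rule that; assumption)
  have K1: "1 \<le> K" using k by simp
  have gi: "int g \<noteq> 0" using g by simp
  consider "w = 0" | "w = q" | "w = p" | "w = 2 * q" | "w = p + q" using w by auto
  then have "r = 2 * s"
  proof cases
    case 1
    have "int g * (3 * (int a * int s + int K * int r * int s + int N * int r)) = int g * (2 * int k * (int r + int s))"
      using star unfolding 1 sr'(3,4) by (simp add: algebra_simps)
    then have "3 * (int a * int s + int K * int r * int s + int N * int r) = 2 * int k * (int r + int s)"
      using gi by (subst (asm) mult_left_cancel)
    then have "int (3 * (a * s + K * r * s + N * r)) = int (2 * k * (r + s))" by simp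
    then have "3 * (a * s + K * r * s + N * r) = 2 * k * (r + s)" by (simp only: of_nat_eq_iff)
    then have "3 * (K * r * s) \<le> 2 * k * (r + s)" unfolding distrib_left by linarith
    then show ?thesis by (rule quadratic_from_weight_0[OF sr1(1) sr'(2) K1 k(2)])
  next
    case 2
    have L: "l0 = [:1, - (of_nat (g * s) / 2):]" "l1 = [:1, of_nat (g * s) / 2:]"
      "l2 = [:1, of_nat (g * r) - of_nat (g * s) / 2:]"
      unfolding l \<nu> 2 sr' by simp_all
    have "int g * (3 * (- int E * int s + int (a + K * r) * int s + int N * (2 * int r - int s))) = int g * (2 * int k * (2 * int r - int s))"
      using star unfolding 2 sr'(3,4) by (simp add: algebra_simps)
    then have "3 * (- int E * int s + int (a + K * r) * int s + int N * (2 * int r - int s)) = 2 * int k * (2 * int r - int s)"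
      using gi by (subst (asm) mult_left_cancel)
    then show ?thesis by (rule quadratic_transversal[OF sr1(1) sr'(2) sr1(2) K1 k(2) P(1,2) evb[unfolded L]])
  next
    case 3
    have L: "l0 = [:1, - (of_nat (g * r) / 2):]" "l2 = [:1, of_nat (g * r) / 2:]"
      "l1 = [:1, of_nat (g * s) - of_nat (g * r) / 2:]"
      unfolding l \<nu> 3 sr' by simp_all
    have "int g * (3 * (- int E * int r + int (a + K * r) * (2 * int s - int r) + int N * int r)) = int g * (2 * int k * (2 * int s - int r))"
      using star unfolding 3 sr'(3,4) by (simp add: algebra_simps)
    then have "3 * (- int E * int r + int (a + K * r) * (2 * int s - int r) + int N * int r) = 2 * int k * (2 * int s - int r)"
      using gi by (subst (asm) mult_left_cancel)
    then show ?thesis by (rule quadratic_tangent_line[OF sr1(1) sr'(2) sr1(2) K1 k(2) P(1) evb[unfolded L]])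
  next
    case 4
    have "(of_nat (g * (r - s)) :: complex) = of_nat (g * r) - of_nat (g * s)"
      using sr' by (simp add: of_nat_diff right_diff_distrib)
    then have L: "l0 = [:1, - of_nat (g * s):]" "l1 = [:1, 0:]" "l2 = [:1, of_nat (g * (r - s)):]"
      unfolding l \<nu> 4 sr' by simp_all
    have "(2 * int g) * (3 * (int N * (int r - int s) - int E * int s)) = (2 * int g) * (2 * int k * (int r - 2 * int s))"
      using star unfolding 4 sr'(3,4) by (simp add: algebra_simps)
    then have "3 * (int N * (int r - int s) - int E * int s) = 2 * int k * (int r - 2 * int s)"
      using gi by (subst (asm) mult_left_cancel) auto
    moreover have "even (E + a + N + r * K)" using P(3) n by simp
    ultimately show ?thesis
      by (intro quadratic_node_transversal[OF sr1(1) sr'(2) sr1(2) K1 k(2) P(2) _ evb[unfolded L]])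
  next
    case 5
    have rs: "(of_nat (g * (r - s)) :: complex) = of_nat (g * r) - of_nat (g * s)"
      using sr' by (simp add: of_nat_diff right_diff_distrib)
    have L: "l0 = [:1, - of_nat (g * (r + s)) / 2:]" "l1 = [:1, - (of_nat (g * (r - s)) / 2):]"
      "l2 = [:1, of_nat (g * (r - s)) / 2:]"
      unfolding l \<nu> 5 sr' rs by (simp_all add: diff_divide_distrib add_divide_distrib distrib_left)
    have "int g * (3 * (- int E * (int r + int s) + int (a + K * r) * (int s - int r) + int N * (int r - int s))) =
      int g * (- 2 * int k * (int r + int s))"
      using star unfolding 5 sr'(3,4) by (simp add: algebra_simps)
    then have "3 * (- int E * (int r + int s) + int (a + K * r) * (int s - int r) + int N * (int r - int s)) = - 2 * int k * (int r + int s)"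
      using gi by (subst (asm) mult_left_cancel)
    then show ?thesis by (rule quadratic_node_tangent[OF sr1(1) sr'(2) sr1(2) K1 k(2) P(1,2) evb[unfolded L]])
  qed
  then show ?thesis using sr' by simp
qed

lemma quasihomogeneous_weight_bound:
  fixes c :: "nat \<Rightarrow> nat \<Rightarrow> complex"
  assumes q: "0 < q" and w: "2 * q \<le> w"
    and ne: "j' + k' \<le> n" "q * j' + (2 * q) * k' = W" "c j' k' \<noteq> 0"
    and \<nu>: "\<nu> = of_nat w / (2 :: complex)"
    and l: "l0 = [:1, - \<nu>:]" "l1 = [:1, of_nat q - \<nu>:]" "l2 = [:1, of_nat (2 * q) - \<nu>:]"
    and ev: "even_poly (qterm (\<lambda>c. [:c:]) c n q (2 * q) W l0 l1 l2)"
    and z: "poly (qterm (\<lambda>c. [:c:]) c n q (2 * q) W l0 l1 l2) 0 = 0"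
  shows "n * q \<le> W"
proof -
  have sr: "0 < (1::nat)" "(1::nat) < 2" "coprime 1 (2::nat)" "0 < q" "q = q * 1" "2 * q = q * 2" using q by auto
  obtain E a N K P k P1 where En: "E + a + N + 2 * K = n"
    and W: "q * (a + 2 * K) + (2 * q) * N = W" and k: "k \<le> K"
    and star: "3 * (- int E * int w + int (a + K * 2) * (2 * int q - int w) + int N * (2 * int (2 * q) - int w)) =
       2 * int k * (2 * int q + 2 * int (2 * q) - 3 * int w)"
    by (rule quasihomogeneous_even_form[where c = c, OF sr ne \<nu> l ev z]) (rule that; assumption)
  have n: "int n = int E + int a + int N + 2 * int K" using En by simp
  have Wi: "int W = int q * (int a + 2 * int K) + 2 * int q * int N" using W by (simp add: algebra_simps flip: W)
  have "2 * int W = int n * int w - 2 * int k * (int w - 2 * int q)"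
  proof -
    have "3 * (2 * int W) = 3 * (int n * int w - 2 * int k * (int w - 2 * int q))"
      using star unfolding n Wi by (simp add: algebra_simps)
    then show ?thesis by simp
  qed
  moreover have "2 * int k * (int w - 2 * int q) \<le> int n * (int w - 2 * int q)"
    using w k n by (intro mult_right_mono) auto
  ultimately have "int n * int w - int n * (int w - 2 * int q) \<le> 2 * int W" by linarith
  then have "2 * (int n * int q) \<le> 2 * int W" by (simp add: algebra_simps)
  then have "int (n * q) \<le> int W" by simp
  then show ?thesis by (simp only: of_nat_le_iff)
qed

lemma quasihomogeneous_perturbation:
  fixes c :: "nat \<Rightarrow> nat \<Rightarrow> complex"
  assumes q: "0 < q"
    and ne: "j' + k' \<le> n" "q * j' + (2 * q) * k' = W" "c j' k' \<noteq> 0"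
    and \<nu>: "\<nu> = of_nat w / (2 :: complex)"
    and l: "l0 = [:1, - \<nu>:]" "l1 = [:1, of_nat q - \<nu>:]" "l2 = [:1, of_nat (2 * q) - \<nu>:]"
    and ev: "even_poly (qterm (\<lambda>c. [:c:]) c n q (2 * q) W l0 l1 l2)"
    and z: "poly (qterm (\<lambda>c. [:c:]) c n q (2 * q) W l0 l1 l2) 0 = 0"
    and e: "e \<noteq> 0" and d: "d0 = [:0, - \<delta>:]" "d2 = [:e, e * (of_nat M - \<nu>) - \<delta>:]"
    and ev': "even_poly (poly (pderiv (qterm (\<lambda>c. [:[:c:]:]) c n q (2 * q) W [:l0, d0:] [:l1, d0:] [:l2, d2:])) 0)"
  shows "M = w"
proof -
  have sr: "0 < (1::nat)" "(1::nat) < 2" "coprime 1 (2::nat)" "0 < q" "q = q * 1" "2 * q = q * 2" using q by auto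
  define D0 where "D0 = l2 ^ 1 * l0 ^ (2 - 1) - l1 ^ 2"
  have D0: "D0 = [:- (of_nat q ^ 2):] * [:0, 1:] ^ 2"
    unfolding D0_def l by (simp add: power2_eq_square algebra_simps)
  have evD: "even_poly (D0 ^ k)" for k
    unfolding D0 by (rule even_poly_power) (simp add: even_poly_def power2_eq_square)
  have D0nz: "D0 \<noteq> 0" unfolding D0 using q by simp
  obtain E a N K P k P1 where
    P: "P = [:-1, 1:] ^ k * P1" "poly P1 1 \<noteq> 0" "degree P1 + k = K" and k: "1 \<le> k" "k \<le> K"
    and evH: "even_poly ((l2 ^ 1 * l0 ^ (2 - 1) - l1 ^ 2) ^ k) \<longrightarrow>
       even_poly (l0 ^ E * l1 ^ a * l2 ^ N * cbin (K - k) P1 (l2 ^ 1 * l0 ^ (2 - 1)) (l1 ^ 2))"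
    and form: "\<forall>(h :: complex \<Rightarrow> complex poly poly) x0 x1 x2. ring_hom_fun h \<longrightarrow>
       qterm h c n q (2 * q) W x0 x1 x2 = x0 ^ E * x1 ^ a * x2 ^ N * binform h K P (x2 ^ 1 * x0 ^ (2 - 1)) (x1 ^ 2)"
    by (rule quasihomogeneous_even_form[where c = c, OF sr ne \<nu> l ev z]) (rule that; assumption)
  define h :: "complex \<Rightarrow> complex poly poly" where "h = (\<lambda>c. [:[:c:]:])"
  have hh: "ring_hom_fun h" unfolding h_def by (auto simp: ring_hom_fun_def one_pCons)
  define X0 X1 X2 where "X0 = [:l0, d0:]" and "X1 = [:l1, d0:]" and "X2 = [:l2, d2:]"
  define H where "H = X0 ^ E * X1 ^ a * X2 ^ N * binform h (K - k) P1 (X2 * X0) (X1 ^ 2)"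
  define D where "D = X2 * X0 - X1 ^ 2"
  have kK: "K = (K - k) + k" using k by simp
  have "binform h K P (X2 * X0) (X1 ^ 2) = D ^ k * binform h (K - k) P1 (X2 * X0) (X1 ^ 2)"
    unfolding D_def P(1) by (subst kK, rule binform_power_factor[OF hh]) (use P(3) in auto)
  then have Q: "qterm h c n q (2 * q) W X0 X1 X2 = D ^ k * H"
    using form hh by (simp add: H_def mult_ac)
  have H0: "poly H 0 = l0 ^ E * l1 ^ a * l2 ^ N * cbin (K - k) P1 (l2 ^ 1 * l0 ^ (2 - 1)) (l1 ^ 2)"
    unfolding H_def binform_def h_def X0_def X1_def X2_def by (simp add: poly_sum poly_power mult.commute)
  have evH0: "even_poly (poly H 0)" unfolding H0 using evH evD[of k] unfolding D0_def by blast
  have HH: "poly (poly H 0) 0 \<noteq> 0"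
  proof -
    have "poly (poly H 0) 0 = binform (\<lambda>c. c) (K - k) P1 1 1" unfolding H0 l by (simp add: poly_power poly_cbin)
    then show ?thesis using P by (simp add: binform_1_1)
  qed
  have PD0: "poly D 0 = D0" by (simp add: D_def X0_def X1_def X2_def D0_def poly_power)
  define b where "b = [:e:] * [:1, of_nat M - \<nu>:] * l0"
  have PD1: "poly (pderiv D) 0 = b"
  proof -
    have "poly (pderiv D) 0 = l2 * d0 + l0 * d2 - 2 * l1 * d0"
      unfolding D_def X0_def X1_def X2_def by (simp add: pderiv_diff pderiv_mult pderiv_pCons power2_eq_square algebra_simps)
    also have "\<dots> = b" unfolding b_def l d by (simp add: algebra_simps numeral_poly)
    finally show ?thesis .
  qed
  obtain k' where k': "k = Suc k'" using k(1) by (cases k) auto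
  have "poly (pderiv (D ^ k * H)) 0 = D0 ^ k' * (D0 * poly (pderiv H) 0 + poly H 0 * (of_nat k * b))"
    unfolding k' pderiv_mult pderiv_power_Suc by (simp add: poly_power PD0 PD1 algebra_simps)
  then have "even_poly (D0 ^ k' * (D0 * poly (pderiv H) 0 + poly H 0 * (of_nat k * b)))"
    using ev' Q unfolding h_def X0_def X1_def X2_def by simp
  then have evB: "even_poly (D0 * poly (pderiv H) 0 + poly H 0 * (of_nat k * b))"
    by (rule even_poly_cancel[OF _ evD]) (use D0nz in simp)
  have dH: "poly (pderiv (poly H 0)) 0 = 0" using even_poly_pderiv[OF evH0, of 0] by simp
  have b0: "poly b 0 = e" "poly (pderiv b) 0 = e * (of_nat M - 2 * \<nu>)"
    unfolding b_def l by (simp_all add: pderiv_mult pderiv_pCons pderiv_smult algebra_simps)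
  have D00: "poly D0 0 = 0" "poly (pderiv D0) 0 = 0"
    unfolding D0 by (simp_all add: pderiv_pCons pderiv_mult pderiv_smult power2_eq_square)
  have kp: "poly (of_nat k * b) 0 = of_nat k * e" "poly (pderiv (of_nat k * b)) 0 = of_nat k * (e * (of_nat M - 2 * \<nu>))"
    by (simp_all add: b0 pderiv_mult)
  have "0 = poly (pderiv (D0 * poly (pderiv H) 0 + poly H 0 * (of_nat k * b))) 0"
    using even_poly_pderiv[OF evB, of 0] by simp
  also have "\<dots> = poly (poly H 0) 0 * (of_nat k * (e * (of_nat M - 2 * \<nu>)))"
    unfolding pderiv_add pderiv_mult[of D0] pderiv_mult[of "poly H 0"] by (simp add: D00 dH kp)
  finally have "of_nat M - 2 * \<nu> = 0" using HH e k(1) by auto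
  then have "(of_nat M :: complex) = of_nat w" by (simp add: \<nu>)
  then show ?thesis by (simp only: of_nat_eq_iff)
qed

section \<open>Leading terms along a branch\<close>

definition qderiv :: "('b::comm_ring_1 \<Rightarrow> 'a::comm_ring_1) \<Rightarrow> (nat \<Rightarrow> nat \<Rightarrow> 'b) \<Rightarrow> nat \<Rightarrow> nat \<Rightarrow> nat \<Rightarrow> nat \<Rightarrow>
    'a \<Rightarrow> 'a \<Rightarrow> 'a \<Rightarrow> 'a \<Rightarrow> 'a \<Rightarrow> 'a \<Rightarrow> 'a" where
  "qderiv h c n q p W x0 x1 x2 d0 d1 d2 =
     (\<Sum>(j,k)\<in>{(j,k). j + k \<le> n \<and> q * j + p * k = W}. h (c j k) *
        (of_nat (n - j - k) * x0 ^ (n - j - k - 1) * d0 * x1 ^ j * x2 ^ k +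
         x0 ^ (n - j - k) * (of_nat j * x1 ^ (j - 1) * d1) * x2 ^ k +
         x0 ^ (n - j - k) * x1 ^ j * (of_nat k * x2 ^ (k - 1) * d2)))"

lemma power_first_order:
  fixes a b t :: "'a::comm_ring_1"
  shows "\<exists>R. (a + t * b) ^ i = a ^ i + t * (of_nat i * a ^ (i - 1) * b) + t ^ 2 * R"
proof (induction i)
  case 0
  have "(a + t * b) ^ 0 = a ^ 0 + t * (of_nat 0 * a ^ (0 - 1) * b) + t ^ 2 * 0" by simp
  then show ?case by blast
next
  case (Suc i)
  then obtain R where R: "(a + t * b) ^ i = a ^ i + t * (of_nat i * a ^ (i - 1) * b) + t ^ 2 * R" by blast
  have i: "of_nat i * a ^ i = of_nat i * a ^ (i - 1) * a" by (cases i) (auto simp: mult.commute)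
  have "(a + t * b) ^ Suc i = a ^ Suc i + t * (of_nat (Suc i) * a ^ (Suc i - 1) * b) +
     t ^ 2 * (of_nat i * a ^ (i - 1) * b * b + R * (a + t * b))"
    unfolding power_Suc R using i by (simp add: algebra_simps power2_eq_square)
  then show ?case by blast
qed

lemma monomial_first_order:
  fixes x0 x1 x2 d0 d1 d2 t :: "'a::comm_ring_1"
  shows "\<exists>R. (x0 + t * d0) ^ i * (x1 + t * d1) ^ j * (x2 + t * d2) ^ k = x0 ^ i * x1 ^ j * x2 ^ k +
    t * (of_nat i * x0 ^ (i - 1) * d0 * x1 ^ j * x2 ^ k + x0 ^ i * (of_nat j * x1 ^ (j - 1) * d1) * x2 ^ k +
         x0 ^ i * x1 ^ j * (of_nat k * x2 ^ (k - 1) * d2)) + t ^ 2 * R"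
proof -
  define b0 where "b0 = of_nat i * x0 ^ (i - 1) * d0"
  define b1 where "b1 = of_nat j * x1 ^ (j - 1) * d1"
  define b2 where "b2 = of_nat k * x2 ^ (k - 1) * d2"
  obtain R0 where R0: "(x0 + t * d0) ^ i = x0 ^ i + t * b0 + t ^ 2 * R0"
    using power_first_order[of x0 t d0 i] unfolding b0_def by blast
  obtain R1 where R1: "(x1 + t * d1) ^ j = x1 ^ j + t * b1 + t ^ 2 * R1"
    using power_first_order[of x1 t d1 j] unfolding b1_def by blast
  obtain R2 where R2: "(x2 + t * d2) ^ k = x2 ^ k + t * b2 + t ^ 2 * R2"
    using power_first_order[of x2 t d2 k] unfolding b2_def by blast
  have two: "(A + t * a + t ^ 2 * r) * (B + t * b + t ^ 2 * s) =
     A * B + t * (a * B + A * b) + t ^ 2 * (A * s + a * b + r * B + t * (a * s + r * b) + t ^ 2 * (r * s))"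
    for A a r B b s :: 'a
    by (simp add: algebra_simps power2_eq_square)
  have dist: "(b0 * x1 ^ j + x0 ^ i * b1) * x2 ^ k + x0 ^ i * x1 ^ j * b2 =
      b0 * x1 ^ j * x2 ^ k + x0 ^ i * b1 * x2 ^ k + x0 ^ i * x1 ^ j * b2" by (simp add: algebra_simps)
  show ?thesis
    unfolding R0 R1 R2 two dist b0_def[symmetric] b1_def[symmetric] b2_def[symmetric]
    by (intro exI) (rule refl)
qed

lemma coeff_qterm_1:
  fixes h :: "'b::comm_ring_1 \<Rightarrow> 'a::comm_ring_1"
  shows "coeff (qterm (\<lambda>c. [:h c:]) c n q p W [:x0, d0:] [:x1, d1:] [:x2, d2:]) 1 = qderiv h c n q p W x0 x1 x2 d0 d1 d2"
proof -
  have m: "coeff ([:x0, d0:] ^ i * [:x1, d1:] ^ j * [:x2, d2:] ^ k) 1 =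
      of_nat i * x0 ^ (i - 1) * d0 * x1 ^ j * x2 ^ k + x0 ^ i * (of_nat j * x1 ^ (j - 1) * d1) * x2 ^ k +
         x0 ^ i * x1 ^ j * (of_nat k * x2 ^ (k - 1) * d2)" for i j k
  proof -
    have e: "[:x, d:] = [:x:] + [:0, 1:] * [:d:]" for x d :: 'a by simp
    obtain R where R: "[:x0, d0:] ^ i * [:x1, d1:] ^ j * [:x2, d2:] ^ k = [:x0:] ^ i * [:x1:] ^ j * [:x2:] ^ k +
      [:0, 1:] * (of_nat i * [:x0:] ^ (i - 1) * [:d0:] * [:x1:] ^ j * [:x2:] ^ k + [:x0:] ^ i * (of_nat j * [:x1:] ^ (j - 1) * [:d1:]) * [:x2:] ^ k +
         [:x0:] ^ i * [:x1:] ^ j * (of_nat k * [:x2:] ^ (k - 1) * [:d2:])) + [:0, 1:] ^ 2 * R"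
      using monomial_first_order[of "[:x0:]" "[:0, 1:]" "[:d0:]" i "[:x1:]" "[:d1:]" j "[:x2:]" "[:d2:]" k] unfolding e[symmetric] by blast
    have pw: "[:x:] ^ i = [:x ^ i:]" for x :: 'a and i by (induction i) (auto simp: one_pCons)
    show ?thesis unfolding R pw of_nat_poly power2_eq_square by (simp add: mult_ac)
  qed
  show ?thesis
    unfolding qterm_def qderiv_def coeff_sum
  proof (intro sum.cong refl, clarify)
    fix j k :: nat
    have "[:h (c j k):] * [:x0, d0:] ^ (n - j - k) * [:x1, d1:] ^ j * [:x2, d2:] ^ k =
       smult (h (c j k)) ([:x0, d0:] ^ (n - j - k) * [:x1, d1:] ^ j * [:x2, d2:] ^ k)" by (simp add: mult.assoc)
    then show "coeff ([:h (c j k):] * [:x0, d0:] ^ (n - j - k) * [:x1, d1:] ^ j * [:x2, d2:] ^ k) 1 = h (c j k) *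
        (of_nat (n - j - k) * x0 ^ (n - j - k - 1) * d0 * x1 ^ j * x2 ^ k +
         x0 ^ (n - j - k) * (of_nat j * x1 ^ (j - 1) * d1) * x2 ^ k +
         x0 ^ (n - j - k) * x1 ^ j * (of_nat k * x2 ^ (k - 1) * d2))"
      by (simp only: coeff_smult m)
  qed
qed

lemma ev_weighted:
  fixes F :: poly3
  defines "c n j k \<equiv> cf3 F (n - j - k) j k"
  assumes F: "homogeneous n F"
    and W: "\<And>j k. j + k \<le> n \<Longrightarrow> c n j k \<noteq> 0 \<Longrightarrow> W \<le> q * j + p * k"
  shows "\<exists>G. ev fps_const F v0 (fps_X ^ q * v1) (fps_X ^ p * v2) = fps_X ^ W * G \<and>
    fps_nth G 0 = qterm (\<lambda>x. x) (c n) n q p W (fps_nth v0 0) (fps_nth v1 0) (fps_nth v2 0)"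
proof -
  define f where "f j k = fps_const (c n j k) * v0 ^ (n - j - k) * v1 ^ j * v2 ^ k" for j k
  let ?T = "{(j,k). j + k \<le> n}"
  define G where "G = (\<Sum>(j,k)\<in>?T. f j k * fps_X ^ (q * j + p * k - W))"
  have "ev fps_const F v0 (fps_X ^ q * v1) (fps_X ^ p * v2) =
     (\<Sum>(j,k)\<in>?T. f j k * fps_X ^ (q * j + p * k))"
    unfolding ev_homogeneous[OF ring_hom_fun_fps_const F] f_def c_def
  proof (intro sum.cong refl, clarify)
    fix j k :: nat
    have B: "(fps_X ^ (q * j + p * k) :: complex fps) = (fps_X ^ q) ^ j * (fps_X ^ p) ^ k" by (simp add: power_add power_mult)
    show "fps_const (cf3 F (n - j - k) j k) * v0 ^ (n - j - k) * (fps_X ^ q * v1) ^ j * (fps_X ^ p * v2) ^ k =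
       fps_const (cf3 F (n - j - k) j k) * v0 ^ (n - j - k) * v1 ^ j * v2 ^ k * fps_X ^ (q * j + p * k)"
      unfolding B power_mult_distrib by (simp only: mult_ac)
  qed
  also have "\<dots> = fps_X ^ W * G"
    unfolding G_def sum_distrib_left
  proof (intro sum.cong refl)
    fix x assume "x \<in> ?T"
    then obtain j k where x: "x = (j, k)" "j + k \<le> n" by auto
    show "(case x of (j, k) \<Rightarrow> f j k * fps_X ^ (q * j + p * k)) =
       fps_X ^ W * (case x of (j, k) \<Rightarrow> f j k * fps_X ^ (q * j + p * k - W))"
    proof (cases "c n j k = 0")
      case True
      then show ?thesis unfolding x by (simp add: f_def)
    next
      case False
      then have "q * j + p * k = W + (q * j + p * k - W)" using W[OF x(2)] by simp
      then have "fps_X ^ (q * j + p * k) = fps_X ^ W * (fps_X ^ (q * j + p * k - W) :: complex fps)"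
        by (metis power_add)
      then show ?thesis unfolding x by (simp add: mult_ac)
    qed
  qed
  finally have 1: "ev fps_const F v0 (fps_X ^ q * v1) (fps_X ^ p * v2) = fps_X ^ W * G" .
  have "fps_nth G 0 = (\<Sum>(j,k)\<in>?T. if q * j + p * k = W then c n j k * fps_nth v0 0 ^ (n - j - k) * fps_nth v1 0 ^ j * fps_nth v2 0 ^ k else 0)"
    unfolding G_def fps_sum_nth
  proof (intro sum.cong refl)
    fix x assume "x \<in> ?T"
    then obtain j k where x: "x = (j, k)" "j + k \<le> n" by auto
    have f0: "fps_nth (f j k) 0 = c n j k * fps_nth v0 0 ^ (n - j - k) * fps_nth v1 0 ^ j * fps_nth v2 0 ^ k"
      by (simp add: f_def fps_power_zeroth)
    have "c n j k = 0 \<or> q * j + p * k = W \<or> q * j + p * k - W > 0" using W[OF x(2)] by force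
    then show "fps_nth (case x of (j, k) \<Rightarrow> f j k * fps_X ^ (q * j + p * k - W)) 0 =
       (case x of (j, k) \<Rightarrow> if q * j + p * k = W then c n j k * fps_nth v0 0 ^ (n - j - k) * fps_nth v1 0 ^ j * fps_nth v2 0 ^ k else 0)"
      unfolding x by (auto simp: f0 fps_mult_nth_0 fps_power_zeroth)
  qed
  also have "\<dots> = qterm (\<lambda>x. x) (c n) n q p W (fps_nth v0 0) (fps_nth v1 0) (fps_nth v2 0)"
    unfolding qterm_def by (rule sum.mono_neutral_cong_right) (auto intro: finite_triangle split: if_splits)
  finally show ?thesis using 1 by blast
qed

lemma ev_weighted_diff:
  fixes F :: poly3
  defines "c n j k \<equiv> cf3 F (n - j - k) j k"
  assumes F: "homogeneous n F" and M: "M > 0"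
    and W: "\<And>j k. j + k \<le> n \<Longrightarrow> c n j k \<noteq> 0 \<Longrightarrow> W \<le> q * j + p * k"
  shows "\<exists>G. ev fps_const F (v0 + fps_X ^ M * d0) (fps_X ^ q * (v1 + fps_X ^ M * d1)) (fps_X ^ p * (v2 + fps_X ^ M * d2)) -
      ev fps_const F v0 (fps_X ^ q * v1) (fps_X ^ p * v2) = fps_X ^ (W + M) * G \<and>
    fps_nth G 0 = qderiv (\<lambda>x. x) (c n) n q p W (fps_nth v0 0) (fps_nth v1 0) (fps_nth v2 0)
      (fps_nth d0 0) (fps_nth d1 0) (fps_nth d2 0)"
proof -
  let ?T = "{(j,k). j + k \<le> n}"
  define t :: "complex fps" where "t = fps_X ^ M"
  define dm where "dm j k = of_nat (n - j - k) * v0 ^ (n - j - k - 1) * d0 * v1 ^ j * v2 ^ k +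
         v0 ^ (n - j - k) * (of_nat j * v1 ^ (j - 1) * d1) * v2 ^ k +
         v0 ^ (n - j - k) * v1 ^ j * (of_nat k * v2 ^ (k - 1) * d2)" for j k
  have "\<exists>R. (v0 + t * d0) ^ (n - j - k) * (v1 + t * d1) ^ j * (v2 + t * d2) ^ k =
     v0 ^ (n - j - k) * v1 ^ j * v2 ^ k + t * dm j k + t ^ 2 * R" for j k
    unfolding dm_def by (rule monomial_first_order)
  then obtain R where R: "\<And>j k. (v0 + t * d0) ^ (n - j - k) * (v1 + t * d1) ^ j * (v2 + t * d2) ^ k =
     v0 ^ (n - j - k) * v1 ^ j * v2 ^ k + t * dm j k + t ^ 2 * R j k" by metis
  define G where "G = (\<Sum>(j,k)\<in>?T. fps_const (c n j k) * (dm j k + t * R j k) * fps_X ^ (q * j + p * k - W))"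
  have "ev fps_const F (v0 + t * d0) (fps_X ^ q * (v1 + t * d1)) (fps_X ^ p * (v2 + t * d2)) -
      ev fps_const F v0 (fps_X ^ q * v1) (fps_X ^ p * v2) =
     (\<Sum>(j,k)\<in>?T. fps_const (c n j k) * (t * dm j k + t ^ 2 * R j k) * fps_X ^ (q * j + p * k))"
    unfolding ev_homogeneous[OF ring_hom_fun_fps_const F] c_def sum_subtractf[symmetric]
  proof (intro sum.cong refl)
    fix x assume "x \<in> ?T"
    obtain j k where x: "x = (j, k)" by (cases x)
    define A where "A = fps_const (cf3 F (n - j - k) j k)"
    define B where "B = (fps_X ^ (q * j + p * k) :: complex fps)"
    have B: "B = (fps_X ^ q) ^ j * (fps_X ^ p) ^ k" by (simp add: B_def power_add power_mult)
    have "A * (v0 + t * d0) ^ (n - j - k) * (fps_X ^ q * (v1 + t * d1)) ^ j * (fps_X ^ p * (v2 + t * d2)) ^ k =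
       A * B * ((v0 + t * d0) ^ (n - j - k) * (v1 + t * d1) ^ j * (v2 + t * d2) ^ k)"
      unfolding B power_mult_distrib by (simp only: mult_ac)
    also have "\<dots> = A * B * (v0 ^ (n - j - k) * v1 ^ j * v2 ^ k + t * dm j k + t ^ 2 * R j k)" unfolding R ..
    finally have 1: "A * (v0 + t * d0) ^ (n - j - k) * (fps_X ^ q * (v1 + t * d1)) ^ j * (fps_X ^ p * (v2 + t * d2)) ^ k =
       A * B * (v0 ^ (n - j - k) * v1 ^ j * v2 ^ k + t * dm j k + t ^ 2 * R j k)" .
    have 2: "A * v0 ^ (n - j - k) * (fps_X ^ q * v1) ^ j * (fps_X ^ p * v2) ^ k = A * B * (v0 ^ (n - j - k) * v1 ^ j * v2 ^ k)"
      unfolding B power_mult_distrib by (simp only: mult_ac)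
    show "(case x of (j, k) \<Rightarrow> fps_const (cf3 F (n - j - k) j k) * (v0 + t * d0) ^ (n - j - k) * (fps_X ^ q * (v1 + t * d1)) ^ j * (fps_X ^ p * (v2 + t * d2)) ^ k) -
      (case x of (j, k) \<Rightarrow> fps_const (cf3 F (n - j - k) j k) * v0 ^ (n - j - k) * (fps_X ^ q * v1) ^ j * (fps_X ^ p * v2) ^ k) =
      (case x of (j, k) \<Rightarrow> fps_const (cf3 F (n - j - k) j k) * (t * dm j k + t ^ 2 * R j k) * fps_X ^ (q * j + p * k))"
      unfolding x prod.case A_def[symmetric] B_def[symmetric] 1 2 by (simp add: algebra_simps)
  qed
  also have "\<dots> = fps_X ^ (W + M) * G"
    unfolding G_def sum_distrib_left
  proof (intro sum.cong refl)
    fix x assume "x \<in> ?T"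
    then obtain j k where x: "x = (j, k)" "j + k \<le> n" by auto
    show "(case x of (j, k) \<Rightarrow> fps_const (c n j k) * (t * dm j k + t ^ 2 * R j k) * fps_X ^ (q * j + p * k)) =
       fps_X ^ (W + M) * (case x of (j, k) \<Rightarrow> fps_const (c n j k) * (dm j k + t * R j k) * fps_X ^ (q * j + p * k - W))"
    proof (cases "c n j k = 0")
      case True
      then show ?thesis unfolding x by simp
    next
      case False
      then have "q * j + p * k = W + (q * j + p * k - W)" using W[OF x(2)] by simp
      then have X: "fps_X ^ (q * j + p * k) = fps_X ^ W * (fps_X ^ (q * j + p * k - W) :: complex fps)"
        by (metis power_add)
      show ?thesis unfolding x prod.case X unfolding power_add t_def[symmetric] power2_eq_square
        by (simp only: distrib_left distrib_right mult_ac)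
    qed
  qed
  finally have 1: "ev fps_const F (v0 + t * d0) (fps_X ^ q * (v1 + t * d1)) (fps_X ^ p * (v2 + t * d2)) -
      ev fps_const F v0 (fps_X ^ q * v1) (fps_X ^ p * v2) = fps_X ^ (W + M) * G" .
  have t0: "fps_nth t 0 = 0" using M by (simp add: t_def)
  define dc where "dc j k = of_nat (n - j - k) * fps_nth v0 0 ^ (n - j - k - 1) * fps_nth d0 0 * fps_nth v1 0 ^ j * fps_nth v2 0 ^ k +
         fps_nth v0 0 ^ (n - j - k) * (of_nat j * fps_nth v1 0 ^ (j - 1) * fps_nth d1 0) * fps_nth v2 0 ^ k +
         fps_nth v0 0 ^ (n - j - k) * fps_nth v1 0 ^ j * (of_nat k * fps_nth v2 0 ^ (k - 1) * fps_nth d2 0)" for j k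
  have on: "fps_nth (of_nat i :: complex fps) 0 = of_nat i" for i by (simp add: fps_of_nat[symmetric])
  have dm0: "fps_nth (dm j k) 0 = dc j k" for j k by (simp add: dm_def dc_def fps_power_zeroth on)
  have "fps_nth G 0 = (\<Sum>(j,k)\<in>?T. if q * j + p * k = W then c n j k * dc j k else 0)"
    unfolding G_def fps_sum_nth
  proof (intro sum.cong refl)
    fix x assume "x \<in> ?T"
    then obtain j k where x: "x = (j, k)" "j + k \<le> n" by auto
    have "c n j k = 0 \<or> q * j + p * k = W \<or> q * j + p * k - W > 0" using W[OF x(2)] by force
    then show "fps_nth (case x of (j, k) \<Rightarrow> fps_const (c n j k) * (dm j k + t * R j k) * fps_X ^ (q * j + p * k - W)) 0 =
       (case x of (j, k) \<Rightarrow> if q * j + p * k = W then c n j k * dc j k else 0)"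
      unfolding x by (auto simp: dm0 t0 fps_mult_nth_0 fps_power_zeroth)
  qed
  also have "\<dots> = qderiv (\<lambda>x. x) (c n) n q p W (fps_nth v0 0) (fps_nth v1 0) (fps_nth v2 0)
      (fps_nth d0 0) (fps_nth d1 0) (fps_nth d2 0)"
    unfolding qderiv_def dc_def[symmetric] by (rule sum.mono_neutral_cong_right) (auto intro: finite_triangle split: if_splits)
  finally show ?thesis using 1 unfolding t_def by blast
qed

section \<open>Branches in an adapted frame\<close>

lemma qterm_poly:
  "poly (qterm (\<lambda>c. [:c:]) c n q p W l0 l1 l2) s = qterm (\<lambda>c. c) c n q p W (poly l0 s) (poly l1 s) (poly l2 s)"
  unfolding qterm_def poly_sum by (intro sum.cong refl) (auto simp: poly_power)

lemma qderiv_poly: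
  "poly (qderiv (\<lambda>c. [:c:]) c n q p W l0 l1 l2 d0 d1 d2) s =
   qderiv (\<lambda>c. c) c n q p W (poly l0 s) (poly l1 s) (poly l2 s) (poly d0 s) (poly d1 s) (poly d2 s)"
  unfolding qderiv_def poly_sum by (intro sum.cong refl) (auto simp: poly_power)

lemma poly_pderiv_0: "poly (pderiv f) 0 = coeff f 1"
  by (simp add: poly_0_coeff_0 coeff_pderiv)

lemma euler_deriv_X_power_mult:
  "fps_X * fps_deriv (fps_X ^ w * g) = fps_X ^ w * (of_nat w * g + fps_X * fps_deriv (g :: complex fps))"
proof -
  have "fps_X * fps_deriv (fps_X ^ w) = of_nat w * (fps_X ^ w :: complex fps)"
  proof (induction w)
    case (Suc w)
    have "fps_X * fps_deriv (fps_X ^ Suc w) = fps_X * (fps_X * fps_deriv (fps_X ^ w)) + fps_X * (fps_X ^ w :: complex fps)"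
      unfolding power_Suc fps_deriv_mult by (simp add: distrib_left)
    then show ?case unfolding Suc by (simp add: algebra_simps)
  qed simp
  then have "fps_X * fps_deriv (fps_X ^ w * g) = of_nat w * fps_X ^ w * g + fps_X * (fps_X ^ w * fps_deriv g)"
    unfolding fps_deriv_mult distrib_left mult.assoc[symmetric] by (simp add: mult.commute)
  then show ?thesis by (simp add: algebra_simps)
qed

locale even_branch =
  fixes F Q :: poly3 and n q p w :: nat and yh gh \<nu> :: "complex fps"
  assumes F: "homogeneous n F" "F \<noteq> 0" and n: "even n"
    and Q: "homogeneous 2 Q"
    and Qnd: "cf3 Q 2 0 0 \<noteq> 0 \<or> cf3 Q 1 1 0 \<noteq> 0 \<or> cf3 Q 1 0 1 \<noteq> 0 \<or> cf3 Q 0 2 0 \<noteq> 0 \<or> cf3 Q 0 1 1 \<noteq> 0"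
    and qp: "0 < q" "q < p"
    and yh: "fps_nth yh 0 = 1"
    and gh: "ev fps_const Q 1 (fps_X ^ q) (fps_X ^ p * yh) = fps_X ^ w * gh" "fps_nth gh 0 \<noteq> 0"
    and \<nu>: "2 * (fps_X ^ w * gh) * \<nu> = fps_X * fps_deriv (fps_X ^ w * gh)"
    and zero: "ev fps_const F 1 (fps_X ^ q) (fps_X ^ p * yh) = 0"
    and even: "\<And>s. ev fps_const F (1 - fps_const s * \<nu>) (fps_X ^ q * (1 + fps_const s * (of_nat q - \<nu>)))
        (fps_X ^ p * (yh + fps_const s * (of_nat p * yh + fps_X * fps_deriv yh - \<nu> * yh))) =
      ev fps_const F (1 - fps_const (-s) * \<nu>) (fps_X ^ q * (1 + fps_const (-s) * (of_nat q - \<nu>)))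
        (fps_X ^ p * (yh + fps_const (-s) * (of_nat p * yh + fps_X * fps_deriv yh - \<nu> * yh)))"
begin

lemma on: "fps_nth (of_nat i :: complex fps) 0 = of_nat i"
  by (simp add: fps_of_nat[symmetric])

lemma nu_0: "fps_nth \<nu> 0 = of_nat w / 2"
proof -
  have "fps_X ^ w * (2 * gh * \<nu>) = fps_X ^ w * (of_nat w * gh + fps_X * fps_deriv gh)"
    using \<nu> unfolding euler_deriv_X_power_mult by (simp only: mult_ac)
  then have "2 * gh * \<nu> = of_nat w * gh + fps_X * fps_deriv gh" by simp
  from arg_cong[OF this, of "\<lambda>f. fps_nth f 0"]
  have "2 * fps_nth gh 0 * fps_nth \<nu> 0 = of_nat w * fps_nth gh 0"
    by (simp add: on fps_mult_nth_0)
  then show ?thesis using gh(2) by (simp add: field_simps)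
qed

definition cc :: "nat \<Rightarrow> nat \<Rightarrow> complex" where "cc j k = cf3 F (n - j - k) j k"

definition S where "S = {(j,k). j + k \<le> n \<and> cc j k \<noteq> 0}"

lemma S_nonempty: "S \<noteq> {}"
proof
  assume S0: "S = {}"
  have "cf3 F i j k = 0" for i j k
  proof (rule ccontr)
    assume nz: "cf3 F i j k \<noteq> 0"
    then have "i + j + k = n" using F(1) by (auto simp: homogeneous_def)
    then have "(j, k) \<in> S" using nz by (auto simp: S_def cc_def)
    then show False using S0 by simp
  qed
  then have "F = 0" by (intro poly3_eqI) simp
  then show False using F(2) by simp
qed

definition W where "W = Min ((\<lambda>(j,k). q * j + p * k) ` S)"

lemma finite_S: "finite S"
  by (rule finite_subset[OF _ finite_triangle[of n]]) (auto simp: S_def)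

lemma W_le: "j + k \<le> n \<Longrightarrow> cc j k \<noteq> 0 \<Longrightarrow> W \<le> q * j + p * k"
  unfolding W_def by (rule Min_le) (use finite_S in \<open>force simp: S_def\<close>)+

lemma W_attained: obtains j k where "j + k \<le> n" "q * j + p * k = W" "cc j k \<noteq> 0"
proof -
  have "W \<in> (\<lambda>(j,k). q * j + p * k) ` S" unfolding W_def using finite_S S_nonempty by (intro Min_in) auto
  then show ?thesis using that by (auto simp: S_def)
qed

definition l0 where "l0 = [:1, - (of_nat w / 2 :: complex):]"
definition l1 where "l1 = [:1, of_nat q - (of_nat w / 2 :: complex):]"
definition l2 where "l2 = [:1, of_nat p - (of_nat w / 2 :: complex):]"
lemmas ll = l0_def l1_def l2_def

lemma leading_even: "even_poly (qterm (\<lambda>c. [:c:]) cc n q p W l0 l1 l2)"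
proof -
  have "poly (qterm (\<lambda>c. [:c:]) cc n q p W l0 l1 l2) s = poly (qterm (\<lambda>c. [:c:]) cc n q p W l0 l1 l2) (- s)" for s
  proof -
    define v0 where "v0 s = 1 - fps_const s * \<nu>" for s
    define v1 where "v1 s = 1 + fps_const s * (of_nat q - \<nu>)" for s
    define v2 where "v2 s = yh + fps_const s * (of_nat p * yh + fps_X * fps_deriv yh - \<nu> * yh)" for s
    have v: "fps_nth (v0 s) 0 = poly l0 s" "fps_nth (v1 s) 0 = poly l1 s" "fps_nth (v2 s) 0 = poly l2 s" for s
      by (simp_all add: v0_def v1_def v2_def ll nu_0 on yh fps_mult_nth_0)
    have "\<exists>G. ev fps_const F (v0 s) (fps_X ^ q * v1 s) (fps_X ^ p * v2 s) = fps_X ^ W * G \<and>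
       fps_nth G 0 = poly (qterm (\<lambda>c. [:c:]) cc n q p W l0 l1 l2) s" for s
      unfolding qterm_poly v[symmetric] using ev_weighted[OF F(1), of W q p "v0 s" "v1 s" "v2 s"] W_le unfolding cc_def[abs_def] by simp
    then obtain G where G: "\<And>s. ev fps_const F (v0 s) (fps_X ^ q * v1 s) (fps_X ^ p * v2 s) = fps_X ^ W * G s"
       "\<And>s. fps_nth (G s) 0 = poly (qterm (\<lambda>c. [:c:]) cc n q p W l0 l1 l2) s" by metis
    have "fps_X ^ W * G s = fps_X ^ W * G (- s)"
      unfolding G(1)[symmetric] v0_def v1_def v2_def by (rule even)
    then have "G s = G (- s)" by simp
    then show ?thesis by (simp flip: G(2))
  qed
  then show ?thesis by (simp add: even_poly_def)
qed

lemma leading_zero: "poly (qterm (\<lambda>c. [:c:]) cc n q p W l0 l1 l2) 0 = 0"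
proof -
  obtain G where G: "ev fps_const F 1 (fps_X ^ q * 1) (fps_X ^ p * yh) = fps_X ^ W * G"
       "fps_nth G 0 = qterm (\<lambda>x. x) cc n q p W (fps_nth 1 0) (fps_nth 1 0) (fps_nth yh 0)"
    using ev_weighted[OF F(1), of W q p 1 1 yh] W_le unfolding cc_def[abs_def] by auto
  have "fps_X ^ W * G = 0" using G(1) zero by simp
  then have "G = 0" by simp
  then show ?thesis using G(2) unfolding qterm_poly by (simp add: ll yh)
qed

abbreviation "c0 \<equiv> cf3 Q 2 0 0"
abbreviation "ca \<equiv> cf3 Q 1 1 0"
abbreviation "cb \<equiv> cf3 Q 1 0 1"
abbreviation "cx \<equiv> cf3 Q 0 2 0"
abbreviation "cd \<equiv> cf3 Q 0 1 1"
abbreviation "ce \<equiv> cf3 Q 0 0 2"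

lemma ev_quadric:
  assumes h: "ring_hom_fun h"
  shows "ev h Q 1 x y = h c0 + h ca * x + h cb * y + h cx * x ^ 2 + h cd * x * y + h ce * y ^ 2"
proof -
  have e: "{(j, k). j + k \<le> (2::nat)} = {(0,0), (1,0), (0,1), (2,0), (1,1), (0,2)}" (is "?L = ?R")
  proof
    show "?L \<subseteq> ?R"
    proof
      fix z assume "z \<in> ?L"
      then obtain j k where z: "z = (j, k)" and jk: "j + k \<le> 2" by auto
      then have "j = 0 \<or> j = 1 \<or> j = 2" by arith
      moreover have "k = 0 \<or> k = 1 \<or> k = 2" using jk by arith
      ultimately show "z \<in> ?R" using jk z by auto
    qed
  qed auto
  show ?thesis unfolding ev_homogeneous[OF h Q] e by (simp add: numeral_2_eq_2[symmetric] algebra_simps)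
qed

lemma gh_expand: "fps_X ^ w * gh = fps_const c0 + fps_const ca * fps_X ^ q + fps_const cb * (fps_X ^ p * yh) + fps_const cx * (fps_X ^ q * fps_X ^ q)
    + fps_const cd * (fps_X ^ q * (fps_X ^ p * yh)) + fps_const ce * ((fps_X ^ p * yh) * (fps_X ^ p * yh))"
  unfolding gh(1)[symmetric] ev_quadric[OF ring_hom_fun_fps_const] power2_eq_square
  by (simp only: mult_ac)

lemma w_eqI:
  assumes "fps_X ^ w * gh = fps_X ^ r * k" "fps_nth k 0 \<noteq> 0"
  shows "w = r"
proof -
  have "subdegree (fps_X ^ w * gh) = w" "subdegree (fps_X ^ r * k) = r"
    using gh(2) assms(2) by (subst subdegree_mult; force simp: subdegree_eq_0)+
  then show ?thesis using assms(1) by metis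
qed

lemmas w_eqI' = w_eqI[unfolded gh_expand]
lemmas gh_simps = power_add algebra_simps power2_eq_square fps_mult_nth_0 fps_power_zeroth zero_power

lemma w_cases: "w \<in> {0, q, p, 2 * q, p + q}" if p2: "p \<noteq> 2 * q"
proof -
  obtain m where m: "p = q + m" "0 < m" using qp less_imp_add_positive by metis
  consider "c0 \<noteq> 0" | "c0 = 0" "ca \<noteq> 0" | "c0 = 0" "ca = 0" "cb \<noteq> 0" "p < 2 * q" |
      "c0 = 0" "ca = 0" "cx \<noteq> 0" "2 * q < p" | "c0 = 0" "ca = 0" "cb \<noteq> 0" "cx = 0" |
      "c0 = 0" "ca = 0" "cb = 0" "cx \<noteq> 0" | "c0 = 0" "ca = 0" "cb = 0" "cx = 0" "cd \<noteq> 0"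
    using Qnd p2 by force
  then show ?thesis
  proof cases
    case 1
    have "w = 0"
      by (rule w_eqI[of _ "fps_X ^ w * gh"]) (use 1 qp in \<open>simp_all add: gh_expand fps_mult_nth_0 fps_power_zeroth zero_power\<close>)
    then show ?thesis by simp
  next
    case 2
    have "w = q"
      by (rule w_eqI'[of _ "fps_const ca + fps_const cb * fps_X ^ m * yh + fps_const cx * fps_X ^ q + fps_const cd * fps_X ^ p * yh
          + fps_const ce * fps_X ^ (p + m) * yh ^ 2"])
        (use 2 m qp in \<open>simp_all add: gh_simps\<close>)
    then show ?thesis by simp
  next
    case 3
    then obtain m' where m': "2 * q = p + m'" "0 < m'" using less_imp_add_positive by metis
    then have "q + q = p + m'" by simp
    then have X: "fps_X ^ q * fps_X ^ q = fps_X ^ p * (fps_X ^ m' :: complex fps)" by (metis power_add)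
    have "w = p"
      by (rule w_eqI'[of _ "fps_const cb * yh + fps_const cx * fps_X ^ m' + fps_const cd * fps_X ^ q * yh
          + fps_const ce * fps_X ^ p * yh ^ 2"])
        (use 3 m' qp yh X in \<open>simp_all add: gh_simps\<close>)
    then show ?thesis by simp
  next
    case 4
    then obtain m' where m': "p = q + q + m'" "0 < m'" using less_imp_add_positive[of "2 * q" p] by auto
    have "w = q + q"
      by (rule w_eqI'[of _ "fps_const cb * fps_X ^ m' * yh + fps_const cx + fps_const cd * fps_X ^ (m' + q) * yh
          + fps_const ce * fps_X ^ (p + m') * yh ^ 2"])
        (use 4 m' qp in \<open>simp_all add: gh_simps\<close>)
    then show ?thesis by simp
  next
    case 5
    have "w = p"
      by (rule w_eqI'[of _ "fps_const cb * yh + fps_const cd * fps_X ^ q * yh + fps_const ce * fps_X ^ p * yh ^ 2"])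
        (use 5 qp yh in \<open>simp_all add: gh_simps\<close>)
    then show ?thesis by simp
  next
    case 6
    have "w = q + q"
      by (rule w_eqI'[of _ "fps_const cx + fps_const cd * fps_X ^ m * yh + fps_const ce * fps_X ^ (m + m) * yh ^ 2"])
        (use 6 m qp in \<open>simp_all add: gh_simps\<close>)
    then show ?thesis by simp
  next
    case 7
    have "w = p + q"
      by (rule w_eqI'[of _ "fps_const cd * yh + fps_const ce * fps_X ^ m * yh ^ 2"])
        (use 7 m qp yh in \<open>simp_all add: gh_simps\<close>)
    then show ?thesis by simp
  qed
qed

lemma p_eq: "p = 2 * q"
proof (rule ccontr)
  assume "p \<noteq> 2 * q"
  moreover obtain j k where jk: "j + k \<le> n" "q * j + p * k = W" "cc j k \<noteq> 0" by (rule W_attained)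
  ultimately show False
    using quasihomogeneous_quadratic[where c = cc, OF qp n jk refl l0_def l1_def l2_def leading_even leading_zero w_cases] by simp
qed

lemma w_double_cases:
  obtains "w = 0" | "w = q" | "w = 2 * q" | "c0 = 0" "ca = 0" "cb = 0" "cx = 0" "w = 3 * q" |
    "c0 = 0" "ca = 0" "cb \<noteq> 0" "cx = - cb" "2 * q < w"
proof -
  have p_eqq: "p = q + q" using p_eq by simp
  consider "c0 \<noteq> 0" | "c0 = 0" "ca \<noteq> 0" | "c0 = 0" "ca = 0" "cb + cx \<noteq> 0" |
      "c0 = 0" "ca = 0" "cb = 0" "cx = 0" "cd \<noteq> 0" | "c0 = 0" "ca = 0" "cb \<noteq> 0" "cb + cx = 0"
    using Qnd by force
  then show thesis
  proof cases
    case 1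
    have "w = 0"
      by (rule w_eqI[of _ "fps_X ^ w * gh"]) (use 1 qp in \<open>simp_all add: gh_expand fps_mult_nth_0 fps_power_zeroth zero_power\<close>)
    then show ?thesis by (intro that) auto
  next
    case 2
    have "w = q"
      by (rule w_eqI'[of _ "fps_const ca + fps_const cb * fps_X ^ q * yh + fps_const cx * fps_X ^ q + fps_const cd * fps_X ^ p * yh
          + fps_const ce * fps_X ^ (p + q) * yh ^ 2"])
        (use 2 p_eqq qp in \<open>simp_all add: gh_simps\<close>)
    then show ?thesis by (intro that) auto
  next
    case 3
    have "w = q + q"
      by (rule w_eqI'[of _ "fps_const cb * yh + fps_const cx + fps_const cd * fps_X ^ q * yh + fps_const ce * fps_X ^ p * yh ^ 2"])
        (use 3 p_eqq qp yh in \<open>simp_all add: gh_simps\<close>)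
    then show ?thesis by (intro that) auto
  next
    case 4
    have "w = q + q + q"
      by (rule w_eqI'[of _ "fps_const cd * yh + fps_const ce * fps_X ^ q * yh ^ 2"])
        (use 4 p_eqq qp yh in \<open>simp_all add: gh_simps numeral_3_eq_3\<close>)
    then show ?thesis using 4 by (intro that(4)) auto
  next
    case 5
    define k where "k = fps_const cb * yh + fps_const cx + fps_const cd * fps_X ^ q * yh + fps_const ce * fps_X ^ p * yh ^ 2"
    have k: "fps_X ^ w * gh = fps_X ^ (q + q) * k"
      using 5 p_eqq unfolding k_def gh_expand by (simp add: gh_simps)
    have k0: "fps_nth k 0 = 0"
      using 5 p_eqq qp yh unfolding k_def by (simp add: fps_mult_nth_0 fps_power_zeroth zero_power)
    have gh0: "gh \<noteq> 0" using gh(2) by auto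
    then have "fps_X ^ w * gh \<noteq> 0" by simp
    then have knz: "k \<noteq> 0" using k by auto
    have "subdegree (fps_X ^ w * gh) = w" using gh(2) gh0 by (subst subdegree_mult) auto
    moreover have "subdegree (fps_X ^ (q + q) * k) = q + q + subdegree k" using knz by (subst subdegree_mult) auto
    moreover have "0 < subdegree k" using k0 knz by (metis gr0I nth_subdegree_nonzero)
    ultimately have "2 * q < w" using k by simp
    then show ?thesis using 5 by (intro that(5)) (auto simp: add_eq_0_iff)
  qed
qed

lemma osculation_order:
  assumes w: "2 * q \<le> w"
  shows "(\<forall>j k. j + k \<le> n \<longrightarrow> cf3 F (n - j - k) j k \<noteq> 0 \<longrightarrow> n \<le> j + 2 * k) \<and>
    (\<Sum>(j,k)\<in>{(j,k). j + k \<le> n \<and> j + 2 * k = n}. cf3 F (n - j - k) j k) = 0"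
proof -
  obtain j k where jk: "j + k \<le> n" "q * j + p * k = W" "cc j k \<noteq> 0" by (rule W_attained)
  have q: "0 < q" using qp by simp
  have W: "n * q \<le> W"
    by (rule quasihomogeneous_weight_bound[where c = cc, OF q w jk(1) _ jk(3) refl l0_def l1_def])
      (use jk leading_even leading_zero l2_def p_eq in simp_all)
  have e: "q * j + p * k = q * (j + 2 * k)" for j k using p_eq by (simp add: algebra_simps)
  have 1: "n \<le> j + 2 * k" if "j + k \<le> n" "cc j k \<noteq> 0" for j k
  proof -
    have "q * n \<le> q * (j + 2 * k)" using W W_le[OF that] unfolding e mult.commute[of n q] by (rule order_trans)
    then show ?thesis using q by (simp only: mult_le_cancel1)
  qed
  have "(\<Sum>(j,k)\<in>{(j,k). j + k \<le> n \<and> j + 2 * k = n}. cc j k) = 0"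
  proof (cases "W = n * q")
    case True
    have "q * (j + 2 * k) = n * q \<longleftrightarrow> j + 2 * k = n" for j k using q by (auto simp: mult.commute)
    then have "(\<Sum>(j,k)\<in>{(j,k). j + k \<le> n \<and> j + 2 * k = n}. cc j k) = poly (qterm (\<lambda>c. [:c:]) cc n q p W l0 l1 l2) 0"
      unfolding qterm_poly unfolding qterm_def True e by (simp add: ll)
    then show ?thesis using leading_zero by simp
  next
    case False
    then have "q * n < W" using W by (simp add: mult.commute)
    have "cc j k = 0" if "j + k \<le> n" "j + 2 * k = n" for j k
      using W_le[OF that(1)] \<open>q * n < W\<close> that(2) unfolding e by force
    then show ?thesis by (intro sum.neutral) auto
  qed
  then show ?thesis using 1 by (simp add: cc_def)
qed

text \<open>
  If \<open>y\<close> is not a series in \<open>t\<^sup>q\<close>, the branch differs from its conjugate under \<open>t \<mapsto> \<omega> t\<close>, where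
  \<open>\<omega>\<^sup>q = 1\<close>; the lowest term of the difference of the two evenness relations is itself even.
\<close>

lemma regular_branch:
  assumes wq: "w \<le> 2 * q \<or> (c0 = 0 \<and> ca = 0 \<and> cb = 0 \<and> cx = 0 \<and> w = 3 * q)" and qw: "q dvd w"
    and nz: "fps_nth yh i \<noteq> 0"
  shows "q dvd i"
proof (rule ccontr)
  assume "\<not> q dvd i"
  then have ex: "\<exists>i. fps_nth yh i \<noteq> 0 \<and> \<not> q dvd i" using nz by blast
  define m where "m = (LEAST i. fps_nth yh i \<noteq> 0 \<and> \<not> q dvd i)"
  have m: "fps_nth yh m \<noteq> 0" "\<not> q dvd m" using LeastI_ex[OF ex] unfolding m_def by auto
  have less: "q dvd i" if "i < m" "fps_nth yh i \<noteq> 0" for i using not_less_Least[of i] that unfolding m_def by blast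
  have m0: "0 < m" using m(2) by (cases m) auto
  have q1: "1 \<le> q" using qp by simp
  define \<omega> :: complex where "\<omega> = exp (2 * of_real pi * \<i> * of_nat 1 / of_nat q)"
  have \<omega>q: "\<omega> ^ q = 1" unfolding \<omega>_def using q1 by (intro complex_root_unity) simp
  have \<omega>i: "\<omega> ^ i = 1 \<longleftrightarrow> q dvd i" for i
  proof -
    have "\<omega> ^ i = exp (2 * of_real pi * \<i> * of_nat i / of_nat q)"
      unfolding \<omega>_def exp_of_nat_mult[symmetric] by (simp add: field_simps)
    then show ?thesis using complex_root_unity_eq_1[OF q1, of i] by simp
  qed
  define rot where "rot f = fps_compose f (fps_const \<omega> * fps_X)" for f
  have rh: "ring_hom_fun rot" unfolding rot_def[abs_def] by (rule ring_hom_fun_compose_fps) simp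
  note rs = ring_hom_fun_simps(1-6)[OF rh]
  have rn: "fps_nth (rot f) i = \<omega> ^ i * fps_nth f i" for f i by (simp add: rot_def)
  have rc: "rot (fps_const a) = fps_const a" for a by (simp add: rot_def)
  have rX: "rot (fps_X ^ q) = fps_X ^ q"
    by (rule fps_ext) (auto simp: rn fps_X_power_nth \<omega>q)
  have rXp: "rot (fps_X ^ p) = fps_X ^ p" unfolding p_eq mult_2 power_add rs rX ..
  have rXw: "rot (fps_X ^ w) = fps_X ^ w"
  proof -
    obtain k where "w = q * k" using qw by blast
    then show ?thesis by (simp add: power_mult ring_hom_fun_simps(7)[OF rh, of "fps_X ^ q"] rX del: power_mult_distrib)
  qed
  have ron: "rot (of_nat i) = of_nat i" for i by (rule ring_hom_fun_of_nat[OF rh])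
  have rd: "rot (fps_X * fps_deriv f) = fps_X * fps_deriv (rot f)" for f
  proof (rule fps_ext)
    fix i show "fps_nth (rot (fps_X * fps_deriv f)) i = fps_nth (fps_X * fps_deriv (rot f)) i"
      by (cases i) (simp_all add: rn)
  qed
  define yr where "yr = rot yh"
  define gr where "gr = rot gh"
  define \<nu>r where "\<nu>r = rot \<nu>"
  define D where "D = Abs_fps (\<lambda>i. fps_nth (yr - yh) (i + m))"
  have D: "yr = yh + fps_X ^ m * D"
  proof (rule fps_ext)
    fix i show "fps_nth yr i = fps_nth (yh + fps_X ^ m * D) i"
      using less[of i] \<omega>i[of i] by (cases "i < m") (auto simp: D_def fps_X_power_mult_nth yr_def rn)
  qed
  define e where "e = fps_nth D 0"
  have e: "e \<noteq> 0" unfolding e_def D_def yr_def using m \<omega>i[of m] by (simp add: rn)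
  have g1: "fps_X ^ w * gr = fps_const c0 + fps_const ca * fps_X ^ q + fps_const cb * (fps_X ^ p * yr) + fps_const cx * (fps_X ^ q * fps_X ^ q)
    + fps_const cd * (fps_X ^ q * (fps_X ^ p * yr)) + fps_const ce * ((fps_X ^ p * yr) * (fps_X ^ p * yr))"
    using arg_cong[OF gh_expand, of rot] unfolding rs rc rX rXp rXw gr_def[symmetric] yr_def[symmetric] .
  have gdiff: "fps_X ^ w * gr - fps_X ^ w * gh = fps_X ^ m * (fps_X ^ p * D * (fps_const cb + fps_const cd * fps_X ^ q + fps_const ce * fps_X ^ p * (yr + yh)))"
    unfolding g1 gh_expand unfolding D by (simp add: algebra_simps)
  have "\<exists>H. fps_X ^ w * gr - fps_X ^ w * gh = fps_X ^ (w + m) * H"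
    using wq
  proof
    assume "w \<le> 2 * q"
    then obtain k where k: "p = w + k" using p_eq le_Suc_ex by blast
    show ?thesis unfolding gdiff k power_add
      by (rule exI[of _ "fps_X ^ k * D * (fps_const cb + fps_const cd * fps_X ^ q + fps_const ce * (fps_X ^ w * fps_X ^ k) * (yr + yh))"])
        (simp only: mult_ac)
  next
    assume "c0 = 0 \<and> ca = 0 \<and> cb = 0 \<and> cx = 0 \<and> w = 3 * q"
    then have b: "cb = 0" "w = p + q" using p_eq by auto
    show ?thesis unfolding gdiff unfolding b power_add p_eq mult_2
      by (rule exI[of _ "D * (fps_const cd + fps_const ce * fps_X ^ q * (yr + yh))"]) (simp add: algebra_simps)
  qed
  then obtain H where H: "fps_X ^ w * gr - fps_X ^ w * gh = fps_X ^ (w + m) * H" by blast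
  have H': "fps_X ^ w * gr = fps_X ^ w * gh + fps_X ^ (w + m) * H" using H by (simp add: algebra_simps)
  have \<nu>r: "2 * (fps_X ^ w * gr) * \<nu>r = fps_X * fps_deriv (fps_X ^ w * gr)"
  proof -
    have r2: "rot 2 = 2" using ron[of 2] by simp
    show ?thesis using arg_cong[OF \<nu>, of rot] unfolding rd unfolding rs rXw r2 gr_def[symmetric] \<nu>r_def[symmetric] .
  qed
  have "fps_X ^ w * (2 * gr * (\<nu>r - \<nu>)) = fps_X ^ w * (fps_X ^ m * (of_nat (w + m) * H + fps_X * fps_deriv H - 2 * H * \<nu>))"
  proof -
    have "fps_X ^ w * (2 * gr * (\<nu>r - \<nu>)) = 2 * (fps_X ^ w * gr) * \<nu>r - 2 * (fps_X ^ w * gr) * \<nu>" by (simp add: algebra_simps)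
    also have "\<dots> = fps_X * fps_deriv (fps_X ^ w * gh + fps_X ^ (w + m) * H) - 2 * (fps_X ^ w * gh + fps_X ^ (w + m) * H) * \<nu>"
      unfolding \<nu>r unfolding H' ..
    also have "\<dots> = fps_X * fps_deriv (fps_X ^ (w + m) * H) - 2 * (fps_X ^ (w + m) * H) * \<nu>"
      using \<nu> by (simp add: algebra_simps)
    also have "\<dots> = fps_X ^ w * (fps_X ^ m * (of_nat (w + m) * H + fps_X * fps_deriv H - 2 * H * \<nu>))"
      unfolding euler_deriv_X_power_mult unfolding power_add by (simp add: algebra_simps)
    finally show ?thesis .
  qed
  then have gN: "2 * gr * (\<nu>r - \<nu>) = fps_X ^ m * (of_nat (w + m) * H + fps_X * fps_deriv H - 2 * H * \<nu>)" (is "_ = _ * ?R") by simp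
  have gr0: "fps_nth (2 * gr) 0 \<noteq> 0" using gh(2) by (simp add: fps_mult_nth_0 gr_def rn)
  define N where "N = inverse (2 * gr) * ?R"
  have N: "\<nu>r = \<nu> + fps_X ^ m * N"
  proof -
    have "inverse (2 * gr) * (2 * gr) = 1" using gr0 by (rule inverse_mult_eq_1)
    then have "\<nu>r - \<nu> = inverse (2 * gr) * (2 * gr * (\<nu>r - \<nu>))" unfolding mult.assoc[symmetric] by simp
    then show ?thesis unfolding gN N_def by (simp add: algebra_simps)
  qed
  define \<delta> where "\<delta> = fps_nth N 0"
  define v0 where "v0 s = 1 - fps_const s * \<nu>" for s
  define v1 where "v1 s = 1 + fps_const s * (of_nat q - \<nu>)" for s
  define v2 where "v2 s = yh + fps_const s * (of_nat p * yh + fps_X * fps_deriv yh - \<nu> * yh)" for s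
  define r0 where "r0 s = 1 - fps_const s * \<nu>r" for s
  define r1 where "r1 s = 1 + fps_const s * (of_nat q - \<nu>r)" for s
  define r2 where "r2 s = yr + fps_const s * (of_nat p * yr + fps_X * fps_deriv yr - \<nu>r * yr)" for s
  have v: "fps_nth (v0 s) 0 = poly l0 s" "fps_nth (v1 s) 0 = poly l1 s" "fps_nth (v2 s) 0 = poly l2 s" for s
    by (simp_all add: v0_def v1_def v2_def ll nu_0 on yh fps_mult_nth_0)
  define d0 where "d0 s = - fps_const s * N" for s
  define d2 where "d2 s = D + fps_const s * (of_nat p * D + of_nat m * D + fps_X * fps_deriv D - \<nu> * D - N * yr)" for s
  have r: "r0 s = v0 s + fps_X ^ m * d0 s" "r1 s = v1 s + fps_X ^ m * d0 s" "r2 s = v2 s + fps_X ^ m * d2 s" for s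
  proof -
    show "r0 s = v0 s + fps_X ^ m * d0 s" "r1 s = v1 s + fps_X ^ m * d0 s"
      unfolding r0_def r1_def v0_def v1_def d0_def N by (simp_all add: algebra_simps del: fps_const_neg)
    have "fps_X * fps_deriv yr = fps_X * fps_deriv yh + fps_X ^ m * (of_nat m * D + fps_X * fps_deriv D)"
      unfolding euler_deriv_X_power_mult[symmetric] D by (simp add: distrib_left)
    then show "r2 s = v2 s + fps_X ^ m * d2 s"
      unfolding r2_def v2_def d2_def N by (simp only: ) (simp add: D algebra_simps)
  qed
  have evr: "ev fps_const F (r0 s) (fps_X ^ q * r1 s) (fps_X ^ p * r2 s) = ev fps_const F (r0 (-s)) (fps_X ^ q * r1 (-s)) (fps_X ^ p * r2 (-s))" for s
  proof -
    have rv: "rot (v0 s) = r0 s" "rot (v1 s) = r1 s" "rot (v2 s) = r2 s" for s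
      unfolding v0_def v1_def v2_def r0_def r1_def r2_def rs(3,5,6) rd
      unfolding rs rc ron rd[unfolded rs] yr_def[symmetric] \<nu>r_def[symmetric] by (rule refl)+
    have "rot (ev fps_const F (v0 s) (fps_X ^ q * v1 s) (fps_X ^ p * v2 s)) = ev fps_const F (r0 s) (fps_X ^ q * r1 s) (fps_X ^ p * r2 s)" for s
      unfolding ev_hom[OF rh ring_hom_fun_fps_const] rs(4) rX rXp rv rc ..
    moreover have "ev fps_const F (v0 s) (fps_X ^ q * v1 s) (fps_X ^ p * v2 s) = ev fps_const F (v0 (-s)) (fps_X ^ q * v1 (-s)) (fps_X ^ p * v2 (-s))"
      unfolding v0_def v1_def v2_def by (rule even)
    ultimately show ?thesis by metis
  qed
  define P where "P = qderiv (\<lambda>c. [:c:]) cc n q p W l0 l1 l2 [:0, - \<delta>:] [:0, - \<delta>:] [:e, e * (of_nat (p + m) - of_nat w / 2) - \<delta>:]"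
  have P: "\<exists>G. ev fps_const F (r0 s) (fps_X ^ q * r1 s) (fps_X ^ p * r2 s) - ev fps_const F (v0 s) (fps_X ^ q * v1 s) (fps_X ^ p * v2 s)
      = fps_X ^ (W + m) * G \<and> fps_nth G 0 = poly P s" for s
  proof -
    have dn: "fps_nth (d0 s) 0 = poly [:0, - \<delta>:] s" "fps_nth (d2 s) 0 = poly [:e, e * (of_nat (p + m) - of_nat w / 2) - \<delta>:] s"
      by (simp_all add: d0_def d2_def \<delta>_def e_def fps_mult_nth_0 nu_0 on yr_def rn yh algebra_simps)
    show ?thesis unfolding P_def qderiv_poly v[symmetric] dn[symmetric] r
      using ev_weighted_diff[OF F(1) m0, of W q p] W_le unfolding cc_def[abs_def] by simp
  qed
  have evP: "even_poly P"
    unfolding even_poly_def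
  proof
    fix s
    obtain G where G: "ev fps_const F (r0 s) (fps_X ^ q * r1 s) (fps_X ^ p * r2 s) - ev fps_const F (v0 s) (fps_X ^ q * v1 s) (fps_X ^ p * v2 s)
      = fps_X ^ (W + m) * G" "fps_nth G 0 = poly P s" using P by blast
    obtain G' where G': "ev fps_const F (r0 (-s)) (fps_X ^ q * r1 (-s)) (fps_X ^ p * r2 (-s)) - ev fps_const F (v0 (-s)) (fps_X ^ q * v1 (-s)) (fps_X ^ p * v2 (-s))
      = fps_X ^ (W + m) * G'" "fps_nth G' 0 = poly P (-s)" using P by blast
    have "ev fps_const F (v0 s) (fps_X ^ q * v1 s) (fps_X ^ p * v2 s) = ev fps_const F (v0 (-s)) (fps_X ^ q * v1 (-s)) (fps_X ^ p * v2 (-s))"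
      unfolding v0_def v1_def v2_def by (rule even)
    then have "fps_X ^ (W + m) * G = fps_X ^ (W + m) * G'" unfolding G(1)[symmetric] G'(1)[symmetric] evr[of s] by simp
    then have "G = G'" by simp
    then show "poly P (- s) = poly P s" using G(2) G'(2) by simp
  qed
  obtain j k where jk: "j + k \<le> n" "q * j + p * k = W" "cc j k \<noteq> 0" by (rule W_attained)
  have q: "0 < q" using qp by simp
  have pd: "poly (pderiv (qterm (\<lambda>c. [:[:c:]:]) cc n q p W [:l0, [:0, - \<delta>:]:] [:l1, [:0, - \<delta>:]:] [:l2, [:e, e * (of_nat (p + m) - of_nat w / 2) - \<delta>:]:])) 0 = P"
    unfolding poly_pderiv_0 coeff_qterm_1 P_def ..
  have "p + m = w"
    by (rule quasihomogeneous_perturbation[where c = cc and q = q and \<delta> = \<delta>, unfolded p_eq[symmetric],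
        OF q jk refl l0_def l1_def l2_def leading_even leading_zero e refl refl])
      (unfold pd, rule evP)
  then have "q dvd 2 * q + m" using qw unfolding p_eq by metis
  then have "q dvd m" unfolding dvd_add_right_iff[OF dvd_triv_right] .
  then show False using m(2) by contradiction
qed

theorem even_branch_cases:
  obtains "p = 2 * q" "\<And>i. fps_nth yh i \<noteq> 0 \<Longrightarrow> q dvd i"
  | "p = 2 * q" "c0 = 0" "ca = 0" "cb \<noteq> 0" "cx = - cb"
     "\<And>j k. j + k \<le> n \<Longrightarrow> cf3 F (n - j - k) j k \<noteq> 0 \<Longrightarrow> n \<le> j + 2 * k"
     "(\<Sum>(j,k)\<in>{(j,k). j + k \<le> n \<and> j + 2 * k = n}. cf3 F (n - j - k) j k) = 0"
proof (rule w_double_cases)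
  assume "w = 0"
  then show thesis by (intro that(1)[OF p_eq]) (erule regular_branch[rotated 2]; simp)
next
  assume "w = q"
  then show thesis by (intro that(1)[OF p_eq]) (erule regular_branch[rotated 2]; simp)
next
  assume "w = 2 * q"
  then show thesis by (intro that(1)[OF p_eq]) (erule regular_branch[rotated 2]; simp)
next
  assume "c0 = 0" "ca = 0" "cb = 0" "cx = 0" "w = 3 * q"
  then show thesis by (intro that(1)[OF p_eq]) (erule regular_branch[rotated 2]; simp)
next
  assume a: "c0 = 0" "ca = 0" "cb \<noteq> 0" "cx = - cb" "2 * q < w"
  then have "2 * q \<le> w" by simp
  from osculation_order[OF this] show thesis by (intro that(2)[OF p_eq a(1-4)]) auto
qed

end

section \<open>A differential invariant of plane curves\<close>

locale field_derivation =
  fixes D :: "'a::field_char_0 \<Rightarrow> 'a"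
  assumes add: "D (x + y) = D x + D y" and mult: "D (x * y) = D x * y + x * D y"
begin

lemma zero [simp]: "D 0 = 0" using add[of 0 0] by simp
lemma one [simp]: "D 1 = 0" using mult[of 1 1] by simp
lemma minus: "D (- x) = - D x" using add[of x "- x"] by (simp add: eq_neg_iff_add_eq_0 add.commute)
lemma diff: "D (x - y) = D x - D y" using add[of x "- y"] by (simp add: minus)
lemma of_nat [simp]: "D (of_nat n) = 0" by (induction n) (auto simp: add)
lemma numeral [simp]: "D (numeral n) = 0" using of_nat[of "numeral n"] by simp

lemma neg_numeral [simp]: "D (- numeral n) = 0" by (simp add: minus)

lemma power: "D (x ^ n) = of_nat n * x ^ (n - 1) * D x"
proof (induction n)
  case (Suc n)
  then show ?case by (cases n) (auto simp: mult algebra_simps)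
qed simp

lemma divide:
  assumes "y \<noteq> 0"
  shows "D (x / y) = (D x * y - x * D y) / y ^ 2"
proof -
  have "D x = D (x / y) * y + x / y * D y" using mult[of "x / y" y] assms by simp
  then show ?thesis using assms by (simp add: field_simps power2_eq_square)
qed

definition conic_invariant :: "'a \<Rightarrow> 'a" where
  "conic_invariant N = (3 * N * D (D N) - 5 * D N ^ 2) ^ 3 / N ^ 8"

lemma conic_invariant_chart:
  fixes l A h
  assumes nz: "l \<noteq> 0" "A \<noteq> 0" "h \<noteq> 0" "\<Delta> \<noteq> 0"
    and const: "D \<Delta> = 0" "D c = 0"
    and l: "D (D l) = c * h" and A: "D A = h * K" and K: "K * D l - D K * l = c * A"
    and D': "\<And>z. D' z = l ^ 2 / A * D z"
  defines "N \<equiv> \<Delta> * h * l ^ 3 / A ^ 3"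
  defines "T \<equiv> (3 * h * D (D h) - 5 * D h ^ 2) * l ^ 2 - 6 * h * D h * l * D l - 9 * h ^ 2 * D l ^ 2 + 18 * c * h ^ 3 * l"
  shows "(3 * N * D' (D' N) - 5 * D' N ^ 2) ^ 3 / N ^ 8 = T ^ 3 / (\<Delta> ^ 2 * h ^ 8)"
proof -
  define l1 h1 h2 K1 where "l1 = D l" and "h1 = D h" and "h2 = D (D h)" and "K1 = D K"
  note defs = l1_def[symmetric] h1_def[symmetric] h2_def[symmetric] K1_def[symmetric]
  note ds = defs add mult diff power const l A l[unfolded defs] h2_def[symmetric, unfolded h1_def[symmetric]]
  define M where "M = (h1 * l + 3 * h * l1) * A - 3 * h ^ 2 * l * K"
  have DM: "D M = (h2 * l + 4 * h1 * l1 + 3 * c * h ^ 2) * A + (h1 * l + 3 * h * l1) * h * K - 3 * (2 * h * h1 * l * K + h ^ 2 * l1 * K + h ^ 2 * l * K1)"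
    unfolding M_def ds by (simp add: ds) (simp add: algebra_simps power2_eq_square)
  have N1: "D' N = \<Delta> * l ^ 4 * M / A ^ 5"
  proof -
    have "D N = \<Delta> * l ^ 2 * M / A ^ 4"
      unfolding N_def divide[OF power_not_zero[OF nz(2)]] ds M_def using nz
      by (simp add: ds power2_eq_square) (simp add: divide_simps, simp add: algebra_simps eval_nat_numeral)
    then show ?thesis unfolding D' using nz by (simp add: divide_simps eval_nat_numeral)
  qed
  have N2: "D' (D' N) = \<Delta> * l ^ 5 * ((4 * l1 * A - 5 * l * h * K) * M + l * A * D M) / A ^ 7"
  proof -
    have "D (D' N) = \<Delta> * l ^ 3 * ((4 * l1 * A - 5 * l * h * K) * M + l * A * D M) / A ^ 6"
      unfolding N1 divide[OF power_not_zero[OF nz(2)]] ds using nz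
      by (simp add: ds power2_eq_square) (simp add: divide_simps, simp add: algebra_simps eval_nat_numeral)
    then show ?thesis unfolding D'[of "D' N"] using nz by (simp add: divide_simps eval_nat_numeral)
  qed
  have "3 * h * ((4 * l1 * A - 5 * l * h * K) * M + l * A * D M) - 5 * M ^ 2 = A ^ 2 * T"
  proof -
    have K': "K * l1 - K1 * l = c * A" using K unfolding defs .
    show ?thesis unfolding DM unfolding T_def defs M_def h2_def[symmetric, unfolded h1_def[symmetric]]
      using K' by algebra
  qed
  then have S: "3 * N * D' (D' N) - 5 * D' N ^ 2 = \<Delta> ^ 2 * l ^ 8 * T / A ^ 8"
  proof -
    assume e: "3 * h * ((4 * l1 * A - 5 * l * h * K) * M + l * A * D M) - 5 * M ^ 2 = A ^ 2 * T"
    have "3 * N * D' (D' N) - 5 * D' N ^ 2 = \<Delta> ^ 2 * l ^ 8 * (3 * h * ((4 * l1 * A - 5 * l * h * K) * M + l * A * D M) - 5 * M ^ 2) / A ^ 10"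
      unfolding N2 unfolding N1 unfolding N_def using nz by (simp add: divide_simps) (simp add: algebra_simps eval_nat_numeral)
    then show ?thesis unfolding e using nz by (simp add: divide_simps eval_nat_numeral)
  qed
  show ?thesis unfolding S unfolding N_def using nz by (simp add: divide_simps eval_nat_numeral)
qed

end

text \<open>
  The equation \<open>D (D (N powr (-2/3))) = const\<close> for \<open>N = y''\<close> (constancy of the invariant) is integrated
  by means of a cube root \<open>u\<close> of \<open>1 / N\<close>; \<open>u\<^sup>2\<close> is then a quadratic polynomial in \<open>x\<close>.
\<close>

lemma (in field_derivation) conic_invariant_cube_root:
  assumes u: "u ^ 3 * N = 1"
  shows "D (D (u ^ 2)) ^ 3 = - (8 / 729) * conic_invariant N"
proof -
  have u0: "u \<noteq> 0" and N0: "N \<noteq> 0" using u by auto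
  have "D (u ^ 3 * N) = 0" unfolding u by simp
  then have "u ^ 2 * (3 * N * D u + u * D N) = 0" by (simp add: mult power algebra_simps eval_nat_numeral)
  then have "3 * N * D u = - u * D N" using u0 by (simp add: eq_neg_iff_add_eq_0)
  then have Du: "D u = - u * D N / (3 * N)" using N0 by (simp add: field_simps)
  have W1: "D (u ^ 2) = - 2 * u ^ 2 * D N / (3 * N)"
    unfolding power Du using N0 by (simp add: field_simps power2_eq_square)
  have "D (D (u ^ 2)) = ((- 2 * (2 * u * D u) * D N - 2 * u ^ 2 * D (D N)) * (3 * N) - (- 2 * u ^ 2 * D N) * (3 * D N)) / (3 * N) ^ 2"
    unfolding W1 using N0 by (subst divide) (simp_all add: mult minus power)
  also have "\<dots> = - 2 * u ^ 2 * (3 * N * D (D N) - 5 * D N ^ 2) / (9 * N ^ 2)"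
    unfolding Du using N0 by (simp add: divide_simps) (simp add: algebra_simps eval_nat_numeral)
  finally have W2: "D (D (u ^ 2)) = - 2 * u ^ 2 * (3 * N * D (D N) - 5 * D N ^ 2) / (9 * N ^ 2)" .
  have "D (D (u ^ 2)) ^ 3 = - (8 / 729) * ((u ^ 3) ^ 2 * (3 * N * D (D N) - 5 * D N ^ 2) ^ 3 / N ^ 6)"
    unfolding W2 power_divide power_mult_distrib by (simp add: power_mult_distrib flip: power_mult)
  also have "u ^ 3 = 1 / N" using u N0 by (simp add: field_simps)
  finally show ?thesis unfolding conic_invariant_def using N0 by (simp add: field_simps eval_nat_numeral)
qed

lemma (in field_derivation) quadratic_of_third_derivative:
  assumes const: "\<And>z. D z = 0 \<Longrightarrow> z \<in> C" and C: "\<And>z. z \<in> C \<Longrightarrow> D z = 0" and X: "D X = 1" and W: "D (D W) \<in> C"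
  obtains \<alpha> \<beta> \<gamma> where "\<alpha> \<in> C" "\<beta> \<in> C" "\<gamma> \<in> C" "W = \<alpha> * X ^ 2 + \<beta> * X + \<gamma>"
proof -
  define \<alpha> where "\<alpha> = D (D W) / 2"
  have \<alpha>: "D \<alpha> = 0" unfolding \<alpha>_def by (subst divide) (auto simp: C[OF W])
  define \<beta> where "\<beta> = D W - 2 * \<alpha> * X"
  have \<beta>: "D \<beta> = 0" unfolding \<beta>_def by (simp add: diff mult X \<alpha>) (simp add: \<alpha>_def)
  define \<gamma> where "\<gamma> = W - \<alpha> * X ^ 2 - \<beta> * X"
  have "D \<gamma> = 0" unfolding \<gamma>_def by (simp add: diff mult power X \<alpha> \<beta>) (simp add: \<beta>_def)
  then show ?thesis using \<alpha> \<beta> const by (intro that[of \<alpha> \<beta> \<gamma>]) (auto simp: \<gamma>_def)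
qed

lemma (in field_derivation) quadratic_of_conic_invariant:
  assumes const: "\<And>z. D z = 0 \<Longrightarrow> z \<in> C" and C: "\<And>z. z \<in> C \<Longrightarrow> D z = 0" and X: "D X = 1"
    and u: "u ^ 3 * D (D Y) = 1" and inv: "D (conic_invariant (D (D Y))) = 0"
  obtains a b c \<alpha> \<beta> \<gamma> where "a \<in> C" "b \<in> C" "c \<in> C" "\<alpha> \<in> C" "\<beta> \<in> C" "\<gamma> \<in> C" "a \<noteq> 0"
      "(a * Y + b * X + c) ^ 2 = \<alpha> * X ^ 2 + \<beta> * X + \<gamma>"
    | a b \<alpha> \<beta> \<gamma> where "a \<in> C" "b \<in> C" "\<alpha> \<in> C" "\<beta> \<in> C" "\<gamma> \<in> C" "a \<noteq> 0 \<or> b \<noteq> 0"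
      "(a * X + b) * Y = \<alpha> * X ^ 2 + \<beta> * X + \<gamma>"
proof -
  note const_iff = iffI[OF const C]
  have Cadd: "x + y \<in> C" "x * y \<in> C" "- x \<in> C" if "x \<in> C" "y \<in> C" for x y
    using that by (auto intro!: const simp: add mult minus C)
  have Cdiv: "x / y \<in> C" if "x \<in> C" "y \<in> C" for x y
    using that by (cases "y = 0") (auto intro!: const simp: divide C)
  have C01: "0 \<in> C" "1 \<in> C" by (auto intro!: const)
  have u0: "u \<noteq> 0" using u by auto
  have "D (D (D (u ^ 2)) ^ 3) = 0"
    unfolding conic_invariant_cube_root[OF u] by (simp add: mult minus inv divide)
  then have "D (D (D (u ^ 2))) = 0 \<or> D (D (u ^ 2)) = 0" by (auto simp: power)
  then have "D (D (u ^ 2)) \<in> C" using const[of "D (D (u ^ 2))"] C01 by auto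
  then obtain \<alpha> \<beta> \<gamma> where abc: "\<alpha> \<in> C" "\<beta> \<in> C" "\<gamma> \<in> C" "u ^ 2 = \<alpha> * X ^ 2 + \<beta> * X + \<gamma>"
    using quadratic_of_third_derivative[OF const C X] by blast
  define k where "k = (4 * \<alpha> * \<gamma> - \<beta> ^ 2) / 4"
  have N: "D (D Y) = 1 / u ^ 3" using u u0 by (simp add: field_simps)
  have "2 * u * D u = 2 * \<alpha> * X + \<beta>"
  proof -
    have "D (u ^ 2) = D (\<alpha> * X ^ 2 + \<beta> * X + \<gamma>)" using abc by simp
    then show ?thesis by (simp add: power add mult X C abc(1-3))
  qed
  then have Du: "D u = (2 * \<alpha> * X + \<beta>) / (2 * u)" using u0 by (simp add: field_simps)
  have "D (D u) = (2 * \<alpha> * (2 * u) - (2 * \<alpha> * X + \<beta>) * (2 * D u)) / (2 * u) ^ 2"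
    using u0 by (subst Du, subst divide) (simp_all add: add mult X C abc(1-3))
  also have "\<dots> = (2 * \<alpha> * (2 * u) - (2 * \<alpha> * X + \<beta>) * (2 * ((2 * \<alpha> * X + \<beta>) / (2 * u)))) / (2 * u) ^ 2"
    unfolding Du ..
  also have "\<dots> = (4 * \<alpha> * u ^ 2 - (2 * \<alpha> * X + \<beta>) ^ 2) / (4 * u ^ 3)"
    using u0 by (simp add: divide_simps) (simp add: algebra_simps eval_nat_numeral)
  also have "\<dots> = k / u ^ 3"
    unfolding abc(4) k_def using u0 by (simp add: divide_simps) (simp add: algebra_simps eval_nat_numeral)
  finally have D2u: "D (D u) = k * D (D Y)" unfolding N by simp
  have k: "k \<in> C" by (rule const) (simp add: k_def divide diff mult power C abc(1-3))
  define b where "b = D (u - k * Y)"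
  have b: "b \<in> C" by (rule const) (simp add: b_def diff mult C[OF k] D2u)
  define c where "c = u - k * Y - b * X"
  have c: "c \<in> C" by (rule const) (simp add: c_def diff[of "u - k * Y" "b * X"] b_def[symmetric] mult C[OF b] X)
  have uk: "u = k * Y + b * X + c" by (simp add: c_def)
  show thesis
  proof (cases "k = 0")
    case False
    show ?thesis by (rule that(1)[OF k b c abc(1-3) False]) (use uk abc(4) in simp)
  next
    case True
    then have u': "u = b * X + c" using uk by simp
    show ?thesis
    proof (cases "b = 0")
      case True
      have "D (D Y) \<in> C" by (rule const) (use u0 u' True in \<open>simp add: N C[OF c] divide power\<close>)
      then obtain \<alpha> \<beta> \<gamma> where "\<alpha> \<in> C" "\<beta> \<in> C" "\<gamma> \<in> C" "Y = \<alpha> * X ^ 2 + \<beta> * X + \<gamma>"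
        using quadratic_of_third_derivative[OF const C X] by blast
      then show ?thesis using C01 by (intro that(2)[of 0 1 \<alpha> \<beta> \<gamma>]) auto
    next
      case False
      have Du': "D u = b" unfolding u' by (simp add: add mult X C[OF b] C[OF c])
      define r where "r = D (Y - 1 / (2 * b ^ 2 * u))"
      have "D (1 / (2 * b ^ 2 * u)) = - 1 / (2 * b * u ^ 2)"
        using False u0 by (subst divide) (simp_all add: mult power C[OF b] Du' field_simps eval_nat_numeral)
      then have "D (D (1 / (2 * b ^ 2 * u))) = D (- 1 / (2 * b * u ^ 2))" by simp
      also have "\<dots> = 1 / u ^ 3"
        using False u0 by (subst divide) (simp_all add: mult power minus C[OF b] Du' field_simps eval_nat_numeral)
      finally have r: "r \<in> C" by (intro const) (simp add: r_def diff N)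
      define s where "s = Y - 1 / (2 * b ^ 2 * u) - r * X"
      have s: "s \<in> C" by (rule const) (simp add: s_def diff[of "Y - 1 / (2 * b ^ 2 * u)" "r * X"] r_def[symmetric] mult C[OF r] X)
      have "Y = 1 / (2 * b ^ 2 * u) + r * X + s" by (simp add: s_def)
      then have "(b * X + c) * Y = 1 / (2 * b ^ 2) + (b * X + c) * (r * X + s)"
        unfolding u'[symmetric] using u0 False by (simp add: field_simps)
      then have "(b * X + c) * Y = (b * r) * X ^ 2 + (b * s + c * r) * X + (c * s + 1 / (2 * b ^ 2))"
        by (simp add: algebra_simps power2_eq_square)
      moreover have "b * r \<in> C" "b * s + c * r \<in> C" "c * s + 1 / (2 * b ^ 2) \<in> C"
      proof -
        have "1 / (2 * b ^ 2) \<in> C" by (rule const) (use False in \<open>simp add: divide mult power C[OF b]\<close>)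
        then show "b * r \<in> C" "b * s + c * r \<in> C" "c * s + 1 / (2 * b ^ 2) \<in> C" using b c r s by (auto intro!: Cadd)
      qed
      ultimately show ?thesis using b c False by (intro that(2)[of b c "b * r"]) auto
    qed
  qed
qed

definition xd :: "complex fls \<Rightarrow> complex fls \<Rightarrow> complex fls" where
  "xd X z = fls_deriv z / fls_deriv X"

lemma field_derivation_xd: "field_derivation (xd X)"
  by unfold_locales (simp_all add: xd_def add_divide_distrib fls_deriv_mult algebra_simps)

lemma field_derivation_fls_deriv: "field_derivation (fls_deriv :: complex fls \<Rightarrow> complex fls)"
  by unfold_locales (simp_all add: fls_deriv_mult algebra_simps)

lemma xd_compose:
  assumes "G \<noteq> 0" "fps_nth G 0 = 0"
  shows "xd (fls_compose_fps X G) (fls_compose_fps z G) = fls_compose_fps (xd X z) G"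
proof -
  have "fps_deriv G \<noteq> 0" using assms fps_deriv_eq_0_iff[of G] by (metis fps_const_0_eq_0 fps_nth_fps_const)
  then have "fps_to_fls (fps_deriv G) \<noteq> 0" by simp
  moreover have "fls_compose_fps (a / b) G = fls_compose_fps a G / fls_compose_fps b G" for a b :: "complex fls"
    using assms by (simp add: fls_compose_fps_divide)
  ultimately show ?thesis using assms by (simp add: xd_def deriv_compose_fls)
qed

lemma fps_root_exists:
  fixes a :: "complex fps"
  assumes "fps_nth a 0 \<noteq> 0" "n > 0"
  obtains b where "b ^ n = a" "fps_nth b 0 \<noteq> 0"
proof -
  obtain k where n: "n = Suc k" using assms by (cases n) auto
  obtain c where c: "c ^ n = fps_nth a 0"
  proof -
    have "(exp (Ln (fps_nth a 0) / of_nat n)) ^ n = fps_nth a 0"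
      using assms by (simp add: exp_of_nat_mult[symmetric])
    then show ?thesis by (rule that)
  qed
  then have c0: "c \<noteq> 0" using assms by (auto simp: zero_power)
  define b where "b = fps_radical (\<lambda>_ _. c) (Suc k) a"
  have "b ^ Suc k = a" using power_radical[of a "\<lambda>_ _. c" k] assms(1) c unfolding b_def n by simp
  moreover from this have "fps_nth b 0 \<noteq> 0" using assms(1) by (metis fps_nth_power_0 power_0_Suc)
  ultimately show ?thesis using that n by blast
qed

lemma fls_root_exists:
  fixes z :: "complex fls"
  assumes "z \<noteq> 0" "n > 0" "fls_subdegree z = int n * k"
  obtains u where "u ^ n = z"
proof -
  have "fps_nth (fls_base_factor_to_fps z) 0 \<noteq> 0" using nth_fls_subdegree_nonzero[OF assms(1)] by simp
  from fps_root_exists[OF this assms(2)] obtain b where b: "b ^ n = fls_base_factor_to_fps z" by blast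
  have "(fls_X_intpow k * fps_to_fls b) ^ n = fls_X_intpow (int n * k) * fps_to_fls (b ^ n)"
    by (simp add: power_mult_distrib fls_X_intpow_power fps_to_fls_power mult.commute)
  also have "\<dots> = z" unfolding b assms(3)[symmetric] fls_X_intpow_times_conv_shift
    by (rule fls_conv_base_factor_to_fps_shift_subdegree[symmetric])
  finally show ?thesis by (rule that)
qed

lemma xd_rational:
  assumes f: "irreducible f" "degree f > 0"
  shows "\<exists>b'. \<forall>X Y. fls_deriv X \<noteq> 0 \<longrightarrow> e2 X Y f = 0 \<longrightarrow>
    xd X (e2 X Y b / e2 X Y (pderiv f) ^ k) = e2 X Y b' / e2 X Y (pderiv f) ^ (k + 2)"
proof -
  define t where "t b = pderiv f * map_poly pderiv b - map_poly pderiv f * pderiv b" for b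
  define b' where "b' = t b * pderiv f - of_nat k * b * t (pderiv f)"
  show ?thesis
  proof (intro exI[of _ b'] allI impI)
    fix X Y assume X: "fls_deriv X \<noteq> 0" and Y: "e2 X Y f = 0"
    interpret field_derivation "xd X" by (rule field_derivation_xd)
    define G where "G = e2 X Y (pderiv f)"
    have G: "G \<noteq> 0" unfolding G_def by (rule e2_pderiv_neq_0[OF f X Y])
    have "fls_deriv (e2 X Y f) = 0" using Y by simp
    then have Y': "G * fls_deriv Y = - e2 X Y (map_poly pderiv f) * fls_deriv X"
      unfolding deriv_e2 G_def by (simp add: eq_neg_iff_add_eq_0)
    have t: "G * xd X (e2 X Y b) = e2 X Y (t b)" for b
    proof -
      have "G * fls_deriv (e2 X Y b) = e2 X Y (pderiv b) * (G * fls_deriv Y) + G * e2 X Y (map_poly pderiv b) * fls_deriv X"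
        unfolding deriv_e2 by (simp add: algebra_simps)
      also have "\<dots> = e2 X Y (t b) * fls_deriv X" unfolding Y' unfolding t_def G_def by (simp add: algebra_simps)
      finally show ?thesis using X by (simp add: xd_def field_simps)
    qed
    have 1: "xd X (e2 X Y b) = e2 X Y (t b) / G" "xd X G = e2 X Y (t (pderiv f)) / G"
      using t[of b] t[of "pderiv f"] G by (simp_all add: field_simps G_def)
    have "xd X (e2 X Y b / G ^ k) = (e2 X Y (t b) / G * G ^ k - e2 X Y b * (of_nat k * G ^ (k - 1) * (e2 X Y (t (pderiv f)) / G))) / (G ^ k) ^ 2"
      using G by (subst divide) (simp_all add: power 1)
    also have "\<dots> = e2 X Y b' / G ^ (k + 2)"
    proof (cases k)
      case 0
      then show ?thesis using G unfolding b'_def by (simp add: field_simps power2_eq_square G_def)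
    next
      case (Suc j)
      have "e2 X Y b' = e2 X Y (t b) * G - of_nat k * e2 X Y b * e2 X Y (t (pderiv f))"
        by (simp add: b'_def G_def ring_hom_fun_of_nat[OF ring_hom_fun_e2])
      then show ?thesis using G Suc by (simp add: divide_simps power2_eq_square del: of_nat_Suc) (simp add: algebra_simps del: of_nat_Suc)
    qed
    finally show "xd X (e2 X Y b / e2 X Y (pderiv f) ^ k) = e2 X Y b' / e2 X Y (pderiv f) ^ (k + 2)"
      unfolding G_def .
  qed
qed

lemma place_exists:
  assumes "lead_coeff f = 1" "degree f > 0"
  obtains X Y where "fls_deriv X \<noteq> 0" "e2 X Y f = 0"
proof -
  have X: "fls_deriv (fls_X :: complex fls) \<noteq> 0" by simp
  have "degree (map_poly (e1 fls_X) f) = degree f"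
    by (rule degree_map_poly) (use X e1_eq_0_iff in blast)
  moreover from this have "lead_coeff (map_poly (e1 fls_X) f) = 1" using assms by (simp add: coeff_map_poly)
  ultimately obtain N r where N: "N > 0" "peval (ram N) r (map_poly (e1 fls_X) f) = 0"
    using puiseux_root[of "map_poly (e1 fls_X) f"] assms(2) by auto
  have "peval (ram N) r (map_poly (e1 fls_X) f) = e2 (ram N fls_X) r f"
    unfolding peval_def e2_def using N(1) by (subst map_poly_map_poly) (auto simp: o_def e1_ram)
  then have "e2 (ram N fls_X) r f = 0" using N(2) by simp
  moreover have "fls_deriv (ram N fls_X) \<noteq> 0" using deriv_ram_eq_0_iff[OF N(1), of fls_X] X by simp
  ultimately show ?thesis using that by blast
qed

theorem affine_curve_degree_le_2:
  fixes f :: "complex poly poly"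
  assumes f: "irreducible f" "lead_coeff f = 1" "degree f > 0"
    and N: "\<And>X Y. fls_deriv X \<noteq> 0 \<Longrightarrow> e2 X Y f = 0 \<Longrightarrow> xd X (xd X Y) \<noteq> 0"
    and reg: "\<And>X Y. fls_deriv X \<noteq> 0 \<Longrightarrow> e2 X Y f = 0 \<Longrightarrow>
       fls_subdegree (field_derivation.conic_invariant (xd X) (xd X (xd X Y))) \<ge> 0"
  shows "degree f \<le> 2"
proof -
  define G where "G = pderiv f"
  define pl where "pl X Y \<longleftrightarrow> fls_deriv X \<noteq> 0 \<and> e2 X Y f = 0" for X Y
  have R: "\<exists>b'. \<forall>X Y. pl X Y \<longrightarrow> xd X (e2 X Y b / e2 X Y G ^ k) = e2 X Y b' / e2 X Y G ^ m" if "m = k + 2" for b k m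
    using xd_rational[OF f(1,3), of b k] unfolding pl_def G_def that by blast
  have "2 = 0 + (2::nat)" by simp
  from R[OF this, of "[:0, 1:]"] obtain n1 where n1: "\<forall>X Y. pl X Y \<longrightarrow> xd X (e2 X Y [:0, 1:] / e2 X Y G ^ 0) = e2 X Y n1 / e2 X Y G ^ 2" by blast
  have "4 = 2 + (2::nat)" by simp
  from R[OF this, of "n1"] obtain n2 where n2: "\<forall>X Y. pl X Y \<longrightarrow> xd X (e2 X Y n1 / e2 X Y G ^ 2) = e2 X Y n2 / e2 X Y G ^ 4" by blast
  have "6 = 4 + (2::nat)" by simp
  from R[OF this, of "n2"] obtain n3 where n3: "\<forall>X Y. pl X Y \<longrightarrow> xd X (e2 X Y n2 / e2 X Y G ^ 4) = e2 X Y n3 / e2 X Y G ^ 6" by blast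
  have "8 = 6 + (2::nat)" by simp
  from R[OF this, of "n3"] obtain n4 where n4: "\<forall>X Y. pl X Y \<longrightarrow> xd X (e2 X Y n3 / e2 X Y G ^ 6) = e2 X Y n4 / e2 X Y G ^ 8" by blast
  note ns = n1[rule_format] n2[rule_format]
  have Y: "e2 X Y [:0, 1:] = Y" for X Y by (simp add: e2_def peval_pCons)
  have G: "e2 X Y G \<noteq> 0" if "pl X Y" for X Y
    using e2_pderiv_neq_0[OF f(1,3)] that by (auto simp: pl_def G_def)
  have N2: "xd X (xd X Y) = e2 X Y n2 / e2 X Y G ^ 4" if "pl X Y" for X Y
    using ns(1)[OF that] ns(2)[OF that] unfolding Y by simp
  define a where "a = (3 * n2 * n4 - 5 * n3 ^ 2) ^ 3"
  define b where "b = n2 ^ 8 * G ^ 4"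
  have num: "e2 X Y (numeral k) = numeral k" for X Y k
    using ring_hom_fun_of_nat[OF ring_hom_fun_e2, of X Y "numeral k"] by simp
  have n2nz: "e2 X Y n2 \<noteq> 0" if "pl X Y" for X Y
    using N[of X Y] N2[OF that] that by (auto simp: pl_def)
  have inv: "field_derivation.conic_invariant (xd X) (xd X (xd X Y)) = e2 X Y a / e2 X Y b" if "pl X Y" for X Y
    unfolding field_derivation.conic_invariant_def[OF field_derivation_xd] N2[OF that] n3[rule_format, OF that] n4[rule_format, OF that] a_def b_def
    using G[OF that] n2nz[OF that]
    by (simp add: num divide_simps)
  obtain X0 Y0 where XY0: "pl X0 Y0" using place_exists[OF f(2,3)] unfolding pl_def by blast
  have bnz: "e2 X Y b \<noteq> 0" if "pl X Y" for X Y using G[OF that] n2nz[OF that] by (simp add: b_def)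
  have "\<not> f dvd b"
  proof
    assume "f dvd b"
    moreover have "e2 X0 Y0 f = 0" using XY0 by (simp add: pl_def)
    ultimately have "e2 X0 Y0 b = 0" by (rule ring_hom_fun_dvd[OF ring_hom_fun_e2])
    then show False using bnz[OF XY0] by contradiction
  qed
  from irreducible_bezout[OF f(1,3) this] obtain u v r where r: "r \<noteq> 0" "u * f + v * b = [:r:]" .
  have vb: "e2 X Y v * e2 X Y b = e1 X r" if "pl X Y" for X Y
    using arg_cong[OF r(2), of "e2 X Y"] that by (simp add: pl_def)
  have inv': "field_derivation.conic_invariant (xd X) (xd X (xd X Y)) = e2 X Y (a * v) / e1 X r" if "pl X Y" for X Y
  proof -
    have "e1 X r \<noteq> 0" using e1_eq_0_iff[of X r] r that by (simp add: pl_def)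
    then show ?thesis unfolding inv[OF that] using vb[OF that] bnz[OF that] by (auto simp: field_simps)
  qed
  have const: "fls_deriv (field_derivation.conic_invariant (xd X) (xd X (xd X Y))) = 0" if "pl X Y" for X Y
    unfolding inv'[OF that]
  proof (rule regular_function_constant[OF f(1,2) refl f(3) r(1)])
    show "fls_deriv X \<noteq> 0" "e2 X Y f = 0" using that by (auto simp: pl_def)
    fix X Y assume XY: "fls_deriv X \<noteq> 0" "e2 X Y f = 0"
    then have "pl X Y" by (simp add: pl_def)
    show "fls_subdegree (e2 X Y (a * v) / e1 X r) \<ge> 0"
      unfolding inv'[OF \<open>pl X Y\<close>, symmetric] by (rule reg[OF XY])
  qed
  define X Y where "X = ram 3 X0" and "Y = ram 3 Y0"
  have XY: "pl X Y" using XY0 unfolding pl_def X_def Y_def by (simp add: deriv_ram_eq_0_iff flip: e2_ram)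
  interpret field_derivation "xd X" by (rule field_derivation_xd)
  have X': "fls_deriv X \<noteq> 0" using XY by (simp add: pl_def)
  have N0: "xd X0 (xd X0 Y0) \<noteq> 0" using N XY0 by (simp add: pl_def)
  have NX: "xd X (xd X Y) = ram 3 (xd X0 (xd X0 Y0))"
    unfolding X_def Y_def by (simp add: xd_compose)
  have "inverse (xd X (xd X Y)) \<noteq> 0" "fls_subdegree (inverse (xd X (xd X Y))) = int 3 * (- fls_subdegree (xd X0 (xd X0 Y0)))"
    unfolding NX using N0 by (simp_all add: ram_eq_0_iff subdegree_ram)
  then obtain u where u: "u ^ 3 = inverse (xd X (xd X Y))" using fls_root_exists[of _ 3] by (metis zero_less_numeral)
  have u3: "u ^ 3 * xd X (xd X Y) = 1" unfolding u using N0 NX by (simp add: ram_eq_0_iff)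
  have X1: "xd X X = 1" using X' by (simp add: xd_def)
  have inv0: "xd X (conic_invariant (xd X (xd X Y))) = 0" using const[OF XY] by (simp add: xd_def)
  have C1: "z \<in> range fls_const" if "xd X z = 0" for z
    using that X' fls_deriv_eq_0_iff[of z] by (auto simp: xd_def)
  have C2: "xd X z = 0" if "z \<in> range fls_const" for z using that by (auto simp: xd_def)
  have le: "degree f \<le> 2" if "e2 X Y E = 0" "E \<noteq> 0" "degree E \<le> 2" for E
  proof -
    have "f dvd E" using e2_neq_0[OF f(1,3) _ X'] that(1) XY by (auto simp: pl_def)
    then show ?thesis using dvd_imp_degree_le[of f E] that by simp
  qed
  have e1l: "e1 X [:c, b, a:] = fls_const a * X ^ 2 + fls_const b * X + fls_const c" for a b c
    by (simp add: e1_def peval_pCons algebra_simps power2_eq_square)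
  have e1l2: "e1 X [:c, b:] = fls_const b * X + fls_const c" for b c
    by (simp add: e1_def peval_pCons algebra_simps)
  show ?thesis
  proof (rule quadratic_of_conic_invariant[OF C1 C2 X1 u3 inv0])
    fix a b c \<alpha> \<beta> \<gamma>
    assume "a \<in> range fls_const" "b \<in> range fls_const" "c \<in> range fls_const" "\<alpha> \<in> range fls_const"
      "\<beta> \<in> range fls_const" "\<gamma> \<in> range fls_const" and a: "a \<noteq> 0"
      and e: "(a * Y + b * X + c) ^ 2 = \<alpha> * X ^ 2 + \<beta> * X + \<gamma>"
    then obtain a' b' c' \<alpha>' \<beta>' \<gamma>' where c: "a = fls_const a'" "b = fls_const b'" "c = fls_const c'" "\<alpha> = fls_const \<alpha>'"
       "\<beta> = fls_const \<beta>'" "\<gamma> = fls_const \<gamma>'" by blast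
    define E where "E = [:[:c', b':], [:a':]:] ^ 2 - [:[:\<gamma>', \<beta>', \<alpha>':]:]"
    have "e2 X Y [:[:c', b':], [:a':]:] = a * Y + b * X + c"
      unfolding c e2_def by (simp add: peval_pCons e1l2 algebra_simps) (simp add: e1_def peval_pCons)
    then have "e2 X Y E = 0" using e by (simp add: E_def e1l c)
    moreover have "coeff E 2 = [:a' ^ 2:]" by (simp add: E_def power2_eq_square numeral_2_eq_2)
    then have "E \<noteq> 0" using a c(1) by auto
    moreover have "degree E \<le> 2" unfolding E_def power2_eq_square by (rule degree_diff_le) (rule order_trans[OF degree_mult_le], auto)
    ultimately show ?thesis by (rule le)
  next
    fix a b \<alpha> \<beta> \<gamma>
    assume "a \<in> range fls_const" "b \<in> range fls_const" "\<alpha> \<in> range fls_const"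
      "\<beta> \<in> range fls_const" "\<gamma> \<in> range fls_const" and ab: "a \<noteq> 0 \<or> b \<noteq> 0"
      and e: "(a * X + b) * Y = \<alpha> * X ^ 2 + \<beta> * X + \<gamma>"
    then obtain a' b' \<alpha>' \<beta>' \<gamma>' where c: "a = fls_const a'" "b = fls_const b'" "\<alpha> = fls_const \<alpha>'"
       "\<beta> = fls_const \<beta>'" "\<gamma> = fls_const \<gamma>'" by blast
    define E where "E = [:- [:\<gamma>', \<beta>', \<alpha>':], [:b', a':]:]"
    have "e2 X Y E = e1 X [:b', a':] * Y - e1 X [:\<gamma>', \<beta>', \<alpha>':]"
      unfolding E_def e2_def by (simp add: peval_pCons algebra_simps del: minus_pCons)
    then have "e2 X Y E = 0" using e by (simp add: e1l e1l2 c)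
    moreover have "E \<noteq> 0" using ab c by (auto simp: E_def)
    moreover have "degree E \<le> 2" unfolding E_def by (rule order_trans[OF degree_pCons_le]) simp
    ultimately show ?thesis by (rule le)
  qed
qed

definition det3 :: "complex \<times> complex \<times> complex \<Rightarrow> complex \<times> complex \<times> complex \<Rightarrow> complex \<times> complex \<times> complex \<Rightarrow> complex" where
  "det3 u v w = (case (u, v, w) of ((u1,u2,u3), (v1,v2,v3), (w1,w2,w3)) \<Rightarrow>
     u1 * (v2 * w3 - v3 * w2) - v1 * (u2 * w3 - u3 * w2) + w1 * (u2 * v3 - u3 * v2))"

lemma fls_X_pow_deriv_nz: "q > 0 \<Longrightarrow> fls_deriv (fls_X ^ q :: complex fls) \<noteq> 0"
  by (rule fls_deriv_nz_of_subdegree) simp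

lemma xd_X_power_mult:
  assumes q: "q > 0"
  shows "xd (fls_X ^ q) (fls_X_intpow (int q * k) * fps_to_fls z) =
    fls_X_intpow (int q * (k - 1)) * fps_to_fls (Abs_fps (\<lambda>i. (of_int k + of_nat i / of_nat q) * fps_nth z i))"
proof -
  define S :: "complex fls" where "S = fls_X ^ q"
  have S': "fls_deriv S \<noteq> 0" using q unfolding S_def by (rule fls_X_pow_deriv_nz)
  have dS: "fls_deriv S = fls_shift (1 - int q) (fls_const (of_nat q))"
  proof (rule fls_eqI)
    fix i
    show "fls_nth (fls_deriv S) i = fls_nth (fls_shift (1 - int q) (fls_const (of_nat q))) i"
      by (cases "i = int q - 1") (auto simp: S_def)
  qed
  have sh: "fls_X_intpow k * f = fls_shift (- k) f" for k and f :: "complex fls"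
    by (rule fls_X_intpow_times_conv_shift)
  have "fls_deriv (fls_X_intpow (int q * k) * fps_to_fls z) =
     fls_deriv S * (fls_X_intpow (int q * (k - 1)) * fps_to_fls (Abs_fps (\<lambda>i. (of_int k + of_nat i / of_nat q) * fps_nth z i)))"
    unfolding dS sh
  proof (rule fls_eqI)
    fix i
    have sh2: "fls_shift (1 - int q) (fls_const (of_nat q)) * fls_shift (- (int q * (k - 1))) g =
      fls_const (of_nat q) * fls_shift (1 - int q * k) g" for g :: "complex fls"
    proof -
      have e: "1 - int q + - (int q * (k - 1)) = 1 - int q * k" by (simp add: algebra_simps)
      show ?thesis unfolding fls_times_both_shifted_simp e by (simp only: fls_shifted_times_simps)
    qed
    define j where "j = i + 1 - int q * k"
    have i: "i + 1 = j + int q * k" "i + (1 - int q * k) = j" by (simp_all add: j_def)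
    have "fls_nth (fls_deriv (fls_shift (- (int q * k)) (fps_to_fls z))) i = of_int (j + int q * k) * fls_nth (fps_to_fls z) j"
    proof -
      have ij: "i + 1 + - (int q * k) = j" by (simp only: j_def)
      show ?thesis unfolding fls_deriv_nth fls_shift_nth ij i(1)[symmetric] ..
    qed
    also have "\<dots> = of_nat q * fls_nth (fps_to_fls (Abs_fps (\<lambda>i. (of_int k + of_nat i / of_nat q) * fps_nth z i))) j"
    proof (cases "j < 0")
      case True
      then show ?thesis by simp
    next
      case False
      then obtain m where m: "j = int m" using nonneg_int_cases by (metis linorder_not_less)
      have "of_nat q * (of_int k + of_nat m / of_nat q) = (of_int (int m + int q * k) :: complex)"
        using q by (simp add: distrib_left)
      then show ?thesis unfolding m by (simp add: mult.assoc[symmetric] del: of_int_add of_int_mult)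
    qed
    finally show "fls_nth (fls_deriv (fls_shift (- (int q * k)) (fps_to_fls z))) i =
      fls_nth (fls_shift (1 - int q) (fls_const (of_nat q)) * fls_shift (- (int q * (k - 1))) (fps_to_fls (Abs_fps (\<lambda>i. (of_int k + of_nat i / of_nat q) * fps_nth z i)))) i"
      unfolding sh2 fls_mult_const_nth fls_shift_nth i(2) .
  qed
  then show ?thesis using S' unfolding xd_def S_def[symmetric] by simp
qed

lemma wronskian_identity:
  fixes u1 u2 u3 v1 v2 v3 w1 w2 w3 s y m :: "'a::comm_ring_1"
  shows "(w1 * (u3 + v3 * s + w3 * y) - w3 * (u1 + v1 * s + w1 * y)) *
      ((v2 + w2 * m) * (u3 + v3 * s + w3 * y) - (u2 + v2 * s + w2 * y) * (v3 + w3 * m)) -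
    ((v1 + w1 * m) * (u3 + v3 * s + w3 * y) - (u1 + v1 * s + w1 * y) * (v3 + w3 * m)) *
      (w2 * (u3 + v3 * s + w3 * y) - w3 * (u2 + v2 * s + w2 * y)) =
    - (u1 * (v2 * w3 - v3 * w2) - v1 * (u2 * w3 - u3 * w2) + w1 * (u2 * v3 - u3 * v2)) * (u3 + v3 * s + w3 * y)"
  by (simp add: algebra_simps)

lemma osculating_identity:
  fixes S i w y z1 z2 z3 z4 :: "'a::field"
  assumes "S * i = 1"
  shows "(3 * z2 * (i ^ 2 * z4) - 5 * (i * z3) ^ 2) * (w * (S ^ 2 * y)) ^ 2 - 6 * z2 * (i * z3) * (w * (S ^ 2 * y)) * (w * (S * z1))
      - 9 * z2 ^ 2 * (w * (S * z1)) ^ 2 + 18 * w * z2 ^ 3 * (w * (S ^ 2 * y)) =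
    w ^ 2 * S ^ 2 * ((3 * z2 * z4 - 5 * z3 ^ 2) * y ^ 2 - 6 * z2 * z3 * y * z1 - 9 * z2 ^ 2 * z1 ^ 2 + 18 * z2 ^ 3 * y)"
  using assms by algebra

lemma conic_invariant_branch:
  fixes yh :: "complex fps"
  assumes q: "q > 0" and yh: "fps_nth yh 0 = 1" and det: "det3 (u1,u2,u3) (v1,v2,v3) (w1,w2,w3) \<noteq> 0"
  defines "y \<equiv> fls_X ^ (2 * q) * fps_to_fls yh"
  defines "b \<equiv> fls_const u1 + fls_const v1 * fls_X ^ q + fls_const w1 * y"
  defines "a \<equiv> fls_const u2 + fls_const v2 * fls_X ^ q + fls_const w2 * y"
  defines "l \<equiv> fls_const u3 + fls_const v3 * fls_X ^ q + fls_const w3 * y"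
  assumes l: "l \<noteq> 0" and X': "fls_deriv (a / l) \<noteq> 0"
    and reg: "(\<forall>i. fps_nth yh i \<noteq> 0 \<longrightarrow> q dvd i) \<or> (u3 = 0 \<and> v3 = 0)"
  shows "xd (a / l) (xd (a / l) (b / l)) \<noteq> 0"
    "fls_subdegree (field_derivation.conic_invariant (xd (a / l)) (xd (a / l) (xd (a / l) (b / l)))) \<ge> 0"
proof -
  define S :: "complex fls" where "S = fls_X ^ q"
  have S': "fls_deriv S \<noteq> 0" using q unfolding S_def by (rule fls_X_pow_deriv_nz)
  have S0: "S \<noteq> 0" using S' by auto
  interpret D: field_derivation "xd S" by (rule field_derivation_xd)
  have cst: "xd S (fls_const k) = 0" for k by (simp add: xd_def)
  have DS: "xd S S = 1" using S' by (simp add: xd_def)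
  note ds = D.add D.mult D.diff cst DS
  define z1 where "z1 = Abs_fps (\<lambda>i. (2 + of_nat i / of_nat q) * fps_nth yh i)"
  define z2 where "z2 = Abs_fps (\<lambda>i. (1 + of_nat i / of_nat q) * fps_nth z1 i)"
  define z3 where "z3 = Abs_fps (\<lambda>i. (of_nat i / of_nat q) * fps_nth z2 i)"
  define z4 where "z4 = Abs_fps (\<lambda>i. (- 1 + of_nat i / of_nat q) * fps_nth z3 i)"
  have y: "y = S ^ 2 * fps_to_fls yh" by (simp add: y_def S_def mult.commute flip: power_mult)
  have pw: "fls_X_intpow (int q * 2) = S ^ 2" "fls_X_intpow (int q * 1) = S" "fls_X_intpow (int q * 0) = (1 :: complex fls)"
     "fls_X_intpow (int q * (- 1)) = inverse S" "fls_X_intpow (int q * (- 2)) = inverse S ^ 2"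
  proof -
    have Si: "S = fls_X_intpow (int q)" by (simp add: S_def fls_X_power_conv_shift_1)
    have "S * fls_X_intpow (- int q) = 1" unfolding Si fls_X_intpow_times_fls_X_intpow by simp
    then have inv: "inverse S = fls_X_intpow (- int q)" by (rule inverse_unique)
    show "fls_X_intpow (int q * 2) = S ^ 2" "fls_X_intpow (int q * 1) = S" "fls_X_intpow (int q * 0) = (1 :: complex fls)"
      unfolding Si fls_X_intpow_power by (simp_all add: mult.commute)
    show "fls_X_intpow (int q * (- 1)) = inverse S" "fls_X_intpow (int q * (- 2)) = inverse S ^ 2"
      unfolding inv fls_X_intpow_power by (simp_all add: mult.commute)
  qed
  note xp = xd_X_power_mult[OF q, folded S_def]
  have y1: "xd S y = S * fps_to_fls z1"
    using xp[of 2 yh] unfolding y z1_def by (simp add: pw pw(2)[simplified])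
  have y2: "xd S (xd S y) = fps_to_fls z2"
    using xp[of 1 z1] unfolding y1 z2_def by (simp add: pw pw(2)[simplified] pw(3)[simplified])
  have y3: "xd S (fps_to_fls z2) = inverse S * fps_to_fls z3"
    using xp[of 0 z2] unfolding z3_def by (simp add: pw pw(4)[simplified])
  have y4: "xd S (inverse S * fps_to_fls z3) = inverse S ^ 2 * fps_to_fls z4"
    using xp[of "-1" z3] unfolding z4_def by (simp add: pw(4)[simplified] pw(5)[simplified])
  define h where "h = fps_to_fls z2"
  have z20: "fps_nth z2 0 = 2" by (simp add: z2_def z1_def yh)
  then have h0: "h \<noteq> 0" unfolding h_def by auto
  have l1: "xd S l = fls_const v3 + fls_const w3 * xd S y" unfolding l_def S_def[symmetric] by (simp add: ds)
  have a1: "xd S a = fls_const v2 + fls_const w2 * xd S y" unfolding a_def S_def[symmetric] by (simp add: ds)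
  have b1: "xd S b = fls_const v1 + fls_const w1 * xd S y" unfolding b_def S_def[symmetric] by (simp add: ds)
  have l2: "xd S (xd S l) = fls_const w3 * h" unfolding l1 by (simp add: ds y2 h_def)
  have a2: "xd S (xd S a) = fls_const w2 * h" unfolding a1 by (simp add: ds y2 h_def)
  have b2: "xd S (xd S b) = fls_const w1 * h" unfolding b1 by (simp add: ds y2 h_def)
  define A where "A = xd S a * l - a * xd S l"
  define B where "B = xd S b * l - b * xd S l"
  define \<Delta> where "\<Delta> = - fls_const (det3 (u1,u2,u3) (v1,v2,v3) (w1,w2,w3))"
  define K where "K = fls_const w2 * l - fls_const w3 * a"
  have \<Delta>0: "\<Delta> \<noteq> 0" using det by (simp add: \<Delta>_def)
  have change: "xd X z = xd S z / xd S X" for X z using S' by (simp add: xd_def)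
  have XA: "xd S (a / l) = A / l ^ 2" unfolding D.divide[OF l] A_def ..
  have YB: "xd S (b / l) = B / l ^ 2" unfolding D.divide[OF l] B_def ..
  have A0: "A \<noteq> 0"
  proof
    assume "A = 0"
    then have "xd S (a / l) = 0" using XA by simp
    then show False using X' S' by (simp add: xd_def)
  qed
  have D': "xd (a / l) z = l ^ 2 / A * xd S z" for z unfolding change[of "a / l"] XA using A0 l by simp
  have A': "xd S A = h * K" unfolding A_def D.diff D.mult l2 a2 K_def by (simp add: algebra_simps)
  have B': "xd S B = h * (fls_const w1 * l - fls_const w3 * b)" unfolding B_def D.diff D.mult l2 b2 by (simp add: algebra_simps)
  have K1: "K * xd S l - xd S K * l = fls_const w3 * A"
    unfolding K_def A_def D.diff D.mult cst by (simp add: algebra_simps)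
  have W: "xd S B * A - B * xd S A = h * \<Delta> * l"
  proof -
    have fd: "\<Delta> = - (fls_const u1 * (fls_const v2 * fls_const w3 - fls_const v3 * fls_const w2) - fls_const v1 * (fls_const u2 * fls_const w3 - fls_const u3 * fls_const w2)
        + fls_const w1 * (fls_const u2 * fls_const v3 - fls_const u3 * fls_const v2))"
      unfolding \<Delta>_def det3_def by (simp add: fls_plus_const fls_minus_const)
    have e: "(fls_const w1 * l - fls_const w3 * b) * A - B * K = \<Delta> * l"
      unfolding fd A_def B_def K_def l1 a1 b1 unfolding l_def a_def b_def by (rule wronskian_identity)
    have "h * (fls_const w1 * l - fls_const w3 * b) * A - B * (h * K) = h * ((fls_const w1 * l - fls_const w3 * b) * A - B * K)"
      by (simp only: right_diff_distrib mult_ac)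
    then show ?thesis unfolding A' B' e by (simp add: mult.assoc)
  qed
  have N: "xd (a / l) (xd (a / l) (b / l)) = \<Delta> * h * l ^ 3 / A ^ 3"
  proof -
    have "xd (a / l) (b / l) = B / A" unfolding D' YB using l A0 by simp
    then have "xd (a / l) (xd (a / l) (b / l)) = l ^ 2 / A * ((xd S B * A - B * xd S A) / A ^ 2)"
      by (simp only: D' D.divide[OF A0])
    then show ?thesis unfolding W using A0 by (simp add: power2_eq_square power3_eq_cube mult_ac)
  qed
  show "xd (a / l) (xd (a / l) (b / l)) \<noteq> 0" unfolding N using \<Delta>0 h0 l A0 by simp
  define T where "T = (3 * h * xd S (xd S h) - 5 * xd S h ^ 2) * l ^ 2 - 6 * h * xd S h * l * xd S l - 9 * h ^ 2 * xd S l ^ 2 + 18 * fls_const w3 * h ^ 3 * l"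
  have inv: "field_derivation.conic_invariant (xd (a / l)) (xd (a / l) (xd (a / l) (b / l))) = T ^ 3 / (\<Delta> ^ 2 * h ^ 8)"
    unfolding field_derivation.conic_invariant_def[OF field_derivation_xd] N T_def
    by (rule D.conic_invariant_chart[OF l A0 h0 \<Delta>0 _ cst l2 A' K1 D']) (simp add: \<Delta>_def D.minus cst)
  have T: "\<exists>t. T = fps_to_fls t"
    using reg
  proof
    assume r: "\<forall>i. fps_nth yh i \<noteq> 0 \<longrightarrow> q dvd i"
    have z3i: "fps_nth z3 i = 0" if "i < q" for i
    proof (cases "i = 0")
      case False
      then have "\<not> q dvd i" using that by (auto dest: dvd_imp_le)
      then have "fps_nth yh i = 0" using r by blast
      then show ?thesis by (simp add: z3_def z2_def z1_def)
    qed (simp add: z3_def)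
    have z4i: "fps_nth z4 i = 0" if "i < 2 * q" for i
    proof (cases "q dvd i")
      case True
      then have "i = 0 \<or> i = q" using that q by (auto elim!: dvdE)
      then show ?thesis using q by (auto simp: z4_def z3_def)
    next
      case False
      then have "fps_nth yh i = 0" using r by blast
      then show ?thesis by (simp add: z4_def z3_def z2_def z1_def)
    qed
    have div: "\<exists>t. fps_to_fls z = fls_X ^ k * fps_to_fls t" if "\<And>i. i < k \<Longrightarrow> fps_nth z i = 0" for z :: "complex fps" and k
    proof -
      have "z = fps_X ^ k * Abs_fps (\<lambda>i. fps_nth z (i + k))"
        by (rule fps_ext) (use that in \<open>auto simp: fps_X_power_mult_nth\<close>)
      then have "fps_to_fls z = fps_to_fls (fps_X ^ k) * fps_to_fls (Abs_fps (\<lambda>i. fps_nth z (i + k)))"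
        by (metis fls_times_fps_to_fls)
      then show ?thesis by (auto simp: fps_to_fls_power)
    qed
    obtain t3 where t3: "fps_to_fls z3 = S * fps_to_fls t3" using div[of q z3] z3i unfolding S_def by blast
    obtain t4 where t4: "fps_to_fls z4 = S ^ 2 * fps_to_fls t4" using div[of "2 * q" z4] z4i unfolding S_def by (auto simp: mult.commute simp flip: power_mult)
    have h1: "xd S h = fps_to_fls t3" unfolding h_def y3 t3 using S0 by simp
    have h2: "xd S (xd S h) = fps_to_fls t4" unfolding h_def y3 y4 t4 using S0 by (simp add: field_simps)
    have SF: "S = fps_to_fls (fps_X ^ q)" by (simp add: S_def fps_to_fls_power)
    have lF: "l = fps_to_fls (fps_const u3 + fps_const v3 * fps_X ^ q + fps_const w3 * ((fps_X ^ q) ^ 2 * yh))" (is "_ = fps_to_fls ?l")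
      unfolding l_def S_def[symmetric] y SF by (simp add: fls_times_fps_to_fls fps_to_fls_power)
    have l1F: "xd S l = fps_to_fls (fps_const v3 + fps_const w3 * (fps_X ^ q * z1))" (is "_ = fps_to_fls ?m")
      unfolding l1 y1 unfolding SF by (simp add: fls_times_fps_to_fls)
    have "T = fps_to_fls ((3 * z2 * t4 - 5 * t3 ^ 2) * ?l ^ 2 - 6 * z2 * t3 * ?l * ?m - 9 * z2 ^ 2 * ?m ^ 2 + 18 * fps_const w3 * z2 ^ 3 * ?l)"
      unfolding T_def unfolding h2 unfolding h1 l1F unfolding lF h_def by (simp add: fls_times_fps_to_fls fps_to_fls_power)
    then show ?thesis by blast
  next
    assume "u3 = 0 \<and> v3 = 0"
    then have ly: "l = fls_const w3 * (S ^ 2 * fps_to_fls yh)" "xd S l = fls_const w3 * (S * fps_to_fls z1)"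
      unfolding l1 y1 unfolding l_def y by simp_all
    have SF: "S = fps_to_fls (fps_X ^ q)" by (simp add: S_def fps_to_fls_power)
    have "T = fls_const w3 ^ 2 * S ^ 2 * ((3 * fps_to_fls z2 * fps_to_fls z4 - 5 * fps_to_fls z3 ^ 2) * fps_to_fls yh ^ 2 - 6 * fps_to_fls z2 * fps_to_fls z3 * fps_to_fls yh * fps_to_fls z1
        - 9 * fps_to_fls z2 ^ 2 * fps_to_fls z1 ^ 2 + 18 * fps_to_fls z2 ^ 3 * fps_to_fls yh)"
      unfolding T_def unfolding ly(2) unfolding ly(1) h_def y3 y4 by (rule osculating_identity) (use S0 in simp)
    also have "\<dots> = fps_to_fls (fps_const w3 ^ 2 * (fps_X ^ q) ^ 2 * ((3 * z2 * z4 - 5 * z3 ^ 2) * yh ^ 2 - 6 * z2 * z3 * yh * z1 - 9 * z2 ^ 2 * z1 ^ 2 + 18 * z2 ^ 3 * yh))"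
      unfolding SF by (simp add: fls_times_fps_to_fls fps_to_fls_power fls_const_power)
    finally show ?thesis by blast
  qed
  then obtain t where t: "T = fps_to_fls t" by blast
  have "T ^ 3 / (\<Delta> ^ 2 * h ^ 8) = fps_to_fls (t ^ 3 * inverse (fps_const (det3 (u1,u2,u3) (v1,v2,v3) (w1,w2,w3)) ^ 2 * z2 ^ 8))"
  proof -
    have "fps_to_fls (inverse d) = inverse (fps_to_fls d)" if "fps_nth d 0 \<noteq> 0" for d :: "complex fps"
    proof -
      have "fps_to_fls (inverse d) * fps_to_fls d = 1"
        using inverse_mult_eq_1[OF that] by (metis fls_times_fps_to_fls fps_one_to_fls)
      then show ?thesis by (metis inverse_unique mult.commute)
    qed
    moreover have "fps_nth (fps_const (det3 (u1,u2,u3) (v1,v2,v3) (w1,w2,w3)) ^ 2 * z2 ^ 8) 0 \<noteq> 0"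
      using det z20 by (simp add: fps_mult_nth_0 fps_power_zeroth)
    ultimately show ?thesis unfolding t \<Delta>_def h_def
      by (simp add: fls_times_fps_to_fls fps_to_fls_power divide_inverse fls_const_power)
  qed
  then show "fls_subdegree (field_derivation.conic_invariant (xd (a / l)) (xd (a / l) (xd (a / l) (b / l)))) \<ge> 0"
    unfolding inv by (simp add: fls_subdegree_fls_to_fps)
qed

section \<open>Adapted frames\<close>

lemma poly3_ev_eqI: "(\<And>a b c. ev (\<lambda>x. x) F a b c = ev (\<lambda>x. x) G a b c) \<Longrightarrow> F = G"
  using ev_eq_0_iff[of "F - G"] by (simp add: ev_simps(6)[OF ring_hom_fun_id])

lemma ring_hom_fun_subst3: "ring_hom_fun (subst3 u v w)"
  by (cases u, cases v, cases w) (simp add: subst3_def[abs_def] ring_hom_fun_ev)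

definition lc3 :: "complex \<times> complex \<times> complex \<Rightarrow> complex \<times> complex \<times> complex \<Rightarrow> complex \<times> complex \<times> complex \<Rightarrow> complex \<times> complex \<times> complex \<Rightarrow> complex \<times> complex \<times> complex" where
  "lc3 u v w x = (case (u, v, w, x) of ((u1,u2,u3), (v1,v2,v3), (w1,w2,w3), (x1,x2,x3)) \<Rightarrow>
     (u1 * x1 + v1 * x2 + w1 * x3, u2 * x1 + v2 * x2 + w2 * x3, u3 * x1 + v3 * x2 + w3 * x3))"

lemma subst3_subst3: "subst3 a b c (subst3 u v w F) = subst3 (lc3 u v w a) (lc3 u v w b) (lc3 u v w c) F"
  by (cases u, cases v, cases w, cases a, cases b, cases c, simp only: lc3_def prod.case,
      rule poly3_ev_eqI, simp only: ev_subst3[OF ring_hom_fun_id], simp add: algebra_simps)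

lemma det3_lc3: "det3 (lc3 u v w a) (lc3 u v w b) (lc3 u v w c) = det3 u v w * det3 a b c"
  by (cases u, cases v, cases w, cases a, cases b, cases c) (simp add: lc3_def det3_def algebra_simps)

lemma subst3_inverse:
  assumes det: "det3 u v w \<noteq> 0"
  obtains u' v' w' where "\<And>x. lc3 u v w (lc3 u' v' w' x) = x" "det3 u' v' w' \<noteq> 0" "\<And>F. subst3 u' v' w' (subst3 u v w F) = F" "\<And>F. subst3 u v w (subst3 u' v' w' F) = F"
proof -
  obtain u1 u2 u3 v1 v2 v3 w1 w2 w3 where uvw: "u = (u1,u2,u3)" "v = (v1,v2,v3)" "w = (w1,w2,w3)"
    by (cases u, cases v, cases w) auto
  define d where "d = u1 * (v2 * w3 - v3 * w2) - v1 * (u2 * w3 - u3 * w2) + w1 * (u2 * v3 - u3 * v2)"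
  have d: "d \<noteq> 0" using det by (simp add: det3_def uvw d_def)
  define i where "i = 1 / d"
  have di: "i * (u1 * (v2 * w3 - v3 * w2) - v1 * (u2 * w3 - u3 * w2) + w1 * (u2 * v3 - u3 * v2)) = 1"
    unfolding i_def d_def[symmetric] using d by simp
  define x1 x2 x3 where "x1 = i * (v2 * w3 - v3 * w2)" and "x2 = - i * (u2 * w3 - u3 * w2)" and "x3 = i * (u2 * v3 - u3 * v2)"
  define y1 y2 y3 where "y1 = - i * (v1 * w3 - v3 * w1)" and "y2 = i * (u1 * w3 - u3 * w1)" and "y3 = - i * (u1 * v3 - u3 * v1)"
  define z1 z2 z3 where "z1 = i * (v1 * w2 - v2 * w1)" and "z2 = - i * (u1 * w2 - u2 * w1)" and "z3 = i * (u1 * v2 - u2 * v1)"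
  note defs = x1_def x2_def x3_def y1_def y2_def y3_def z1_def z2_def z3_def
  have a: "u1 * (x1 * a + y1 * b + z1 * c) + v1 * (x2 * a + y2 * b + z2 * c) + w1 * (x3 * a + y3 * b + z3 * c) = a"
    "u2 * (x1 * a + y1 * b + z1 * c) + v2 * (x2 * a + y2 * b + z2 * c) + w2 * (x3 * a + y3 * b + z3 * c) = b"
    "u3 * (x1 * a + y1 * b + z1 * c) + v3 * (x2 * a + y2 * b + z2 * c) + w3 * (x3 * a + y3 * b + z3 * c) = c"
    "x1 * (u1 * a + v1 * b + w1 * c) + y1 * (u2 * a + v2 * b + w2 * c) + z1 * (u3 * a + v3 * b + w3 * c) = a"
    "x2 * (u1 * a + v1 * b + w1 * c) + y2 * (u2 * a + v2 * b + w2 * c) + z2 * (u3 * a + v3 * b + w3 * c) = b"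
    "x3 * (u1 * a + v1 * b + w1 * c) + y3 * (u2 * a + v2 * b + w2 * c) + z3 * (u3 * a + v3 * b + w3 * c) = c" for a b c
    unfolding defs using di by algebra+
  have det': "det3 (x1,x2,x3) (y1,y2,y3) (z1,z2,z3) * d = 1"
    unfolding det3_def prod.case defs d_def using di by algebra
  have "det3 (x1,x2,x3) (y1,y2,y3) (z1,z2,z3) \<noteq> 0" using det' by auto
  moreover have "subst3 (x1,x2,x3) (y1,y2,y3) (z1,z2,z3) (subst3 u v w F) = F" "subst3 u v w (subst3 (x1,x2,x3) (y1,y2,y3) (z1,z2,z3) F) = F" for F
    by (rule poly3_ev_eqI, unfold uvw ev_subst3[OF ring_hom_fun_id] a, rule refl)+
  moreover have "lc3 u v w (lc3 (x1,x2,x3) (y1,y2,y3) (z1,z2,z3) x) = x" for x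
    by (cases x) (simp add: uvw lc3_def a)
  ultimately show ?thesis by (intro that[of "(x1,x2,x3)" "(y1,y2,y3)" "(z1,z2,z3)"]) blast+
qed

lemma subst3_eq_0_iff:
  assumes "det3 u v w \<noteq> 0"
  shows "subst3 u v w F = 0 \<longleftrightarrow> F = 0"
proof -
  obtain u' v' w' where "subst3 u' v' w' (subst3 u v w F) = F" using subst3_inverse[OF assms] by metis
  moreover have "subst3 a b c 0 = 0" for a b c by (rule ring_hom_fun_simps(1)[OF ring_hom_fun_subst3])
  ultimately show ?thesis by metis
qed

lemma quadratic_indices: "{(j, k). j + k \<le> (2::nat)} = {(0,0), (1,0), (0,1), (2,0), (1,1), (0,2)}" (is "?L = ?R")
proof
  show "?L \<subseteq> ?R"
  proof
    fix z assume "z \<in> ?L"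
    then obtain j k where z: "z = (j, k)" and jk: "j + k \<le> 2" by auto
    then have "j = 0 \<or> j = 1 \<or> j = 2" by arith
    moreover have "k = 0 \<or> k = 1 \<or> k = 2" using jk by arith
    ultimately show "z \<in> ?R" using jk z by auto
  qed
qed auto

lemma ev_quadratic:
  assumes h: "ring_hom_fun h" and Q: "homogeneous 2 Q"
  shows "ev h Q z x y = h (cf3 Q 2 0 0) * z ^ 2 + h (cf3 Q 1 1 0) * z * x + h (cf3 Q 1 0 1) * z * y +
    h (cf3 Q 0 2 0) * x ^ 2 + h (cf3 Q 0 1 1) * x * y + h (cf3 Q 0 0 2) * y ^ 2"
  unfolding ev_homogeneous[OF h Q] quadratic_indices by (simp add: numeral_2_eq_2[symmetric] algebra_simps)

definition double_line :: "poly3 \<Rightarrow> bool" where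
  "double_line Q \<longleftrightarrow> (\<exists>e p q r. Q = const3 e * lin3 p q r ^ 2)"

lemma double_line_subst3:
  assumes "double_line Q"
  shows "double_line (subst3 u v w Q)"
proof -
  obtain u1 u2 u3 v1 v2 v3 w1 w2 w3 where uvw: "u = (u1,u2,u3)" "v = (v1,v2,v3)" "w = (w1,w2,w3)"
    by (cases u, cases v, cases w) auto
  obtain e p q r where Q: "Q = const3 e * lin3 p q r ^ 2" using assms by (auto simp: double_line_def)
  have "subst3 u v w Q = const3 e * lin3 (p * u1 + q * u2 + r * u3) (p * v1 + q * v2 + r * v3) (p * w1 + q * w2 + r * w3) ^ 2"
    unfolding Q uvw
    by (rule poly3_ev_eqI)
      (simp only: ev_subst3[OF ring_hom_fun_id] ev_simps[OF ring_hom_fun_id] ev_const3[OF ring_hom_fun_id] ev_lin3[OF ring_hom_fun_id],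
       simp add: algebra_simps)
  then show ?thesis unfolding double_line_def by blast
qed

lemma not_double_line_coeffs:
  assumes Q: "homogeneous 2 Q" "\<not> double_line Q"
  shows "cf3 Q 2 0 0 \<noteq> 0 \<or> cf3 Q 1 1 0 \<noteq> 0 \<or> cf3 Q 1 0 1 \<noteq> 0 \<or> cf3 Q 0 2 0 \<noteq> 0 \<or> cf3 Q 0 1 1 \<noteq> 0"
proof (rule ccontr)
  assume "\<not> ?thesis"
  then have z: "cf3 Q 2 0 0 = 0" "cf3 Q 1 1 0 = 0" "cf3 Q 1 0 1 = 0" "cf3 Q 0 2 0 = 0" "cf3 Q 0 1 1 = 0" by blast+
  have "Q = const3 (cf3 Q 0 0 2) * lin3 0 0 1 ^ 2"
    by (rule poly3_ev_eqI, unfold ev_quadratic[OF ring_hom_fun_id Q(1)] z)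
      (simp add: ev_simps[OF ring_hom_fun_id] ev_const3[OF ring_hom_fun_id] ev_lin3[OF ring_hom_fun_id])
  then show False using Q(2) by (auto simp: double_line_def)
qed

lemma fls_subtract_leading:
  fixes a b :: "complex fls"
  assumes "a \<noteq> 0" "fls_subdegree a \<le> fls_subdegree b"
  obtains c where "b - fls_const c * a = 0 \<or> fls_subdegree a < fls_subdegree (b - fls_const c * a)"
proof -
  define n where "n = fls_subdegree a"
  define c where "c = fls_nth b n / fls_nth a n"
  have an: "fls_nth a n \<noteq> 0" using assms(1) by (simp add: n_def)
  have "fls_nth (b - fls_const c * a) i = 0" if "i \<le> n" for i
  proof (cases "i = n")
    case True
    then show ?thesis using an by (simp add: c_def)
  next
    case False
    then show ?thesis using that assms(2) by (simp add: n_def)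
  qed
  then have "b - fls_const c * a = 0 \<or> n < fls_subdegree (b - fls_const c * a)"
    by (metis linorder_not_less nth_fls_subdegree_nonzero)
  then show ?thesis using that n_def by blast
qed

lemma ordered_frame_aux:
  fixes a b c :: "complex fls"
  assumes ind: "\<And>p q r. fls_const p * a + fls_const q * b + fls_const r * c = 0 \<Longrightarrow> p = 0 \<and> q = 0 \<and> r = 0"
    and le: "fls_subdegree a \<le> fls_subdegree b" "fls_subdegree a \<le> fls_subdegree c"
  obtains u1 u2 u3 v1 v2 v3 w1 w2 w3 a' b' c' where "det3 (u1,u2,u3) (v1,v2,v3) (w1,w2,w3) \<noteq> 0"
    "a = fls_const u1 * a' + fls_const v1 * b' + fls_const w1 * c'"
    "b = fls_const u2 * a' + fls_const v2 * b' + fls_const w2 * c'"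
    "c = fls_const u3 * a' + fls_const v3 * b' + fls_const w3 * c'"
    "a' \<noteq> 0" "b' \<noteq> 0" "c' \<noteq> 0" "fls_subdegree a' < fls_subdegree b'" "fls_subdegree b' < fls_subdegree c'"
proof -
  have a0: "a \<noteq> 0" using ind[of 1 0 0] by auto
  obtain \<beta> where \<beta>: "b - fls_const \<beta> * a = 0 \<or> fls_subdegree a < fls_subdegree (b - fls_const \<beta> * a)"
    using fls_subtract_leading[OF a0 le(1)] .
  obtain \<gamma> where \<gamma>: "c - fls_const \<gamma> * a = 0 \<or> fls_subdegree a < fls_subdegree (c - fls_const \<gamma> * a)"
    using fls_subtract_leading[OF a0 le(2)] .
  define b1 where "b1 = b - fls_const \<beta> * a"
  define c1 where "c1 = c - fls_const \<gamma> * a"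
  note fh = ring_hom_fun_simps[OF ring_hom_fun_fls_const]
  have "fls_const (- \<beta>) * a + fls_const 1 * b + fls_const 0 * c = b1"
    unfolding b1_def fh by simp
  then have b10: "b1 \<noteq> 0" using ind[of "- \<beta>" 1 0] by (metis zero_neq_one)
  have "fls_const (- \<gamma>) * a + fls_const 0 * b + fls_const 1 * c = c1"
    unfolding c1_def fh by simp
  then have c10: "c1 \<noteq> 0" using ind[of "- \<gamma>" 0 1] by (metis zero_neq_one)
  have s: "fls_subdegree a < fls_subdegree b1" "fls_subdegree a < fls_subdegree c1"
    using \<beta> \<gamma> b10 c10 by (auto simp: b1_def c1_def)
  show ?thesis
  proof (cases "fls_subdegree b1 \<le> fls_subdegree c1")
    case True
    obtain \<delta> where \<delta>: "c1 - fls_const \<delta> * b1 = 0 \<or> fls_subdegree b1 < fls_subdegree (c1 - fls_const \<delta> * b1)"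
      using fls_subtract_leading[OF b10 True] .
    have e: "c1 - fls_const \<delta> * b1 = fls_const (\<delta> * \<beta> - \<gamma>) * a + fls_const (- \<delta>) * b + fls_const 1 * c"
      unfolding b1_def c1_def fh by (simp add: algebra_simps del: fls_const_mult_const)
    have "c1 - fls_const \<delta> * b1 \<noteq> 0" unfolding e using ind[of "\<delta> * \<beta> - \<gamma>" "- \<delta>" 1] by auto
    then show ?thesis
      using \<delta> a0 b10 s
      by (intro that[of 1 \<beta> \<gamma> 0 1 \<delta> 0 0 1 a b1 "c1 - fls_const \<delta> * b1"]) (auto simp: det3_def b1_def c1_def)
  next
    case False
    then have le': "fls_subdegree c1 \<le> fls_subdegree b1" by simp
    obtain \<delta> where \<delta>: "b1 - fls_const \<delta> * c1 = 0 \<or> fls_subdegree c1 < fls_subdegree (b1 - fls_const \<delta> * c1)"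
      using fls_subtract_leading[OF c10 le'] .
    have e: "b1 - fls_const \<delta> * c1 = fls_const (\<delta> * \<gamma> - \<beta>) * a + fls_const 1 * b + fls_const (- \<delta>) * c"
      unfolding b1_def c1_def fh by (simp add: algebra_simps del: fls_const_mult_const)
    have "b1 - fls_const \<delta> * c1 \<noteq> 0" unfolding e using ind[of "\<delta> * \<gamma> - \<beta>" 1 "- \<delta>"] by auto
    then show ?thesis
      using \<delta> a0 c10 s
      by (intro that[of 1 \<beta> \<gamma> 0 \<delta> 1 0 1 0 a c1 "b1 - fls_const \<delta> * c1"]) (auto simp: det3_def b1_def c1_def)
  qed
qed

lemma ordered_frame:
  fixes a b c :: "complex fls"
  assumes ind: "\<And>p q r. fls_const p * a + fls_const q * b + fls_const r * c = 0 \<Longrightarrow> p = 0 \<and> q = 0 \<and> r = 0"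
  obtains u1 u2 u3 v1 v2 v3 w1 w2 w3 a' b' c' where "det3 (u1,u2,u3) (v1,v2,v3) (w1,w2,w3) \<noteq> 0"
    "a = fls_const u1 * a' + fls_const v1 * b' + fls_const w1 * c'"
    "b = fls_const u2 * a' + fls_const v2 * b' + fls_const w2 * c'"
    "c = fls_const u3 * a' + fls_const v3 * b' + fls_const w3 * c'"
    "a' \<noteq> 0" "b' \<noteq> 0" "c' \<noteq> 0" "fls_subdegree a' < fls_subdegree b'" "fls_subdegree b' < fls_subdegree c'"
proof -
  consider "fls_subdegree a \<le> fls_subdegree b" "fls_subdegree a \<le> fls_subdegree c"
    | "fls_subdegree b \<le> fls_subdegree a" "fls_subdegree b \<le> fls_subdegree c"
    | "fls_subdegree c \<le> fls_subdegree b" "fls_subdegree c \<le> fls_subdegree a" by linarith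
  then show thesis
  proof cases
    case 1
    show ?thesis by (rule ordered_frame_aux[OF ind 1]) (assumption, rule that)
  next
    case 2
    have ind': "p = 0 \<and> q = 0 \<and> r = 0" if "fls_const p * b + fls_const q * a + fls_const r * c = 0" for p q r
      using ind[of q p r] that by (simp add: add_ac)
    show ?thesis
    proof (rule ordered_frame_aux[OF ind' 2])
      fix u1 u2 u3 v1 v2 v3 w1 w2 w3 a' b' c'
      assume "det3 (u1,u2,u3) (v1,v2,v3) (w1,w2,w3) \<noteq> 0"
        and r: "b = fls_const u1 * a' + fls_const v1 * b' + fls_const w1 * c'"
        "a = fls_const u2 * a' + fls_const v2 * b' + fls_const w2 * c'"
        "c = fls_const u3 * a' + fls_const v3 * b' + fls_const w3 * c'"
        "a' \<noteq> 0" "b' \<noteq> 0" "c' \<noteq> 0" "fls_subdegree a' < fls_subdegree b'" "fls_subdegree b' < fls_subdegree c'"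
      moreover have "det3 (u2,u1,u3) (v2,v1,v3) (w2,w1,w3) = - det3 (u1,u2,u3) (v1,v2,v3) (w1,w2,w3)"
        by (simp add: det3_def algebra_simps)
      ultimately have "det3 (u2,u1,u3) (v2,v1,v3) (w2,w1,w3) \<noteq> 0" by simp
      from that[OF this r(2,1,3-)] show thesis .
    qed
  next
    case 3
    have ind': "p = 0 \<and> q = 0 \<and> r = 0" if "fls_const p * c + fls_const q * b + fls_const r * a = 0" for p q r
      using ind[of r q p] that by (simp add: add_ac)
    show ?thesis
    proof (rule ordered_frame_aux[OF ind' 3])
      fix u1 u2 u3 v1 v2 v3 w1 w2 w3 a' b' c'
      assume "det3 (u1,u2,u3) (v1,v2,v3) (w1,w2,w3) \<noteq> 0"
        and r: "c = fls_const u1 * a' + fls_const v1 * b' + fls_const w1 * c'"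
        "b = fls_const u2 * a' + fls_const v2 * b' + fls_const w2 * c'"
        "a = fls_const u3 * a' + fls_const v3 * b' + fls_const w3 * c'"
        "a' \<noteq> 0" "b' \<noteq> 0" "c' \<noteq> 0" "fls_subdegree a' < fls_subdegree b'" "fls_subdegree b' < fls_subdegree c'"
      moreover have "det3 (u3,u2,u1) (v3,v2,v1) (w3,w2,w1) = - det3 (u1,u2,u3) (v1,v2,v3) (w1,w2,w3)"
        by (simp add: det3_def algebra_simps)
      ultimately have "det3 (u3,u2,u1) (v3,v2,v1) (w3,w2,w1) \<noteq> 0" by simp
      from that[OF this r(3,2,1,4-)] show thesis .
    qed
  qed
qed

lemma fls_pos_subdegree:
  fixes z :: "complex fls"
  assumes "z \<noteq> 0" "0 < fls_subdegree z"
  obtains q g where "0 < q" "int q = fls_subdegree z" "z = fps_to_fls (fps_X ^ q * g)" "fps_nth g 0 \<noteq> 0"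
proof -
  define q where "q = nat (fls_subdegree z)"
  have q: "int q = fls_subdegree z" "0 < q" using assms by (auto simp: q_def)
  define g where "g = fls_base_factor_to_fps z"
  have "z = fls_X_intpow (int q) * fps_to_fls g"
    unfolding q g_def fls_X_intpow_times_conv_shift by (rule fls_conv_base_factor_to_fps_shift_subdegree)
  also have "\<dots> = fps_to_fls (fps_X ^ q * g)"
    by (simp add: fls_times_fps_to_fls fps_to_fls_power fls_X_power_conv_shift_1)
  finally have "z = fps_to_fls (fps_X ^ q * g)" .
  moreover have "fps_nth g 0 \<noteq> 0" using nth_fls_subdegree_nonzero[OF assms(1)] by (simp add: g_def)
  ultimately show ?thesis using that q by blast
qed

lemma adapted_frame:
  fixes x y z :: "complex fls"
  assumes ind: "\<And>p q r. fls_const p * x + fls_const q * y + fls_const r * z = 0 \<Longrightarrow> p = 0 \<and> q = 0 \<and> r = 0"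
  obtains G m q p yh u1 u2 u3 v1 v2 v3 w1 w2 w3 where "fps_nth G 0 = 0" "fps_nth G 1 \<noteq> 0" "m \<noteq> 0" "0 < q" "q < p" "fps_nth yh 0 = 1"
    "det3 (u1,u2,u3) (v1,v2,v3) (w1,w2,w3) \<noteq> 0"
    "fls_compose_fps x G = m * fps_to_fls (fps_const u1 + fps_const v1 * fps_X ^ q + fps_const w1 * (fps_X ^ p * yh))"
    "fls_compose_fps y G = m * fps_to_fls (fps_const u2 + fps_const v2 * fps_X ^ q + fps_const w2 * (fps_X ^ p * yh))"
    "fls_compose_fps z G = m * fps_to_fls (fps_const u3 + fps_const v3 * fps_X ^ q + fps_const w3 * (fps_X ^ p * yh))"
proof -
  obtain u1 u2 u3 v1 v2 v3 w1 w2 w3 a b c where det: "det3 (u1,u2,u3) (v1,v2,v3) (w1,w2,w3) \<noteq> 0"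
    and xyz: "x = fls_const u1 * a + fls_const v1 * b + fls_const w1 * c"
    "y = fls_const u2 * a + fls_const v2 * b + fls_const w2 * c"
    "z = fls_const u3 * a + fls_const v3 * b + fls_const w3 * c"
    and nz: "a \<noteq> 0" "b \<noteq> 0" "c \<noteq> 0" and lt: "fls_subdegree a < fls_subdegree b" "fls_subdegree b < fls_subdegree c"
    by (rule ordered_frame[OF ind]) (assumption, rule that)
  have sb: "fls_subdegree (b / a) = fls_subdegree b - fls_subdegree a" "fls_subdegree (c / a) = fls_subdegree c - fls_subdegree a"
    using nz by (simp_all add: fls_divide_subdegree)
  obtain q g where q: "0 < q" "int q = fls_subdegree (b / a)" "b / a = fps_to_fls (fps_X ^ q * g)" "fps_nth g 0 \<noteq> 0"
    using fls_pos_subdegree[of "b / a"] nz lt sb by auto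
  obtain p k where p: "0 < p" "int p = fls_subdegree (c / a)" "c / a = fps_to_fls (fps_X ^ p * k)" "fps_nth k 0 \<noteq> 0"
    using fls_pos_subdegree[of "c / a"] nz lt sb by auto
  have qp: "q < p" using q(2) p(2) sb lt by linarith
  obtain h where h: "h ^ q = g" "fps_nth h 0 \<noteq> 0" using fps_root_exists[OF q(4,1)] .
  define \<psi> where "\<psi> = fps_X * h"
  have \<psi>: "fps_nth \<psi> 0 = 0" "fps_nth \<psi> 1 \<noteq> 0" using h by (simp_all add: \<psi>_def)
  define G where "G = fps_inv \<psi>"
  have \<psi>G: "fps_compose \<psi> G = fps_X" unfolding G_def using \<psi> by (rule fps_inv_right)
  have G0: "fps_nth G 0 = 0" by (simp add: G_def fps_inv_def)
  have G1: "fps_nth G 1 \<noteq> 0"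
  proof
    assume "fps_nth G 1 = 0"
    moreover have "G * fps_compose h G = fps_X"
      using \<psi>G G0 unfolding \<psi>_def by (simp add: fps_compose_mult_distrib fps_X_fps_compose_startby0)
    then have "fps_nth (G * fps_compose h G) 1 = 1" by simp
    ultimately show False using G0 by (simp add: fps_mult_nth_1)
  qed
  have Gnz: "G \<noteq> 0" using G1 by auto
  note G = Gnz G0
  define G' where "G' = fps_shift 1 G"
  have GG': "G = fps_X * G'" unfolding G'_def by (rule fps_ext) (use G0 in \<open>auto simp: fps_X_mult_nth\<close>)
  have G'0: "fps_nth G' 0 \<noteq> 0" using G1 by (simp add: G'_def)
  define Y where "Y = G' ^ p * fps_compose k G"
  have Y0: "fps_nth Y 0 \<noteq> 0" using G'0 p(4) by (simp add: Y_def fps_mult_nth_0 fps_power_zeroth)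
  define \<kappa> where "\<kappa> = fps_nth Y 0"
  define yh where "yh = fps_const (1 / \<kappa>) * Y"
  have yh: "fps_nth yh 0 = 1" "Y = fps_const \<kappa> * yh" using Y0 by (simp_all add: yh_def \<kappa>_def mult.assoc[symmetric])
  have ba: "fls_compose_fps (b / a) G = fps_to_fls (fps_X ^ q)"
  proof -
    have "fps_X ^ q * g = \<psi> ^ q" by (simp add: \<psi>_def power_mult_distrib h(1))
    then show ?thesis unfolding q(3) using G by (simp add: fps_compose_power[OF G0, symmetric] \<psi>G)
  qed
  have ca: "fls_compose_fps (c / a) G = fls_const \<kappa> * fps_to_fls (fps_X ^ p * yh)"
  proof -
    have "fps_compose (fps_X ^ p * k) G = G ^ p * fps_compose k G"
      using G0 by (simp add: fps_compose_mult_distrib fps_X_power_compose)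
    also have "\<dots> = fps_X ^ p * Y"
    proof -
      have "G ^ p = fps_X ^ p * G' ^ p" by (subst GG') (rule power_mult_distrib)
      then show ?thesis by (simp add: Y_def mult.assoc)
    qed
    also have "\<dots> = fps_const \<kappa> * (fps_X ^ p * yh)" unfolding yh(2) by (simp only: mult_ac)
    finally show ?thesis unfolding p(3) fls_compose_fps_to_fls[OF G] by (simp only: fls_times_fps_to_fls fps_const_to_fls)
  qed
  define m where "m = fls_compose_fps a G"
  have m: "m \<noteq> 0" unfolding m_def using nz G by (simp add: fls_compose_fps_eq_0_iff)
  note rh = ring_hom_fun_simps[OF ring_hom_fun_compose_fls[OF G]]
  have comp: "fls_compose_fps (fls_const r * a + fls_const s * b + fls_const t * c) G =
     m * fps_to_fls (fps_const r + fps_const s * fps_X ^ q + fps_const (t * \<kappa>) * (fps_X ^ p * yh))" for r s t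
  proof -
    have e: "fls_const r * a + fls_const s * b + fls_const t * c = a * (fls_const r + fls_const s * (b / a) + fls_const t * (c / a))"
      using nz by (simp add: field_simps)
    show ?thesis unfolding e rh ba ca fls_compose_fps_const m_def
      unfolding ring_hom_fun_simps[OF ring_hom_fun_fps_const] ring_hom_fun_simps(3,4)[OF ring_hom_fun_fps_to_fls] fps_const_to_fls by (simp only: mult_ac)
  qed
  have det': "det3 (u1,u2,u3) (v1,v2,v3) (w1 * \<kappa>,w2 * \<kappa>,w3 * \<kappa>) = \<kappa> * det3 (u1,u2,u3) (v1,v2,v3) (w1,w2,w3)"
    by (simp add: det3_def algebra_simps)
  have \<kappa>: "\<kappa> \<noteq> 0" using Y0 by (simp add: \<kappa>_def)
  show ?thesis
    by (rule that[OF G0 G1 m q(1) qp yh(1) _ comp[of u1 v1 w1, folded xyz] comp[of u2 v2 w2, folded xyz] comp[of u3 v3 w3, folded xyz]])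
      (use det det' \<kappa> in simp)
qed

section \<open>Regularity of the invariant at all places\<close>

lemma homogeneous_pderiv:
  assumes "homogeneous d f"
  shows "homogeneous (d - 1) (pderiv f)"
  unfolding homogeneous_def
proof (intro allI impI)
  fix i j k assume "cf3 (pderiv f) i j k \<noteq> 0"
  moreover have "cf3 (pderiv f) i j k = of_nat (Suc i) * cf3 f (Suc i) j k"
  proof -
    have "of_nat m * g = smult (of_nat m) g" for m and g :: "'a::comm_ring_1 poly"
      by (simp add: of_nat_poly)
    note o = this
    show ?thesis by (simp only: coeff_pderiv o coeff_smult)
  qed
  ultimately have "cf3 f (Suc i) j k \<noteq> 0" by auto
  then have "Suc i + j + k = d" using assms unfolding homogeneous_def by blast
  then show "i + j + k = d - 1" by simp
qed

text \<open>
  The evenness of \<open>F\<close> on the tangent lines, read at a place \<open>C = (x, y, z)\<close>: with \<open>g = Q(C)\<close> and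
  \<open>2 g \<nu> = t g'\<close>, the vector \<open>t C' - \<nu> C\<close> is tangent and polar to \<open>C\<close> with respect to \<open>Q\<close>.
\<close>

definition even_along :: "poly3 \<Rightarrow> poly3 \<Rightarrow> poly3 \<Rightarrow> bool" where
  "even_along f F Q \<longleftrightarrow> (\<forall>x y z \<nu> s. ev fls_const f x y z = 0 \<longrightarrow> ev fls_const Q x y z \<noteq> 0 \<longrightarrow>
     ev fls_const (pderiv f) x y z \<noteq> 0 \<longrightarrow>
     2 * ev fls_const Q x y z * \<nu> = fls_X * fls_deriv (ev fls_const Q x y z) \<longrightarrow>
     ev fls_const F (x + fls_const s * (fls_X * fls_deriv x - \<nu> * x)) (y + fls_const s * (fls_X * fls_deriv y - \<nu> * y))
        (z + fls_const s * (fls_X * fls_deriv z - \<nu> * z)) =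
     ev fls_const F (x + fls_const (-s) * (fls_X * fls_deriv x - \<nu> * x)) (y + fls_const (-s) * (fls_X * fls_deriv y - \<nu> * y))
        (z + fls_const (-s) * (fls_X * fls_deriv z - \<nu> * z)))"

definition osculating :: "poly3 \<Rightarrow> poly3 \<Rightarrow> nat \<Rightarrow> complex \<times> complex \<times> complex \<Rightarrow> complex \<times> complex \<times> complex \<Rightarrow> complex \<times> complex \<times> complex \<Rightarrow> bool" where
  "osculating F Q n u v w \<longleftrightarrow> det3 u v w \<noteq> 0 \<and>
     cf3 (subst3 u v w Q) 2 0 0 = 0 \<and> cf3 (subst3 u v w Q) 1 1 0 = 0 \<and> cf3 (subst3 u v w Q) 1 0 1 \<noteq> 0 \<and>
     cf3 (subst3 u v w Q) 0 2 0 = - cf3 (subst3 u v w Q) 1 0 1 \<and>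
     (\<forall>j k. j + k \<le> n \<longrightarrow> cf3 (subst3 u v w F) (n - j - k) j k \<noteq> 0 \<longrightarrow> n \<le> j + 2 * k) \<and>
     (\<Sum>(j,k)\<in>{(j,k). j + k \<le> n \<and> j + 2 * k = n}. cf3 (subst3 u v w F) (n - j - k) j k) = 0"

lemma branch_cases:
  assumes F: "homogeneous n F" "F \<noteq> 0" "even n" and Q: "homogeneous 2 Q" "\<not> double_line Q"
    and even: "even_along f F Q" and fF: "f dvd F"
    and qp: "0 < q" "q < p" and yh: "fps_nth yh 0 = 1" and det: "det3 (u1,u2,u3) (v1,v2,v3) (w1,w2,w3) \<noteq> 0"
    and P: "P1 = fps_const u1 + fps_const v1 * fps_X ^ q + fps_const w1 * (fps_X ^ p * yh)"
      "P2 = fps_const u2 + fps_const v2 * fps_X ^ q + fps_const w2 * (fps_X ^ p * yh)"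
      "P3 = fps_const u3 + fps_const v3 * fps_X ^ q + fps_const w3 * (fps_X ^ p * yh)"
    and f0: "ev fls_const f (fps_to_fls P1) (fps_to_fls P2) (fps_to_fls P3) = 0"
    and Q0: "ev fls_const Q (fps_to_fls P1) (fps_to_fls P2) (fps_to_fls P3) \<noteq> 0"
    and f1: "ev fls_const (pderiv f) (fps_to_fls P1) (fps_to_fls P2) (fps_to_fls P3) \<noteq> 0"
  shows "p = 2 * q \<and> ((\<forall>i. fps_nth yh i \<noteq> 0 \<longrightarrow> q dvd i) \<or> osculating F Q n (u1,u2,u3) (v1,v2,v3) (w1,w2,w3))"
proof -
  let ?u = "(u1,u2,u3)" and ?v = "(v1,v2,v3)" and ?w = "(w1,w2,w3)"
  define F' where "F' = subst3 ?u ?v ?w F"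
  define Q' where "Q' = subst3 ?u ?v ?w Q"
  note es = ev_subst3[OF ring_hom_fun_fps_const, of u1 u2 u3 v1 v2 v3 w1 w2 w3]
  note efls = ev_hom[OF ring_hom_fun_fps_to_fls ring_hom_fun_fps_const, unfolded fps_const_to_fls]
  note toinj = fps_to_fls_eq_iff
  have P': "fps_const u1 * 1 + fps_const v1 * fps_X ^ q + fps_const w1 * (fps_X ^ p * yh) = P1"
    "fps_const u2 * 1 + fps_const v2 * fps_X ^ q + fps_const w2 * (fps_X ^ p * yh) = P2"
    "fps_const u3 * 1 + fps_const v3 * fps_X ^ q + fps_const w3 * (fps_X ^ p * yh) = P3"
    by (simp_all add: P)
  define g where "g = ev fps_const Q' 1 (fps_X ^ q) (fps_X ^ p * yh)"
  have g: "g = ev fps_const Q P1 P2 P3" unfolding g_def Q'_def es P' ..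
  have gfls: "fps_to_fls g = ev fls_const Q (fps_to_fls P1) (fps_to_fls P2) (fps_to_fls P3)" unfolding g efls ..
  then have g0: "g \<noteq> 0" using Q0 by auto
  define w where "w = subdegree g"
  define gh where "gh = fps_shift w g"
  have gh: "g = fps_X ^ w * gh" "fps_nth gh 0 \<noteq> 0"
    using g0 by (simp_all add: gh_def w_def subdegree_decompose[symmetric] mult.commute[of "fps_X ^ subdegree g"] flip: subdegree_decompose)
  define \<nu> where "\<nu> = inverse (2 * gh) * (of_nat w * gh + fps_X * fps_deriv gh)"
  have \<nu>: "2 * g * \<nu> = fps_X * fps_deriv g"
  proof -
    have "inverse (2 * gh) * (2 * gh) = 1" using gh(2) by (intro inverse_mult_eq_1) (simp add: fps_mult_nth_0)
    then have "2 * gh * \<nu> = of_nat w * gh + fps_X * fps_deriv gh" unfolding \<nu>_def by (simp add: mult.assoc[symmetric] mult.commute)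
    then have "2 * (fps_X ^ w * gh) * \<nu> = fps_X ^ w * (of_nat w * gh + fps_X * fps_deriv gh)" by (simp add: mult_ac)
    then show ?thesis unfolding gh(1) euler_deriv_X_power_mult .
  qed
  have zero: "ev fps_const F' 1 (fps_X ^ q) (fps_X ^ p * yh) = 0"
  proof -
    have "ev fls_const F (fps_to_fls P1) (fps_to_fls P2) (fps_to_fls P3) = 0"
      by (rule ring_hom_fun_dvd[OF ring_hom_fun_ev[OF ring_hom_fun_fls_const] fF f0])
    then have "fps_to_fls (ev fps_const F P1 P2 P3) = 0" unfolding efls .
    then show ?thesis unfolding F'_def es P' by simp
  qed
  have evn: "ev fps_const F' (1 - fps_const s * \<nu>) (fps_X ^ q * (1 + fps_const s * (of_nat q - \<nu>)))
        (fps_X ^ p * (yh + fps_const s * (of_nat p * yh + fps_X * fps_deriv yh - \<nu> * yh))) =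
      ev fps_const F' (1 - fps_const (-s) * \<nu>) (fps_X ^ q * (1 + fps_const (-s) * (of_nat q - \<nu>)))
        (fps_X ^ p * (yh + fps_const (-s) * (of_nat p * yh + fps_X * fps_deriv yh - \<nu> * yh)))" for s
  proof -
    have Xq: "fps_X * fps_deriv (fps_X ^ q) = fps_X ^ q * (of_nat q :: complex fps)"
      using euler_deriv_X_power_mult[of q 1] by simp
    have arg: "fps_const a * (1 - fps_const s * \<nu>) + fps_const b * (fps_X ^ q * (1 + fps_const s * (of_nat q - \<nu>))) +
        fps_const c * (fps_X ^ p * (yh + fps_const s * (of_nat p * yh + fps_X * fps_deriv yh - \<nu> * yh))) =
      R + fps_const s * (fps_X * fps_deriv R - \<nu> * R)"
      if R: "R = fps_const a + fps_const b * fps_X ^ q + fps_const c * (fps_X ^ p * yh)" for a b c s R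
    proof -
      have "fps_X * fps_deriv R = fps_const b * (fps_X * fps_deriv (fps_X ^ q)) + fps_const c * (fps_X * fps_deriv (fps_X ^ p * yh))"
        unfolding R by (simp add: distrib_left mult_ac)
      then have dR: "fps_X * fps_deriv R = fps_const b * (fps_X ^ q * of_nat q) + fps_const c * (fps_X ^ p * (of_nat p * yh + fps_X * fps_deriv yh))"
        unfolding Xq euler_deriv_X_power_mult .
      show ?thesis unfolding dR unfolding R by (simp add: algebra_simps)
    qed
    have e2: "2 * fps_to_fls g * fps_to_fls \<nu> = fls_X * fls_deriv (fps_to_fls g)"
      using arg_cong[OF \<nu>, of fps_to_fls] by (simp add: fls_times_fps_to_fls fls_deriv_fps_to_fls)
    have "fps_to_fls (ev fps_const F (P1 + fps_const s * (fps_X * fps_deriv P1 - \<nu> * P1)) (P2 + fps_const s * (fps_X * fps_deriv P2 - \<nu> * P2)) (P3 + fps_const s * (fps_X * fps_deriv P3 - \<nu> * P3))) =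
      fps_to_fls (ev fps_const F (P1 + fps_const (-s) * (fps_X * fps_deriv P1 - \<nu> * P1)) (P2 + fps_const (-s) * (fps_X * fps_deriv P2 - \<nu> * P2)) (P3 + fps_const (-s) * (fps_X * fps_deriv P3 - \<nu> * P3)))"
    proof -
      have c: "fps_to_fls (R + fps_const s * (fps_X * fps_deriv R - \<nu> * R)) =
         fps_to_fls R + fls_const s * (fls_X * fls_deriv (fps_to_fls R) - fps_to_fls \<nu> * fps_to_fls R)" for s R
        by (simp add: fls_times_fps_to_fls fls_deriv_fps_to_fls)
      show ?thesis unfolding efls c
        using even[unfolded even_along_def, rule_format, OF f0 Q0 f1 e2[unfolded gfls]] .
    qed
    then show ?thesis unfolding F'_def es arg[OF P(1)] arg[OF P(2)] arg[OF P(3)] by simp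
  qed
  have Q'h: "homogeneous 2 Q'" unfolding Q'_def by (rule homogeneous_subst3[OF Q(1)])
  have Q'd: "\<not> double_line Q'"
  proof
    assume a: "double_line Q'"
    obtain u' v' w' where "\<And>F. subst3 u' v' w' (subst3 ?u ?v ?w F) = F" using subst3_inverse[OF det] by metis
    then have "Q = subst3 u' v' w' Q'" unfolding Q'_def by simp
    then show False using double_line_subst3[OF a, of u' v' w'] Q(2) by simp
  qed
  interpret even_branch F' Q' n q p w yh gh \<nu>
  proof
    show "homogeneous n F'" unfolding F'_def by (rule homogeneous_subst3[OF F(1)])
    show "F' \<noteq> 0" unfolding F'_def subst3_eq_0_iff[OF det] by (rule F(2))
    show "ev fps_const Q' 1 (fps_X ^ q) (fps_X ^ p * yh) = fps_X ^ w * gh" unfolding g_def[symmetric] by (rule gh(1))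
    show "2 * (fps_X ^ w * gh) * \<nu> = fps_X * fps_deriv (fps_X ^ w * gh)" using \<nu> unfolding gh(1)[symmetric] .
  qed (use F Q'h not_double_line_coeffs[OF Q'h Q'd] qp yh gh(2) zero evn in auto)
  show ?thesis
  proof (rule even_branch_cases)
    assume "p = 2 * q" "\<And>i. fps_nth yh i \<noteq> 0 \<Longrightarrow> q dvd i"
    then show ?thesis by blast
  next
    assume a: "p = 2 * q" "cf3 Q' 2 0 0 = 0" "cf3 Q' 1 1 0 = 0" "cf3 Q' 1 0 1 \<noteq> 0" "cf3 Q' 0 2 0 = - cf3 Q' 1 0 1"
      "\<And>j k. j + k \<le> n \<Longrightarrow> cf3 F' (n - j - k) j k \<noteq> 0 \<Longrightarrow> n \<le> j + 2 * k"
      "(\<Sum>(j,k)\<in>{(j,k). j + k \<le> n \<and> j + 2 * k = n}. cf3 F' (n - j - k) j k) = 0"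
    then have "osculating F Q n ?u ?v ?w" unfolding osculating_def F'_def[symmetric] Q'_def[symmetric] using det by blast
    then show ?thesis using a(1) by blast
  qed
qed

theorem place_regular:
  assumes F: "homogeneous n F" "F \<noteq> 0" "even n" and Q: "homogeneous 2 Q" "\<not> double_line Q"
    and f: "homogeneous d f" and even: "even_along f F Q" and fF: "f dvd F"
    and osc: "\<And>u1 u2 u3 v1 v2 v3 w1 w2 w3. osculating F Q n (u1,u2,u3) (v1,v2,v3) (w1,w2,w3) \<Longrightarrow> u3 = 0 \<and> v3 = 0"
    and XY: "fls_deriv X \<noteq> 0" "ev fls_const f Y X 1 = 0" "ev fls_const Q Y X 1 \<noteq> 0" "ev fls_const (pderiv f) Y X 1 \<noteq> 0"
    and ind: "\<And>p q r. fls_const p * Y + fls_const q * X + fls_const r * 1 = 0 \<Longrightarrow> p = 0 \<and> q = 0 \<and> r = 0"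
  shows "xd X (xd X Y) \<noteq> 0 \<and> 0 \<le> fls_subdegree (field_derivation.conic_invariant (xd X) (xd X (xd X Y)))"
proof -
  obtain G m q p yh u1 u2 u3 v1 v2 v3 w1 w2 w3 where G: "fps_nth G 0 = 0" "fps_nth G 1 \<noteq> 0" and m: "m \<noteq> 0"
    and qp: "0 < q" "q < p" and yh: "fps_nth yh 0 = 1" and det: "det3 (u1,u2,u3) (v1,v2,v3) (w1,w2,w3) \<noteq> 0"
    and C: "fls_compose_fps Y G = m * fps_to_fls (fps_const u1 + fps_const v1 * fps_X ^ q + fps_const w1 * (fps_X ^ p * yh))"
      "fls_compose_fps X G = m * fps_to_fls (fps_const u2 + fps_const v2 * fps_X ^ q + fps_const w2 * (fps_X ^ p * yh))"
      "fls_compose_fps 1 G = m * fps_to_fls (fps_const u3 + fps_const v3 * fps_X ^ q + fps_const w3 * (fps_X ^ p * yh))"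
    by (rule adapted_frame[OF ind]) (assumption, rule that)
  have Gnz: "G \<noteq> 0" using G by auto
  note rh = ring_hom_fun_compose_fls[OF Gnz G(1)]
  define P1 where "P1 = fps_const u1 + fps_const v1 * fps_X ^ q + fps_const w1 * (fps_X ^ p * yh)"
  define P2 where "P2 = fps_const u2 + fps_const v2 * fps_X ^ q + fps_const w2 * (fps_X ^ p * yh)"
  define P3 where "P3 = fps_const u3 + fps_const v3 * fps_X ^ q + fps_const w3 * (fps_X ^ p * yh)"
  note C' = C[folded P1_def P2_def P3_def]
  have sc: "fls_compose_fps (ev fls_const H Y X 1) G = m ^ k * ev fls_const H (fps_to_fls P1) (fps_to_fls P2) (fps_to_fls P3)"
    if "homogeneous k H" for H k
    unfolding ev_hom[OF rh ring_hom_fun_fls_const] C' fls_compose_fps_const by (rule ev_scale[OF ring_hom_fun_fls_const that])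
  have f0: "ev fls_const f (fps_to_fls P1) (fps_to_fls P2) (fps_to_fls P3) = 0"
    using sc[OF f] XY(2) m by simp
  have Q0: "ev fls_const Q (fps_to_fls P1) (fps_to_fls P2) (fps_to_fls P3) \<noteq> 0"
    using sc[OF Q(1)] XY(3) Gnz G(1) fls_compose_fps_eq_0_iff[of G "ev fls_const Q Y X 1"] by auto
  have f1: "ev fls_const (pderiv f) (fps_to_fls P1) (fps_to_fls P2) (fps_to_fls P3) \<noteq> 0"
    using sc[OF homogeneous_pderiv[OF f]] XY(4) Gnz G(1) fls_compose_fps_eq_0_iff[of G "ev fls_const (pderiv f) Y X 1"] by auto
  have br: "p = 2 * q \<and> ((\<forall>i. fps_nth yh i \<noteq> 0 \<longrightarrow> q dvd i) \<or> osculating F Q n (u1,u2,u3) (v1,v2,v3) (w1,w2,w3))"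
    by (rule branch_cases[OF F Q even fF qp yh det P1_def P2_def P3_def f0 Q0 f1])
  then have p: "p = 2 * q" by simp
  have reg: "(\<forall>i. fps_nth yh i \<noteq> 0 \<longrightarrow> q dvd i) \<or> (u3 = 0 \<and> v3 = 0)" using br osc by blast
  define y where "y = fls_X ^ (2 * q) * fps_to_fls yh"
  have Pf: "fps_to_fls (fps_const a + fps_const b * fps_X ^ q + fps_const c * (fps_X ^ p * yh)) =
     fls_const a + fls_const b * fls_X ^ q + fls_const c * y" for a b c
    by (simp add: y_def p fls_times_fps_to_fls fps_to_fls_power)
  define b where "b = fls_const u1 + fls_const v1 * fls_X ^ q + fls_const w1 * y"
  define a where "a = fls_const u2 + fls_const v2 * fls_X ^ q + fls_const w2 * y"
  define l where "l = fls_const u3 + fls_const v3 * fls_X ^ q + fls_const w3 * y"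
  have ml: "m * l = 1" using C(3) unfolding Pf l_def by simp
  then have l: "l \<noteq> 0" by auto
  have ml': "m = 1 / l" using ml l by (simp add: field_simps)
  have Xc: "fls_compose_fps X G = a / l" unfolding C(2) Pf a_def[symmetric] ml' by simp
  have Yc: "fls_compose_fps Y G = b / l" unfolding C(1) Pf b_def[symmetric] ml' by simp
  have Xd: "fls_deriv (a / l) \<noteq> 0"
  proof -
    have "fps_deriv G \<noteq> 0" using G fps_deriv_eq_0_iff[of G] by (metis fps_nth_fps_const zero_neq_one)
    then show ?thesis unfolding Xc[symmetric] using deriv_compose_fls[OF Gnz G(1), of X] XY(1) Gnz G(1)
      by (simp add: fls_compose_fps_eq_0_iff)
  qed
  note B = conic_invariant_branch[OF qp(1) yh det l[unfolded l_def y_def] Xd[unfolded a_def l_def y_def] reg, folded y_def, folded a_def b_def l_def]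
  have dc: "xd (a / l) (fls_compose_fps z G) = fls_compose_fps (xd X z) G" for z
    unfolding Xc[symmetric] by (rule xd_compose[OF Gnz G(1)])
  have N: "xd (a / l) (xd (a / l) (b / l)) = fls_compose_fps (xd X (xd X Y)) G"
    unfolding Yc[symmetric] dc ..
  have num: "fls_compose_fps (numeral k) G = (numeral k :: complex fls)" for k
    using ring_hom_fun_of_nat[OF rh, of "numeral k"] by simp
  have "field_derivation.conic_invariant (xd (a / l)) (xd (a / l) (xd (a / l) (b / l))) =
     fls_compose_fps (field_derivation.conic_invariant (xd X) (xd X (xd X Y))) G"
    unfolding N field_derivation.conic_invariant_def[OF field_derivation_xd] dc
    unfolding fls_compose_fps_divide[OF Gnz G(1)] ring_hom_fun_simps[OF rh] num ..
  then have "0 \<le> fls_subdegree (fls_compose_fps (field_derivation.conic_invariant (xd X) (xd X (xd X Y))) G)"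
    using B(2) by simp
  then have "0 \<le> fls_subdegree (field_derivation.conic_invariant (xd X) (xd X (xd X Y))) * int (subdegree G)"
    using Gnz G(1) by simp
  moreover have "subdegree G = 1" using G by (intro subdegreeI) auto
  moreover have "xd X (xd X Y) \<noteq> 0" using B(1) unfolding N by auto
  ultimately show ?thesis by simp
qed

section \<open>Uniqueness of the osculation point\<close>

lemma ring_hom_fun_fps_of_poly: "ring_hom_fun (fps_of_poly :: complex poly \<Rightarrow> complex fps)"
  by (auto simp: ring_hom_fun_def fps_of_poly_add fps_of_poly_mult)

lemma osculation_restriction:
  assumes F: "homogeneous n F" and W: "\<And>j k. j + k \<le> n \<Longrightarrow> cf3 F (n - j - k) j k \<noteq> 0 \<Longrightarrow> n \<le> j + 2 * k"
    and sum: "(\<Sum>(j,k)\<in>{(j,k). j + k \<le> n \<and> j + 2 * k = n}. cf3 F (n - j - k) j k) = 0"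
    and c: "c * \<gamma>2 = \<beta>1 ^ 2"
  shows "monom 1 (Suc n) dvd ev (\<lambda>c. [:c:]) F [:c, \<beta>0, \<gamma>0:] [:0, \<beta>1, \<gamma>1:] [:0, 0, \<gamma>2:]"
proof -
  define p where "p = ev (\<lambda>c. [:c:]) F [:c, \<beta>0, \<gamma>0:] [:0, \<beta>1, \<gamma>1:] [:0, 0, \<gamma>2:]"
  define v0 where "v0 = fps_of_poly [:c, \<beta>0, \<gamma>0:]"
  define v1 where "v1 = fps_of_poly [:\<beta>1, \<gamma>1:]"
  define v2 where "v2 = fps_of_poly [:\<gamma>2:]"
  have P: "[:0, \<beta>1, \<gamma>1:] = [:0, 1:] ^ 1 * [:\<beta>1, \<gamma>1:]" "[:0, 0, \<gamma>2:] = [:0, 1:] ^ 2 * [:\<gamma>2:]"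
    by (simp_all add: power2_eq_square)
  have X: "fps_of_poly ([:0, 1:] ^ k * q) = fps_X ^ k * fps_of_poly q" for k and q :: "complex poly"
    by (simp add: fps_of_poly_mult fps_of_poly_power)
  have p: "fps_of_poly p = ev fps_const F v0 (fps_X ^ 1 * v1) (fps_X ^ 2 * v2)"
    unfolding p_def ev_hom[OF ring_hom_fun_fps_of_poly ring_hom_fun_pCons_const] P X v0_def v1_def v2_def fps_of_poly_const ..
  obtain G where G: "fps_of_poly p = fps_X ^ n * G" and G0: "fps_nth G 0 = qterm (\<lambda>x. x) (\<lambda>j k. cf3 F (n - j - k) j k) n 1 2 n (fps_nth v0 0) (fps_nth v1 0) (fps_nth v2 0)"
    using ev_weighted[OF F, of n 1 2 v0 v1 v2] W unfolding p by auto
  have "fps_nth G 0 = (\<Sum>(j,k)\<in>{(j,k). j + k \<le> n \<and> j + 2 * k = n}. \<beta>1 ^ n * cf3 F (n - j - k) j k)"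
    unfolding G0 qterm_def
  proof (intro sum.cong)
    fix x assume "x \<in> {(j,k). j + k \<le> n \<and> j + 2 * k = n}"
    then obtain j k where x: "x = (j, k)" "j + 2 * k = n" by auto
    then have nk: "n - j - k = k" by simp
    have "c ^ k * \<beta>1 ^ j * \<gamma>2 ^ k = \<beta>1 ^ n"
    proof -
      have "c ^ k * \<beta>1 ^ j * \<gamma>2 ^ k = (c * \<gamma>2) ^ k * \<beta>1 ^ j" by (simp add: power_mult_distrib)
      also have "\<dots> = \<beta>1 ^ (2 * k + j)" unfolding c by (simp add: power_add power_mult)
      finally show ?thesis using x(2) by (simp add: add.commute)
    qed
    then show "(case x of (j, k) \<Rightarrow> cf3 F (n - j - k) j k * fps_nth v0 0 ^ (n - j - k) * fps_nth v1 0 ^ j * fps_nth v2 0 ^ k) =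
       (case x of (j, k) \<Rightarrow> \<beta>1 ^ n * cf3 F (n - j - k) j k)"
      unfolding x(1) prod.case nk v0_def v1_def v2_def by (simp add: mult_ac)
  qed simp
  also have "\<dots> = \<beta>1 ^ n * (\<Sum>(j,k)\<in>{(j,k). j + k \<le> n \<and> j + 2 * k = n}. cf3 F (n - j - k) j k)"
    by (simp add: sum_distrib_left case_prod_unfold)
  finally have "fps_nth G 0 = 0" using sum by simp
  have "coeff p i = 0" if "i < Suc n" for i
  proof -
    have "coeff p i = fps_nth (fps_X ^ n * G) i" unfolding G[symmetric] by simp
    also have "\<dots> = 0" using that \<open>fps_nth G 0 = 0\<close> by (auto simp: fps_X_power_mult_nth)
    finally show ?thesis .
  qed
  then show ?thesis unfolding p_def[symmetric] by (simp add: monom_1_dvd_iff')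
qed

text \<open>
  Two osculation points, placed at \<open>s = 0\<close> and \<open>s = \<infinity>\<close> of a parametrization of the conic: the
  restriction of \<open>F\<close> is a form of degree \<open>2 n\<close> with two zeros of order greater than \<open>n\<close>.
\<close>

lemma form_with_two_high_zeros:
  fixes p p' :: "complex poly"
  assumes "monom 1 (Suc n) dvd p" "monom 1 (Suc n) dvd p'"
    and rec: "\<And>s. s \<noteq> 0 \<Longrightarrow> poly p' s = s ^ (2 * n) * poly p (1 / s)"
  shows "p = 0"
proof -
  obtain P where P: "p = monom 1 (Suc n) * P" using assms(1) by (auto elim: dvdE)
  obtain P' where P': "p' = monom 1 (Suc n) * P'" using assms(2) by (auto elim: dvdE)
  have "poly (reflect_poly P) s = poly (monom 1 (degree P + 2) * P') s" if s: "s \<noteq> 0" for s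
  proof -
    have "s ^ Suc n * poly P' s = s ^ (2 * n) * ((1 / s) ^ Suc n * poly P (1 / s))"
      using rec[OF s] by (simp add: P P' poly_monom)
    then have "(s ^ n * s ^ n) * (s ^ 2 * poly P' s) = (s ^ n * s ^ n) * poly P (1 / s)"
      using s by (simp add: field_simps power2_eq_square mult_2 mult_2_right power_add)
    moreover have "s ^ n * s ^ n \<noteq> 0" using s by simp
    ultimately have "s ^ 2 * poly P' s = poly P (1 / s)" using mult_left_cancel by blast
    then have "s ^ degree P * poly P (inverse s) = s ^ degree P * (s ^ 2 * poly P' s)" unfolding inverse_eq_divide by (simp only: )
    then show ?thesis unfolding poly_reflect_poly_nz[OF s] poly_mult poly_monom power_add mult_1_left mult.assoc .
  qed
  then have "poly ([:0, 1:] * (reflect_poly P - monom 1 (degree P + 2) * P')) s = 0" for s by (cases "s = 0") auto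
  then have "[:0, 1:] * (reflect_poly P - monom 1 (degree P + 2) * P') = 0" by (subst poly_all_0_iff_0[symmetric]) blast
  then have "reflect_poly P = monom 1 (degree P + 2) * P'" by (simp only: mult_eq_0_iff pCons_eq_0_iff) auto
  then have "coeff (reflect_poly P) 0 = 0" by (simp add: coeff_monom_mult)
  then have "P = 0" by simp
  then show ?thesis by (simp add: P)
qed

lemma ev_conic: "ev (\<lambda>x. x) [:- [:0, [:0, 1:]:], 0, 1:] a b c = a ^ 2 - b * c"
proof -
  note [simp] = ring_hom_fun_simps[OF ring_hom_fun_peval[OF ring_hom_fun_peval[OF ring_hom_fun_id]]] ring_hom_fun_simps[OF ring_hom_fun_peval[OF ring_hom_fun_id]]
  show ?thesis by (simp add: ev_def peval_pCons power2_eq_square algebra_simps del: minus_pCons)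
qed

lemma conic_dvd_of_vanishing:
  fixes F :: poly3
  assumes F: "\<And>s t. ev (\<lambda>x. x) F (s * t) (s ^ 2) (t ^ 2) = 0"
  shows "[:- [:0, [:0, 1:]:], 0, 1:] dvd F"
proof -
  define q :: poly3 where "q = [:- [:0, [:0, 1:]:], 0, 1:]"
  have q: "lead_coeff q = 1" "degree q > 0" "degree q = 2" by (simp_all add: q_def)
  obtain r where r: "q dvd F - r" "degree r < 2" using monic_remainder[OF q(1,2), of F] q(3) by auto
  have evq: "ev (\<lambda>x. x) q a b c = a ^ 2 - b * c" for a b c
    unfolding q_def by (rule ev_conic)
  have evr: "ev (\<lambda>x. x) r (s * t) (s ^ 2) (t ^ 2) = 0" for s t
  proof -
    have "ev (\<lambda>x. x) q (s * t) (s ^ 2) (t ^ 2) = 0" unfolding evq by (simp add: power_mult_distrib)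
    then have "ev (\<lambda>x. x) (F - r) (s * t) (s ^ 2) (t ^ 2) = 0" by (rule ring_hom_fun_dvd[OF ring_hom_fun_ev[OF ring_hom_fun_id] r(1)])
    then show ?thesis using F[of s t] by (simp add: ev_simps[OF ring_hom_fun_id])
  qed
  define E where "E g b c = peval (peval (\<lambda>x. x) c) b g" for g :: "complex poly poly" and b c
  obtain A B where AB: "r = [:A, B:]"
  proof -
    have "r = [:coeff r 0, coeff r 1:]"
      by (rule poly_eqI) (use r(2) in \<open>auto simp: coeff_pCons coeff_eq_0 split: nat.splits\<close>)
    then show ?thesis by (rule that)
  qed
  have er: "ev (\<lambda>x. x) r a b c = E A b c + a * E B b c" for a b c
    unfolding ev_def AB E_def by (simp add: peval_pCons ring_hom_fun_peval)
  have AB0: "E A b c = 0 \<and> csqrt b * csqrt c * E B b c = 0" for b c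
  proof -
    have "E A b c + csqrt b * csqrt c * E B b c = 0" using evr[of "csqrt b" "csqrt c"] unfolding er by simp
    moreover have "E A b c - csqrt b * csqrt c * E B b c = 0" using evr[of "- csqrt b" "csqrt c"] unfolding er by simp
    ultimately show ?thesis by (auto simp: add_eq_0_iff2)
  qed
  have rh: "ring_hom_fun (\<lambda>g. E g b c)" for b c unfolding E_def by (intro ring_hom_fun_peval) simp
  have "lin3 0 1 0 * lin3 0 0 1 * r = 0"
  proof (rule ev_eq_0_iff)
    fix a b c
    have "b * c * E B b c = (csqrt b * csqrt c) * (csqrt b * csqrt c * E B b c)"
      by (simp add: power2_eq_square[symmetric] power_mult_distrib[symmetric] mult_ac)
    then have "b * c * E B b c = 0" using AB0[of b c] by simp
    then show "ev (\<lambda>x. x) (lin3 0 1 0 * lin3 0 0 1 * r) a b c = 0"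
      using AB0[of b c] by (simp add: ev_simps[OF ring_hom_fun_id] ev_lin3[OF ring_hom_fun_id] er algebra_simps)
  qed
  moreover have "lin3 0 1 0 \<noteq> 0" "lin3 0 0 1 \<noteq> 0" by (simp_all add: lin3_def)
  ultimately have "r = 0" by simp
  then show ?thesis using r(1) unfolding q_def by simp
qed

lemma osculating_tangent:
  assumes F: "homogeneous n F" and Q: "homogeneous 2 Q" "\<not> Q dvd F"
    and o1: "osculating F Q n u v w" and o2: "osculating F Q n u' v' w'"
  shows "det3 u v u' = 0 \<and> det3 u v v' = 0"
proof -
  have det: "det3 u v w \<noteq> 0" "det3 u' v' w' \<noteq> 0" using o1 o2 by (auto simp: osculating_def)
  define F1 where "F1 = subst3 u v w F"
  define Q1 where "Q1 = subst3 u v w Q"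
  obtain ui vi wi where inv: "\<And>x. lc3 u v w (lc3 ui vi wi x) = x" "\<And>F. subst3 ui vi wi (subst3 u v w F) = F" using subst3_inverse[OF det(1)] by metis
  obtain a0 a1 a2 where a: "u' = lc3 u v w (a0,a1,a2)" using inv(1) by (metis prod_cases3)
  obtain b0 b1 b2 where b: "v' = lc3 u v w (b0,b1,b2)" using inv(1) by (metis prod_cases3)
  obtain c0 c1 c2 where c: "w' = lc3 u v w (c0,c1,c2)" using inv(1) by (metis prod_cases3)
  have d2: "det3 (a0,a1,a2) (b0,b1,b2) (c0,c1,c2) \<noteq> 0" using det unfolding a b c det3_lc3 by simp
  define F2 where "F2 = subst3 (a0,a1,a2) (b0,b1,b2) (c0,c1,c2) F1"
  define Q2 where "Q2 = subst3 (a0,a1,a2) (b0,b1,b2) (c0,c1,c2) Q1"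
  have F2': "F2 = subst3 u' v' w' F" "Q2 = subst3 u' v' w' Q" unfolding F2_def Q2_def F1_def Q1_def subst3_subst3 a b c by (rule refl)+
  note hom = homogeneous_subst3[OF F, of u v w, folded F1_def] homogeneous_subst3[OF Q(1), of u v w, folded Q1_def]
    homogeneous_subst3[OF F, of u' v' w', folded F2'] homogeneous_subst3[OF Q(1), of u' v' w', folded F2']
  note O1 = o1[unfolded osculating_def F1_def[symmetric] Q1_def[symmetric]]
  note O2 = o2[unfolded osculating_def F2'[symmetric]]
  define k1 where "k1 = cf3 Q1 1 0 1"
  define d1 where "d1 = cf3 Q1 0 1 1"
  define e1 where "e1 = cf3 Q1 0 0 2"
  define k2 where "k2 = cf3 Q2 1 0 1"
  define d2 where "d2 = cf3 Q2 0 1 1"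
  define e2 where "e2 = cf3 Q2 0 0 2"
  have k: "k1 \<noteq> 0" "k2 \<noteq> 0" using O1 O2 by (auto simp: k1_def k2_def)
  have q1: "ev (\<lambda>x. x) Q1 x y z = k1 * (x * z - y ^ 2) + d1 * y * z + e1 * z ^ 2" for x y z
    unfolding ev_quadratic[OF ring_hom_fun_id hom(2)] using O1 by (simp add: k1_def d1_def e1_def algebra_simps)
  have q2: "ev (\<lambda>x. x) Q2 x y z = k2 * (x * z - y ^ 2) + d2 * y * z + e2 * z ^ 2" for x y z
    unfolding ev_quadratic[OF ring_hom_fun_id hom(4)] using O2 by (simp add: k2_def d2_def e2_def algebra_simps)
  have q21: "ev (\<lambda>x. x) Q2 x y z = ev (\<lambda>x. x) Q1 (a0 * x + b0 * y + c0 * z) (a1 * x + b1 * y + c1 * z) (a2 * x + b2 * y + c2 * z)" for x y z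
    unfolding Q2_def by (rule ev_subst3[OF ring_hom_fun_id])
  have qa: "k1 * (a0 * a2 - a1 ^ 2) + d1 * a1 * a2 + e1 * a2 ^ 2 = 0"
    using q21[of 1 0 0] unfolding q1 q2 by simp
  have "a2 = 0"
  proof (rule ccontr)
    assume a2: "a2 \<noteq> 0"
    define r where "r = (2 * k1 * a1 / a2 - d1) / k1"
    have lcs: "\<exists>x y z. a0 * x + b0 * y + c0 * z = X \<and> a1 * x + b1 * y + c1 * z = Y \<and> a2 * x + b2 * y + c2 * z = Z" for X Y Z
    proof -
      obtain ui vi wi where "\<And>x. lc3 (a0,a1,a2) (b0,b1,b2) (c0,c1,c2) (lc3 ui vi wi x) = x" using subst3_inverse[OF \<open>det3 (a0,a1,a2) (b0,b1,b2) (c0,c1,c2) \<noteq> 0\<close>] by metis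
      then have "\<exists>t. lc3 (a0,a1,a2) (b0,b1,b2) (c0,c1,c2) t = (X,Y,Z)" by metis
      then show ?thesis by (auto simp: lc3_def)
    qed
    obtain x0 x1 x2 where x: "a0 * x0 + b0 * x1 + c0 * x2 = r" "a1 * x0 + b1 * x1 + c1 * x2 = 1" "a2 * x0 + b2 * x1 + c2 * x2 = 0" using lcs by blast
    obtain y0 y1 y2 where y: "a0 * y0 + b0 * y1 + c0 * y2 = 1" "a1 * y0 + b1 * y1 + c1 * y2 = 0" "a2 * y0 + b2 * y1 + c2 * y2 = 0" using lcs by blast
    have kr: "k1 * r = 2 * k1 * a1 / a2 - d1" using k by (simp add: r_def)
    have krr: "k1 * r * a2 = 2 * k1 * a1 - d1 * a2" unfolding kr using a2 by (simp add: field_simps)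
    have "x2 = 0"
    proof -
      have "ev (\<lambda>x. x) Q2 (1 + x0) x1 x2 - ev (\<lambda>x. x) Q2 1 0 0 - ev (\<lambda>x. x) Q2 x0 x1 x2 = k2 * x2"
        unfolding q2 by (simp add: algebra_simps)
      moreover have "ev (\<lambda>x. x) Q2 (1 + x0) x1 x2 - ev (\<lambda>x. x) Q2 1 0 0 - ev (\<lambda>x. x) Q2 x0 x1 x2 =
         ev (\<lambda>x. x) Q1 (a0 + r) (a1 + 1) a2 - ev (\<lambda>x. x) Q1 a0 a1 a2 - ev (\<lambda>x. x) Q1 r 1 0"
      proof -
        have e: "a0 * (1 + x0) + b0 * x1 + c0 * x2 = a0 + (a0 * x0 + b0 * x1 + c0 * x2)"
          "a1 * (1 + x0) + b1 * x1 + c1 * x2 = a1 + (a1 * x0 + b1 * x1 + c1 * x2)"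
          "a2 * (1 + x0) + b2 * x1 + c2 * x2 = a2 + (a2 * x0 + b2 * x1 + c2 * x2)" by (simp_all add: algebra_simps)
        show ?thesis unfolding q21 e unfolding x by simp
      qed
      moreover have "\<dots> = k1 * r * a2 - 2 * k1 * a1 + d1 * a2"
        unfolding q1 by (simp add: algebra_simps power2_eq_square)
      ultimately have "k2 * x2 = 0" using krr by simp
      then show ?thesis using k by simp
    qed
    have rel: "1 / a2 * y2 = x1 ^ 2"
    proof -
      have "ev (\<lambda>x. x) Q2 x0 x1 x2 + ev (\<lambda>x. x) Q2 (1 / a2 + y0) y1 y2 - ev (\<lambda>x. x) Q2 (1 / a2) 0 0 - ev (\<lambda>x. x) Q2 y0 y1 y2
         = k2 * (1 / a2 * y2 - x1 ^ 2)"
        unfolding q2 \<open>x2 = 0\<close> by (simp add: algebra_simps)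
      moreover have "ev (\<lambda>x. x) Q2 x0 x1 x2 + ev (\<lambda>x. x) Q2 (1 / a2 + y0) y1 y2 - ev (\<lambda>x. x) Q2 (1 / a2) 0 0 - ev (\<lambda>x. x) Q2 y0 y1 y2
         = ev (\<lambda>x. x) Q1 r 1 0 + ev (\<lambda>x. x) Q1 (a0 / a2 + 1) (a1 / a2) 1 - ev (\<lambda>x. x) Q1 (a0 / a2) (a1 / a2) 1 - ev (\<lambda>x. x) Q1 1 0 0"
      proof -
        have e: "a0 * (1 / a2 + y0) + b0 * y1 + c0 * y2 = a0 / a2 + (a0 * y0 + b0 * y1 + c0 * y2)"
          "a1 * (1 / a2 + y0) + b1 * y1 + c1 * y2 = a1 / a2 + (a1 * y0 + b1 * y1 + c1 * y2)"
          "a2 * (1 / a2 + y0) + b2 * y1 + c2 * y2 = 1 + (a2 * y0 + b2 * y1 + c2 * y2)" using a2 by (simp_all add: algebra_simps)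
        show ?thesis unfolding q21 e unfolding x y using a2 by simp
      qed
      moreover have "\<dots> = 0" unfolding q1 by (simp add: algebra_simps)
      ultimately show ?thesis using k by simp
    qed
    define p where "p = ev (\<lambda>c. [:c:]) F1 [:1, r, a0 / a2:] [:0, 1, a1 / a2:] [:0, 0, 1:]"
    define p' where "p' = ev (\<lambda>c. [:c:]) F2 [:1 / a2, x0, y0:] [:0, x1, y1:] [:0, 0, y2:]"
    have pp: "poly (ev (\<lambda>c. [:c:]) H A B C) s = ev (\<lambda>x. x) H (poly A s) (poly B s) (poly C s)" for H A B C and s :: complex
      by (subst ev_hom[OF ring_hom_fun_poly ring_hom_fun_pCons_const]) simp
    have m: "monom 1 (Suc n) dvd p" "monom 1 (Suc n) dvd p'"
      unfolding p_def p'_def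
      by (rule osculation_restriction; use O1 O2 hom rel in simp)+
    have ps: "poly p s = ev (\<lambda>x. x) F1 (1 + s * r + s ^ 2 * (a0 / a2)) (s + s ^ 2 * (a1 / a2)) (s ^ 2)" for s
      unfolding p_def pp by (simp add: algebra_simps power2_eq_square)
    have ps': "poly p' s = ev (\<lambda>x. x) F1 (a0 / a2 + s * r + s ^ 2) (a1 / a2 + s) 1" for s
    proof -
      have e: "a0 * (1 / a2 + s * x0 + s ^ 2 * y0) + b0 * (s * x1 + s ^ 2 * y1) + c0 * (s ^ 2 * y2) = a0 / a2 + s * (a0 * x0 + b0 * x1 + c0 * x2) + s ^ 2 * (a0 * y0 + b0 * y1 + c0 * y2)"
        "a1 * (1 / a2 + s * x0 + s ^ 2 * y0) + b1 * (s * x1 + s ^ 2 * y1) + c1 * (s ^ 2 * y2) = a1 / a2 + s * (a1 * x0 + b1 * x1 + c1 * x2) + s ^ 2 * (a1 * y0 + b1 * y1 + c1 * y2)"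
        "a2 * (1 / a2 + s * x0 + s ^ 2 * y0) + b2 * (s * x1 + s ^ 2 * y1) + c2 * (s ^ 2 * y2) = 1 + s * (a2 * x0 + b2 * x1 + c2 * x2) + s ^ 2 * (a2 * y0 + b2 * y1 + c2 * y2)"
        using a2 \<open>x2 = 0\<close> by (simp_all add: algebra_simps)
      have pe: "poly [:1 / a2, x0, y0:] s = 1 / a2 + s * x0 + s ^ 2 * y0" "poly [:0, x1, y1:] s = s * x1 + s ^ 2 * y1" "poly [:0, 0, y2:] s = s ^ 2 * y2"
        by (simp_all add: algebra_simps power2_eq_square)
      show ?thesis unfolding p'_def pp pe F2_def ev_subst3[OF ring_hom_fun_id] e unfolding x y by simp
    qed
    have "poly p' s = s ^ (2 * n) * poly p (1 / s)" if s: "s \<noteq> 0" for s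
    proof -
      have "(s ^ 2) ^ n * poly p (1 / s) = ev (\<lambda>x. x) F1 (s ^ 2 * (1 + 1 / s * r + (1 / s) ^ 2 * (a0 / a2))) (s ^ 2 * (1 / s + (1 / s) ^ 2 * (a1 / a2))) (s ^ 2 * (1 / s) ^ 2)"
        unfolding ps by (rule ev_scale[OF ring_hom_fun_id hom(1), symmetric])
      also have "s ^ 2 * (1 + 1 / s * r + (1 / s) ^ 2 * (a0 / a2)) = a0 / a2 + s * r + s ^ 2" using s by (simp add: field_simps power2_eq_square)
      also have "s ^ 2 * (1 / s + (1 / s) ^ 2 * (a1 / a2)) = a1 / a2 + s" using s by (simp add: field_simps power2_eq_square)
      also have "s ^ 2 * (1 / s) ^ 2 = 1" using s by (simp add: field_simps)
      finally show ?thesis unfolding ps' by (simp add: power_mult)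
    qed
    then have p0: "p = 0" using m by (intro form_with_two_high_zeros)
    have "poly p' s = 0" if "s \<noteq> 0" for s using \<open>\<And>s. s \<noteq> 0 \<Longrightarrow> poly p' s = s ^ (2 * n) * poly p (1 / s)\<close>[OF that] p0 by simp
    then have "poly ([:0, 1:] * p') s = 0" for s by (cases "s = 0") auto
    then have p'0: "p' = 0" by (metis mult_eq_0_iff pCons_eq_0_iff poly_all_0_iff_0 zero_neq_one)
    define F3 where "F3 = subst3 (r,1,0) (1,0,0) (a0 / a2, a1 / a2, 1) F1"
    define Q3 where "Q3 = subst3 (r,1,0) (1,0,0) (a0 / a2, a1 / a2, 1) Q1"
    have d3: "det3 (r,1,0) (1,0,0) (a0 / a2, a1 / a2, 1) \<noteq> 0" by (simp add: det3_def)
    have F3: "ev (\<lambda>x. x) F3 (s * t) (s ^ 2) (t ^ 2) = 0" for s t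
    proof -
      have e: "ev (\<lambda>x. x) F3 (s * t) (s ^ 2) (t ^ 2) = ev (\<lambda>x. x) F1 (r * (s * t) + s ^ 2 + a0 / a2 * t ^ 2) (s * t + a1 / a2 * t ^ 2) (t ^ 2)"
        unfolding F3_def ev_subst3[OF ring_hom_fun_id] by simp
      show ?thesis
      proof (cases "t = 0")
        case True
        have "ev (\<lambda>x. x) F1 (s ^ 2 * 1) (s ^ 2 * 0) (s ^ 2 * 0) = 0"
          unfolding ev_scale[OF ring_hom_fun_id hom(1)] using ps[of 0] p0 by simp
        then show ?thesis unfolding e unfolding True by simp
      next
        case False
        define k where "k = s / t"
        have s: "s = k * t" using False by (simp add: k_def)
        have "ev (\<lambda>x. x) F1 (t ^ 2 * (a0 / a2 + k * r + k ^ 2)) (t ^ 2 * (a1 / a2 + k)) (t ^ 2 * 1) = 0"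
          unfolding ev_scale[OF ring_hom_fun_id hom(1)] using ps'[of k] p'0 by simp
        moreover have "t ^ 2 * (a0 / a2 + k * r + k ^ 2) = r * (s * t) + s ^ 2 + a0 / a2 * t ^ 2"
          "t ^ 2 * (a1 / a2 + k) = s * t + a1 / a2 * t ^ 2" unfolding s by (simp_all add: algebra_simps power2_eq_square)
        ultimately show ?thesis unfolding e by simp
      qed
    qed
    have dv: "[:- [:0, [:0, 1:]:], 0, 1:] dvd F3" by (rule conic_dvd_of_vanishing[OF F3])
    have "Q3 = const3 (- k1) * [:- [:0, [:0, 1:]:], 0, 1:]"
    proof (rule poly3_ev_eqI)
      fix x y z
      define A0 A1 where "A0 = a0 / a2" and "A1 = a1 / a2"
      have A: "a0 = A0 * a2" "a1 = A1 * a2" using a2 by (simp_all add: A0_def A1_def)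
      have "a2 ^ 2 * (k1 * (A0 - A1 ^ 2) + d1 * A1 + e1) = 0" using qa unfolding A by (simp add: algebra_simps power2_eq_square)
      then have qA: "k1 * (A0 - A1 ^ 2) + d1 * A1 + e1 = 0" using a2 by simp
      have kA: "k1 * r = 2 * k1 * A1 - d1" unfolding kr A1_def by simp
      have "ev (\<lambda>x. x) Q3 x y z = k1 * ((r * x + y + A0 * z) * z - (x + A1 * z) ^ 2) + d1 * (x + A1 * z) * z + e1 * z ^ 2"
        unfolding Q3_def ev_subst3[OF ring_hom_fun_id] q1 A0_def A1_def by simp
      also have "\<dots> = (k1 * r) * x * z - 2 * k1 * A1 * x * z + d1 * x * z + (k1 * (A0 - A1 ^ 2) + d1 * A1 + e1) * z ^ 2 - k1 * (x ^ 2 - y * z)"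
        by (simp add: algebra_simps power2_eq_square)
      also have "\<dots> = - k1 * (x ^ 2 - y * z)" unfolding qA kA by (simp add: algebra_simps)
      finally show "ev (\<lambda>x. x) Q3 x y z = ev (\<lambda>x. x) (const3 (- k1) * [:- [:0, [:0, 1:]:], 0, 1:]) x y z"
        unfolding ev_simps(4)[OF ring_hom_fun_id] ev_conic ev_const3[OF ring_hom_fun_id] .
    qed
    moreover have "const3 (- k1) * const3 (- 1 / k1) = 1"
    proof -
      have "const3 (- k1) * const3 (- 1 / k1) = const3 (- k1 * (- 1 / k1))" by (rule ring_hom_fun_simps(4)[OF ring_hom_fun_const3, symmetric])
      also have "- k1 * (- 1 / k1) = 1" using k by simp
      finally show ?thesis by (simp only: ring_hom_fun_simps(2)[OF ring_hom_fun_const3])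
    qed
    then have "is_unit (const3 (- k1))" by (rule dvdI[OF sym])
    ultimately have "Q3 dvd F3" using dv by (simp only: mult_unit_dvd_iff')
    then have "Q1 dvd F1"
    proof -
      obtain u3 v3 w3 where i3: "\<And>F. subst3 u3 v3 w3 (subst3 (r,1,0) (1,0,0) (a0 / a2, a1 / a2, 1) F) = F" using subst3_inverse[OF d3] by metis
      obtain K where "F3 = Q3 * K" using \<open>Q3 dvd F3\<close> by (auto elim: dvdE)
      then have "subst3 u3 v3 w3 F3 = subst3 u3 v3 w3 Q3 * subst3 u3 v3 w3 K" by (simp add: ring_hom_fun_simps[OF ring_hom_fun_subst3])
      then show ?thesis unfolding F3_def Q3_def i3 by simp
    qed
    then obtain K where "F1 = Q1 * K" by (auto elim: dvdE)
    then have "subst3 ui vi wi F1 = subst3 ui vi wi Q1 * subst3 ui vi wi K" by (simp add: ring_hom_fun_simps[OF ring_hom_fun_subst3])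
    then have "Q dvd F" unfolding F1_def Q1_def inv by simp
    then show False using Q(2) by contradiction
  qed
  then have a1: "a1 = 0" using qa k by simp
  have a0: "a0 \<noteq> 0"
  proof
    assume "a0 = 0"
    then have "det3 (a0,a1,a2) (b0,b1,b2) (c0,c1,c2) = 0" using a1 \<open>a2 = 0\<close> by (simp add: det3_def)
    then show False using \<open>det3 (a0,a1,a2) (b0,b1,b2) (c0,c1,c2) \<noteq> 0\<close> by contradiction
  qed
  have "k1 * a0 * b2 = ev (\<lambda>x. x) Q2 1 1 0 - ev (\<lambda>x. x) Q2 1 0 0 - ev (\<lambda>x. x) Q2 0 1 0"
    unfolding q21 q1 a1 \<open>a2 = 0\<close> by (simp add: algebra_simps)
  also have "\<dots> = 0" unfolding q2 by simp
  finally have "b2 = 0" using k a0 by simp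
  have L: "det3 u v (lc3 u v w (x,y,z)) = det3 u v w * z" for x y z
    by (cases u, cases v, cases w) (simp add: det3_def lc3_def algebra_simps)
  show ?thesis unfolding a b L using \<open>a2 = 0\<close> \<open>b2 = 0\<close> by simp
qed

section \<open>From points to places\<close>

lemma deriv_peval_along:
  assumes add: "\<And>x y. E (x + y) = E x + (E y :: 'c::comm_ring_1)" and mult: "\<And>x y. E (x * y) = E x * k y + k x * E y"
    and k: "ring_hom_fun k" and h: "ring_hom_fun h"
  shows "E (peval h x p) = peval (\<lambda>c. k (h c)) (k x) (pderiv p) * E x + peval (\<lambda>c. E (h c)) (k x) p"
proof -
  have E0: "E 0 = 0" using add[of 0 0] by simp
  have kh: "ring_hom_fun (\<lambda>c. k (h c))" by (rule ring_hom_fun_comp[OF k h])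
  note hs = ring_hom_fun_simps[OF h] ring_hom_fun_simps[OF k]
  show ?thesis
  proof (induction p)
    case 0
    then show ?case by (simp add: E0)
  next
    case (pCons a p)
    have "E (peval h x (pCons a p)) = E (h a) + E x * k (peval h x p) + k x * E (peval h x p)"
      by (simp add: peval_pCons hs add mult)
    also have "k (peval h x p) = peval (\<lambda>c. k (h c)) (k x) p" by (rule peval_hom_comp[OF k h])
    finally show ?case unfolding pCons.IH pderiv_pCons
      using ring_hom_fun_simps(3)[OF ring_hom_fun_peval[OF kh]] by (simp add: peval_pCons hs E0 algebra_simps)
  qed
qed

lemma peval_map_deriv:
  fixes A :: "'x::comm_ring_1 \<Rightarrow> 'c::comm_ring_1" and D :: "'y::comm_ring_1 \<Rightarrow> 'x"
  assumes "A 0 = 0" "D 0 = 0"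
  shows "peval (\<lambda>G. A (D G) * e) x F = peval A x (map_poly D F) * e"
  by (induction F) (use assms in \<open>simp_all add: peval_pCons map_poly_pCons algebra_simps\<close>)

lemma peval_add_fun:
  fixes A B :: "'x::comm_ring_1 \<Rightarrow> 'c::comm_ring_1"
  assumes "A 0 = 0" "B 0 = 0"
  shows "peval (\<lambda>G. A G + B G) x F = peval A x F + peval B x F"
  by (induction F) (use assms in \<open>simp_all add: peval_pCons algebra_simps\<close>)

definition gr2 :: "poly3 \<Rightarrow> poly3" where "gr2 = map_poly pderiv"
definition gr3 :: "poly3 \<Rightarrow> poly3" where "gr3 = map_poly (map_poly pderiv)"

lemma chain_rule_along:
  assumes add: "\<And>x y. E (x + y) = E x + (E y :: 'c::comm_ring_1)" and mult: "\<And>x y. E (x * y) = E x * k y + k x * E y"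
    and k: "ring_hom_fun k" and h: "ring_hom_fun h" and Eh: "\<And>c. E (h c) = 0"
  shows "E (ev h F a b c) = ev (\<lambda>c. k (h c)) (pderiv F) (k a) (k b) (k c) * E a + ev (\<lambda>c. k (h c)) (gr2 F) (k a) (k b) (k c) * E b +
     ev (\<lambda>c. k (h c)) (gr3 F) (k a) (k b) (k c) * E c"
proof -
  have E0: "E 0 = 0" using add[of 0 0] by simp
  have h1: "ring_hom_fun (peval h c)" and h2: "ring_hom_fun (peval (peval h c) b)" by (intro ring_hom_fun_peval h)+
  have kh: "ring_hom_fun (\<lambda>c. k (h c))" by (rule ring_hom_fun_comp[OF k h])
  define K1 where "K1 = peval (\<lambda>c. k (h c)) (k c)"
  define K2 where "K2 = peval K1 (k b)"
  have K: "ring_hom_fun K1" "ring_hom_fun K2" unfolding K1_def K2_def by (intro ring_hom_fun_peval kh)+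
  have k1: "k (peval h c p) = K1 p" for p unfolding K1_def by (rule peval_hom_comp[OF k h])
  have k2: "k (peval (peval h c) b p) = K2 p" for p unfolding K2_def peval_hom_comp[OF k h1] k1 ..
  have s1: "E (peval h c p) = K1 (pderiv p) * E c" for p
    unfolding deriv_peval_along[of E k, OF add mult k h] Eh K1_def by (simp add: peval_eq_0I)
  have s2: "E (peval (peval h c) b p) = K2 (pderiv p) * E b + K2 (map_poly pderiv p) * E c" for p
    unfolding deriv_peval_along[of E k, OF add mult k h1] k1 s1 K2_def peval_map_deriv[of K1 pderiv, OF ring_hom_fun_simps(1)[OF K(1)] pderiv_0] ..
  have z: "K2 0 = 0" using ring_hom_fun_simps(1)[OF K(2)] .
  show ?thesis
    unfolding ev_def deriv_peval_along[of E k, OF add mult k h2] k2 s2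
    unfolding K1_def[symmetric] K2_def[symmetric] gr2_def gr3_def
    by (subst peval_add_fun) (simp_all add: z peval_map_deriv[of K2 pderiv, OF z] peval_map_deriv[of K2 "map_poly pderiv", OF z] add.assoc)
qed

lemma chain_rule_fls:
  "fls_deriv (ev fls_const F a b c) = ev fls_const (pderiv F) a b c * fls_deriv a + ev fls_const (gr2 F) a b c * fls_deriv b +
     ev fls_const (gr3 F) a b c * fls_deriv c"
  by (rule chain_rule_along[of fls_deriv "\<lambda>x. x" fls_const, OF _ _ ring_hom_fun_id ring_hom_fun_fls_const])
    (simp_all add: fls_deriv_mult algebra_simps)

text \<open>The derivative of \<open>F\<close> at \<open>(a, b, c)\<close> in the direction \<open>(a', b', c')\<close>.\<close>

definition dd :: "(complex \<Rightarrow> 'a::comm_ring_1) \<Rightarrow> poly3 \<Rightarrow> 'a \<Rightarrow> 'a \<Rightarrow> 'a \<Rightarrow> 'a \<Rightarrow> 'a \<Rightarrow> 'a \<Rightarrow> 'a" where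
  "dd h F a b c a' b' c' = coeff (ev (\<lambda>x. [:h x:]) F [:a, a':] [:b, b':] [:c, c':]) 1"

lemma dd_eq_grad:
  assumes h: "ring_hom_fun h"
  shows "dd h F a b c a' b' c' = ev h (pderiv F) a b c * a' + ev h (gr2 F) a b c * b' + ev h (gr3 F) a b c * c'"
proof -
  have k: "ring_hom_fun (\<lambda>p. coeff p 0 :: 'a)" by (auto simp: ring_hom_fun_def coeff_mult)
  have hh: "ring_hom_fun (\<lambda>x. [:h x:])" by (rule ring_hom_fun_comp[OF ring_hom_fun_pCons_const h])
  have m: "coeff (x * y) 1 = coeff x 1 * coeff y 0 + coeff x 0 * coeff y 1" for x y :: "'a poly"
    by (simp add: coeff_mult)
  show ?thesis unfolding dd_def
    using chain_rule_along[of "\<lambda>p. coeff p 1" "\<lambda>p. coeff p 0" "\<lambda>x. [:h x:]" F "[:a, a':]" "[:b, b':]" "[:c, c':]", OF _ m k hh] by simp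
qed

lemma dd_euler:
  assumes h: "ring_hom_fun h" and F: "homogeneous n F"
  shows "dd h F a b c a b c = of_nat n * ev h F a b c"
proof -
  have hh: "ring_hom_fun (\<lambda>x. [:h x:])" by (rule ring_hom_fun_comp[OF ring_hom_fun_pCons_const h])
  have e: "[:x, x:] = [:1, 1:] * [:x:]" for x :: 'a by simp
  have "ev (\<lambda>x. [:h x:]) F [:a, a:] [:b, b:] [:c, c:] = [:1, 1:] ^ n * ev (\<lambda>x. [:h x:]) F [:a:] [:b:] [:c:]"
    by (subst e[of a], subst e[of b], subst e[of c]) (rule ev_scale[OF hh F])
  also have "ev (\<lambda>x. [:h x:]) F [:a:] [:b:] [:c:] = [:ev h F a b c:]" using ev_hom[OF ring_hom_fun_pCons_const h, of F a b c] by simp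
  finally have e1: "ev (\<lambda>x. [:h x:]) F [:a, a:] [:b, b:] [:c, c:] = [:1, 1:] ^ n * [:ev h F a b c:]" .
  have "coeff ([:1, 1:] ^ n :: 'a poly) 1 = of_nat n"
    by (induction n) (simp_all add: coeff_mult coeff_pCons poly_0_coeff_0[symmetric] poly_power)
  then show ?thesis unfolding dd_def e1 by simp
qed

lemma dd_linear:
  assumes h: "ring_hom_fun h"
  shows "dd h F a b c (s * a' + t * a'') (s * b' + t * b'') (s * c' + t * c'') = s * dd h F a b c a' b' c' + t * dd h F a b c a'' b'' c''"
  unfolding dd_eq_grad[OF h] by (simp add: algebra_simps)

definition even_at_points :: "poly3 \<Rightarrow> poly3 \<Rightarrow> poly3 \<Rightarrow> bool" where
  "even_at_points f F Q \<longleftrightarrow> (\<forall>a b c a' b' c' a'' b'' c''. ev (\<lambda>x. x) f a b c = 0 \<longrightarrow> ev (\<lambda>x. x) Q a b c \<noteq> 0 \<longrightarrow>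
     dd (\<lambda>x. x) f a b c a'' b'' c'' \<noteq> 0 \<longrightarrow> dd (\<lambda>x. x) f a b c a' b' c' = 0 \<longrightarrow> dd (\<lambda>x. x) Q a b c a' b' c' = 0 \<longrightarrow>
     ev (\<lambda>x. x) F (a + a') (b + b') (c + c') = ev (\<lambda>x. x) F (a - a') (b - b') (c - c'))"

lemma dd_subst3:
  "dd (\<lambda>x. x) (subst3 (u1,u2,u3) (v1,v2,v3) (w1,w2,w3) F) a b c a' b' c' =
   dd (\<lambda>x. x) F (u1 * a + v1 * b + w1 * c) (u2 * a + v2 * b + w2 * c) (u3 * a + v3 * b + w3 * c)
     (u1 * a' + v1 * b' + w1 * c') (u2 * a' + v2 * b' + w2 * c') (u3 * a' + v3 * b' + w3 * c')"
  unfolding dd_def ev_subst3[OF ring_hom_fun_pCons_const] by (simp add: mult.commute)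

lemma even_at_points_subst3:
  assumes "even_at_points f F Q"
  shows "even_at_points (subst3 u v w f) (subst3 u v w F) (subst3 u v w Q)"
proof -
  obtain u1 u2 u3 v1 v2 v3 w1 w2 w3 where uvw: "u = (u1,u2,u3)" "v = (v1,v2,v3)" "w = (w1,w2,w3)"
    by (cases u, cases v, cases w) auto
  have e: "x * (a + a') + y * (b + b') + z * (c + c') = (x * a + y * b + z * c) + (x * a' + y * b' + z * c')"
    "x * (a - a') + y * (b - b') + z * (c - c') = (x * a + y * b + z * c) - (x * a' + y * b' + z * c')" for x y z a b c a' b' c' :: complex
    by (simp_all add: algebra_simps)
  show ?thesis
    unfolding even_at_points_def uvw dd_subst3 ev_subst3[OF ring_hom_fun_id] e
    using assms unfolding even_at_points_def by blast
qed

lemma fls_poly_eq_0I: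
  fixes p :: "complex fls poly"
  assumes "\<And>s. poly p (fls_const s) = 0"
  shows "p = 0"
proof (rule ccontr)
  assume "p \<noteq> 0"
  then have "finite {x. poly p x = 0}" by (rule poly_roots_finite)
  moreover have "range fls_const \<subseteq> {x. poly p x = 0}" using assms by auto
  ultimately have "finite (range (fls_const :: complex \<Rightarrow> complex fls))" by (rule rev_finite_subset)
  moreover have "inj (fls_const :: complex \<Rightarrow> complex fls)" by (rule injI, drule arg_cong[of _ _ "\<lambda>z. fls_nth z 0"]) simp
  ultimately show False by (simp add: finite_image_iff infinite_UNIV_char_0)
qed

lemma cross_parallel:
  fixes x1 x2 x3 y1 y2 y3 r1 r2 r3 :: "'a::field"
  assumes v: "v1 = x2 * y3 - x3 * y2" "v2 = x3 * y1 - x1 * y3" "v3 = x1 * y2 - x2 * y1"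
    and nz: "v1 \<noteq> 0 \<or> v2 \<noteq> 0 \<or> v3 \<noteq> 0"
    and r: "x1 * r1 + x2 * r2 + x3 * r3 = 0" "y1 * r1 + y2 * r2 + y3 * r3 = 0"
  obtains t where "r1 = t * v1" "r2 = t * v2" "r3 = t * v3"
proof -
  have c: "r1 * v2 = r2 * v1" "r1 * v3 = r3 * v1" "r2 * v3 = r3 * v2"
    unfolding v using r by algebra+
  consider "v1 \<noteq> 0" | "v2 \<noteq> 0" | "v3 \<noteq> 0" using nz by blast
  then show thesis
  proof cases
    case 1 then show ?thesis using c by (intro that[of "r1 / v1"]) (auto simp: field_simps)
  next
    case 2 then show ?thesis using c by (intro that[of "r2 / v2"]) (auto simp: field_simps)
  next
    case 3 then show ?thesis using c by (intro that[of "r3 / v3"]) (auto simp: field_simps)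
  qed
qed

text \<open>The tangent and polar directions are the multiples of \<open>\<nabla>f \<times> \<nabla>Q\<close>.\<close>

lemma even_at_places:
  assumes f: "irreducible f" "homogeneous d f" "\<not> f dvd Q" "\<not> f dvd pderiv f" and Q: "homogeneous 2 Q"
    and even: "even_at_points f F Q"
    and C: "ev fls_const f a b c = 0" "ev fls_const Q a b c \<noteq> 0" "ev fls_const (pderiv f) a b c \<noteq> 0"
    and R: "dd fls_const f a b c a' b' c' = 0" "dd fls_const Q a b c a' b' c' = 0"
  shows "ev fls_const F (a + t * a') (b + t * b') (c + t * c') = ev fls_const F (a - t * a') (b - t * b') (c - t * c')"
proof -
  define V1 where "V1 = gr2 f * gr3 Q - gr3 f * gr2 Q"
  define V2 where "V2 = gr3 f * pderiv Q - pderiv f * gr3 Q"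
  define V3 where "V3 = pderiv f * gr2 Q - gr2 f * pderiv Q"
  define S where "S s = ev const3 F (lin3 1 0 0 + const3 s * V1) (lin3 0 1 0 + const3 s * V2) (lin3 0 0 1 + const3 s * V3)" for s
  have evS: "ev h (S s) x y z = ev h F (x + h s * ev h V1 x y z) (y + h s * ev h V2 x y z) (z + h s * ev h V3 x y z)"
    if h: "ring_hom_fun h" for h :: "complex \<Rightarrow> 'x::comm_ring_1" and s x y z
    unfolding S_def
    by (subst ev_hom[of "\<lambda>F. ev h F x y z", OF ring_hom_fun_ev[OF h] ring_hom_fun_const3])
      (simp add: ev_simps[OF h] ev_const3[OF h] ev_lin3[OF h] ring_hom_fun_simps[OF h])
  have cross: "ev h V1 x y z * ev h (pderiv G) x y z + ev h V2 x y z * ev h (gr2 G) x y z + ev h V3 x y z * ev h (gr3 G) x y z = 0"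
    if h: "ring_hom_fun h" and G: "G = f \<or> G = Q" for h :: "complex \<Rightarrow> 'x::comm_ring_1" and x y z G
    using G unfolding V1_def V2_def V3_def by (auto simp: ev_simps[OF h] algebra_simps)
  have dv: "f dvd S s - S (- s)" for s
  proof -
    have "f dvd Q * pderiv f * (S s - S (- s))"
    proof (rule irreducible_dvd_of_zeros[OF f(1)])
      fix x y z assume z: "ev (\<lambda>x. x) f x y z = 0"
      note i = ring_hom_fun_id
      show "ev (\<lambda>x. x) (Q * pderiv f * (S s - S (- s))) x y z = 0"
      proof (cases "ev (\<lambda>x. x) Q x y z = 0 \<or> ev (\<lambda>x. x) (pderiv f) x y z = 0")
        case True
        then show ?thesis by (auto simp: ev_simps[OF i])
      next
        case False
        define p1 p2 p3 where "p1 = s * ev (\<lambda>x. x) V1 x y z" and "p2 = s * ev (\<lambda>x. x) V2 x y z" and "p3 = s * ev (\<lambda>x. x) V3 x y z"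
        have dz: "dd (\<lambda>x. x) G x y z p1 p2 p3 = 0" if "G = f \<or> G = Q" for G
        proof -
          have "dd (\<lambda>x. x) G x y z p1 p2 p3 = s * (ev (\<lambda>x. x) V1 x y z * ev (\<lambda>x. x) (pderiv G) x y z + ev (\<lambda>x. x) V2 x y z * ev (\<lambda>x. x) (gr2 G) x y z + ev (\<lambda>x. x) V3 x y z * ev (\<lambda>x. x) (gr3 G) x y z)"
            unfolding dd_eq_grad[OF i] p1_def p2_def p3_def by (simp add: algebra_simps)
          then show ?thesis unfolding cross[OF i that] by simp
        qed
        have "dd (\<lambda>x. x) f x y z 1 0 0 \<noteq> 0" unfolding dd_eq_grad[OF i] using False by simp
        then have "ev (\<lambda>x. x) F (x + p1) (y + p2) (z + p3) = ev (\<lambda>x. x) F (x - p1) (y - p2) (z - p3)"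
          using even z False dz[of f] dz[of Q] unfolding even_at_points_def by blast
        then show ?thesis by (simp add: ev_simps[OF i] evS[OF i] p1_def p2_def p3_def)
      qed
    qed
    moreover have "prime_elem f" using f(1) by (simp add: prime_elem_iff_irreducible)
    ultimately show ?thesis using f(3,4) by (simp add: prime_elem_dvd_mult_iff)
  qed
  note ic = ring_hom_fun_fls_const
  define W1 where "W1 = ev fls_const V1 a b c"
  define W2 where "W2 = ev fls_const V2 a b c"
  define W3 where "W3 = ev fls_const V3 a b c"
  define H :: "complex \<Rightarrow> complex fls poly" where "H = (\<lambda>x. [:fls_const x:])"
  have H: "ring_hom_fun H" unfolding H_def by (rule ring_hom_fun_comp[OF ring_hom_fun_pCons_const ic])
  define p where "p = ev H F [:a, W1:] [:b, W2:] [:c, W3:] - ev H F [:a, - W1:] [:b, - W2:] [:c, - W3:]"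
  have pp: "poly p \<tau> = ev fls_const F (a + \<tau> * W1) (b + \<tau> * W2) (c + \<tau> * W3) - ev fls_const F (a - \<tau> * W1) (b - \<tau> * W2) (c - \<tau> * W3)" for \<tau>
    unfolding p_def poly_diff ev_hom[OF ring_hom_fun_poly H] by (simp add: H_def)
  have "p = 0"
  proof (rule fls_poly_eq_0I)
    fix s
    have "ev fls_const (S s - S (- s)) a b c = 0"
      by (rule ring_hom_fun_dvd[OF ring_hom_fun_ev[OF ic] dv C(1)])
    then show "poly p (fls_const s) = 0"
      unfolding pp ev_simps(6)[OF ic] evS[OF ic] W1_def W2_def W3_def by (simp add: ring_hom_fun_simps(5)[OF ic])
  qed
  define x1 x2 x3 where "x1 = ev fls_const (pderiv f) a b c" and "x2 = ev fls_const (gr2 f) a b c" and "x3 = ev fls_const (gr3 f) a b c"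
  define y1 y2 y3 where "y1 = ev fls_const (pderiv Q) a b c" and "y2 = ev fls_const (gr2 Q) a b c" and "y3 = ev fls_const (gr3 Q) a b c"
  have W: "W1 = x2 * y3 - x3 * y2" "W2 = x3 * y1 - x1 * y3" "W3 = x1 * y2 - x2 * y1"
    by (simp_all add: W1_def W2_def W3_def V1_def V2_def V3_def ev_simps[OF ic] x1_def x2_def x3_def y1_def y2_def y3_def)
  have xC: "x1 * a + x2 * b + x3 * c = 0"
    using dd_euler[OF ic f(2), of a b c] C(1) unfolding dd_eq_grad[OF ic] x1_def x2_def x3_def by simp
  have yC: "y1 * a + y2 * b + y3 * c = 2 * ev fls_const Q a b c"
    using dd_euler[OF ic Q, of a b c] unfolding dd_eq_grad[OF ic] y1_def y2_def y3_def by simp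
  have Wnz: "W1 \<noteq> 0 \<or> W2 \<noteq> 0 \<or> W3 \<noteq> 0"
  proof (rule ccontr)
    assume "\<not> ?thesis"
    then have z: "x2 * y3 - x3 * y2 = 0" "x3 * y1 - x1 * y3 = 0" "x1 * y2 - x2 * y1 = 0" unfolding W by auto
    have "x1 * (y1 * a + y2 * b + y3 * c) = 0" using z xC by algebra
    then show False using yC C(2,3) by (simp add: x1_def)
  qed
  have "x1 * a' + x2 * b' + x3 * c' = 0" "y1 * a' + y2 * b' + y3 * c' = 0"
    using R unfolding dd_eq_grad[OF ic] x1_def x2_def x3_def y1_def y2_def y3_def by simp_all
  from cross_parallel[OF W Wnz this] obtain r where "a' = r * W1" "b' = r * W2" "c' = r * W3" .
  then have "t * a' = (t * r) * W1" "t * b' = (t * r) * W2" "t * c' = (t * r) * W3" by (simp_all only: mult_ac)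
  note q = this
  show ?thesis unfolding q using pp[of "t * r"] \<open>p = 0\<close> by simp
qed

lemma place_direction:
  assumes f: "homogeneous d f" and z: "ev fls_const f a b c = 0"
  shows "dd fls_const f a b c (fls_X * fls_deriv a - \<nu> * a) (fls_X * fls_deriv b - \<nu> * b) (fls_X * fls_deriv c - \<nu> * c) = 0"
    "2 * ev fls_const Q a b c * \<nu> = fls_X * fls_deriv (ev fls_const Q a b c) \<Longrightarrow> homogeneous 2 Q \<Longrightarrow>
      dd fls_const Q a b c (fls_X * fls_deriv a - \<nu> * a) (fls_X * fls_deriv b - \<nu> * b) (fls_X * fls_deriv c - \<nu> * c) = 0"
proof -
  note ic = ring_hom_fun_fls_const
  have gen: "dd fls_const G a b c (fls_X * fls_deriv a - \<nu> * a) (fls_X * fls_deriv b - \<nu> * b) (fls_X * fls_deriv c - \<nu> * c) =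
     fls_X * fls_deriv (ev fls_const G a b c) - \<nu> * (of_nat k * ev fls_const G a b c)" if G: "homogeneous k G" for G k
    unfolding dd_euler[OF ic G, symmetric] chain_rule_fls dd_eq_grad[OF ic] by (simp add: algebra_simps)
  show "dd fls_const f a b c (fls_X * fls_deriv a - \<nu> * a) (fls_X * fls_deriv b - \<nu> * b) (fls_X * fls_deriv c - \<nu> * c) = 0"
    unfolding gen[OF f] z by simp
  assume e: "2 * ev fls_const Q a b c * \<nu> = fls_X * fls_deriv (ev fls_const Q a b c)" and Q: "homogeneous 2 Q"
  show "dd fls_const Q a b c (fls_X * fls_deriv a - \<nu> * a) (fls_X * fls_deriv b - \<nu> * b) (fls_X * fls_deriv c - \<nu> * c) = 0"
    unfolding gen[OF Q] e[symmetric] by simp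
qed

lemma even_along_of_points:
  assumes f: "irreducible f" "homogeneous d f" "\<not> f dvd Q" "\<not> f dvd pderiv f" and Q: "homogeneous 2 Q"
    and even: "even_at_points f F Q"
  shows "even_along f F Q"
  unfolding even_along_def
proof (intro allI impI)
  fix x y z \<nu> and s :: complex
  assume a: "ev fls_const f x y z = 0" "ev fls_const Q x y z \<noteq> 0" "ev fls_const (pderiv f) x y z \<noteq> 0"
    "2 * ev fls_const Q x y z * \<nu> = fls_X * fls_deriv (ev fls_const Q x y z)"
  have m: "u + fls_const (- s) * v = u - fls_const s * v" for u v
    using ring_hom_fun_simps(5)[OF ring_hom_fun_fls_const, of s] by simp
  show "ev fls_const F (x + fls_const s * (fls_X * fls_deriv x - \<nu> * x)) (y + fls_const s * (fls_X * fls_deriv y - \<nu> * y)) (z + fls_const s * (fls_X * fls_deriv z - \<nu> * z)) =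
    ev fls_const F (x + fls_const (- s) * (fls_X * fls_deriv x - \<nu> * x)) (y + fls_const (- s) * (fls_X * fls_deriv y - \<nu> * y)) (z + fls_const (- s) * (fls_X * fls_deriv z - \<nu> * z))"
    unfolding m by (rule even_at_places[OF f Q even a(1-3) place_direction(1)[OF f(2) a(1)] place_direction(2)[OF f(2) a(1,4) Q]])
qed

lemma constant_along_place:
  assumes f: "irreducible f" "homogeneous d f" "\<not> f dvd Q" "\<not> f dvd pderiv f" and Q: "homogeneous 2 Q"
    and even: "even_at_points f F Q" and F: "homogeneous (2 * m) F"
    and C: "ev fls_const f a b c = 0" "ev fls_const Q a b c \<noteq> 0" "ev fls_const (pderiv f) a b c \<noteq> 0"
  obtains k where "ev fls_const (F - const3 k * Q ^ m) a b c = 0"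
proof -
  note ic = ring_hom_fun_fls_const
  define g where "g = ev fls_const Q a b c"
  define \<phi> where "\<phi> = ev fls_const F a b c"
  define \<nu> where "\<nu> = fls_X * fls_deriv g / (2 * g)"
  have g0: "g \<noteq> 0" using C(2) by (simp add: g_def)
  have \<nu>: "2 * g * \<nu> = fls_X * fls_deriv g" using g0 by (simp add: \<nu>_def)
  define a' b' c' where "a' = fls_X * fls_deriv a - \<nu> * a" and "b' = fls_X * fls_deriv b - \<nu> * b" and "c' = fls_X * fls_deriv c - \<nu> * c"
  define H :: "complex \<Rightarrow> complex fls poly" where "H = (\<lambda>x. [:fls_const x:])"
  have H: "ring_hom_fun H" unfolding H_def by (rule ring_hom_fun_comp[OF ring_hom_fun_pCons_const ic])
  define p where "p = ev H F [:a, a':] [:b, b':] [:c, c':]"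
  have pp: "poly p t = ev fls_const F (a + t * a') (b + t * b') (c + t * c')" for t
    unfolding p_def ev_hom[OF ring_hom_fun_poly H] by (simp add: H_def)
  have "poly p (- t) = poly p t" for t
    using even_at_places[OF f Q even C place_direction(1)[OF f(2) C(1)] place_direction(2)[OF f(2) C(1) \<nu>[unfolded g_def] Q], of t] unfolding pp
    by (simp add: a'_def b'_def c'_def)
  then have "pcompose p [:0, -1:] = p" by (intro poly_eq_poly_eq_iff[THEN iffD1] ext) (simp add: poly_pcompose)
  then have "coeff (pcompose p [:0, -1:]) 1 = coeff p 1" by simp
  then have "- coeff p 1 = coeff p 1" by (simp add: coeff_pcompose_linear)
  then have "2 * coeff p 1 = 0" by (metis add.right_inverse mult_2)
  then have "coeff p 1 = 0" by simp
  then have "dd fls_const F a b c a' b' c' = 0" by (simp add: dd_def p_def H_def)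
  then have "fls_X * fls_deriv \<phi> - \<nu> * (of_nat (2 * m) * \<phi>) = 0"
    unfolding a'_def b'_def c'_def \<phi>_def dd_euler[OF ic F, symmetric] chain_rule_fls dd_eq_grad[OF ic] by (simp add: algebra_simps)
  then have "g * (fls_X * fls_deriv \<phi>) = of_nat m * \<phi> * (2 * g * \<nu>)" by (simp add: algebra_simps)
  then have "fls_X * (g * fls_deriv \<phi> - of_nat m * \<phi> * fls_deriv g) = 0" unfolding \<nu> by (simp add: algebra_simps)
  then have e: "g * fls_deriv \<phi> = of_nat m * \<phi> * fls_deriv g" by simp
  interpret D: field_derivation "fls_deriv :: complex fls \<Rightarrow> complex fls" by (rule field_derivation_fls_deriv)
  have "fls_deriv (\<phi> / g ^ m) = (fls_deriv \<phi> * g ^ m - \<phi> * (of_nat m * g ^ (m - 1) * fls_deriv g)) / (g ^ m) ^ 2"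
    using g0 by (subst D.divide) (simp_all add: D.power)
  also have "fls_deriv \<phi> * g ^ m - \<phi> * (of_nat m * g ^ (m - 1) * fls_deriv g) = 0"
  proof (cases m)
    case 0
    then show ?thesis using e g0 by simp
  next
    case (Suc j)
    have "fls_deriv \<phi> * g ^ m - \<phi> * (of_nat m * g ^ (m - 1) * fls_deriv g) = g ^ j * (g * fls_deriv \<phi> - of_nat m * \<phi> * fls_deriv g)"
      unfolding Suc by (simp add: algebra_simps del: of_nat_Suc)
    then show ?thesis using e by simp
  qed
  finally have "fls_deriv (\<phi> / g ^ m) = 0" by simp
  then obtain k where "\<phi> / g ^ m = fls_const k" using fls_deriv_eq_0_iff[of "\<phi> / g ^ m"] by blast
  then have "\<phi> = fls_const k * g ^ m" using g0 by (simp add: field_simps)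
  then have "ev fls_const (F - const3 k * Q ^ m) a b c = 0"
    unfolding ev_simps(4,6,7)[OF ic] ev_const3[OF ic] \<phi>_def g_def by simp
  then show ?thesis by (rule that)
qed

section \<open>Affine charts\<close>

lemma const_poly_power: "[:x:] ^ n = [:x ^ n :: 'a::comm_semiring_1:]"
  by (induction n) (simp_all add: one_pCons mult.commute)

lemma ring_hom_fun_pCons2: "ring_hom_fun (\<lambda>c::'a::comm_ring_1. [:[:c:]:])"
  by (rule ring_hom_fun_comp[OF ring_hom_fun_pCons_const ring_hom_fun_pCons_const])

definition dehom :: "poly3 \<Rightarrow> complex poly poly" where
  "dehom F = ev (\<lambda>c. [:[:c:]:]) F [:0, 1:] [:[:0, 1:]:] 1"

lemma ring_hom_fun_dehom: "ring_hom_fun dehom"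
  unfolding dehom_def by (rule ring_hom_fun_ev[OF ring_hom_fun_pCons2])

lemmas dehom_simps = ring_hom_fun_simps[OF ring_hom_fun_dehom]

lemma e2_dehom: "e2 X Y (dehom F) = ev fls_const F Y X 1"
proof -
  have "e2 X Y [:[:c:]:] = fls_const c" for c by (simp add: e1_def peval_const)
  moreover have "e2 X Y [:0, 1:] = Y" by (simp add: e2_def peval_pCons)
  moreover have "e2 X Y [:[:0, 1:]:] = X" by (simp add: e1_def peval_pCons)
  ultimately show ?thesis unfolding dehom_def ev_hom[OF ring_hom_fun_e2 ring_hom_fun_pCons2] by simp
qed

lemma X_power: "[:0, 1:] ^ i = (monom 1 i :: 'a::comm_ring_1 poly)"
  by (simp add: monom_altdef)

lemma monom2_eq: "[:[:c:]:] * [:0, 1:] ^ i * [:[:0, 1:]:] ^ j = monom (monom (c::'a::comm_ring_1) j) i"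
  unfolding X_power const_poly_power by (simp add: smult_monom mult.commute)

lemma coeff_dehom:
  assumes F: "homogeneous n F"
  shows "coeff (coeff (dehom F) i) j = (if i + j \<le> n then cf3 F i j (n - i - j) else 0)"
proof -
  let ?T = "{(j,k). j + k \<le> n}"
  have "dehom F = (\<Sum>(j,k)\<in>?T. monom (monom (cf3 F (n - j - k) j k) j) (n - j - k))"
    unfolding dehom_def ev_homogeneous[OF ring_hom_fun_pCons2 F]
    by (intro sum.cong refl, clarify, simp only: monom2_eq power_one mult_1_right)
  then have "coeff (coeff (dehom F) i) j = (\<Sum>(j',k)\<in>?T. if n - j' - k = i \<and> j' = j then cf3 F (n - j' - k) j' k else 0)"
    by (simp add: coeff_sum case_prod_unfold) (intro sum.cong, auto)
  also have "\<dots> = (\<Sum>x\<in>?T. if x = (j, n - i - j) then (if i + j \<le> n then cf3 F i j (n - i - j) else 0) else 0)"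
    by (intro sum.cong refl) (auto split: if_splits)
  also have "\<dots> = (if i + j \<le> n then cf3 F i j (n - i - j) else 0)"
    by (subst sum.delta) (auto intro: finite_triangle)
  finally show ?thesis .
qed

lemma dehom_inj:
  assumes F: "homogeneous n F" and G: "homogeneous n G" and e: "dehom F = dehom G"
  shows "F = G"
proof (rule poly3_eqI)
  fix i j k
  show "cf3 F i j k = cf3 G i j k"
  proof (cases "i + j + k = n")
    case True
    then have "k = n - i - j" "i + j \<le> n" by auto
    then show ?thesis using coeff_dehom[OF F, of i j] coeff_dehom[OF G, of i j] e by simp
  next
    case False
    then show ?thesis using F G unfolding homogeneous_def by metis
  qed
qed

lemma pderiv_dehom: "pderiv (dehom F) = dehom (pderiv F)"
  unfolding dehom_def
  by (subst chain_rule_along[of pderiv "\<lambda>x. x", OF _ _ ring_hom_fun_id ring_hom_fun_pCons2])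
    (simp_all add: pderiv_add pderiv_mult pderiv_pCons add.commute)

lemma homogenization:
  obtains N where "\<And>n. N \<le> n \<Longrightarrow> \<exists>G. homogeneous n G \<and> dehom G = g"
proof -
  define N where "N = degree g + (\<Sum>i\<le>degree g. degree (coeff g i))"
  have bound: "i + j \<le> N" if "coeff (coeff g i) j \<noteq> 0" for i j
  proof -
    have i: "i \<le> degree g" using that by (intro le_degree) auto
    have "j \<le> degree (coeff g i)" using that by (rule le_degree)
    also have "\<dots> \<le> (\<Sum>i\<le>degree g. degree (coeff g i))" using i by (intro member_le_sum) auto
    finally show ?thesis using i by (simp add: N_def)
  qed
  have "\<exists>G. homogeneous n G \<and> dehom G = g" if n: "N \<le> n" for n
  proof -
    define G where "G = (\<Sum>(i,j)\<in>{(i,j). i + j \<le> n}. const3 (coeff (coeff g i) j) * lin3 1 0 0 ^ i * lin3 0 1 0 ^ j * lin3 0 0 1 ^ (n - i - j))"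
    have "homogeneous n (const3 c * lin3 1 0 0 ^ i * lin3 0 1 0 ^ j * lin3 0 0 1 ^ (n - i - j))" if "i + j \<le> n" for c i j
    proof -
      have "homogeneous (0 + 1 * i + 1 * j + 1 * (n - i - j)) (const3 c * lin3 1 0 0 ^ i * lin3 0 1 0 ^ j * lin3 0 0 1 ^ (n - i - j))"
        by (intro homogeneous_mult homogeneous_power homogeneous_lin3 homogeneous_const3)
      then show ?thesis using that by simp
    qed
    then have "homogeneous n G" unfolding G_def by (intro homogeneous_sum) auto
    moreover have "dehom G = g"
    proof -
      have l: "dehom (lin3 1 0 0) = [:0, 1:]" "dehom (lin3 0 1 0) = [:[:0, 1:]:]" "dehom (lin3 0 0 1) = 1" "dehom (const3 c) = [:[:c:]:]" for c
        by (simp_all add: dehom_def ev_lin3[OF ring_hom_fun_pCons2] ev_const3[OF ring_hom_fun_pCons2] one_pCons)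
      have "dehom G = (\<Sum>(i,j)\<in>{(i,j). i + j \<le> n}. monom (monom (coeff (coeff g i) j) j) i)"
        unfolding G_def ring_hom_fun_sum[OF ring_hom_fun_dehom]
        by (intro sum.cong refl) (clarify, simp only: dehom_simps l monom2_eq power_one mult_1_right)
      also have "\<dots> = g"
      proof (intro poly_eqI)
        fix i j
        have "coeff (coeff (\<Sum>(i,j)\<in>{(i,j). i + j \<le> n}. monom (monom (coeff (coeff g i) j) j) i) i) j =
           (\<Sum>x\<in>{(i,j). i + j \<le> n}. if x = (i, j) then coeff (coeff g i) j else 0)"
          by (simp add: coeff_sum case_prod_unfold) (intro sum.cong, auto)
        also have "\<dots> = coeff (coeff g i) j"
        proof -
          have "coeff (coeff g i) j = 0 \<or> i + j \<le> n" using bound[of i j] n by fastforce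
          then show ?thesis by (subst sum.delta) (auto intro: finite_triangle)
        qed
        finally show "coeff (coeff (\<Sum>(i,j)\<in>{(i,j). i + j \<le> n}. monom (monom (coeff (coeff g i) j) j) i) i) j = coeff (coeff g i) j" .
      qed
      finally show ?thesis .
    qed
    ultimately show ?thesis by blast
  qed
  then show ?thesis by (rule that)
qed

lemma dehom_lin3_001: "dehom (lin3 0 0 1) = 1"
  by (simp add: dehom_def ev_lin3[OF ring_hom_fun_pCons2] one_pCons)

lemma ev_100:
  assumes "homogeneous d f"
  shows "ev (\<lambda>x. x) f 1 0 0 = cf3 f d 0 0"
proof -
  have "ev (\<lambda>x. x) f 1 0 0 = (\<Sum>x\<in>{(j,k). j + k \<le> d}. if x = (0, 0) then cf3 f d 0 0 else 0)"
    unfolding ev_homogeneous[OF ring_hom_fun_id assms] by (intro sum.cong refl) auto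
  then show ?thesis by (subst (asm) sum.delta) (auto intro: finite_triangle)
qed

locale monic_form =
  fixes f :: poly3 and d :: nat
  assumes irr: "irreducible f" and hom: "homogeneous d f" and lead: "cf3 f d 0 0 = 1" and d: "d > 0"
begin

lemma not_dvd_z: "\<not> f dvd lin3 0 0 1 ^ e"
proof
  assume "f dvd lin3 0 0 1 ^ e"
  then have z: "f dvd lin3 0 0 1" using irr by (auto dest: prime_elem_dvd_power simp flip: prime_elem_iff_irreducible)
  then obtain h where h: "lin3 0 0 1 = f * h" by (elim dvdE)
  have "ev (\<lambda>x. x) h 1 0 0 = 0"
    using arg_cong[OF h, of "\<lambda>F. ev (\<lambda>x. x) F 1 0 0"] ev_100[OF hom] lead
    by (simp add: ev_lin3[OF ring_hom_fun_id] ev_simps[OF ring_hom_fun_id])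
  have "dehom f * dehom h = 1" using arg_cong[OF h, of dehom] by (simp add: dehom_simps dehom_lin3_001)
  then have "degree (dehom f) = 0" using degree_mult_eq[of "dehom f" "dehom h"] by (metis add_is_0 degree_1 mult_zero_left mult_zero_right zero_neq_one)
  moreover have "coeff (coeff (dehom f) d) 0 = 1" using coeff_dehom[OF hom, of d 0] lead by simp
  then have "d \<le> degree (dehom f)" by (intro le_degree) auto
  ultimately show False using d by simp
qed

lemma degree_dehom: "degree (dehom f) = d" "lead_coeff (dehom f) = 1"
proof -
  have c: "coeff (coeff (dehom f) i) j = (if i + j \<le> d then cf3 f i j (d - i - j) else 0)" for i j by (rule coeff_dehom[OF hom])
  have t: "coeff (dehom f) d = 1"
    by (rule poly_eqI) (auto simp: c lead)
  show 1: "degree (dehom f) = d"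
  proof (rule antisym)
    show "degree (dehom f) \<le> d" by (rule degree_le) (auto simp: poly_eq_iff c)
    show "d \<le> degree (dehom f)" using t by (intro le_degree) auto
  qed
  show "lead_coeff (dehom f) = 1" unfolding 1 by (rule t)
qed

lemma dvd_of_homogenized:
  assumes P: "homogeneous n P" and e: "dehom P = dehom f * g"
  shows "f dvd P"
proof -
  obtain N where N: "\<And>n. N \<le> n \<Longrightarrow> \<exists>G. homogeneous n G \<and> dehom G = g" using homogenization by blast
  obtain G where G: "homogeneous (N + n) G" "dehom G = g" using N[of "N + n"] by auto
  have h1: "homogeneous (d + (N + n)) (f * G)" by (rule homogeneous_mult[OF hom G(1)])
  have "homogeneous (1 * (d + N) + n) (lin3 0 0 1 ^ (d + N) * P)" by (intro homogeneous_mult homogeneous_power homogeneous_lin3 P)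
  then have h2: "homogeneous (d + (N + n)) (lin3 0 0 1 ^ (d + N) * P)" by (simp add: add.assoc)
  have "dehom (lin3 0 0 1 ^ (d + N) * P) = dehom (f * G)" using e G by (simp add: dehom_simps dehom_lin3_001)
  then have "lin3 0 0 1 ^ (d + N) * P = f * G" by (rule dehom_inj[OF h2 h1])
  then have "f dvd lin3 0 0 1 ^ (d + N) * P" by simp
  then show ?thesis using not_dvd_z irr by (auto simp: prime_elem_dvd_mult_iff simp flip: prime_elem_iff_irreducible)
qed

lemma irreducible_dehom: "irreducible (dehom f)"
proof (rule irreducibleI)
  show "dehom f \<noteq> 0" using degree_dehom d by auto
  show "\<not> is_unit (dehom f)" using degree_dehom(1) d dvd_imp_degree_le[of "dehom f" 1] by auto
  fix g h assume e: "dehom f = g * h"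
  obtain N where N: "\<And>n. N \<le> n \<Longrightarrow> \<exists>G. homogeneous n G \<and> dehom G = g" using homogenization by blast
  obtain M where M: "\<And>n. M \<le> n \<Longrightarrow> \<exists>G. homogeneous n G \<and> dehom G = h" using homogenization by blast
  obtain G where G: "homogeneous (N + d) G" "dehom G = g" using N[of "N + d"] by auto
  obtain H where H: "homogeneous M H" "dehom H = h" using M[of M] by auto
  have h1: "homogeneous (N + d + M) (G * H)" by (rule homogeneous_mult[OF G(1) H(1)])
  have "homogeneous (1 * (N + M) + d) (lin3 0 0 1 ^ (N + M) * f)" by (intro homogeneous_mult homogeneous_power homogeneous_lin3 hom)
  then have h2: "homogeneous (N + d + M) (lin3 0 0 1 ^ (N + M) * f)" by (simp add: ac_simps)
  have "dehom (lin3 0 0 1 ^ (N + M) * f) = dehom (G * H)" using e G H by (simp add: dehom_simps dehom_lin3_001)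
  then have "lin3 0 0 1 ^ (N + M) * f = G * H" by (rule dehom_inj[OF h2 h1])
  then have "f dvd G * H" by (metis dvd_triv_right)
  then have "f dvd G \<or> f dvd H" using irr by (auto simp: prime_elem_dvd_mult_iff simp flip: prime_elem_iff_irreducible)
  then have "dehom f dvd g \<or> dehom f dvd h" using G H by (auto simp: dehom_simps elim!: dvdE)
  moreover have nz: "g \<noteq> 0" "h \<noteq> 0" using e degree_dehom d by auto
  ultimately show "is_unit g \<or> is_unit h"
    unfolding e using dvd_times_left_cancel_iff[of g h 1] dvd_times_right_cancel_iff[of h g 1] by auto
qed

lemma dehom_dvd_iff: "homogeneous n P \<Longrightarrow> dehom f dvd dehom P \<Longrightarrow> f dvd P"
  using dvd_of_homogenized by (auto elim: dvdE)

lemma not_dvd_pderiv: "\<not> f dvd pderiv f"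
proof
  assume "f dvd pderiv f"
  then obtain h where "pderiv f = f * h" by (elim dvdE)
  then have "pderiv (dehom f) = dehom f * dehom h" unfolding pderiv_dehom by (simp only: dehom_simps)
  then have "dehom f dvd pderiv (dehom f)" by (rule dvdI)
  moreover have "pderiv (dehom f) \<noteq> 0" using degree_dehom d by (simp add: pderiv_eq_0_iff)
  ultimately have "degree (dehom f) \<le> degree (pderiv (dehom f))" by (intro dvd_imp_degree_le)
  then show False using degree_dehom d by (simp add: degree_pderiv)
qed

lemma place_neq_0:
  assumes "homogeneous n P" "\<not> f dvd P" "fls_deriv X \<noteq> 0" "ev fls_const f Y X 1 = 0"
  shows "ev fls_const P Y X 1 \<noteq> 0"
  unfolding e2_dehom[symmetric]
  by (rule e2_neq_0[OF irreducible_dehom]) (use assms degree_dehom d dehom_dvd_iff in \<open>auto simp: e2_dehom\<close>)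

lemma constant_along_curve:
  assumes Q: "homogeneous 2 Q" "\<not> f dvd Q" and even: "even_at_points f F Q" and F: "homogeneous (2 * m) F"
  obtains k where "f dvd F - const3 k * Q ^ m"
proof -
  obtain X Y where XY: "fls_deriv X \<noteq> 0" "e2 X Y (dehom f) = 0" using place_exists[of "dehom f"] degree_dehom d by auto
  have f0: "ev fls_const f Y X 1 = 0" using XY(2) by (simp add: e2_dehom)
  have "ev fls_const Q Y X 1 \<noteq> 0" by (rule place_neq_0[OF Q XY(1) f0])
  moreover have "ev fls_const (pderiv f) Y X 1 \<noteq> 0" by (rule place_neq_0[OF homogeneous_pderiv[OF hom] not_dvd_pderiv XY(1) f0])
  ultimately obtain k where k: "ev fls_const (F - const3 k * Q ^ m) Y X 1 = 0"
    using constant_along_place[OF irr hom Q(2) not_dvd_pderiv Q(1) even F f0] by blast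
  have "homogeneous (0 + 2 * m) (const3 k * Q ^ m)" by (intro homogeneous_mult homogeneous_power homogeneous_const3 Q)
  then have h: "homogeneous (2 * m) (F - const3 k * Q ^ m)" using F by (intro homogeneous_diff) simp_all
  have "f dvd F - const3 k * Q ^ m" using place_neq_0[OF h _ XY(1) f0] k by blast
  then show ?thesis by (rule that)
qed

lemma degree_le_2_of_osculation:
  assumes d2: "2 \<le> d" and F: "homogeneous n F" "F \<noteq> 0" "even n" "f dvd F" and Q: "homogeneous 2 Q" "\<not> double_line Q" "\<not> f dvd Q"
    and even: "even_at_points f F Q"
    and osc: "\<And>u1 u2 u3 v1 v2 v3 w1 w2 w3. osculating F Q n (u1,u2,u3) (v1,v2,v3) (w1,w2,w3) \<Longrightarrow> u3 = 0 \<and> v3 = 0"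
  shows "d \<le> 2"
proof -
  have al: "even_along f F Q" by (rule even_along_of_points[OF irr hom Q(3) not_dvd_pderiv Q(1) even])
  have reg: "xd X (xd X Y) \<noteq> 0 \<and> 0 \<le> fls_subdegree (field_derivation.conic_invariant (xd X) (xd X (xd X Y)))"
    if XY: "fls_deriv X \<noteq> 0" "e2 X Y (dehom f) = 0" for X Y
  proof (rule place_regular[OF F(1-3) Q(1,2) hom al F(4) osc XY(1)])
    show f0: "ev fls_const f Y X 1 = 0" using XY(2) by (simp add: e2_dehom)
    show "ev fls_const Q Y X 1 \<noteq> 0" by (rule place_neq_0[OF Q(1,3) XY(1) f0])
    show "ev fls_const (pderiv f) Y X 1 \<noteq> 0" by (rule place_neq_0[OF homogeneous_pderiv[OF hom] not_dvd_pderiv XY(1) f0])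
    fix p q r assume z: "fls_const p * Y + fls_const q * X + fls_const r * 1 = 0"
    define E where "E = [:[:r, q:], [:p:]:]"
    have "e2 X Y E = 0" using z by (simp add: E_def e2_def peval_pCons e1_def algebra_simps)
    then have "dehom f dvd E" using e2_neq_0[OF irreducible_dehom _ _ XY(1,2), of E] degree_dehom d by auto
    moreover have "degree E < degree (dehom f)" using degree_dehom(1) d2 degree_pCons_le[of "[:r, q:]" "[:[:p:]:]"] by (simp add: E_def)
    ultimately have "E = 0" using dvd_imp_degree_le[of "dehom f" E] by force
    then show "p = 0 \<and> q = 0 \<and> r = 0" by (simp add: E_def)
  qed
  have "degree (dehom f) \<le> 2"
    by (rule affine_curve_degree_le_2[OF irreducible_dehom degree_dehom(2)]) (use degree_dehom(1) d reg in auto)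
  then show ?thesis using degree_dehom(1) by simp
qed

end

lemma homogeneous_factor:
  fixes f h :: poly3
  assumes f: "homogeneous d f" "f \<noteq> 0" and h: "h \<noteq> 0" and fh: "homogeneous n (f * h)"
  shows "d \<le> n \<and> homogeneous (n - d) h"
proof -
  define H where "H c = [:const3 c:]" for c
  have H: "ring_hom_fun H" unfolding H_def[abs_def] by (rule ring_hom_fun_comp[OF ring_hom_fun_pCons_const ring_hom_fun_const3])
  define x1 x2 x3 :: poly3 where "x1 = [:0, 1:]" and "x2 = [:[:0, 1:]:]" and "x3 = [:[:[:0, 1:]:]:]"
  have m: "const3 c * x1 ^ i * x2 ^ j * x3 ^ k = monom (monom (monom c k) j) i" for c i j k
  proof -
    show ?thesis unfolding const3_def x1_def x2_def x3_def X_power const_poly_power by (simp add: smult_monom mult.commute)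
  qed
  define \<Phi> where "\<Phi> g = ev H g (monom x1 1) (monom x2 1) (monom x3 1)" for g
  have \<Phi>m: "\<Phi> (g * g') = \<Phi> g * \<Phi> g'" for g g' unfolding \<Phi>_def by (rule ev_simps(4)[OF H])
  have c\<Phi>: "cf3 (coeff (\<Phi> g) N) i j k = (if i + j + k = N then cf3 g i j k else 0)" for g N i j k
  proof -
    obtain B where B: "\<And>i j k. cf3 g i j k \<noteq> 0 \<Longrightarrow> i \<le> B \<and> j \<le> B \<and> k \<le> B" using ex_coeff_bound by blast
    have "\<Phi> g = (\<Sum>i\<le>B. \<Sum>j\<le>B. \<Sum>k\<le>B. H (cf3 g i j k) * monom x1 1 ^ i * monom x2 1 ^ j * monom x3 1 ^ k)"
      unfolding \<Phi>_def by (rule ev_altdef[OF H]) (use B in blast)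
    also have "\<dots> = (\<Sum>i\<le>B. \<Sum>j\<le>B. \<Sum>k\<le>B. monom (monom (monom (monom (cf3 g i j k) k) j) i) (i + j + k))"
      by (intro sum.cong refl) (simp add: H_def monom_power mult_monom m[symmetric] smult_monom mult.assoc)
    finally have "cf3 (coeff (\<Phi> g) N) i j k = (\<Sum>i'\<le>B. \<Sum>j'\<le>B. \<Sum>k'\<le>B. if k' = k then (if j' = j then (if i' = i then (if i + j + k = N then cf3 g i j k else 0) else 0) else 0) else 0)"
      by (simp only: coeff_sum) (intro sum.cong refl, auto)
    also have "\<dots> = (if i + j + k = N then cf3 g i j k else 0)"
      using B[of i j k] by (cases "k \<le> B"; cases "j \<le> B"; cases "i \<le> B"; auto simp: sum.delta)
    finally show ?thesis .
  qed
  have hm: "\<Phi> g = monom g e" if "homogeneous e g" for g e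
    by (rule poly_eqI, rule poly3_eqI) (use that in \<open>auto simp: c\<Phi> homogeneous_def\<close>)
  have "monom f d * \<Phi> h = monom (f * h) n" using \<Phi>m[of f h] hm[OF f(1)] hm[OF fh] by simp
  then have e: "coeff (monom f d * \<Phi> h) (N + d) = (if N + d = n then f * h else 0)" for N by simp
  have "f * coeff (\<Phi> h) N = f * (if N + d = n then h else 0)" for N
    using e[of N] by (simp add: coeff_monom_mult)
  then have ch: "coeff (\<Phi> h) N = (if N + d = n then h else 0)" for N using f(2) mult_left_cancel by blast
  obtain i j k where ijk: "cf3 h i j k \<noteq> 0" using h poly3_eqI[of h 0] by auto
  then have "cf3 (coeff (\<Phi> h) (i + j + k)) i j k \<noteq> 0" using c\<Phi>[of h "i + j + k" i j k] by simp
  then have "i + j + k + d = n" unfolding ch by (auto split: if_splits)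
  then have dn: "d \<le> n" by simp
  moreover have "homogeneous (n - d) h"
    unfolding homogeneous_def
  proof (intro allI impI)
    fix i j k assume "cf3 h i j k \<noteq> 0"
    then have "cf3 (coeff (\<Phi> h) (i + j + k)) i j k \<noteq> 0" using c\<Phi>[of h "i + j + k" i j k] by simp
    then have "i + j + k + d = n" unfolding ch by (auto split: if_splits)
    then show "i + j + k = n - d" by simp
  qed
  ultimately show ?thesis by simp
qed

section \<open>The degree of the curve\<close>

lemma subst3_dvd_iff:
  assumes "det3 u v w \<noteq> 0"
  shows "subst3 u v w f dvd subst3 u v w P \<longleftrightarrow> f dvd P"
proof -
  obtain u' v' w' where i: "\<And>F. subst3 u' v' w' (subst3 u v w F) = F" using subst3_inverse[OF assms] by metis
  have d: "subst3 a b c g dvd subst3 a b c h" if "g dvd h" for a b c g h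
    using that by (auto simp: ring_hom_fun_simps(4)[OF ring_hom_fun_subst3] elim!: dvdE)
  show ?thesis using d[of f P u v w] d[of "subst3 u v w f" "subst3 u v w P" u' v' w'] unfolding i by blast
qed

lemma irreducible_subst3:
  assumes det: "det3 u v w \<noteq> 0" and f: "irreducible f"
  shows "irreducible (subst3 u v w f)"
proof (rule irreducibleI)
  obtain u' v' w' where i: "\<And>F. subst3 u' v' w' (subst3 u v w F) = F" "\<And>F. subst3 u v w (subst3 u' v' w' F) = F"
    using subst3_inverse[OF det] by metis
  note s = ring_hom_fun_simps[OF ring_hom_fun_subst3]
  have unit: "is_unit (subst3 u v w g) \<longleftrightarrow> is_unit g" for g using subst3_dvd_iff[OF det, of g 1] by (simp add: s)
  show "subst3 u v w f \<noteq> 0" using f by (auto simp: subst3_eq_0_iff[OF det])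
  show "\<not> is_unit (subst3 u v w f)" using f by (simp add: unit irreducible_not_unit)
  fix g h assume "subst3 u v w f = g * h"
  then have "f = subst3 u' v' w' g * subst3 u' v' w' h" using i(1)[of f] by (simp add: s)
  then have "is_unit (subst3 u' v' w' g) \<or> is_unit (subst3 u' v' w' h)" using f by (auto dest: irreducibleD)
  then show "is_unit g \<or> is_unit h" using unit[of "subst3 u' v' w' g"] unit[of "subst3 u' v' w' h"] unfolding i(2) by blast
qed

lemma double_line_subst3_iff:
  assumes det: "det3 u v w \<noteq> 0"
  shows "double_line (subst3 u v w Q) \<longleftrightarrow> double_line Q"
proof -
  obtain u' v' w' where i: "\<And>F. subst3 u' v' w' (subst3 u v w F) = F" using subst3_inverse[OF det] by metis
  show ?thesis using double_line_subst3[of Q u v w] double_line_subst3[of "subst3 u v w Q" u' v' w'] unfolding i by blast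
qed

lemma monic_chart:
  assumes f: "irreducible f" "homogeneous d f" "d > 0" and det: "det3 u v w \<noteq> 0" and u: "u = (a, b, c)" "ev (\<lambda>x. x) f a b c \<noteq> 0"
  obtains f' where "monic_form f' d" "\<And>P. f' dvd subst3 u v w P \<longleftrightarrow> f dvd P"
    "\<And>F Q. even_at_points f F Q \<Longrightarrow> even_at_points f' (subst3 u v w F) (subst3 u v w Q)"
proof -
  define g where "g = subst3 u v w f"
  define k where "k = ev (\<lambda>x. x) f a b c"
  have k: "k \<noteq> 0" using u by (simp add: k_def)
  note c3 = ring_hom_fun_simps[OF ring_hom_fun_const3]
  have cc: "const3 (1 / k) * const3 k = 1" unfolding c3(4)[symmetric] using k by (simp add: c3(2))
  have un: "is_unit (const3 (1 / k))" by (rule dvdI[OF cc[symmetric]])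
  define f' where "f' = const3 (1 / k) * g"
  have g: "irreducible g" "homogeneous d g" unfolding g_def by (rule irreducible_subst3[OF det f(1)], rule homogeneous_subst3[OF f(2)])
  have g1: "ev (\<lambda>x. x) g 1 0 0 = k"
    unfolding g_def k_def u by (cases v, cases w) (simp add: ev_subst3[OF ring_hom_fun_id])
  have dvd: "f' dvd P \<longleftrightarrow> g dvd P" for P unfolding f'_def using un by (simp add: mult_unit_dvd_iff')
  have h': "homogeneous d f'" using homogeneous_mult[OF homogeneous_const3 g(2), of "1 / k"] by (simp add: f'_def)
  have m: "monic_form f' d"
  proof
    show "irreducible f'" unfolding f'_def using un g(1) by (simp add: irreducible_mult_unit_left)
    show "cf3 f' d 0 0 = 1" unfolding ev_100[OF h', symmetric] unfolding f'_def using g1 k by (simp add: ev_simps[OF ring_hom_fun_id] ev_const3[OF ring_hom_fun_id])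
  qed (fact h' f(3))+
  have e: "ev (\<lambda>x. x) f' x y z = 1 / k * ev (\<lambda>x. x) g x y z" for x y z
    unfolding f'_def ev_simps(4)[OF ring_hom_fun_id] ev_const3[OF ring_hom_fun_id] ..
  have dde: "dd (\<lambda>x. x) f' x y z x' y' z' = 1 / k * dd (\<lambda>x. x) g x y z x' y' z'" for x y z x' y' z'
    unfolding dd_def f'_def ev_simps(4)[OF ring_hom_fun_pCons_const] ev_const3[OF ring_hom_fun_pCons_const] by simp
  have "even_at_points f' (subst3 u v w F) (subst3 u v w Q)" if "even_at_points f F Q" for F Q
    using even_at_points_subst3[OF that, of u v w] k unfolding even_at_points_def e dde g_def[symmetric] by simp
  moreover have "f' dvd subst3 u v w P \<longleftrightarrow> f dvd P" for P unfolding dvd g_def by (rule subst3_dvd_iff[OF det])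
  ultimately show ?thesis using that[OF m] by blast
qed

lemma frame_completion:
  assumes "(a, b, c) \<noteq> (0, 0, 0)"
  obtains v w where "det3 (a, b, c) v w \<noteq> 0"
proof -
  consider "a \<noteq> 0" | "b \<noteq> 0" | "c \<noteq> 0" using assms by auto
  then show thesis
  proof cases
    case 1 then show ?thesis by (intro that[of "(0,1,0)" "(0,0,1)"]) (simp add: det3_def)
  next
    case 2 then show ?thesis by (intro that[of "(0,0,1)" "(1,0,0)"]) (simp add: det3_def)
  next
    case 3 then show ?thesis by (intro that[of "(1,0,0)" "(0,1,0)"]) (simp add: det3_def)
  qed
qed

lemma ev_origin: "homogeneous d f \<Longrightarrow> d > 0 \<Longrightarrow> ev (\<lambda>x. x) f 0 0 0 = 0"
  using ev_scale[OF ring_hom_fun_id, of d f 0 0 0 0] by (simp add: zero_power)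

lemma constant_along_curve:
  assumes f: "irreducible f" "homogeneous d f" "d > 0" and Q: "homogeneous 2 Q" "\<not> f dvd Q" and even: "even_at_points f F Q" and F: "homogeneous (2 * m) F"
  obtains k where "f dvd F - const3 k * Q ^ m"
proof -
  have "f \<noteq> 0" using f by auto
  then obtain a b c where abc: "ev (\<lambda>x. x) f a b c \<noteq> 0" using ev_eq_0_iff by blast
  then have "(a, b, c) \<noteq> (0, 0, 0)" using ev_origin[OF f(2,3)] by auto
  then obtain v w where det: "det3 (a, b, c) v w \<noteq> 0" by (rule frame_completion)
  obtain f' where f': "monic_form f' d" "\<And>P. f' dvd subst3 (a,b,c) v w P \<longleftrightarrow> f dvd P"
    "\<And>F Q. even_at_points f F Q \<Longrightarrow> even_at_points f' (subst3 (a,b,c) v w F) (subst3 (a,b,c) v w Q)"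
    using monic_chart[OF f det refl abc] by blast
  interpret monic_form f' d by (rule f'(1))
  obtain k where k: "f' dvd subst3 (a,b,c) v w F - const3 k * subst3 (a,b,c) v w Q ^ m"
    by (rule constant_along_curve[OF homogeneous_subst3[OF Q(1)] _ f'(3)[OF even] homogeneous_subst3[OF F]]) (use Q(2) f'(2) in auto)
  have "subst3 (a,b,c) v w (const3 k) = const3 k"
    by (rule poly3_ev_eqI, cases v, cases w) (simp add: ev_subst3[OF ring_hom_fun_id] ev_const3[OF ring_hom_fun_id])
  then have "subst3 (a,b,c) v w F - const3 k * subst3 (a,b,c) v w Q ^ m = subst3 (a,b,c) v w (F - const3 k * Q ^ m)"
    by (simp add: ring_hom_fun_simps[OF ring_hom_fun_subst3])
  then have "f dvd F - const3 k * Q ^ m" using k f'(2) by simp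
  then show ?thesis by (rule that)
qed

lemma irreducible_z: "irreducible (lin3 0 0 1)"
proof -
  have "irreducible ([:0, 1:] :: complex poly)" by (rule irreducible_linear_field_poly) simp
  then have "irreducible [:[:[:0, 1:] :: complex poly:]:]" by (simp only: irreducible_const_poly_iff)
  then show ?thesis by (simp add: lin3_def)
qed

lemma point_off_curve_on_line:
  assumes f: "irreducible f" "homogeneous d f" "2 \<le> d"
  obtains a b where "ev (\<lambda>x. x) f a b 0 \<noteq> 0"
proof (rule ccontr)
  assume "\<not> thesis"
  then have z: "ev (\<lambda>x. x) f a b 0 = 0" for a b using that by blast
  have "lin3 0 0 1 dvd f"
    by (rule irreducible_dvd_of_zeros[OF irreducible_z]) (use z in \<open>simp add: ev_lin3[OF ring_hom_fun_id]\<close>)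
  then obtain g where g: "f = lin3 0 0 1 * g" by (elim dvdE)
  then have "is_unit g" using f(1) irreducible_z by (auto dest: irreducibleD simp: irreducible_not_unit)
  then obtain h where "g * h = 1" by (auto elim: dvdE)
  then have "f * h = lin3 0 0 1" unfolding g by (simp add: mult.assoc)
  moreover have "lin3 0 0 1 \<noteq> 0" using irreducible_z by auto
  moreover from calculation have "h \<noteq> 0" by auto
  moreover have "f \<noteq> 0" using f(1) by auto
  ultimately have "d \<le> 1" using homogeneous_factor[OF f(2), of h 1] homogeneous_lin3[of 0 0 1] by auto
  then show False using f(3) by simp
qed

theorem degree_le_2:
  assumes f: "irreducible f" "homogeneous d f" "2 \<le> d" and Q: "homogeneous 2 Q" "\<not> double_line Q" "\<not> f dvd Q"
    and even: "even_at_points f F0 Q" and F0: "homogeneous (2 * m) F0" "\<And>k. F0 \<noteq> const3 k * Q ^ m"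
  shows "d \<le> 2"
proof -
  have d0: "d > 0" using f(3) by simp
  have fnz: "f \<noteq> 0" using f(1) by auto
  obtain k where k: "f dvd F0 - const3 k * Q ^ m" by (rule constant_along_curve[OF f(1,2) d0 Q(1,3) even F0(1)])
  define F1 where "F1 = F0 - const3 k * Q ^ m"
  have "homogeneous (0 + 2 * m) (const3 k * Q ^ m)" by (intro homogeneous_mult homogeneous_power homogeneous_const3 Q)
  then have F1: "homogeneous (2 * m) F1" "F1 \<noteq> 0" using F0 unfolding F1_def by (auto intro: homogeneous_diff)
  have nd: "double_line 0" unfolding double_line_def by (rule exI[of _ 0]) (simp add: ring_hom_fun_simps[OF ring_hom_fun_const3])
  then have Q0: "Q \<noteq> 0" using Q(2) by auto
  have Qnu: "\<not> is_unit Q"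
  proof
    assume "is_unit Q"
    then obtain h where h: "Q * h = 1" by (auto elim: dvdE)
    have "homogeneous 0 (Q * h)" unfolding h using homogeneous_const3[of 1] by (simp add: ring_hom_fun_simps[OF ring_hom_fun_const3])
    moreover have "h \<noteq> 0" using h by auto
    ultimately have "2 \<le> (0::nat)" using homogeneous_factor[OF Q(1) Q0, of h 0] by blast
    then show False by simp
  qed
  obtain F where F: "F1 = Q ^ multiplicity Q F1 * F" "\<not> Q dvd F"
    using multiplicity_decompose'[of F1 Q] F1(2) Qnu by metis
  define e where "e = multiplicity Q F1"
  have Fnz: "F \<noteq> 0" using F1(2) F(1) by auto
  have Qe: "homogeneous (2 * e) (Q ^ e)" by (rule homogeneous_power[OF Q(1)])
  have "2 * e \<le> 2 * m \<and> homogeneous (2 * m - 2 * e) F"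
    by (rule homogeneous_factor[OF Qe]) (use Q0 Fnz F1(1) F(1) e_def in auto)
  then have Fh: "homogeneous (2 * m - 2 * e) F" by simp
  define n where "n = 2 * m - 2 * e"
  have n: "Parity.even n" by (simp add: n_def)
  have "prime_elem f" using f(1) by (simp add: prime_elem_iff_irreducible)
  then have fF: "f dvd F" using k F(1) Q(3) unfolding F1_def[symmetric] by (metis prime_elem_dvd_mult_iff prime_elem_dvd_power)
  have evF: "even_at_points f F Q"
    unfolding even_at_points_def
  proof (intro allI impI)
    fix a b c a' b' c' a'' b'' c''
    assume z: "ev (\<lambda>x. x) f a b c = 0" "ev (\<lambda>x. x) Q a b c \<noteq> 0" "dd (\<lambda>x. x) f a b c a'' b'' c'' \<noteq> 0"
      "dd (\<lambda>x. x) f a b c a' b' c' = 0" "dd (\<lambda>x. x) Q a b c a' b' c' = 0"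
    define r where "r G = ev (\<lambda>x. [:x:]) G [:a, a':] [:b, b':] [:c, c':]" for G
    have pr: "poly (r G) s = ev (\<lambda>x. x) G (a + s * a') (b + s * b') (c + s * c')" for G s
      unfolding r_def ev_hom[OF ring_hom_fun_poly ring_hom_fun_pCons_const] by simp
    have rF0: "even_poly (r F0)"
      unfolding even_poly_def pr
    proof
      fix s
      have "dd (\<lambda>x. x) G a b c (s * a') (s * b') (s * c') = s * dd (\<lambda>x. x) G a b c a' b' c'" for G
        using dd_linear[OF ring_hom_fun_id, of G a b c s a' 0 0 b' 0 c' 0] by simp
      then have "dd (\<lambda>x. x) f a b c (s * a') (s * b') (s * c') = 0" "dd (\<lambda>x. x) Q a b c (s * a') (s * b') (s * c') = 0" using z by simp_all
      then have "ev (\<lambda>x. x) F0 (a + s * a') (b + s * b') (c + s * c') = ev (\<lambda>x. x) F0 (a - s * a') (b - s * b') (c - s * c')"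
        using even z(1-3) unfolding even_at_points_def by blast
      then show "ev (\<lambda>x. x) F0 (a + - s * a') (b + - s * b') (c + - s * c') = ev (\<lambda>x. x) F0 (a + s * a') (b + s * b') (c + s * c')" by simp
    qed
    have pol: "poly (r Q) s = ev (\<lambda>x. x) Q a b c + s * dd (\<lambda>x. x) Q a b c a' b' c' + s ^ 2 * ev (\<lambda>x. x) Q a' b' c'" for s
    proof -
      have "coeff (r Q) 1 = dd (\<lambda>x. x) Q a b c a' b' c'" by (simp add: r_def dd_def)
      moreover have "r Q = [:ev (\<lambda>x. x) Q a b c, dd (\<lambda>x. x) Q a b c a' b' c', ev (\<lambda>x. x) Q a' b' c':]"
        unfolding dd_def r_def ev_quadratic[OF ring_hom_fun_id Q(1)] ev_quadratic[OF ring_hom_fun_pCons_const Q(1)]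
        by (simp add: power2_eq_square algebra_simps)
      ultimately show ?thesis by (simp add: power2_eq_square algebra_simps)
    qed
    have rQ: "even_poly (r Q)" unfolding even_poly_def pol z(5) by simp
    have "poly (r Q) 0 \<noteq> 0" unfolding pol using z(2) by simp
    then have rQ0: "r Q \<noteq> 0" by auto
    have rm: "r (G * H) = r G * r H" "r (G - H) = r G - r H" "r (G ^ j) = r G ^ j" "r (const3 s) = [:s:]" for G H j s
      unfolding r_def by (simp_all add: ev_simps[OF ring_hom_fun_pCons_const] ev_const3[OF ring_hom_fun_pCons_const])
    have "poly (r F1) (- s) = poly (r F1) s" for s
      using rF0 rQ unfolding F1_def rm even_poly_def by (simp add: poly_power)
    moreover have "r F1 = r Q ^ e * r F" using F(1) unfolding e_def[symmetric] by (simp add: rm)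
    ultimately have q: "poly (r Q) s ^ e * (poly (r F) (- s) - poly (r F) s) = 0" for s
      using rQ unfolding even_poly_def by (simp add: poly_power algebra_simps)
    have "r Q ^ e * (pcompose (r F) [:0, -1:] - r F) = 0"
      by (intro poly_eq_poly_eq_iff[THEN iffD1] ext) (use q in \<open>simp add: poly_power poly_pcompose\<close>)
    then have "pcompose (r F) [:0, -1:] = r F" using rQ0 by simp
    moreover have "poly (pcompose (r F) [:0, -1:]) 1 = poly (r F) (- 1)" by (simp add: poly_pcompose)
    ultimately have "poly (r F) 1 = poly (r F) (- 1)" by simp
    then show "ev (\<lambda>x. x) F (a + a') (b + b') (c + c') = ev (\<lambda>x. x) F (a - a') (b - b') (c - c')" unfolding pr by simp
  qed
  obtain u0 v0 w0 where det0: "det3 u0 v0 w0 \<noteq> 0" and osc: "\<And>u v w. osculating F Q n u v w \<Longrightarrow> det3 u0 v0 u = 0 \<and> det3 u0 v0 v = 0"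
  proof (cases "\<exists>u v w. osculating F Q n u v w")
    case True
    then obtain u v w where o: "osculating F Q n u v w" by blast
    show ?thesis
      by (rule that[of u v w]) (use o osculating_tangent[OF Fh[folded n_def] Q(1) F(2) o] in \<open>auto simp: osculating_def\<close>)
  next
    case False
    show ?thesis by (rule that[of "(1,0,0)" "(0,1,0)" "(0,0,1)"]) (use False in \<open>auto simp: det3_def\<close>)
  qed
  define f0 where "f0 = subst3 u0 v0 w0 f"
  have f0: "irreducible f0" "homogeneous d f0" unfolding f0_def by (rule irreducible_subst3[OF det0 f(1)], rule homogeneous_subst3[OF f(2)])
  obtain x y where xy: "ev (\<lambda>x. x) f0 x y 0 \<noteq> 0" by (rule point_off_curve_on_line[OF f0 f(3)])
  have "(x, y) \<noteq> (0, 0)" using xy ev_origin[OF f0(2) d0] by auto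
  then obtain x' y' where det1: "det3 (x,y,0) (x',y',0) (0,0,1) \<noteq> 0"
  proof (cases "x = 0")
    case True
    then show ?thesis using \<open>(x, y) \<noteq> (0, 0)\<close> by (intro that[of 1 0]) (simp add: det3_def)
  next
    case False
    then show ?thesis by (intro that[of 0 1]) (simp add: det3_def)
  qed
  define u v w where "u = lc3 u0 v0 w0 (x,y,0)" and "v = lc3 u0 v0 w0 (x',y',0)" and "w = lc3 u0 v0 w0 (0,0,1)"
  have det: "det3 u v w \<noteq> 0" unfolding u_def v_def w_def det3_lc3 using det0 det1 by simp
  obtain a b c where abc: "u = (a, b, c)" by (cases u)
  have "ev (\<lambda>x. x) f a b c = ev (\<lambda>x. x) f0 x y 0"
    using abc unfolding u_def f0_def by (cases u0, cases v0, cases w0) (simp add: lc3_def ev_subst3[OF ring_hom_fun_id])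
  then have uf: "ev (\<lambda>x. x) f a b c \<noteq> 0" using xy by simp
  obtain f' where f': "monic_form f' d" "\<And>P. f' dvd subst3 u v w P \<longleftrightarrow> f dvd P"
    "\<And>F Q. even_at_points f F Q \<Longrightarrow> even_at_points f' (subst3 u v w F) (subst3 u v w Q)"
    using monic_chart[OF f(1,2) d0 det abc uf] by blast
  interpret monic_form f' d by (rule f'(1))
  show ?thesis
  proof (rule degree_le_2_of_osculation[OF f(3) homogeneous_subst3[OF Fh[folded n_def]] _ n _ homogeneous_subst3[OF Q(1)] _ _ f'(3)[OF evF]])
    show "subst3 u v w F \<noteq> 0" using Fnz by (simp add: subst3_eq_0_iff[OF det])
    show "f' dvd subst3 u v w F" unfolding f'(2) by (rule fF)
    show "\<not> double_line (subst3 u v w Q)" unfolding double_line_subst3_iff[OF det] by (rule Q(2))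
    show "\<not> f' dvd subst3 u v w Q" unfolding f'(2) by (rule Q(3))
    fix u1 u2 u3 v1 v2 v3 w1 w2 w3
    assume o: "osculating (subst3 u v w F) (subst3 u v w Q) n (u1,u2,u3) (v1,v2,v3) (w1,w2,w3)"
    have "osculating F Q n (lc3 u v w (u1,u2,u3)) (lc3 u v w (v1,v2,v3)) (lc3 u v w (w1,w2,w3))"
      using o det unfolding osculating_def subst3_subst3 det3_lc3 by simp
    then have "det3 u0 v0 (lc3 u v w (u1,u2,u3)) = 0 \<and> det3 u0 v0 (lc3 u v w (v1,v2,v3)) = 0" by (rule osc)
    moreover have "det3 u0 v0 (lc3 u v w (p,q,r)) = det3 u0 v0 w0 * r" for p q r
      unfolding u_def v_def w_def by (cases u0, cases v0, cases w0) (simp add: lc3_def det3_def algebra_simps)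
    ultimately show "u3 = 0 \<and> v3 = 0" using det0 by simp
  qed
qed

section \<open>Angular billiards\<close>

definition vec3 :: "complex \<Rightarrow> complex \<Rightarrow> complex \<Rightarrow> complex^3" where
  "vec3 a b c = vector [a, b, c]"

lemma vec3_nth [simp]: "vec_nth (vec3 a b c) 1 = a" "vec_nth (vec3 a b c) 2 = b" "vec_nth (vec3 a b c) 3 = c"
  by (simp_all add: vec3_def vector_3)

lemma vec_eq3: "v = w \<longleftrightarrow> vec_nth v 1 = vec_nth w 1 \<and> vec_nth v 2 = vec_nth w 2 \<and> vec_nth v 3 = vec_nth (w :: complex^3) 3"
  by (simp add: vec_eq_iff forall_3)

lemma eval3_vec3: "eval3 F (vec3 a b c) = ev (\<lambda>x. x) F a b c"
  by (simp add: eval3_eq_ev)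

lemma abs_cp2_scale:
  assumes "k \<noteq> 0" "v \<noteq> 0"
  shows "abs_cp2 (k *s v) = abs_cp2 v"
proof -
  have "proj_rel v (k *s v)" using assms by (auto simp: proj_rel_def)
  then show ?thesis using Quotient3_rel[OF Quotient3_cp2, of v "k *s v"] by auto
qed

lemma abs_cp2_eqD:
  assumes "abs_cp2 v = abs_cp2 w" "v \<noteq> 0" "w \<noteq> 0"
  obtains k where "k \<noteq> 0" "w = k *s v"
proof -
  obtain c where c: "c \<noteq> 0" "rep_cp2 (abs_cp2 v) = c *s v" using rep_abs_cp2[OF assms(2)] .
  obtain d where d: "d \<noteq> 0" "rep_cp2 (abs_cp2 w) = d *s w" using rep_abs_cp2[OF assms(3)] .
  have "c *s v = d *s w" using c d assms(1) by simp
  then have "w = (c / d) *s v" using d(1) by (auto simp: vec_eq_iff field_simps)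
  then show ?thesis using c d by (intro that[of "c / d"]) auto
qed

lemma dd_scale:
  assumes F: "homogeneous n F" and k: "k \<noteq> (0::complex)"
  shows "dd (\<lambda>x. x) F (k * a) (k * b) (k * c) a' b' c' = k ^ n / k * dd (\<lambda>x. x) F a b c a' b' c'"
proof -
  have e: "[:k * x, y:] = [:k:] * [:x, 1 / k * y:]" for x y using k by simp
  have "dd (\<lambda>x. x) F (k * a) (k * b) (k * c) a' b' c' = k ^ n * dd (\<lambda>x. x) F a b c (1 / k * a') (1 / k * b') (1 / k * c')"
    unfolding dd_def e ev_scale[OF ring_hom_fun_pCons_const F] const_poly_power by simp
  also have "\<dots> = k ^ n * (1 / k * dd (\<lambda>x. x) F a b c a' b' c')"
    using dd_linear[OF ring_hom_fun_id, of F a b c "1 / k" a' 0 0 b' 0 c' 0] by simp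
  finally show ?thesis by simp
qed

lemma ev_quadratic_span:
  assumes Q: "homogeneous 2 Q"
  shows "ev (\<lambda>x. x) Q (x * a + y * a') (x * b + y * b') (x * c + y * c') =
    x ^ 2 * ev (\<lambda>x. x) Q a b c + x * y * dd (\<lambda>x. x) Q a b c a' b' c' + y ^ 2 * ev (\<lambda>x. x) Q a' b' c'"
  unfolding dd_def ev_quadratic[OF ring_hom_fun_id Q] ev_quadratic[OF ring_hom_fun_pCons_const Q]
  by (simp add: power2_eq_square algebra_simps)

lemma grad3_dot:
  "vec_nth (grad3 f v) 1 * x + vec_nth (grad3 f v) 2 * y + vec_nth (grad3 f v) 3 * z =
    dd (\<lambda>x. x) f (vec_nth v 1) (vec_nth v 2) (vec_nth v 3) x y z"
  unfolding dd_eq_grad[OF ring_hom_fun_id] grad3_def by (simp add: vector_3 eval3_eq_ev gr2_def gr3_def)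

lemma angular_symmetry_reflection:
  fixes C R :: "complex^3" and A :: "complex^3^3"
  assumes Q: "homogeneous 2 Q" and I: "I = zero_locus Q"
    and QCR: "\<And>x y. eval3 Q (x *s C + y *s R) = x ^ 2 * eval3 Q C + y ^ 2 * eval3 Q R"
    and QC: "eval3 Q C \<noteq> 0"
    and ind: "\<And>x y. (\<And>i. x * vec_nth C i + y * vec_nth R i = 0) \<Longrightarrow> x = 0 \<and> y = 0"
    and L: "\<And>v. v \<noteq> 0 \<Longrightarrow> abs_cp2 v \<in> L \<longleftrightarrow> (\<exists>x y. v = x *s C + y *s R)" and line: "projective_line L"
    and A: "invertible A" "\<And>p. \<sigma> p = abs_cp2 (A *v rep_cp2 p)" and sym: "is_angular_symmetry I (abs_cp2 C) \<sigma>"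
  obtains k where "k \<noteq> 0" "\<And>s. A *v (C + s *s R) = k *s (C - s *s R)"
proof -
  have C0: "C \<noteq> 0"
  proof
    assume "C = 0"
    then show False using QCR[of 0 0] QCR[of 1 0] QC by simp
  qed
  have R0: "R \<noteq> 0" using ind[of 0 1] by auto
  have A0: "A *v v \<noteq> 0" if "v \<noteq> 0" for v
    using that A(1) by (metis invertible_def matrix_vector_mul_assoc matrix_vector_mul_lid matrix_vector_mult_0_right)
  have sg: "\<sigma> (abs_cp2 v) = abs_cp2 (A *v v)" if v: "v \<noteq> 0" for v
  proof -
    obtain c where c: "c \<noteq> 0" "rep_cp2 (abs_cp2 v) = c *s v" using rep_abs_cp2[OF v] .
    then show ?thesis using abs_cp2_scale[OF c(1) A0[OF v]] by (simp add: A(2) vector_scalar_commute)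
  qed
  have fix_vec: "\<exists>k. k \<noteq> 0 \<and> A *v v = k *s w" if "\<sigma> (abs_cp2 v) = abs_cp2 w" "v \<noteq> 0" "w \<noteq> 0" for v w
    using abs_cp2_eqD[of w "A *v v"] that A0[of v] sg[of v] by metis
  have fx: "\<sigma> (abs_cp2 C) = abs_cp2 C" and inv: "\<sigma> \<circ> \<sigma> = id" using sym by (auto simp: is_angular_symmetry_def)
  obtain k where k: "k \<noteq> 0" "A *v C = k *s C" using fix_vec[OF fx C0 C0] by blast
  have CL: "abs_cp2 C \<in> L" unfolding L[OF C0] by (rule exI[of _ 1], rule exI[of _ 0]) simp
  note symL = sym[unfolded is_angular_symmetry_def, THEN conjunct2, THEN conjunct2, THEN conjunct2, rule_format, OF conjI[OF line CL]]
  have lin: "A *v (x *s C + y *s R) = (x * k) *s C + y *s (A *v R)" for x y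
    by (simp add: matrix_vector_right_distrib vector_scalar_commute k(2))
  have comb0: "x *s C + y *s R \<noteq> 0" if "x \<noteq> 0 \<or> y \<noteq> 0" for x y
    using ind[of x y] that by (auto simp: vec_eq_iff)
  have II: "abs_cp2 v \<in> I \<longleftrightarrow> eval3 Q v = 0" if "v \<noteq> 0" for v unfolding I by (rule abs_cp2_in_zero_locus_iff[OF Q that])
  have "A *v R = (- k) *s R"
  proof (cases "eval3 Q R = 0")
    case False
    define \<rho> where "\<rho> = csqrt (- eval3 Q C / eval3 Q R)"
    have \<rho>2: "\<rho> ^ 2 * eval3 Q R = - eval3 Q C" using False by (simp add: \<rho>_def)
    have \<rho>: "\<rho> \<noteq> 0" using \<rho>2 QC by auto
    define V W where "V = 1 *s C + \<rho> *s R" and "W = 1 *s C + (- \<rho>) *s R"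
    have VW: "V \<noteq> 0" "W \<noteq> 0" unfolding V_def W_def by (rule comb0, simp)+
    have qVW: "eval3 Q V = 0" "eval3 Q W = 0" unfolding V_def W_def QCR using \<rho>2 by simp_all
    have ne: "abs_cp2 V \<noteq> abs_cp2 W"
    proof
      assume "abs_cp2 V = abs_cp2 W"
      then obtain t where t: "W = t *s V" using abs_cp2_eqD[of V W] VW by blast
      have "(1 - t) * vec_nth C i + (- \<rho> - t * \<rho>) * vec_nth R i = 0" for i
        using arg_cong[OF t, of "\<lambda>v. vec_nth v i"] unfolding V_def W_def by (simp add: algebra_simps)
      then have "1 - t = 0 \<and> - \<rho> - t * \<rho> = 0" by (rule ind)
      then have "t = 1" "- \<rho> - t * \<rho> = 0" by auto
      then show False using \<rho> by simp
    qed
    have "L \<inter> I = {abs_cp2 V, abs_cp2 W}"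
    proof (intro equalityI subsetI)
      fix x assume x: "x \<in> L \<inter> I"
      define v where "v = rep_cp2 x"
      have v: "v \<noteq> 0" "abs_cp2 v = x" by (simp_all add: v_def rep_cp2_nonzero abs_rep_cp2)
      obtain \<alpha> \<beta> where ab: "v = \<alpha> *s C + \<beta> *s R" using x v L[OF v(1)] by auto
      have "\<alpha> ^ 2 * eval3 Q C + \<beta> ^ 2 * eval3 Q R = 0" using x v II[OF v(1)] unfolding ab QCR by auto
      moreover have "\<alpha> ^ 2 * eval3 Q C = - ((\<alpha> * \<rho>) ^ 2 * eval3 Q R)" using \<rho>2 by (simp add: power_mult_distrib mult.assoc)
      ultimately have "(\<beta> ^ 2 - (\<alpha> * \<rho>) ^ 2) * eval3 Q R = 0" by (simp add: algebra_simps)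
      then have "\<beta> ^ 2 = (\<alpha> * \<rho>) ^ 2" using False by simp
      then have \<beta>: "\<beta> = \<alpha> * \<rho> \<or> \<beta> = - (\<alpha> * \<rho>)" by (simp add: power2_eq_iff)
      then have \<alpha>: "\<alpha> \<noteq> 0" using v(1) ab by auto
      have "v = \<alpha> *s V \<or> v = \<alpha> *s W" using \<beta> unfolding ab V_def W_def by (auto simp: vec_eq_iff algebra_simps)
      then show "x \<in> {abs_cp2 V, abs_cp2 W}" using v(2) abs_cp2_scale[OF \<alpha>] VW by auto
    next
      fix x assume "x \<in> {abs_cp2 V, abs_cp2 W}"
      moreover have "abs_cp2 V \<in> L" "abs_cp2 W \<in> L"
        unfolding L[OF VW(1)] L[OF VW(2)] unfolding V_def W_def by blast+
      ultimately show "x \<in> L \<inter> I" using II[OF VW(1)] II[OF VW(2)] qVW by auto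
    qed
    then have "\<sigma> (abs_cp2 V) = abs_cp2 W" "\<sigma> (abs_cp2 W) = abs_cp2 V" using symL ne by blast+
    then obtain m m' where m: "A *v V = m *s W" "A *v W = m' *s V" using fix_vec VW by blast
    have c1: "k * vec_nth C i + \<rho> * vec_nth (A *v R) i = m * (vec_nth C i - \<rho> * vec_nth R i)"
      and c2: "k * vec_nth C i - \<rho> * vec_nth (A *v R) i = m' * (vec_nth C i + \<rho> * vec_nth R i)" for i
      using arg_cong[OF m(1), of "\<lambda>v. vec_nth v i"] arg_cong[OF m(2), of "\<lambda>v. vec_nth v i"]
      unfolding V_def W_def lin by (simp_all add: algebra_simps)
    have "(2 * k - m - m') * vec_nth C i + \<rho> * (m - m') * vec_nth R i = 0" for i
      using c1[of i] c2[of i] by algebra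
    then have "2 * k - m - m' = 0 \<and> \<rho> * (m - m') = 0" by (rule ind)
    then have mk: "m = k" "m' = k" using \<rho> by auto
    have "\<rho> * (vec_nth (A *v R) i + k * vec_nth R i) = 0" for i
      using c1[of i] unfolding mk by algebra
    then have "vec_nth (A *v R) i + k * vec_nth R i = 0" for i using \<rho> by simp
    then show ?thesis by (simp add: vec_eq_iff eq_neg_iff_add_eq_0)
  next
    case True
    have "L \<inter> I = {abs_cp2 R}"
    proof (intro equalityI subsetI)
      fix x assume x: "x \<in> L \<inter> I"
      define v where "v = rep_cp2 x"
      have v: "v \<noteq> 0" "abs_cp2 v = x" by (simp_all add: v_def rep_cp2_nonzero abs_rep_cp2)
      obtain \<alpha> \<beta> where ab: "v = \<alpha> *s C + \<beta> *s R" using x v L[OF v(1)] by auto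
      have "\<alpha> ^ 2 * eval3 Q C = 0" using x v II[OF v(1)] True unfolding ab QCR by auto
      then have "\<alpha> = 0" using QC by simp
      then have "v = \<beta> *s R" "\<beta> \<noteq> 0" using ab v(1) by auto
      then show "x \<in> {abs_cp2 R}" using v(2) abs_cp2_scale[OF _ R0, of \<beta>] by auto
    next
      fix x assume "x \<in> {abs_cp2 R}"
      moreover have "abs_cp2 R \<in> L" unfolding L[OF R0] by (rule exI[of _ 0], rule exI[of _ 1]) simp
      ultimately show "x \<in> L \<inter> I" using II[OF R0] True by auto
    qed
    then have sR: "\<sigma> (abs_cp2 R) = abs_cp2 R" and nt: "\<exists>x\<in>L. \<sigma> x \<noteq> x" using symL by blast+
    obtain m where m: "m \<noteq> 0" "A *v R = m *s R" using fix_vec[OF sR R0 R0] by blast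
    define V where "V = 1 *s C + 1 *s R"
    have V: "V \<noteq> 0" unfolding V_def by (rule comb0) simp
    have AV: "A *v V = k *s C + m *s R" unfolding V_def lin m(2) by simp
    have AAV: "A *v (A *v V) = (k * k) *s C + (m * m) *s R" unfolding AV lin m(2) by (simp add: vec_eq_iff)
    have "\<sigma> (\<sigma> (abs_cp2 V)) = abs_cp2 V" using inv by (metis comp_apply id_apply)
    then have "abs_cp2 (A *v (A *v V)) = abs_cp2 V" using sg[OF V] sg[OF A0[OF V]] by simp
    then obtain t where t: "A *v (A *v V) = t *s V" using abs_cp2_eqD[of V "A *v (A *v V)"] V A0 by metis
    have "(k * k - t) * vec_nth C i + (m * m - t) * vec_nth R i = 0" for i
      using arg_cong[OF t, of "\<lambda>v. vec_nth v i"] unfolding AAV unfolding V_def by (simp add: algebra_simps)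
    then have "k * k - t = 0 \<and> m * m - t = 0" by (rule ind)
    then have "m ^ 2 = k ^ 2" by (simp add: power2_eq_square)
    then have mk: "m = k \<or> m = - k" by (simp add: power2_eq_iff)
    have "m \<noteq> k"
    proof
      assume mk: "m = k"
      obtain x where x: "x \<in> L" "\<sigma> x \<noteq> x" using nt by blast
      define v where "v = rep_cp2 x"
      have v: "v \<noteq> 0" "abs_cp2 v = x" by (simp_all add: v_def rep_cp2_nonzero abs_rep_cp2)
      obtain \<alpha> \<beta> where ab: "v = \<alpha> *s C + \<beta> *s R" using x(1) v L[OF v(1)] by auto
      have "A *v v = k *s v" unfolding ab lin m(2) mk by (simp add: vec_eq_iff algebra_simps)
      then have "\<sigma> x = x" using sg[OF v(1)] abs_cp2_scale[OF k(1) v(1)] v(2) by simp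
      then show False using x(2) by contradiction
    qed
    then show ?thesis using mk m(2) by simp
  qed
  then have "A *v (C + s *s R) = k *s (C - s *s R)" for s
    using lin[of 1 s] by (simp add: vec_eq_iff algebra_simps)
  then show ?thesis by (rule that[OF k(1)])
qed

lemma det3_of_tangent:
  assumes g: "g1 * a + g2 * b + g3 * c = 0" "g1 * a' + g2 * b' + g3 * c' = 0" "g1 * a'' + g2 * b'' + g3 * c'' \<noteq> (0::complex)"
    and ind: "b * c' - c * b' \<noteq> 0 \<or> c * a' - a * c' \<noteq> 0 \<or> a * b' - b * a' \<noteq> 0"
  shows "det3 (a,b,c) (a',b',c') (a'',b'',c'') \<noteq> 0"
proof
  assume "det3 (a,b,c) (a',b',c') (a'',b'',c'') = 0"
  then have d: "a * (b' * c'' - c' * b'') - a' * (b * c'' - c * b'') + a'' * (b * c' - c * b') = 0" by (simp add: det3_def)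
  have "(b * c' - c * b') * (g1 * a'' + g2 * b'' + g3 * c'') = 0"
    "(c * a' - a * c') * (g1 * a'' + g2 * b'' + g3 * c'') = 0"
    "(a * b' - b * a') * (g1 * a'' + g2 * b'' + g3 * c'') = 0"
    using d g(1,2) by algebra+
  then show False using g(3) ind by auto
qed

lemma even_at_points_of_billiard:
  assumes Q: "homogeneous 2 Q" and I: "I = zero_locus Q"
    and f: "irreducible f" "homogeneous d f" "d > 0" and \<gamma>: "\<gamma> = zero_locus f"
    and PD: "homogeneous D P" "homogeneous D Qd" and K: "Q ^ N = Qd * K"
    and bil: "\<forall>C\<in>\<gamma> - I. \<forall>L. tangent_line_at \<gamma> C L \<longrightarrow>
           (\<exists>\<sigma>. is_angular_symmetry I C \<sigma> \<and> (\<forall>x\<in>L - I. fraction_value P Qd (\<sigma> x) = fraction_value P Qd x))"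
  shows "even_at_points f (P * K) Q"
  unfolding even_at_points_def
proof (intro allI impI)
  fix a b c a' b' c' a'' b'' c''
  assume f0: "ev (\<lambda>x. x) f a b c = 0" and Q0: "ev (\<lambda>x. x) Q a b c \<noteq> 0" and S: "dd (\<lambda>x. x) f a b c a'' b'' c'' \<noteq> 0"
    and Rf: "dd (\<lambda>x. x) f a b c a' b' c' = 0" and RQ: "dd (\<lambda>x. x) Q a b c a' b' c' = 0"
  note i = ring_hom_fun_id
  show "ev (\<lambda>x. x) (P * K) (a + a') (b + b') (c + c') = ev (\<lambda>x. x) (P * K) (a - a') (b - b') (c - c')"
  proof (cases "a' = 0 \<and> b' = 0 \<and> c' = 0")
    case True
    then show ?thesis by simp
  next
    case False
    have C0: "a \<noteq> 0 \<or> b \<noteq> 0 \<or> c \<noteq> 0" using Q0 ev_origin[OF Q] by auto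
    define g1 g2 g3 where "g1 = ev (\<lambda>x. x) (pderiv f) a b c" and "g2 = ev (\<lambda>x. x) (gr2 f) a b c" and "g3 = ev (\<lambda>x. x) (gr3 f) a b c"
    have g: "dd (\<lambda>x. x) f a b c x y z = g1 * x + g2 * y + g3 * z" for x y z
      unfolding dd_eq_grad[OF i] g1_def g2_def g3_def ..
    have gC: "g1 * a + g2 * b + g3 * c = 0" unfolding g[symmetric] dd_euler[OF i f(2)] f0 by simp
    have par: "a' = t * a \<and> b' = t * b \<and> c' = t * c \<Longrightarrow> False" for t
    proof -
      assume p: "a' = t * a \<and> b' = t * b \<and> c' = t * c"
      have "dd (\<lambda>x. x) Q a b c a' b' c' = t * (2 * ev (\<lambda>x. x) Q a b c)"
        using dd_linear[OF i, of Q a b c t a 0 0 b 0 c 0] dd_euler[OF i Q, of a b c] p by simp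
      then show False using RQ Q0 p False by auto
    qed
    have minor: "b * c' - c * b' \<noteq> 0 \<or> c * a' - a * c' \<noteq> 0 \<or> a * b' - b * a' \<noteq> 0"
    proof (rule ccontr)
      assume "\<not> ?thesis"
      then have m: "b * c' = c * b'" "c * a' = a * c'" "a * b' = b * a'" by auto
      show False
        using C0 m par[of "a' / a"] par[of "b' / b"] par[of "c' / c"] by (elim disjE) (simp_all add: field_simps)
    qed
    have det: "det3 (a,b,c) (a',b',c') (a'',b'',c'') \<noteq> 0"
      by (rule det3_of_tangent[OF gC Rf[unfolded g] S[unfolded g] minor])
    define C R where "C = vec3 a b c" and "R = vec3 a' b' c'"
    have ind: "x = 0 \<and> y = 0" if "\<And>i. x * vec_nth C i + y * vec_nth R i = 0" for x y
    proof -
      have e: "x * a + y * a' = 0" "x * b + y * b' = 0" "x * c + y * c' = 0"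
        using that[of 1] that[of 2] that[of 3] by (simp_all add: C_def R_def)
      have "x * (b * c' - c * b') = 0" "x * (c * a' - a * c') = 0" "x * (a * b' - b * a') = 0"
        "y * (b * c' - c * b') = 0" "y * (c * a' - a * c') = 0" "y * (a * b' - b * a') = 0" using e by algebra+
      then show ?thesis using minor by auto
    qed
    have CR: "x *s C + y *s R = vec3 (x * a + y * a') (x * b + y * b') (x * c + y * c')" for x y
      by (simp add: vec_eq3 C_def R_def)
    have Cnz: "C \<noteq> 0" using C0 by (auto simp: C_def vec_eq3)
    define p where "p = abs_cp2 C"
    obtain k where k: "k \<noteq> 0" "rep_cp2 p = k *s C" using rep_abs_cp2[OF Cnz] unfolding p_def .
    have gp: "vec_nth (grad3 f (rep_cp2 p)) 1 * x + vec_nth (grad3 f (rep_cp2 p)) 2 * y + vec_nth (grad3 f (rep_cp2 p)) 3 * z =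
      k ^ d / k * (g1 * x + g2 * y + g3 * z)" for x y z
      unfolding grad3_dot k(2) using dd_scale[OF f(2) k(1), of a b c x y z] by (simp add: C_def g)
    define L where "L = {x. (\<Sum>i\<in>UNIV. vec_nth (grad3 f (rep_cp2 p)) i * vec_nth (rep_cp2 x) i) = 0}"
    have Lx: "x \<in> L \<longleftrightarrow> g1 * vec_nth (rep_cp2 x) 1 + g2 * vec_nth (rep_cp2 x) 2 + g3 * vec_nth (rep_cp2 x) 3 = 0" for x
      unfolding L_def mem_Collect_eq sum_3 gp using k(1) by simp
    have gnz: "g1 \<noteq> 0 \<or> g2 \<noteq> 0 \<or> g3 \<noteq> 0" using S[unfolded g] by auto
    have Lz: "L = zero_locus (lin3 g1 g2 g3)"
      unfolding zero_locus_def by (auto simp: Lx eval3_eq_ev ev_lin3[OF i])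
    have line: "projective_line L"
      unfolding projective_line_def
    proof (intro exI conjI)
      show "lin3 g1 g2 g3 \<noteq> 0" using gnz by (auto simp: lin3_def)
      show "homogeneous 1 (lin3 g1 g2 g3)" by (rule homogeneous_lin3)
    qed (rule Lz)
    have Lv: "abs_cp2 v \<in> L \<longleftrightarrow> (\<exists>x y. v = x *s C + y *s R)" if v: "v \<noteq> 0" for v
    proof -
      have "abs_cp2 v \<in> L \<longleftrightarrow> g1 * vec_nth v 1 + g2 * vec_nth v 2 + g3 * vec_nth v 3 = 0"
        unfolding Lz abs_cp2_in_zero_locus_iff[OF homogeneous_lin3 v] by (simp add: eval3_eq_ev ev_lin3[OF i])
      also have "\<dots> \<longleftrightarrow> (\<exists>x y. v = x *s C + y *s R)"
      proof
        assume gv: "g1 * vec_nth v 1 + g2 * vec_nth v 2 + g3 * vec_nth v 3 = 0"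
        obtain ui vi wi where "\<And>x. lc3 (a,b,c) (a',b',c') (a'',b'',c'') (lc3 ui vi wi x) = x" using subst3_inverse[OF det] by metis
        then have "\<exists>t. lc3 (a,b,c) (a',b',c') (a'',b'',c'') t = (vec_nth v 1, vec_nth v 2, vec_nth v 3)" by metis
        then obtain x y z where xyz: "a * x + a' * y + a'' * z = vec_nth v 1" "b * x + b' * y + b'' * z = vec_nth v 2" "c * x + c' * y + c'' * z = vec_nth v 3"
          by (auto simp: lc3_def)
        have "z * (g1 * a'' + g2 * b'' + g3 * c'') = 0"
          using gv gC Rf[unfolded g] unfolding xyz[symmetric] by algebra
        then have "z = 0" using S[unfolded g] by simp
        then have "v = x *s C + y *s R" unfolding CR using xyz by (simp add: vec_eq3 mult.commute)
        then show "\<exists>x y. v = x *s C + y *s R" by blast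
      next
        assume "\<exists>x y. v = x *s C + y *s R"
        then obtain x y where v': "v = x *s C + y *s R" by blast
        show "g1 * vec_nth v 1 + g2 * vec_nth v 2 + g3 * vec_nth v 3 = 0"
          unfolding v' CR vec3_nth using gC Rf[unfolded g] by algebra
      qed
      finally show ?thesis .
    qed
    have evC: "eval3 F C = ev (\<lambda>x. x) F a b c" "eval3 F R = ev (\<lambda>x. x) F a' b' c'" for F by (simp_all add: C_def R_def eval3_vec3)
    have pI: "p \<in> \<gamma> - I"
      unfolding p_def \<gamma> I using f0 Q0 by (simp add: abs_cp2_in_zero_locus_iff[OF f(2) Cnz] abs_cp2_in_zero_locus_iff[OF Q Cnz] evC)
    have tan: "tangent_line_at \<gamma> p L"
      unfolding tangent_line_at_def
    proof (intro conjI exI)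
      show "p \<in> \<gamma>" using pI by blast
      show "irreducible_curve_equation f \<gamma>" unfolding irreducible_curve_equation_def using f \<gamma> by blast
      show "grad3 f (rep_cp2 p) \<noteq> 0"
      proof
        assume "grad3 f (rep_cp2 p) = 0"
        then have "k ^ d / k * (g1 * a'' + g2 * b'' + g3 * c'') = 0" using gp[of a'' b'' c''] by simp
        then show False using k(1) S[unfolded g] by simp
      qed
    qed (rule L_def)
    obtain \<sigma> where sg: "is_angular_symmetry I p \<sigma> \<and> (\<forall>x\<in>L - I. fraction_value P Qd (\<sigma> x) = fraction_value P Qd x)"
      using bspec[OF bil pI, THEN spec, THEN mp, OF tan] by (rule exE)
    have \<sigma>: "is_angular_symmetry I p \<sigma>" "\<And>x. x \<in> L - I \<Longrightarrow> fraction_value P Qd (\<sigma> x) = fraction_value P Qd x"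
      using conjunct1[OF sg] bspec[OF conjunct2[OF sg]] by simp_all
    have "projective_transformation \<sigma>" using \<sigma>(1) by (simp only: is_angular_symmetry_def)
    then obtain A :: "complex^3^3" where A0: "invertible A \<and> (\<forall>p. \<sigma> p = abs_cp2 (A *v rep_cp2 p))"
      unfolding projective_transformation_def by (rule exE)
    have A: "invertible A" "\<And>p. \<sigma> p = abs_cp2 (A *v rep_cp2 p)" using A0 by simp_all
    have QCR: "eval3 Q (x *s C + y *s R) = x ^ 2 * eval3 Q C + y ^ 2 * eval3 Q R" for x y
      unfolding CR eval3_vec3 evC ev_quadratic_span[OF Q] RQ by simp
    obtain m where m: "m \<noteq> 0" "\<And>s. A *v (C + s *s R) = m *s (C - s *s R)"
      using angular_symmetry_reflection[OF Q I QCR _ ind Lv line A \<sigma>(1)[unfolded p_def]] Q0 by (auto simp: evC)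
    have sum0: "C + s *s R \<noteq> 0" for s using ind[of 1 s] by (auto simp: vec_eq_iff)
    have CRs: "C + s *s R = vec3 (a + s * a') (b + s * b') (c + s * c')" "C - s *s R = C + (- s) *s R" for s
      by (simp_all add: vec_eq3 C_def R_def)
    define q where "q s = ev (\<lambda>x. x) Q (a + s * a') (b + s * b') (c + s * c')" for s
    have qs: "q s = ev (\<lambda>x. x) Q a b c + s ^ 2 * ev (\<lambda>x. x) Q a' b' c'" for s
      using ev_quadratic_span[OF Q, of 1 a s a' b b' c c'] RQ by (simp add: q_def)
    define F where "F s = ev (\<lambda>x. x) (P * K) (a + s * a') (b + s * b') (c + s * c')" for s
    have Fv: "F s = eval3 P (C + s *s R) / eval3 Qd (C + s *s R) * q s ^ N" if "q s \<noteq> 0" for s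
    proof -
      have "q s ^ N = ev (\<lambda>x. x) Qd (a + s * a') (b + s * b') (c + s * c') * ev (\<lambda>x. x) K (a + s * a') (b + s * b') (c + s * c')"
        unfolding q_def using K by (simp flip: ev_simps(4,7)[OF i])
      moreover from this have "ev (\<lambda>x. x) Qd (a + s * a') (b + s * b') (c + s * c') \<noteq> 0" using that by auto
      ultimately show ?thesis unfolding F_def CRs eval3_vec3 ev_simps(4)[OF i] by simp
    qed
    have Feven: "F s = F (- s)" if q: "q s \<noteq> 0" for s
    proof -
      have q': "q (- s) = q s" unfolding qs by simp
      have x: "abs_cp2 (C + s *s R) \<in> L - I"
      proof
        show "abs_cp2 (C + s *s R) \<in> L" unfolding Lv[OF sum0] by (rule exI[of _ 1], rule exI[of _ s]) simp
        show "abs_cp2 (C + s *s R) \<notin> I" unfolding I abs_cp2_in_zero_locus_iff[OF Q sum0] unfolding CRs eval3_vec3 using q by (simp add: q_def)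
      qed
      obtain t where t: "t \<noteq> 0" "rep_cp2 (abs_cp2 (C + s *s R)) = t *s (C + s *s R)" using rep_abs_cp2[OF sum0] .
      have "\<sigma> (abs_cp2 (C + s *s R)) = abs_cp2 ((t * m) *s (C + (- s) *s R))"
        unfolding A(2) t(2) vector_scalar_commute m(2) CRs(2) by (simp add: mult.assoc)
      also have "\<dots> = abs_cp2 (C + (- s) *s R)" by (rule abs_cp2_scale) (use t m in simp, rule sum0)
      finally have "fraction_value P Qd (abs_cp2 (C + (- s) *s R)) = fraction_value P Qd (abs_cp2 (C + s *s R))"
        using \<sigma>(2)[OF x] by simp
      then show ?thesis unfolding fraction_value_abs[OF PD sum0] using Fv[OF q] Fv[of "- s"] q q' by simp
    qed
    define r where "r G = ev (\<lambda>x. [:x:]) G [:a, a':] [:b, b':] [:c, c':]" for G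
    have pr: "poly (r G) s = ev (\<lambda>x. x) G (a + s * a') (b + s * b') (c + s * c')" for G s
      unfolding r_def ev_hom[OF ring_hom_fun_poly ring_hom_fun_pCons_const] by simp
    have "poly (r Q) 0 \<noteq> 0" unfolding pr using Q0 by simp
    then have rQ0: "r Q \<noteq> 0" by auto
    have e: "poly (r Q) s * (poly (r (P * K)) s - poly (r (P * K)) (- s)) = 0" for s
      using Feven[of s] unfolding pr F_def q_def by auto
    have "r Q * (r (P * K) - pcompose (r (P * K)) [:0, -1:]) = 0"
      by (intro poly_eq_poly_eq_iff[THEN iffD1] ext) (use e in \<open>simp add: poly_pcompose\<close>)
    then have "r (P * K) = pcompose (r (P * K)) [:0, -1:]" using rQ0 by simp
    then have "poly (r (P * K)) 1 = poly (pcompose (r (P * K)) [:0, -1:]) 1" by simp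
    then show ?thesis by (simp add: poly_pcompose pr)
  qed
qed

lemma linear_form_eq:
  assumes "homogeneous 1 l"
  obtains p q r where "\<And>x y z. ev (\<lambda>x. x) l x y z = p * x + q * y + r * z"
proof -
  have e: "{(j, k). j + k \<le> (1::nat)} = {(0,0), (1,0), (0,1)}" by auto
  have "ev (\<lambda>x. x) l x y z = cf3 l 1 0 0 * x + cf3 l 0 1 0 * y + cf3 l 0 0 1 * z" for x y z
    unfolding ev_homogeneous[OF ring_hom_fun_id assms] e by simp
  then show ?thesis by (rule that)
qed

lemma zero_locus_linear_eq:
  assumes l: "homogeneous 1 l" "l \<noteq> 0" and m: "homogeneous 1 m" "m \<noteq> 0"
    and sub: "\<And>x y z. ev (\<lambda>x. x) l x y z = 0 \<Longrightarrow> ev (\<lambda>x. x) m x y z = 0"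
  shows "zero_locus l = zero_locus m"
proof -
  obtain p q r where pqr: "\<And>x y z. ev (\<lambda>x. x) l x y z = p * x + q * y + r * z" using linear_form_eq[OF l(1)] by blast
  obtain a b c where abc: "\<And>x y z. ev (\<lambda>x. x) m x y z = a * x + b * y + c * z" using linear_form_eq[OF m(1)] by blast
  have l0: "p \<noteq> 0 \<or> q \<noteq> 0 \<or> r \<noteq> 0" using l(2) ev_eq_0_iff[of l] unfolding pqr by auto
  have m0: "a \<noteq> 0 \<or> b \<noteq> 0 \<or> c \<noteq> 0" using m(2) ev_eq_0_iff[of m] unfolding abc by auto
  have e: "a * q = b * p" "a * r = c * p" "b * r = c * q"
    using sub[of q "- p" 0] sub[of r 0 "- p"] sub[of 0 r "- q"] unfolding pqr abc by (simp_all add: mult.commute)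
  have "\<exists>k. k \<noteq> 0 \<and> a = k * p \<and> b = k * q \<and> c = k * r"
    using l0
  proof (elim disjE)
    assume "p \<noteq> 0" then show ?thesis using e m0 by (intro exI[of _ "a / p"]) (auto simp: field_simps)
  next
    assume "q \<noteq> 0" then show ?thesis using e m0 by (intro exI[of _ "b / q"]) (auto simp: field_simps)
  next
    assume "r \<noteq> 0" then show ?thesis using e m0 by (intro exI[of _ "c / r"]) (auto simp: field_simps)
  qed
  then obtain k where k: "k \<noteq> 0" "a = k * p" "b = k * q" "c = k * r" by blast
  have "ev (\<lambda>x. x) m x y z = k * ev (\<lambda>x. x) l x y z" for x y z unfolding abc pqr k by (simp add: algebra_simps)
  then show ?thesis using k(1) by (simp add: zero_locus_def eval3_eq_ev)
qed

lemma conic_equation: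
  assumes "regular_conic I \<or> union_of_two_distinct_lines I"
  obtains Q where "homogeneous 2 Q" "\<not> double_line Q" "I = zero_locus Q"
  using assms
proof
  note i = ring_hom_fun_id
  assume "regular_conic I"
  then obtain Q where Q: "Q \<noteq> 0" "homogeneous 2 Q" "I = zero_locus Q" and reg: "\<And>p. p \<in> I \<Longrightarrow> grad3 Q (rep_cp2 p) \<noteq> 0"
    unfolding regular_conic_def by blast
  have "\<not> double_line Q"
  proof
    assume "double_line Q"
    then obtain e p q r where e: "Q = const3 e * lin3 p q r ^ 2" by (auto simp: double_line_def)
    obtain v :: "complex^3" where v: "v \<noteq> 0" "p * vec_nth v 1 + q * vec_nth v 2 + r * vec_nth v 3 = 0"
    proof (cases "p = 0 \<and> q = 0")
      case True then show ?thesis by (intro that[of "vec3 1 0 0"]) (auto simp: vec_eq3)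
    next
      case False then show ?thesis by (intro that[of "vec3 q (- p) 0"]) (auto simp: vec_eq3)
    qed
    have "eval3 Q v = 0" unfolding eval3_eq_ev e ev_simps(4,7)[OF i] ev_lin3[OF i] v(2) by simp
    then have "abs_cp2 v \<in> I" unfolding Q(3) abs_cp2_in_zero_locus_iff[OF Q(2) v(1)] .
    then have gr: "grad3 Q (rep_cp2 (abs_cp2 v)) \<noteq> 0" by (rule reg)
    obtain k where k: "rep_cp2 (abs_cp2 v) = k *s v" using rep_abs_cp2[OF v(1)] by blast
    define a b c where "a = k * vec_nth v 1" and "b = k * vec_nth v 2" and "c = k * vec_nth v 3"
    have l0: "p * a + q * b + r * c = 0" using v(2) unfolding a_def b_def c_def by algebra
    have "dd (\<lambda>x. x) Q a b c x y z = 0" for x y z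
    proof -
      have "[:p:] * [:a, x:] + [:q:] * [:b, y:] + [:r:] * [:c, z:] = [:0, p * x + q * y + r * z:]" using l0 by (simp add: mult.commute)
      then show ?thesis unfolding dd_def e ev_simps(4,7)[OF ring_hom_fun_pCons_const] ev_lin3[OF ring_hom_fun_pCons_const] ev_const3[OF ring_hom_fun_pCons_const]
        by (simp add: power2_eq_square)
    qed
    then have g0: "vec_nth (grad3 Q (k *s v)) 1 * x + vec_nth (grad3 Q (k *s v)) 2 * y + vec_nth (grad3 Q (k *s v)) 3 * z = 0" for x y z
      unfolding grad3_dot by (simp add: a_def b_def c_def)
    then have "grad3 Q (k *s v) = 0" using g0[of 1 0 0] g0[of 0 1 0] g0[of 0 0 1] by (simp add: vec_eq3)
    then show False using gr k by simp
  qed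
  then show thesis using Q by (intro that)
next
  note i = ring_hom_fun_id
  assume "union_of_two_distinct_lines I"
  then obtain l1 l2 where l: "l1 \<noteq> 0" "homogeneous 1 l1" "l2 \<noteq> 0" "homogeneous 1 l2" and ne: "zero_locus l1 \<noteq> zero_locus l2"
    and I: "I = zero_locus l1 \<union> zero_locus l2"
    unfolding union_of_two_distinct_lines_def projective_line_def by auto
  define Q where "Q = l1 * l2"
  have Q: "homogeneous 2 Q" using homogeneous_mult[OF l(2,4)] by (simp add: Q_def numeral_2_eq_2)
  have Q0: "Q \<noteq> 0" using l by (simp add: Q_def)
  have IQ: "I = zero_locus Q" unfolding I Q_def zero_locus_def eval3_eq_ev ev_simps(4)[OF i] by auto
  have "\<not> double_line Q"
  proof
    assume "double_line Q"
    then obtain e p q r where e: "Q = const3 e * lin3 p q r ^ 2" by (auto simp: double_line_def)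
    have e0: "e \<noteq> 0" "lin3 p q r \<noteq> 0" using Q0 e by (auto simp: ring_hom_fun_simps(1)[OF ring_hom_fun_const3])
    have ee: "ev (\<lambda>x. x) l1 x y z * ev (\<lambda>x. x) l2 x y z = e * ev (\<lambda>x. x) (lin3 p q r) x y z ^ 2" for x y z
      using arg_cong[OF e, of "\<lambda>F. ev (\<lambda>x. x) F x y z"] unfolding Q_def ev_simps(4,7)[OF i] ev_const3[OF i] .
    have "zero_locus l1 = zero_locus (lin3 p q r)"
      by (rule zero_locus_linear_eq[OF l(2,1) homogeneous_lin3 e0(2)]) (use ee e0 in \<open>metis mult_eq_0_iff power_eq_0_iff\<close>)
    moreover have "zero_locus l2 = zero_locus (lin3 p q r)"
      by (rule zero_locus_linear_eq[OF l(4,3) homogeneous_lin3 e0(2)]) (use ee e0 in \<open>metis mult_eq_0_iff power_eq_0_iff\<close>)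
    ultimately show False using ne by simp
  qed
  then show thesis using Q IQ by (intro that)
qed

lemma dvd_power_of_zeros:
  fixes p Q :: poly3
  assumes "p \<noteq> 0" "\<And>a b c. ev (\<lambda>x. x) p a b c = 0 \<Longrightarrow> ev (\<lambda>x. x) Q a b c = 0"
  shows "\<exists>N. p dvd Q ^ N"
  using assms
proof (induction p rule: prime_divisors_induct)
  case zero
  then show ?case by simp
next
  case (unit x)
  then show ?case by (intro exI[of _ 0]) simp
next
  case (factor p x)
  have "p dvd Q"
  proof (rule irreducible_dvd_of_zeros)
    show "irreducible p" using factor.hyps by (simp add: prime_elem_iff_irreducible[symmetric] prime_imp_prime_elem)
    fix a b c assume "ev (\<lambda>x. x) p a b c = 0"
    then show "ev (\<lambda>x. x) Q a b c = 0" using factor.prems(2) by (simp add: ev_simps(4)[OF ring_hom_fun_id])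
  qed
  moreover obtain N where "x dvd Q ^ N"
    using factor.IH factor.prems by (auto simp: ev_simps(4)[OF ring_hom_fun_id])
  ultimately have "p * x dvd Q ^ Suc N" by (simp add: mult_dvd_mono)
  then show ?case by blast
qed

theorem theorem1p25:
  fixes I \<gamma> :: "cp2 set"
  assumes "plane_conic I" and "regular_conic I \<or> union_of_two_distinct_lines I"
    and "irreducible_curve \<gamma>" and "\<not> projective_line \<gamma>" and "\<gamma> \<noteq> I"
    and "generates_rationally_integrable_angular_billiard I \<gamma>"
  shows "plane_conic \<gamma>"
proof -
  note i = ring_hom_fun_id
  obtain Q where Q: "homogeneous 2 Q" "\<not> double_line Q" and I: "I = zero_locus Q" using conic_equation[OF assms(2)] .
  obtain f d where f: "irreducible f" "homogeneous d f" and \<gamma>: "\<gamma> = zero_locus f"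
    using assms(3) unfolding irreducible_curve_def irreducible_curve_equation_def by blast
  have f0: "f \<noteq> 0" using f by auto
  have "double_line 0" unfolding double_line_def by (rule exI[of _ 0]) (simp add: ring_hom_fun_simps[OF ring_hom_fun_const3])
  then have Q0: "Q \<noteq> 0" using Q(2) by auto
  have "d \<noteq> 0"
  proof
    assume "d = 0"
    then have "\<And>i j k. cf3 f i j k \<noteq> 0 \<Longrightarrow> i = 0 \<and> j = 0 \<and> k = 0" using f(2) by (auto simp: homogeneous_def)
    then have e: "f = const3 (cf3 f 0 0 0)"
      by (intro poly3_eqI) (auto simp: const3_def coeff_pCons split: nat.splits)
    then have "cf3 f 0 0 0 \<noteq> 0" using f0 ring_hom_fun_simps(1)[OF ring_hom_fun_const3] by metis
    then have "const3 (cf3 f 0 0 0) * const3 (1 / cf3 f 0 0 0) = 1"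
      unfolding ring_hom_fun_simps(4)[OF ring_hom_fun_const3, symmetric] by (simp add: ring_hom_fun_simps(2)[OF ring_hom_fun_const3])
    then have "is_unit f" using e by (metis dvdI)
    then show False using f(1) by (simp add: irreducible_not_unit)
  qed
  moreover have "d \<noteq> 1"
    using assms(4) f f0 \<gamma> unfolding projective_line_def by blast
  ultimately have d: "2 \<le> d" by simp
  have fQ: "\<not> f dvd Q"
  proof
    assume "f dvd Q"
    then obtain h where h: "Q = f * h" by (elim dvdE)
    have hf: "d \<le> 2 \<and> homogeneous (2 - d) h" by (rule homogeneous_factor[OF f(2) f0]) (use h Q Q0 in auto)
    then have "d = 2" "homogeneous 0 h" using d by auto
    then have "ev (\<lambda>x. x) h x y z = ev (\<lambda>x. x) h 0 0 0" for x y z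
      using ev_scale[OF i, of 0 h 0 x y z] by simp
    then have e: "ev (\<lambda>x. x) Q x y z = ev (\<lambda>x. x) f x y z * ev (\<lambda>x. x) h 0 0 0" for x y z
      unfolding h ev_simps(4)[OF i] by metis
    have "ev (\<lambda>x. x) h 0 0 0 \<noteq> 0" using Q0 ev_eq_0_iff[of Q] unfolding e by auto
    then have "zero_locus Q = zero_locus f" unfolding zero_locus_def eval3_eq_ev e by simp
    then show False using assms(5) I \<gamma> by simp
  qed
  obtain P Qd where PQ: "reduced_fraction P Qd" "\<not> constant_fraction P Qd" "poles P Qd \<subseteq> I"
    and bil: "\<forall>C\<in>\<gamma> - I. \<forall>L. tangent_line_at \<gamma> C L \<longrightarrow>
           (\<exists>\<sigma>. is_angular_symmetry I C \<sigma> \<and> (\<forall>x\<in>L - I. fraction_value P Qd (\<sigma> x) = fraction_value P Qd x))"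
    using assms(6) unfolding generates_rationally_integrable_angular_billiard_def by blast
  obtain D where D: "homogeneous D P" "homogeneous D Qd" and Qd0: "Qd \<noteq> 0" using PQ(1) by (auto simp: reduced_fraction_def)
  have "\<exists>N. Qd dvd Q ^ N"
  proof (rule dvd_power_of_zeros[OF Qd0])
    fix a b c assume z: "ev (\<lambda>x. x) Qd a b c = 0"
    show "ev (\<lambda>x. x) Q a b c = 0"
    proof (cases "vec3 a b c = 0")
      case True
      then show ?thesis using ev_origin[OF Q(1)] by (simp add: vec_eq3)
    next
      case False
      have "abs_cp2 (vec3 a b c) \<in> poles P Qd"
        unfolding poles_def abs_cp2_in_zero_locus_iff[OF D(2) False] eval3_vec3 by (rule z)
      then have "abs_cp2 (vec3 a b c) \<in> zero_locus Q" using PQ(3) I by auto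
      then show ?thesis unfolding abs_cp2_in_zero_locus_iff[OF Q(1) False] eval3_vec3 .
    qed
  qed
  then obtain N K where K: "Q ^ N = Qd * K" by (auto elim: dvdE)
  have K0: "K \<noteq> 0" using K Q0 by auto
  have QN: "homogeneous (2 * N) (Q ^ N)" by (rule homogeneous_power[OF Q(1)])
  have "D \<le> 2 * N \<and> homogeneous (2 * N - D) K" by (rule homogeneous_factor[OF D(2) Qd0 K0]) (use QN K in simp)
  then have PK: "homogeneous (2 * N) (P * K)" using homogeneous_mult[OF D(1), of "2 * N - D" K] by simp
  have "even_at_points f (P * K) Q"
    by (rule even_at_points_of_billiard[OF Q(1) I f _ \<gamma> D K bil]) (use d in simp)
  moreover have "P * K \<noteq> const3 k * Q ^ N" for k
  proof
    assume "P * K = const3 k * Q ^ N"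
    then have "P * K = (const3 k * Qd) * K" unfolding K by (simp add: mult.assoc)
    then have "P = const3 k * Qd" using K0 by simp
    then show False using PQ(2) by (auto simp: constant_fraction_def const3_def)
  qed
  ultimately have "d \<le> 2" by (intro degree_le_2[OF f d Q fQ _ PK])
  then have "d = 2" using d by simp
  then show ?thesis unfolding plane_conic_def using f f0 \<gamma> by blast
qed

end
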